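(* Let $\mathcal{C}:\mathbb{R}^m\to[0,\infty)$ be a multi-material transportation cost, with associated energy $\mathbb{E}$. Let $\mu^-,\mu^+\in\mathscr{M}(\mathbb{R}^n,\mathbb{R}^m)$ be a pair of compactly supported, compatible vector-valued measures. Then the multi-material transport problem for $(\mu^-,\mu^+)$ admits a solution; that is, there exists a multi-material flux $T$ between $\mu^-$ and $\mu^+$ such that $\mathbb{E}(T)\le\mathbb{E}(S)$ for every multi-material flux $S$ between $\mu^-$ and $\mu^+$.
   Context: Throughout $n\ge 2$, $m\ge 1$. $\mathscr{M}(\mathbb{R}^n,V)$ denotes the space of (Radon) measures on $\mathbb{R}^n$ with values in the normed space $V$. Partial order on $\mathbb{R}^m$: $\eta\preceq\theta$ iff $\mathrm{sign}(\eta_j)\,\mathrm{sign}(\theta_j)\ge 0$ and $|\eta_j|\le|\theta_j|$ for every $j=1,\dots,m$. A multi-material transportation cost is a function $\mathcal{C}:\mathbb{R}^m\to[0,\infty)$ such that: (i) $\mathcal{C}$ is even and $\mathcal{C}(\theta)=0$ iff $\theta=0$; (ii) $\mathcal{C}$ is lower semi-continuous; (iii) $\mathcal{C}(\eta+\theta)\le\mathcal{C}(\eta)+\mathcal{C}(\theta)$; (iv) $\mathcal{C}(\eta)\le\mathcal{C}(\theta)$ whenever $\eta\preceq\theta$. Compactly supported $\mu^-,\mu^+\in\mathscr{M}(\mathbb{R}^n,\mathbb{R}^m)$ are compatible if $\mu^-(v)=\mu^+(v)$ for every constant vector field $v:\mathbb{R}^n\to\mathbb{R}^m$ (equivalently $\mu^-(\mathbb{R}^n)=\mu^+(\mathbb{R}^n)$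 in $\mathbb{R}^m$). For $T\in\mathscr{M}(\mathbb{R}^n,\mathbb{R}^{n\times m})$, $\mathrm{div}\,T$ is the $\mathbb{R}^m$-valued distribution $\mathrm{div}\,T(\phi)=-T(D\phi)$, $\phi\in C_c^\infty(\mathbb{R}^n,(\mathbb{R}^m)^* )$. A multi-material flux between $\mu^-$ and $\mu^+$ is a compactly supported $T\in\mathscr{M}(\mathbb{R}^n,\mathbb{R}^{n\times m})$ with $\mathrm{div}\,T=\mu^--\mu^+$. Currents. A $k$-current with coefficients in $\mathbb{R}^m$ is an $m$-tuple $T=(T_1,\dots,T_m)$ of classical $k$-currents in $\mathbb{R}^n$ acting on $m$-tuples $\omega=(\omega_1,\dots,\omega_m)$ of smooth compactly supported $k$-forms by $T(\omega)=\sum_jT_j(\omega_j)$; $\partial T=(\partial T_1,\dots,\partial T_m)$; its mass $\mathbb{M}(T)$ is $\sup|T(\omega)|$ over $\omega$ with $|(\langle\omega_1(x),\tau\rangle,\dots,\langle\omega_m(x),\tau\rangle)|\le 1$ for all $x$ and all simple $k$-vectors $\tau$ with $|\tau|\le 1$. A measure $T\in\mathscr{M}(\mathbb{R}^n,\mathbb{R}^{n\times m})$ is identified with the 1-current whose components are its $m$ columns (then $\partial T=-\mathrm{div}\,T$). A polyhedral $k$-current with coefficients in $\mathbb{R}^m$ is a finite sum $P=\sum_{\ell=1}^N(\tau_\ell\otimes\theta_\ell)\,\mathcal{H}^k\llcorner\sigma_\ell$, where the $\sigma_\ell$ are $k$-simplexes with disjoint relative interiors, $\tau_\ell$ is a unit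 simple $k$-vector orienting $\sigma_\ell$, $\theta_\ell\in\mathbb{R}^m$ (acting by $P(\omega)=\sum_\ell\int_{\sigma_\ell}\sum_j(\theta_\ell)_j\langle\omega_j,\tau_\ell\rangle\,d\mathcal{H}^k$). For polyhedral $P$ the flat norm is $\mathbb{F}(P)=\inf\{\mathbb{M}(R)+\mathbb{M}(S): P=R+\partial S\}$, with $R,S$ polyhedral of dimension $k$ and $k+1$. Flat $k$-currents are the completion of polyhedral $k$-currents under $\mathbb{F}$, realized inside the space of currents, and $\mathbb{F}$ is extended to them; every multi-material flux is a flat 1-current. Energy. A discrete multi-material flux is a polyhedral 1-current $T=\sum_\ell(\tau_\ell\otimes\theta_\ell)\mathcal{H}^1\llcorner\sigma_\ell$ with coefficients in $\mathbb{R}^m$ (its divergence is a difference of finite atomic measures); its energy is $\mathbb{E}(T)=\sum_\ell\mathcal{C}(\theta_\ell)\mathcal{H}^1(\sigma_\ell)$. For a general multi-material flux $T$, $$\mathbb{E}(T):=\inf\{\liminf_h\mathbb{E}(T_h):\ \mathbb{F}(T_h-T)\to 0\}\in[0,+\infty],$$ the infimum being over sequences $(T_h)$ of discrete multi-material fluxes all supported on a common compact set. *)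

theory Defs
  imports "HOL-Analysis.Analysis"
begin

section \<open>Vector-valued measures\<close>

text \<open>
  A measure with values in a finite-dimensional space is a countably additive function on the
  Borel sets of \<open>\<real>\<^sup>n\<close>; it automatically has finite total variation and is Radon. Since all the
  measures below have compact support, nothing is lost with respect to locally finite Radon
  measures. Values on non-Borel sets are irrelevant.
\<close>

definition vector_measure ::
  "('a::euclidean_space set \<Rightarrow> 'v::real_normed_vector) \<Rightarrow> bool" where
  "vector_measure \<mu> \<longleftrightarrow>
     (\<forall>A :: nat \<Rightarrow> 'a set. range A \<subseteq> sets borel \<longrightarrow> disjoint_family A \<longrightarrow>
        (\<lambda>i. \<mu> (A i)) sums \<mu> (\<Union>i. A i))"

definition compactly_supported ::
  "('a::euclidean_space set \<Rightarrow> 'v::real_normed_vector) \<Rightarrow> bool" where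
  "compactly_supported \<mu> \<longleftrightarrow>
     (\<exists>K. compact K \<and> (\<forall>A\<in>sets borel. A \<inter> K = {} \<longrightarrow> \<mu> A = 0))"

text \<open>
  Jordan decomposition: \<open>\<nu>\<^sup>+(A)\<close> is the supremum of \<open>\<nu>(B)\<close> over Borel \<open>B \<subseteq> A\<close>. The coercion
  \<open>ennreal\<close> truncates negative values to \<open>0 = \<nu>(\<emptyset>)\<close>, which does not affect the supremum.
\<close>

definition positive_part_measure :: "('a::euclidean_space set \<Rightarrow> real) \<Rightarrow> 'a measure" where
  "positive_part_measure \<nu> =
     measure_of UNIV (sets borel) (\<lambda>A. SUP B\<in>{B \<in> sets borel. B \<subseteq> A}. ennreal (\<nu> B))"

definition signed_integral ::
  "('a::euclidean_space set \<Rightarrow> real) \<Rightarrow> ('a \<Rightarrow> real) \<Rightarrow> real" where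
  "signed_integral \<nu> f =
     (\<integral>x. f x \<partial>positive_part_measure \<nu>) - (\<integral>x. f x \<partial>positive_part_measure (\<lambda>A. - \<nu> A))"

text \<open>
  The action \<open>\<mu>(v)\<close> of a \<open>V\<close>-valued measure on a \<open>V\<^sup>*\<close>-valued field, where \<open>V\<^sup>*\<close> is identified
  with \<open>V\<close> by the inner product.
\<close>

definition measure_action ::
  "('a::euclidean_space set \<Rightarrow> 'v::euclidean_space) \<Rightarrow> ('a \<Rightarrow> 'v) \<Rightarrow> real" where
  "measure_action \<mu> v = (\<Sum>b\<in>Basis. signed_integral (\<lambda>A. \<mu> A \<bullet> b) (\<lambda>x. v x \<bullet> b))"


section \<open>Transportation costs and multi-material fluxes\<close>

definition preceq :: "real^'m \<Rightarrow> real^'m \<Rightarrow> bool" where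
  "preceq \<eta> \<theta> \<longleftrightarrow> (\<forall>j. sgn (\<eta> $ j) * sgn (\<theta> $ j) \<ge> 0 \<and> \<bar>\<eta> $ j\<bar> \<le> \<bar>\<theta> $ j\<bar>)"

definition lower_semicontinuous :: "('a::topological_space \<Rightarrow> real) \<Rightarrow> bool" where
  "lower_semicontinuous f \<longleftrightarrow> (\<forall>x. ereal (f x) \<le> Liminf (at x) (\<lambda>y. ereal (f y)))"

definition multi_material_cost :: "(real^'m \<Rightarrow> real) \<Rightarrow> bool" where
  "multi_material_cost C \<longleftrightarrow>
     (\<forall>\<theta>. 0 \<le> C \<theta>) \<and>
     (\<forall>\<theta>. C (- \<theta>) = C \<theta>) \<and> (\<forall>\<theta>. C \<theta> = 0 \<longleftrightarrow> \<theta> = 0) \<and>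
     lower_semicontinuous C \<and>
     (\<forall>\<eta> \<theta>. C (\<eta> + \<theta>) \<le> C \<eta> + C \<theta>) \<and>
     (\<forall>\<eta> \<theta>. preceq \<eta> \<theta> \<longrightarrow> C \<eta> \<le> C \<theta>)"

definition compatible ::
  "((real^'n) set \<Rightarrow> real^'m) \<Rightarrow> ((real^'n) set \<Rightarrow> real^'m) \<Rightarrow> bool" where
  "compatible \<mu> \<nu> \<longleftrightarrow> (\<forall>c. measure_action \<mu> (\<lambda>x. c) = measure_action \<nu> (\<lambda>x. c))"

primrec C_k :: "nat \<Rightarrow> ('a::real_normed_vector \<Rightarrow> 'b::real_normed_vector) \<Rightarrow> bool" where
  "C_k 0 f \<longleftrightarrow> continuous_on UNIV f"
| "C_k (Suc k) f \<longleftrightarrow>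
     (\<forall>x. f differentiable (at x)) \<and> (\<forall>v. C_k k (\<lambda>x. frechet_derivative f (at x) v))"

definition smooth :: "('a::real_normed_vector \<Rightarrow> 'b::real_normed_vector) \<Rightarrow> bool" where
  "smooth f \<longleftrightarrow> (\<forall>k. C_k k f)"

definition test_function :: "('a::euclidean_space \<Rightarrow> 'b::real_normed_vector) \<Rightarrow> bool" where
  "test_function \<phi> \<longleftrightarrow> smooth \<phi> \<and> (\<exists>K. compact K \<and> (\<forall>x. x \<notin> K \<longrightarrow> \<phi> x = 0))"

text \<open>
  A matrix in \<open>\<real>\<^sup>n\<^sup>\<times>\<^sup>m\<close> is an element of \<open>real^'m^'n\<close> (\<open>n\<close> rows, \<open>m\<close> columns). The inner product of
  \<open>real^'m^'n\<close> is the Frobenius one, so \<open>T(D\<phi>) = (\<Sum>i. \<Sum>j. \<integral> \<partial>\<^sub>i\<phi>\<^sub>j dT\<^sub>i\<^sub>j)\<close>.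
\<close>

definition divergence :: "((real^'n) set \<Rightarrow> real^'m^'n) \<Rightarrow> (real^'n \<Rightarrow> real^'m) \<Rightarrow> real" where
  "divergence T \<phi> =
     - measure_action T (\<lambda>x. \<chi> i j. frechet_derivative \<phi> (at x) (axis i 1) $ j)"

definition multi_material_flux ::
  "((real^'n) set \<Rightarrow> real^'m^'n) \<Rightarrow>
   ((real^'n) set \<Rightarrow> real^'m) \<Rightarrow> ((real^'n) set \<Rightarrow> real^'m) \<Rightarrow> bool" where
  "multi_material_flux T \<mu>m \<mu>p \<longleftrightarrow>
     vector_measure T \<and> compactly_supported T \<and>
     (\<forall>\<phi>. test_function \<phi> \<longrightarrow> divergence T \<phi> = measure_action \<mu>m \<phi> - measure_action \<mu>p \<phi>)"


section \<open>Hausdorff measure\<close>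

definition hausdorff_content :: "real \<Rightarrow> nat \<Rightarrow> 'a::metric_space set \<Rightarrow> ennreal" where
  "hausdorff_content \<delta> k A =
     Inf {(\<Sum>i. if E i = {} then 0
               else ennreal (unit_ball_vol (real k) * (diameter (E i) / 2) ^ k)) | E :: nat \<Rightarrow> 'a set.
          A \<subseteq> (\<Union>i. E i) \<and> (\<forall>i. bounded (E i) \<and> diameter (E i) \<le> \<delta>)}"

definition hausdorff_measure :: "nat \<Rightarrow> 'a::metric_space measure" where
  "hausdorff_measure k =
     measure_of UNIV (sets borel) (\<lambda>A. SUP \<delta>\<in>{0<..}. hausdorff_content \<delta> k A)"


section \<open>Forms and currents\<close>

text \<open>
  A \<open>k\<close>-form is a function of a point and of a sequence of vectors of which only the entries
  \<open>v 0, \<dots>, v (k - 1)\<close> matter. The simple \<open>k\<close>-vector \<open>v 0 \<and> \<dots> \<and> v (k - 1)\<close> is represented by the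
  sequence \<open>v\<close>, and its pairing with the covector \<open>\<omega> x\<close> is \<open>\<omega> x v\<close>.
\<close>

type_synonym 'a form = "'a \<Rightarrow> (nat \<Rightarrow> 'a) \<Rightarrow> real"

text \<open>The norm of a simple \<open>k\<close>-vector is the square root of the Gram determinant.\<close>

definition simple_vector_norm :: "nat \<Rightarrow> (nat \<Rightarrow> 'a::euclidean_space) \<Rightarrow> real" where
  "simple_vector_norm k v =
     sqrt (\<Sum>p | p permutes {..<k}. of_int (sign p) * (\<Prod>i<k. v i \<bullet> v (p i)))"

definition covector :: "nat \<Rightarrow> ((nat \<Rightarrow> 'a::euclidean_space) \<Rightarrow> real) \<Rightarrow> bool" where
  "covector k \<alpha> \<longleftrightarrow>
     (\<forall>v w. (\<forall>i<k. v i = w i) \<longrightarrow> \<alpha> v = \<alpha> w) \<and>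
     (\<forall>v. \<forall>i<k. linear (\<lambda>u. \<alpha> (v(i := u)))) \<and>
     (\<forall>v. \<forall>i<k. \<forall>j<k. i \<noteq> j \<longrightarrow> v i = v j \<longrightarrow> \<alpha> v = 0)"

definition test_form :: "nat \<Rightarrow> 'a::euclidean_space form \<Rightarrow> bool" where
  "test_form k \<omega> \<longleftrightarrow>
     (\<forall>x. covector k (\<omega> x)) \<and> (\<forall>v. smooth (\<lambda>x. \<omega> x v)) \<and>
     (\<exists>K. compact K \<and> (\<forall>x. x \<notin> K \<longrightarrow> \<omega> x = (\<lambda>v. 0)))"

text \<open>
  The exterior derivative of a \<open>k\<close>-form:
  \<open>d\<omega>(v\<^sub>0,\<dots>,v\<^sub>k) = (\<Sum>i\<le>k. (-1)\<^sup>i D\<omega>(v\<^sub>0,\<dots>,v\<^sub>i\<^sub>-\<^sub>1,v\<^sub>i\<^sub>+\<^sub>1,\<dots>,v\<^sub>k)[v\<^sub>i])\<close>.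
\<close>

definition exterior_derivative :: "nat \<Rightarrow> 'a::euclidean_space form \<Rightarrow> 'a form" where
  "exterior_derivative k \<omega> = (\<lambda>x v. \<Sum>i\<le>k. (- 1) ^ i *
     frechet_derivative (\<lambda>y. \<omega> y (\<lambda>j. if j < i then v j else v (Suc j))) (at x) (v i))"

text \<open>
  A current with coefficients in \<open>\<real>\<^sup>m\<close> is an \<open>m\<close>-tuple of functionals on \<open>k\<close>-forms. Only the values
  on test forms are meaningful, so equality of \<open>k\<close>-currents has to be read as \<open>current_eq k\<close>.
\<close>

type_synonym ('a, 'm) current = "'m \<Rightarrow> 'a form \<Rightarrow> real"

definition current_eq ::
  "nat \<Rightarrow> ('a::euclidean_space, 'm::finite) current \<Rightarrow> ('a, 'm) current \<Rightarrow> bool" where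
  "current_eq k S T \<longleftrightarrow> (\<forall>j \<omega>. test_form k \<omega> \<longrightarrow> S j \<omega> = T j \<omega>)"

definition current_add ::
  "('a, 'm) current \<Rightarrow> ('a, 'm) current \<Rightarrow> ('a, 'm) current" where
  "current_add S T = (\<lambda>j \<omega>. S j \<omega> + T j \<omega>)"

definition current_diff ::
  "('a, 'm) current \<Rightarrow> ('a, 'm) current \<Rightarrow> ('a, 'm) current" where
  "current_diff S T = (\<lambda>j \<omega>. S j \<omega> - T j \<omega>)"

text \<open>\<open>boundary k\<close> maps \<open>(k + 1)\<close>-currents to \<open>k\<close>-currents.\<close>

definition boundary ::
  "nat \<Rightarrow> ('a::euclidean_space, 'm) current \<Rightarrow> ('a, 'm) current" where
  "boundary k T = (\<lambda>j \<omega>. T j (exterior_derivative k \<omega>))"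

definition mass :: "nat \<Rightarrow> ('a::euclidean_space, 'm::finite) current \<Rightarrow> ennreal" where
  "mass k T =
     (SUP \<omega> \<in> {\<omega> :: 'm \<Rightarrow> 'a form. (\<forall>j. test_form k (\<omega> j)) \<and>
                 (\<forall>x \<tau>. simple_vector_norm k \<tau> \<le> 1 \<longrightarrow> norm (\<chi> j. \<omega> j x \<tau>) \<le> 1)}.
        ennreal \<bar>\<Sum>j\<in>UNIV. T j (\<omega> j)\<bar>)"

definition supported_in ::
  "nat \<Rightarrow> ('a::euclidean_space, 'm) current \<Rightarrow> 'a set \<Rightarrow> bool" where
  "supported_in k T K \<longleftrightarrow>
     (\<forall>j \<omega>. test_form k \<omega> \<longrightarrow> closure {x. \<omega> x \<noteq> (\<lambda>v. 0)} \<inter> K = {} \<longrightarrow> T j \<omega> = 0)"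

text \<open>The \<open>1\<close>-current whose components are the columns of a matrix-valued measure.\<close>

definition current_of_measure ::
  "((real^'n) set \<Rightarrow> real^'m^'n) \<Rightarrow> (real^'n, 'm) current" where
  "current_of_measure T =
     (\<lambda>j \<omega>. measure_action (\<lambda>A. column j (T A)) (\<lambda>x. \<chi> i. \<omega> x (\<lambda>_. axis i 1)))"


section \<open>Polyhedral currents and the flat norm\<close>

text \<open>
  A polyhedral chain is given by a list of triples \<open>(\<sigma>, \<tau>, \<theta>)\<close>: a simplex, a unit simple \<open>k\<close>-vector
  orienting it (i.e. spanning the direction of its affine hull), and a multiplicity.
\<close>

type_synonym ('a, 'm) chain = "('a set \<times> (nat \<Rightarrow> 'a) \<times> (real^'m)) list"

definition orients :: "nat \<Rightarrow> (nat \<Rightarrow> 'a::euclidean_space) \<Rightarrow> 'a set \<Rightarrow> bool" where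
  "orients k \<tau> \<sigma> \<longleftrightarrow>
     simple_vector_norm k \<tau> = 1 \<and>
     span (\<tau> ` {..<k}) = {x - y | x y. x \<in> affine hull \<sigma> \<and> y \<in> affine hull \<sigma>}"

definition polyhedral_chain :: "nat \<Rightarrow> ('a::euclidean_space, 'm::finite) chain \<Rightarrow> bool" where
  "polyhedral_chain k P \<longleftrightarrow>
     (\<forall>(\<sigma>, \<tau>, \<theta>) \<in> set P. int k simplex \<sigma> \<and> orients k \<tau> \<sigma>) \<and>
     (\<forall>i<length P. \<forall>j<length P. i \<noteq> j \<longrightarrow>
        rel_interior (fst (P ! i)) \<inter> rel_interior (fst (P ! j)) = {})"

definition current_of_chain ::
  "nat \<Rightarrow> ('a::euclidean_space, 'm::finite) chain \<Rightarrow> ('a, 'm) current" where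
  "current_of_chain k P = (\<lambda>j \<omega>. \<Sum>(\<sigma>, \<tau>, \<theta>)\<leftarrow>P.
     \<theta> $ j * (LINT x:\<sigma>|hausdorff_measure k. \<omega> x \<tau>))"

definition polyhedral_current ::
  "nat \<Rightarrow> ('a::euclidean_space, 'm::finite) current \<Rightarrow> bool" where
  "polyhedral_current k T \<longleftrightarrow> (\<exists>P. polyhedral_chain k P \<and> current_eq k T (current_of_chain k P))"

definition polyhedral_flat_norm ::
  "nat \<Rightarrow> ('a::euclidean_space, 'm::finite) current \<Rightarrow> ennreal" where
  "polyhedral_flat_norm k P =
     Inf {mass k R + mass (Suc k) S | R S.
            polyhedral_current k R \<and> polyhedral_current (Suc k) S \<and>
            current_eq k P (current_add R (boundary k S))}"

text \<open>
  \<open>represents k P T\<close>: the sequence \<open>P\<close> of polyhedral currents is Cauchy for the flat norm, and the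
  element of the completion it defines is realized by the current \<open>T\<close>.
\<close>

definition represents ::
  "nat \<Rightarrow> (nat \<Rightarrow> ('a::euclidean_space, 'm::finite) current) \<Rightarrow> ('a, 'm) current \<Rightarrow> bool" where
  "represents k P T \<longleftrightarrow>
     (\<forall>i. polyhedral_current k (P i)) \<and>
     (\<forall>\<epsilon>>0. \<exists>N. \<forall>i\<ge>N. \<forall>l\<ge>N. polyhedral_flat_norm k (current_diff (P i) (P l)) < \<epsilon>) \<and>
     (\<forall>j \<omega>. test_form k \<omega> \<longrightarrow> (\<lambda>i. P i j \<omega>) \<longlonglongrightarrow> T j \<omega>)"

text \<open>
  The extension of the flat norm to flat currents. For a flat current the set below has exactly one
  element, since the limit does not depend on the representing sequence; for other currents it is
  empty and the value is \<open>\<infinity>\<close>.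
\<close>

definition flat_norm :: "nat \<Rightarrow> ('a::euclidean_space, 'm::finite) current \<Rightarrow> ennreal" where
  "flat_norm k T =
     Inf {L. \<exists>P. represents k P T \<and> (\<lambda>i. polyhedral_flat_norm k (P i)) \<longlonglongrightarrow> L}"


section \<open>Energy\<close>

text \<open>
  The discrete energy does not depend on the chain chosen to write a polyhedral \<open>1\<close>-current, as
  \<open>C\<close> is even and vanishes at \<open>0\<close>.
\<close>

definition discrete_energy ::
  "(real^'m \<Rightarrow> real) \<Rightarrow> ('a::euclidean_space, 'm::finite) chain \<Rightarrow> ennreal" where
  "discrete_energy C P =
     (\<Sum>(\<sigma>, \<tau>, \<theta>)\<leftarrow>P. ennreal (C \<theta>) * emeasure (hausdorff_measure 1) \<sigma>)"

definition energy ::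
  "(real^'m \<Rightarrow> real) \<Rightarrow> ((real^'n) set \<Rightarrow> real^'m^'n) \<Rightarrow> ennreal" where
  "energy C T =
     Inf {liminf (\<lambda>h. discrete_energy C (P h)) | P :: nat \<Rightarrow> (real^'n, 'm) chain.
            (\<forall>h. polyhedral_chain 1 (P h)) \<and>
            (\<exists>K. compact K \<and> (\<forall>h. supported_in 1 (current_of_chain 1 (P h)) K)) \<and>
            (\<lambda>h. flat_norm 1 (current_diff (current_of_chain 1 (P h)) (current_of_measure T)))
              \<longlonglongrightarrow> 0}"

end

theory Submission
 imports Defs "HOL-Probability.Probability" "HOL-Complex_Analysis.Great_Picard"
begin

text \<open>
 Take a minimizing sequence of fluxes and discrete fluxes \<open>P\<^sub>h\<close> close to them in the flat norm. Removing from \<open>P\<^sub>h\<close>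
 a graph of length \<open>O(1/h)\<close> turns its boundary into the discretization of the demand by a fine partition of
 unity. Cancelling cycles then bounds all multiplicities by the total variation of the demand, without raising
 the cost since \<open>C\<close> is monotone, and projecting onto a ball bounds the supports. As \<open>C \<theta> \<ge> c |\<theta>|\<close> for bounded \<open>\<theta>\<close>,
 the masses are bounded. By Stokes' theorem, snapping to a grid of mesh \<open>1/k\<close> shows that up to \<open>O(1/k)\<close> in the flat norm
 only finitely many bounded coefficients matter, so a diagonal subsequence is Cauchy in the flat norm. Its limit is
 a measure: coding points along a space-filling curve reduces weak compactness to Helly's theorem on the line.
 If no flux has finite energy, the same compactness applied to cones over the discretized demand still yields a flux.
\<close>

text \<open>The energy controls neither the mass nor the boundary of an approximant: a cost may grow
  sublinearly, and flat closeness to a flux says nothing about the mass of the boundary. Cancelling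
  cycles bounds the multiplicities only in terms of the mass of the boundary, hence the correction
  by a graph. On exact forms a small flat norm acts like a small mass, so pairing with the
  differentials of the grid functions yields edges of small total length.

  Small length does not mean small cost (for \<open>C \<theta> = |\<theta>|^(1/2)\<close> many thin
  edges are expensive), so the correction \<open>W\<close> must not enter the competitor. Two
  families are kept: chains \<open>L\<close> with the cost bound and differences
  \<open>L - W\<close> with the discretized boundary. Both parts are reduced as one list,
  compactness is applied to \<open>L - W\<close>, and as the length of \<open>W\<close> tends to 0
  the limit is the same for \<open>L\<close>. The energy is a relaxation, so at the limit it is at
  most the limit inferior of the costs of \<open>L\<close>.

  All grid estimates bound a sum over the grid at once; a bound for each point would grow with the
  number of points.\<close>

section \<open>Smooth functions\<close>

text \<open>Lets the inductions work with a derivative delivered by a differentiation rule;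
  uniqueness of the derivative identifies it with \<open>frechet_derivative\<close>.\<close>

lemma C_k_SucI:
 assumes "!!x. (f has_derivative f' x) (at x)" "!!v. C_k k (%x. f' x v)"
 shows "C_k (Suc k) f"
proof -
 have "frechet_derivative f (at x) = f' x" for x
  using frechet_derivative_at[OF assms(1)[of x]] by simp
 then show ?thesis using assms by (auto simp: differentiable_def)
qed

lemma C_k_has_derivative:
 "C_k (Suc k) f ==> (f has_derivative frechet_derivative f (at x)) (at x)"
 by (simp add: frechet_derivative_works)

lemma C_k_SucD: "C_k (Suc k) f ==> C_k k f"
proof (induction k arbitrary: f)
 case 0
 then show ?case
  by (auto intro!: continuous_at_imp_continuous_on differentiable_imp_continuous_within)
next
 case (Suc k)
 then show ?case by (metis C_k.simps(2))
qed

lemma C_k_const: "C_k k (%x. c)"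
proof (induction k arbitrary: c)
 case (Suc k)
 show ?case by (rule C_k_SucI[where f' = "%x h. 0"]) (auto intro: Suc)
qed auto

lemma C_k_add: "C_k k f ==> C_k k g ==> C_k k (%x. f x + g x)"
proof (induction k arbitrary: f g)
 case (Suc k)
 show ?case
  by (rule C_k_SucI[OF has_derivative_add[OF C_k_has_derivative C_k_has_derivative]])
    (use Suc in auto)
qed (simp add: continuous_on_add)

lemma C_k_mult:
 fixes f g :: "'a::real_normed_vector => real"
 shows "C_k k f ==> C_k k g ==> C_k k (%x. f x * g x)"
proof (induction k arbitrary: f g)
 case (Suc k)
 have "C_k k f" "C_k k g" using Suc.prems C_k_SucD by blast+
 then show ?case
  by (intro C_k_SucI[OF has_derivative_mult[OF C_k_has_derivative C_k_has_derivative]] C_k_add Suc.IH)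
    (use Suc.prems in auto)
qed (simp add: continuous_on_mult)

lemma C_k_compose_affine:
 assumes "!!x. (L has_derivative L') (at x)"
 shows "C_k k f ==> C_k k (%x. f (L x))"
proof (induction k arbitrary: f)
 case 0
 have "continuous_on UNIV L"
  using assms by (meson continuous_at_imp_continuous_on has_derivative_continuous)
 then show ?case using 0 by (auto intro: continuous_on_compose2)
next
 case (Suc k)
 show ?case
  by (rule C_k_SucI[OF has_derivative_compose[OF assms C_k_has_derivative]])
    (use Suc in auto)
qed

lemma C_k_inverse:
 fixes f :: "'a::real_normed_vector => real"
 assumes "!!x. f x ~= 0"
 shows "C_k k f ==> C_k k (%x. inverse (f x))"
proof (induction k)
 case 0
 then show ?case using assms by (auto intro!: continuous_intros)
next
 case (Suc k)
 \<comment> \<open>The derivative of \<open>1 / f\<close> contains \<open>1 / f\<close> again, but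
   one order lower, where the induction hypothesis applies.\<close>
 have 1: "C_k k (%x. inverse (f x))" using Suc C_k_SucD by blast
 have 2: "C_k k (%x. frechet_derivative f (at x) v)" for v using Suc by auto
 have "C_k k (%x. (- 1) * (inverse (f x) * frechet_derivative f (at x) v * inverse (f x)))" for v
  by (intro C_k_mult C_k_const 1 2)
 then show ?case
  by (intro C_k_SucI[OF Deriv.has_derivative_inverse[OF _ C_k_has_derivative]])
    (use Suc assms in auto)
qed

lemma C_k_sum: "(!!i. i \<in> I ==> C_k k (f i)) ==> C_k k (%x. \<Sum>i\<in>I. f i x)"
 by (induction I rule: infinite_finite_induct) (auto intro: C_k_const C_k_add)

lemma C_k_prod:
 fixes f :: "'i => 'a::real_normed_vector => real"
 shows "(!!i. i \<in> I ==> C_k k (f i)) ==> C_k k (%x. \<Prod>i\<in>I. f i x)"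
 by (induction I rule: infinite_finite_induct) (auto intro: C_k_const C_k_mult)

lemma C_k_Suc_real:
 assumes "!!x. (f has_real_derivative f' x) (at x)" "C_k k f'"
 shows "C_k (Suc k) f"
 by (rule C_k_SucI[OF assms(1)[unfolded has_field_derivative_def]])
   (auto intro: C_k_mult C_k_const assms(2))

lemma smooth_const: "smooth (%x. c)"
 by (simp add: smooth_def C_k_const)

lemma smooth_add: "smooth f ==> smooth g ==> smooth (%x. f x + g x)"
 by (simp add: smooth_def C_k_add)

lemma smooth_compose_affine:
 "(!!x. (L has_derivative L') (at x)) ==> smooth h ==> smooth (%x. h (L x))"
 unfolding smooth_def using C_k_compose_affine by blast

lemma smooth_sum: "(!!i. i \<in> I ==> smooth (F i)) ==> smooth (%x. \<Sum>i\<in>I. F i x)"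
 by (simp add: smooth_def C_k_sum)

lemma smooth_mult: "smooth f ==> smooth g ==> smooth (%x. f x * g x :: real)"
 by (simp add: smooth_def C_k_mult)

lemma smooth_inverse: "(!!x. f x ~= 0) ==> smooth f ==> smooth (%x. inverse (f x) :: real)"
 by (simp add: smooth_def C_k_inverse)

lemma smooth_prod: "(!!i. i \<in> I ==> smooth (F i)) ==> smooth (%x. \<Prod>i\<in>I. F i x :: real)"
 by (simp add: smooth_def C_k_prod)

lemma smooth_has_derivative: "smooth f ==> (f has_derivative frechet_derivative f (at x)) (at x)"
 unfolding smooth_def by (meson C_k_has_derivative)

lemma smooth_frechet_derivative: "smooth f ==> smooth (%x. frechet_derivative f (at x) v)"
 unfolding smooth_def by (metis C_k.simps(2))

lemma smooth_continuous: "smooth f ==> continuous_on A f"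
 unfolding smooth_def by (meson C_k.simps(1) continuous_on_subset subset_UNIV)

section \<open>The function exp(-1/x), a smooth step and a bump\<close>

definition exp_inv :: "nat => real => real" where
 "exp_inv n x = (if x <= 0 then 0 else exp (- 1 / x) / x ^ n)"

text \<open>The denominators \<open>x ^ n\<close> make the family closed under differentiation, so
  smoothness of every order follows from this one formula. At 0 it suffices that the difference
  quotient \<open>exp (-1/h) / h ^ (n + 1)\<close> tends to 0 from the right.\<close>

lemma exp_inv_deriv:
 "(exp_inv n has_real_derivative exp_inv (n + 2) x - n * exp_inv (n + 1) x) (at x)"
proof -
 consider "x < 0" | "x = 0" | "x > 0" by linarith
 then show ?thesis
 proof cases
  case 1
  have "((%x::real. 0::real) has_real_derivative 0) (at x)" by simp
  then have "(exp_inv n has_real_derivative 0) (at x)"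
   by (rule has_field_derivative_transform_within_open[where S = "{..<0}"])
     (use 1 in \<open>auto simp: exp_inv_def\<close>)
  then show ?thesis using 1 by (simp add: exp_inv_def)
 next
  case 3
  have "((%x::real. exp (- 1 / x) / x ^ n) has_real_derivative
    (exp (- 1 / x) * (1 / x\<^sup>2) * x ^ n - exp (- 1 / x) * (n * x ^ (n - 1))) / (x ^ n * x ^ n)) (at x)"
   using 3 by (auto intro!: derivative_eq_intros simp: power2_eq_square)
  also have "(exp (- 1 / x) * (1 / x\<^sup>2) * x ^ n - exp (- 1 / x) * (n * x ^ (n - 1))) / (x ^ n * x ^ n)
    = exp_inv (n + 2) x - n * exp_inv (n + 1) x"
   using 3 by (cases n) (simp_all add: exp_inv_def field_simps power2_eq_square)
  finally have "((%x::real. exp (- 1 / x) / x ^ n) has_real_derivative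
    exp_inv (n + 2) x - n * exp_inv (n + 1) x) (at x)" .
  then show ?thesis
   by (rule has_field_derivative_transform_within_open[where S = "{0<..}"])
     (use 3 in \<open>auto simp: exp_inv_def\<close>)
 next
  case 2
  have R: "((%h::real. exp_inv n h / h) \<longlongrightarrow> 0) (at_right 0)"
  proof -
   have "((%h::real. inverse h ^ Suc n / exp (inverse h)) \<longlongrightarrow> 0) (at_right 0)"
    by (rule filterlim_compose[OF tendsto_power_div_exp_0 filterlim_inverse_at_top_right])
   moreover have "\<forall>\<^sub>F h in at_right 0. inverse h ^ Suc n / exp (inverse h) = exp_inv n h / h"
    unfolding eventually_at_filter
    by (rule always_eventually)
      (auto simp: exp_inv_def field_simps exp_minus)
   ultimately show ?thesis by (rule Lim_transform_eventually)
  qed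
  have L: "((%h::real. exp_inv n h / h) \<longlongrightarrow> 0) (at_left 0)"
  proof -
   have "((%h::real. 0) \<longlongrightarrow> (0::real)) (at_left 0)" by simp
   moreover have "\<forall>\<^sub>F h in at_left 0. 0 = exp_inv n h / h"
    unfolding eventually_at_filter by (rule always_eventually) (simp add: exp_inv_def)
   ultimately show ?thesis by (rule Lim_transform_eventually)
  qed
  have "((%h. (exp_inv n (0 + h) - exp_inv n 0) / h) \<longlongrightarrow> 0) (at 0)"
   using filterlim_split_at[OF L R] by (simp add: exp_inv_def[of n 0])
  then show ?thesis using 2 unfolding DERIV_def by (simp add: exp_inv_def)
 qed
qed

lemma smooth_exp_inv: "smooth (exp_inv n)"
proof -
 have "C_k k (exp_inv n)" for k
 proof (induction k arbitrary: n)
  case 0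
  have "isCont (exp_inv n) x" for x using exp_inv_deriv DERIV_isCont by blast
  then show ?case by (simp add: continuous_at_imp_continuous_on)
 next
  case (Suc k)
  have "C_k k (%x. exp_inv (n + 2) x + (- real n) * exp_inv (n + 1) x)"
   by (intro C_k_add C_k_mult C_k_const Suc)
  then show ?case by (intro C_k_Suc_real[OF exp_inv_deriv]) simp
 qed
 then show ?thesis by (simp add: smooth_def)
qed

text \<open>The denominator is positive because \<open>x\<close> and \<open>1 - x\<close> are never
  both at most 0, and dividing by it makes the value exactly 1 from \<open>x = 1\<close> on.\<close>

definition smooth_step :: "real => real" where
 "smooth_step x = exp_inv 0 x * inverse (exp_inv 0 x + exp_inv 0 (1 - x))"

lemma exp_inv_nonneg: "0 <= exp_inv n x"
 by (simp add: exp_inv_def)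

lemma exp_inv_sum_pos: "exp_inv 0 x + exp_inv 0 (1 - x) > 0"
proof (cases "x > 0")
 case True
 then have "exp_inv 0 x > 0" by (simp add: exp_inv_def)
 then show ?thesis using exp_inv_nonneg[of 0 "1 - x"] by linarith
next
 case False
 then have "exp_inv 0 (1 - x) > 0" by (simp add: exp_inv_def)
 then show ?thesis using exp_inv_nonneg[of 0 x] by linarith
qed

lemma smooth_smooth_step: "smooth smooth_step"
proof -
 have a: "((%x::real. 1 - x) has_derivative (%h. - h)) (at x)" for x
  by (auto intro!: derivative_eq_intros)
 have "smooth (%x. exp_inv 0 x * inverse (exp_inv 0 x + exp_inv 0 (1 - x)))"
  by (intro smooth_mult smooth_inverse smooth_add smooth_exp_inv smooth_compose_affine[OF a])
    (metis exp_inv_sum_pos less_irrefl)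
 then show ?thesis by (simp add: smooth_step_def[abs_def])
qed

lemma smooth_step_simps: "x <= 0 ==> smooth_step x = 0" "x >= 1 ==> smooth_step x = 1"
 "0 <= smooth_step x" "smooth_step x <= 1"
proof -
 show "smooth_step x = 0" if "x <= 0" using that by (simp add: smooth_step_def exp_inv_def)
 show "smooth_step x = 1" if "x >= 1" using that by (simp add: smooth_step_def exp_inv_def)
 show "0 <= smooth_step x"
  unfolding smooth_step_def by (intro mult_nonneg_nonneg) (auto simp: exp_inv_nonneg)
 show "smooth_step x <= 1"
  using exp_inv_sum_pos[of x] exp_inv_nonneg[of 0 "1 - x"]
  unfolding smooth_step_def by (simp add: divide_inverse[symmetric] divide_le_eq_1)
qed

text \<open>A difference of two unit shifts of one step, so that integer translates form a partition
  of unity by telescoping, with no normalization.\<close>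

definition bump :: "real => real" where "bump x = smooth_step (x + 1) - smooth_step x"

lemma smooth_bump: "smooth bump"
proof -
 have a: "((%x::real. x + 1) has_derivative (%h. h)) (at x)" for x
  by (auto intro!: derivative_eq_intros)
 have "smooth (%x. smooth_step (x + 1) + (- 1) * smooth_step x)"
  by (intro smooth_add smooth_mult smooth_const smooth_smooth_step smooth_compose_affine[OF a])
 then show ?thesis by (simp add: bump_def[abs_def])
qed

lemma bump_nonneg: "0 <= bump x"
 using smooth_step_simps(1,4)[of x] smooth_step_simps(2,3)[of "x + 1"]
 unfolding bump_def by (cases "x <= 0") linarith+

lemma bump_eq_0: "\<bar>x\<bar> >= 1 ==> bump x = 0"
 using smooth_step_simps(1,2)[of x] smooth_step_simps(1,2)[of "x + 1"]
 by (cases "x >= 1") (auto simp: bump_def)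

lemma sum_bump_telescope:
 "(\<Sum>k\<in>{- int L..int L}. bump (x - of_int k)) = smooth_step (x + 1 + L) - smooth_step (x - L)"
proof (induction L)
 case 0
 then show ?case by (simp add: bump_def)
next
 case (Suc L)
 have "{- int (Suc L)..int (Suc L)} = insert (- int (Suc L)) (insert (int (Suc L)) {- int L..int L})"
  by auto
 then show ?case using Suc by (simp add: bump_def algebra_simps)
qed

lemma sum_bump_le_1: "(\<Sum>k\<in>{- int L..int L}. bump (x - of_int k)) <= 1"
 using smooth_step_simps[of "x + 1 + L"] smooth_step_simps[of "x - L"]
 unfolding sum_bump_telescope by linarith

lemma sum_bump_eq_1: "\<bar>x\<bar> <= L ==> (\<Sum>k\<in>{- int L..int L}. bump (x - of_int k)) = 1"
 using smooth_step_simps[of "x + 1 + L"] smooth_step_simps[of "x - L"]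
 unfolding sum_bump_telescope by linarith

lemma bump_derivative:
 obtains b C where "!!x. (bump has_real_derivative b x) (at x)" "C > 0"
  "!!L x. (\<Sum>k\<in>{- int L..int L}. \<bar>b (x - of_int k)\<bar>) <= C"
proof -
 define b where "b x = frechet_derivative bump (at x) 1" for x
 have fd: "(bump has_derivative frechet_derivative bump (at x)) (at x)" for x
  by (rule smooth_has_derivative[OF smooth_bump])
 have d: "(bump has_real_derivative b x) (at x)" for x
  unfolding has_field_derivative_def
 proof -
  have "frechet_derivative bump (at x) = (*) (b x)"
  proof
   fix h
   have "frechet_derivative bump (at x) (h *\<^sub>R 1) = h *\<^sub>R b x"
    unfolding b_def using fd[of x] by (metis has_derivative_linear linear_scale)
   then show "frechet_derivative bump (at x) h = b x * h" by (simp add: mult.commute)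
  qed
  with fd[of x] show "(bump has_derivative (*) (b x)) (at x)" by simp
 qed
 have z: "b x = 0" if "\<bar>x\<bar> > 1" for x
 proof -
  have "((%x. 0) has_real_derivative 0) (at x)" by simp
  then have "(bump has_real_derivative 0) (at x)"
   by (rule has_field_derivative_transform_within_open[where S = "- {-1..1}"])
     (use that in \<open>auto simp: bump_eq_0\<close>)
  with d show ?thesis using DERIV_unique by blast
 qed
 have "continuous_on {-1..1} b"
  unfolding b_def by (intro smooth_continuous smooth_frechet_derivative smooth_bump)
 then have "bounded (b ` {-1..1})" by (intro compact_imp_bounded compact_continuous_image) auto
 then obtain B where B: "!!x. x \<in> {-1..1} ==> \<bar>b x\<bar> <= B"
  unfolding bounded_iff real_norm_def by blast
 have B': "\<bar>b x\<bar> <= B" for x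
 proof (cases "\<bar>x\<bar> > 1")
  case True
  then show ?thesis using z[OF True] B[of 0] by auto
 next
  case False
  then have "x \<in> {-1..1}" by auto
  then show ?thesis by (rule B)
 qed
 \<comment> \<open>Only the translates with \<open>k\<close> within 1 of the floor of
   \<open>x\<close> have a non-zero derivative at \<open>x\<close>, at most three of them; the
   \<open>+ 1\<close> makes the constant positive.\<close>
 have "(\<Sum>k\<in>{- int L..int L}. \<bar>b (x - of_int k)\<bar>) <= 3 * (B + 1)" for L x
 proof -
  have "(\<Sum>k\<in>{- int L..int L}. \<bar>b (x - of_int k)\<bar>)
    = (\<Sum>k\<in>{- int L..int L} \<inter> {\<lfloor>x\<rfloor> - 1..\<lfloor>x\<rfloor> + 1}. \<bar>b (x - of_int k)\<bar>)"
  proof (rule sum.mono_neutral_right)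
   show "\<forall>k\<in>{- int L..int L} - {- int L..int L} \<inter> {\<lfloor>x\<rfloor> - 1..\<lfloor>x\<rfloor> + 1}. \<bar>b (x - real_of_int k)\<bar> = 0"
   proof
    fix k assume "k \<in> {- int L..int L} - {- int L..int L} \<inter> {\<lfloor>x\<rfloor> - 1..\<lfloor>x\<rfloor> + 1}"
    then have "k < \<lfloor>x\<rfloor> - 1 \<or> k > \<lfloor>x\<rfloor> + 1" by auto
    then have "\<bar>x - of_int k\<bar> > 1" by linarith
    then show "\<bar>b (x - real_of_int k)\<bar> = 0" by (simp add: z)
   qed
  qed auto
  also have "... <= (\<Sum>k\<in>{- int L..int L} \<inter> {\<lfloor>x\<rfloor> - 1..\<lfloor>x\<rfloor> + 1}. B)"
   by (intro sum_mono B')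
  also have "... <= 3 * B"
  proof -
   have "card ({- int L..int L} \<inter> {\<lfloor>x\<rfloor> - 1..\<lfloor>x\<rfloor> + 1}) <= card {\<lfloor>x\<rfloor> - 1..\<lfloor>x\<rfloor> + 1}"
    by (intro card_mono) auto
   also have "... = 3" by simp
   finally have "card ({- int L..int L} \<inter> {\<lfloor>x\<rfloor> - 1..\<lfloor>x\<rfloor> + 1}) <= 3" .
   then show ?thesis using B'[of 0] by (simp add: mult_right_mono)
  qed
  finally show ?thesis by simp
 qed
 moreover have "3 * (B + 1) > 0" using order_trans[OF abs_ge_zero B'[of 0]] by simp
 ultimately show thesis by (intro that[OF d])
qed

section \<open>Reduction of flows\<close>

text \<open>A feasible flow with as few active edges as possible has no directed cycle among them,
  since a cycle could be cancelled until one of its edges vanishes. Without cycles, an edge carries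
  at most what crosses the cut given by the points reachable from its head, and that amount is
  bounded by the total demand.\<close>

lemma flow_reduction_nonneg:
 fixes s t :: "'i => 'p" and th :: "'i => real" and c :: "'p => real"
 assumes I: "finite I" and th: "!!i. i \<in> I ==> 0 <= th i"
  and bd: "!!ph. (\<Sum>i\<in>I. th i * (ph (t i) - ph (s i))) = (\<Sum>v\<in>V. c v * ph v)"
  and N: "(\<Sum>v\<in>V. \<bar>c v\<bar>) <= N"
 shows "EX \<eta>. (\<forall>i\<in>I. 0 <= \<eta> i & \<eta> i <= th i & \<eta> i <= N) &
  (ALL ph. (\<Sum>i\<in>I. \<eta> i * (ph (t i) - ph (s i))) = (\<Sum>v\<in>V. c v * ph v))"
proof -
 define feas where "feas \<eta> \<longleftrightarrow> (\<forall>i\<in>I. 0 <= \<eta> i & \<eta> i <= th i) &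
  (ALL ph. (\<Sum>i\<in>I. \<eta> i * (ph (t i) - ph (s i))) = (\<Sum>v\<in>V. c v * ph v))" for \<eta>
 define supp where "supp \<eta> = {i\<in>I. 0 < \<eta> i}" for \<eta> :: "'i => real"
 have "feas th" using th bd by (auto simp: feas_def)
 \<comment> \<open>Minimality of the support stands in for an iterated removal of cycles.\<close>
 then obtain \<eta> where f: "feas \<eta>" and min: "!!\<eta>'. feas \<eta>' ==> card (supp \<eta>) <= card (supp \<eta>')"
  using ex_has_least_nat[of feas th "%\<eta>. card (supp \<eta>)"] by blast
 have nn: "0 <= \<eta> i" if "i \<in> I" for i using f that by (auto simp: feas_def)
 have "\<eta> i0 <= N" if i0: "i0 \<in> I" for i0
 proof (cases "0 < \<eta> i0")
  case False
  have "0 <= N" using N by (meson abs_ge_zero order_trans sum_nonneg)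
  then show ?thesis using False by linarith
 next
  case pos: True
  define E where "E = {(s i, t i) | i. i \<in> supp \<eta>}"
  define R where "R = {x. (t i0, x) \<in> E\<^sup>*}"
  \<comment> \<open>A path of active edges from the head of \<open>i0\<close> to \<open>x\<close>
    gives a non-negative flow on active edges with boundary \<open>x - t i0\<close>; an edge
    traversed twice simply counts twice.\<close>
  have circ: "\<exists>g :: 'i => real. (\<forall>i\<in>I. 0 <= g i) & (\<forall>i\<in>I. g i ~= 0 --> 0 < \<eta> i) &
    (ALL ph. (\<Sum>i\<in>I. g i * (ph (t i) - ph (s i))) = ph x - ph (t i0))" if "(t i0, x) \<in> E\<^sup>*" for x
   using that
  proof (induction rule: rtrancl_induct)
   case base
   show ?case by (rule exI[of _ "%_. 0"]) auto
  next
   case (step y z)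
   then obtain g :: "'i => real" where g: "\<forall>i\<in>I. 0 <= g i" "\<forall>i\<in>I. g i ~= 0 --> 0 < \<eta> i"
    "!!ph. (\<Sum>i\<in>I. g i * (ph (t i) - ph (s i))) = ph y - ph (t i0)" by blast
   from step obtain k where k: "k \<in> I" "0 < \<eta> k" "y = s k" "z = t k" by (auto simp: E_def supp_def)
   have "(\<Sum>i\<in>I. (g i + (if i = k then 1 else 0)) * (ph (t i) - ph (s i))) = ph z - ph (t i0)" for ph
   proof -
    have "(\<Sum>i\<in>I. (g i + (if i = k then 1 else 0)) * (ph (t i) - ph (s i)))
     = (\<Sum>i\<in>I. g i * (ph (t i) - ph (s i))) + (\<Sum>i\<in>I. if i = k then ph (t i) - ph (s i) else 0)"
     by (simp add: distrib_right sum.distrib if_distrib[of "%a. a * _"] cong: if_cong)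
    then show ?thesis using I k g(3) by simp
   qed
   then show ?case using g k by (intro exI[of _ "%i. g i + (if i = k then 1 else 0)"]) auto
  qed
  have "s i0 \<notin> R"
  proof
   assume "s i0 \<in> R"
   then obtain g :: "'i => real" where g: "\<forall>i\<in>I. 0 <= g i" "\<forall>i\<in>I. g i ~= 0 --> 0 < \<eta> i"
    "!!ph. (\<Sum>i\<in>I. g i * (ph (t i) - ph (s i))) = ph (s i0) - ph (t i0)"
    using circ unfolding R_def by blast
   \<comment> \<open>If the tail of \<open>i0\<close> were reachable, the path closed up by
     \<open>i0\<close> itself would be a circulation.\<close>
   define h where "h i = g i + (if i = i0 then 1 else 0)" for i
   have h0: "(\<Sum>i\<in>I. h i * (ph (t i) - ph (s i))) = 0" for ph
   proof -
    have "(\<Sum>i\<in>I. h i * (ph (t i) - ph (s i)))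
     = (\<Sum>i\<in>I. g i * (ph (t i) - ph (s i))) + (\<Sum>i\<in>I. if i = i0 then ph (t i) - ph (s i) else 0)"
     unfolding h_def
     by (simp add: distrib_right sum.distrib if_distrib[of "%a. a * _"] cong: if_cong)
    then show ?thesis using I i0 g(3) by simp
   qed
   define H where "H = {i\<in>I. h i > 0}"
   have "H ~= {}" "finite H" using I i0 g(1) by (auto simp: H_def h_def intro!: exI[of _ i0])
   \<comment> \<open>The edge with the smallest ratio is the first to vanish when multiples of the
     circulation are subtracted, and no edge has become negative by then.\<close>
   then obtain k where k: "k \<in> H" "!!i. i \<in> H ==> \<eta> k / h k <= \<eta> i / h i"
    using arg_min_if_finite(1)[of H "%i. \<eta> i / h i"] arg_min_if_finite(2)[of H "%i. \<eta> i / h i"]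
    by (metis not_le)
   define a where "a = \<eta> k / h k"
   define \<eta>' where "\<eta>' i = \<eta> i - a * h i" for i
   have hk: "h k > 0" "k \<in> I" using k by (auto simp: H_def)
   have h_nn: "h i >= 0" if "i \<in> I" for i using g(1) that by (auto simp: h_def)
   have a0: "a >= 0" using hk nn by (auto simp: a_def)
   have \<eta>'0: "0 <= \<eta>' i" if "i \<in> I" for i
   proof (cases "h i > 0")
    case True
    then have "a <= \<eta> i / h i" using k that by (auto simp: a_def H_def)
    then show ?thesis using True by (simp add: \<eta>'_def field_simps)
   next
    case False
    then show ?thesis using h_nn[OF that] nn[OF that] by (simp add: \<eta>'_def)
   qed
   have le: "\<eta>' i <= \<eta> i" if "i \<in> I" for i using a0 h_nn[OF that] by (simp add: \<eta>'_def)
   have "feas \<eta>'"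
    unfolding feas_def
   proof (intro conjI ballI allI)
    fix ph
    have "(\<Sum>i\<in>I. \<eta>' i * (ph (t i) - ph (s i)))
     = (\<Sum>i\<in>I. \<eta> i * (ph (t i) - ph (s i))) - a * (\<Sum>i\<in>I. h i * (ph (t i) - ph (s i)))"
     by (simp add: \<eta>'_def left_diff_distrib sum_subtractf sum_distrib_left mult.assoc)
    then show "(\<Sum>i\<in>I. \<eta>' i * (ph (t i) - ph (s i))) = (\<Sum>v\<in>V. c v * ph v)"
     using f h0 by (simp add: feas_def)
   qed (use \<eta>'0 le f in \<open>auto simp: feas_def intro: order_trans\<close>)
   moreover have "card (supp \<eta>') < card (supp \<eta>)"
   proof (rule psubset_card_mono)
    show "finite (supp \<eta>)" using I by (simp add: supp_def)
    have "h k ~= 0 ==> 0 < \<eta> k" using g(2) hk pos by (auto simp: h_def split: if_splits)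
    then have "k \<in> supp \<eta>" using hk by (auto simp: supp_def)
    moreover have "k \<notin> supp \<eta>'" using hk by (simp add: supp_def \<eta>'_def a_def)
    moreover have "supp \<eta>' \<subseteq> supp \<eta>" using le by (force simp: supp_def)
    ultimately show "supp \<eta>' \<subset> supp \<eta>" by blast
   qed
   ultimately show False using min by (meson not_le)
  qed
  \<comment> \<open>As a potential, the indicator of the reachable set never decreases along an
    active edge and jumps by 1 along \<open>i0\<close>. So all terms of the boundary sum are
    non-negative, and one of them is \<open>\<eta> i0\<close>.\<close>
  define ph where "ph x = (if x \<in> R then 1 else 0 :: real)" for x
  have t0: "t i0 \<in> R" by (simp add: R_def)
  have step: "ph (s i) <= ph (t i)" if "i \<in> I" "0 < \<eta> i" for i
  proof -
   have "(s i, t i) \<in> E" using that by (auto simp: E_def supp_def)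
   then show ?thesis by (auto simp: ph_def R_def intro: rtrancl_into_rtrancl)
  qed
  have "\<eta> i0 = \<eta> i0 * (ph (t i0) - ph (s i0))" using t0 \<open>s i0 \<notin> R\<close> by (simp add: ph_def)
  also have "... <= (\<Sum>i\<in>I. \<eta> i * (ph (t i) - ph (s i)))"
  proof (rule member_le_sum[OF i0 _ I])
   fix i assume "i \<in> I - {i0}"
   then show "0 <= \<eta> i * (ph (t i) - ph (s i))"
    using step[of i] nn[of i] by (cases "0 < \<eta> i") auto
  qed
  also have "... = (\<Sum>v\<in>V. c v * ph v)" using f by (simp add: feas_def)
  also have "... <= (\<Sum>v\<in>V. \<bar>c v\<bar>)" by (rule sum_mono) (auto simp: ph_def)
  finally show ?thesis using N by linarith
 qed
 then show ?thesis using f by (auto simp: feas_def)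
qed

text \<open>Signs are removed by reversing the edges of negative multiplicity. The result is phrased
  with factors in [0, 1] because such factors make multiplicities smaller in the order
  \<open>preceq\<close>.\<close>

lemma flow_reduction:
 fixes s t :: "'i => 'p" and \<theta> :: "'i => real" and c :: "'p => real"
 assumes I: "finite I"
  and bd: "!!f. (\<Sum>i\<in>I. \<theta> i * (f (t i) - f (s i))) = (\<Sum>v\<in>V. c v * f v)"
  and N: "(\<Sum>v\<in>V. \<bar>c v\<bar>) <= N"
 obtains a where "!!i. i \<in> I ==> 0 <= a i & a i <= 1 & \<bar>a i * \<theta> i\<bar> <= N"
  "!!f. (\<Sum>i\<in>I. a i * \<theta> i * (f (t i) - f (s i))) = (\<Sum>v\<in>V. c v * f v)"
proof -
 define s' where "s' i = (if \<theta> i < 0 then t i else s i)" for i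
 define t' where "t' i = (if \<theta> i < 0 then s i else t i)" for i
 have "(\<Sum>i\<in>I. \<bar>\<theta> i\<bar> * (f (t' i) - f (s' i))) = (\<Sum>i\<in>I. \<theta> i * (f (t i) - f (s i)))" for f
  by (rule sum.cong) (auto simp: s'_def t'_def algebra_simps)
 then have "EX h. (\<forall>i\<in>I. 0 <= h i & h i <= \<bar>\<theta> i\<bar> & h i <= N) &
  (ALL f. (\<Sum>i\<in>I. h i * (f (t' i) - f (s' i))) = (\<Sum>v\<in>V. c v * f v))"
  by (intro flow_reduction_nonneg[OF I _ _ N]) (auto simp: bd)
 then obtain h where h: "!!i. i \<in> I ==> 0 <= h i & h i <= \<bar>\<theta> i\<bar> & h i <= N"
  "!!f. (\<Sum>i\<in>I. h i * (f (t' i) - f (s' i))) = (\<Sum>v\<in>V. c v * f v)" by blast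
 define a where "a i = h i / \<bar>\<theta> i\<bar>" for i
 have a\<theta>: "a i * \<theta> i * (f (t i) - f (s i)) = h i * (f (t' i) - f (s' i))" if "i \<in> I" for i and f :: "'p => real"
  using h(1)[OF that] by (cases "\<theta> i = 0") (auto simp: a_def s'_def t'_def abs_if field_simps)
 show thesis
 proof (rule that[of a])
  fix i assume "i \<in> I"
  with h(1)[OF this] show "0 <= a i & a i <= 1 & \<bar>a i * \<theta> i\<bar> <= N"
   by (cases "\<theta> i = 0") (auto simp: a_def abs_mult)
 next
  fix f show "(\<Sum>i\<in>I. a i * \<theta> i * (f (t i) - f (s i))) = (\<Sum>v\<in>V. c v * f v)"
   using h(2)[of f] a\<theta> by (simp cong: sum.cong)
 qed
qed

text \<open>The constant \<open>C\<close> will have to be fixed before \<open>d\<close> and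
  \<open>r\<close>, as the mesh is chosen in terms of a given chain. The derivative bound concerns
  the sum over all of \<open>V\<close>, so that estimates do not grow with the number of grid
  points.\<close>

definition grid_partition ::
 "real => real => real => 'a::euclidean_space set => ('a => 'a => real) => bool" where
 "grid_partition C d r V lam \<longleftrightarrow> finite V & V \<subseteq> cball 0 (r + d) & (ALL v. test_function (lam v)) &
   (ALL v x. 0 <= lam v x) & (ALL x. (\<Sum>v\<in>V. lam v x) <= 1) &
   (ALL x. norm x <= r --> (\<Sum>v\<in>V. lam v x) = 1) &
   (ALL v x. lam v x ~= 0 --> norm (x - v) <= d) &
   (ALL x h. (\<Sum>v\<in>V. \<bar>frechet_derivative (lam v) (at x) h\<bar>) <= C / d * norm h)"

text \<open>The functions are products of one-dimensional bumps. A lattice sum of products factors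
  into one-dimensional sums, which are at most 1, equal to 1 in the middle, or bounded by
  \<open>B\<close> when the bump is replaced by its derivative.\<close>

lemma grid_partition_exists:
 "\<exists>C>0. \<forall>del>0. ALL r. \<exists>(V::'a::euclidean_space set) lam. grid_partition C del r V lam"
proof -
 obtain b B where db: "!!x. (bump has_real_derivative b x) (at x)" and B: "B > 0"
  "!!L x. (\<Sum>k\<in>{- int L..int L}. \<bar>b (x - of_int k)\<bar>) <= B"
  using bump_derivative by blast
 define d where "d = real DIM('a)"
 have d: "d > 0" by (simp add: d_def)
 have "EX V lam. grid_partition (d * d * B) del r (V::'a set) lam" if del: "del > 0" for del r
 proof -
  \<comment> \<open>On the support each coordinate of \<open>x - v\<close> is at most
    \<open>e\<close>, so the norm, being below the sum of the coordinates, is at most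
    \<open>d * e = del\<close>.\<close>
  define e where "e = del / d"
  let ?u = "%x v c. x \<bullet> c / e - v \<bullet> c / e" and ?P = "%x v c. \<Prod>c'\<in>Basis - {c}. bump (x \<bullet> c' / e - v \<bullet> c' / e)"
  have e: "e > 0" using del d by (simp add: e_def)
  define lam where "lam v x = (\<Prod>c\<in>Basis. bump ((x \<bullet> c) / e - (v \<bullet> c) / e))" for v x :: 'a
  obtain L :: nat where L: "r / e <= L" using real_arch_simple by blast
  define Z where "Z = (Basis :: 'a set) \<rightarrow>\<^sub>E {- int L..int L}"
  define vert where "vert z = (\<Sum>c\<in>Basis. (e * of_int (z c)) *\<^sub>R c)" for z :: "'a => int"
  have vert: "vert z \<bullet> c / e = of_int (z c)" if "c \<in> Basis" for z c
   using that e by (simp add: vert_def)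
  have finZ: "finite Z" unfolding Z_def by (intro finite_PiE) auto
  have inj: "inj_on vert Z"
  proof
   fix z z' assume zz: "z \<in> Z" "z' \<in> Z" "vert z = vert z'"
   show "z = z'"
   proof (rule PiE_ext[OF zz(1)[unfolded Z_def] zz(2)[unfolded Z_def]])
    fix c :: 'a assume "c \<in> Basis"
    then show "z c = z' c" using vert[of c z] vert[of c z'] zz(3) by simp
   qed
  qed
  have gs: "(\<Sum>v\<in>vert ` Z. \<Prod>c\<in>Basis. G c (v \<bullet> c / e)) = (\<Prod>c\<in>Basis. \<Sum>k\<in>{- int L..int L}. G c (of_int k))"
   for G :: "'a => real => real"
  proof -
   have "(\<Sum>v\<in>vert ` Z. \<Prod>c\<in>Basis. G c (v \<bullet> c / e)) = (\<Sum>z\<in>Z. \<Prod>c\<in>Basis. G c (of_int (z c)))"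
    by (subst sum.reindex[OF inj]) (auto intro!: sum.cong prod.cong simp: vert)
   also have "... = (\<Prod>c\<in>Basis. \<Sum>k\<in>{- int L..int L}. G c (of_int k))"
    unfolding Z_def by (subst prod_sum_PiE) auto
   finally show ?thesis .
  qed
  \<comment> \<open>Dropping the far lattice points loses nothing on the ball of radius
    \<open>r\<close>: a point whose function is non-zero there lies within
    \<open>r + del\<close>.\<close>
  define V where "V = vert ` Z \<inter> cball 0 (r + del)"
  have finV: "finite V" unfolding V_def using finZ by auto
  have nn: "0 <= lam v x" for v x unfolding lam_def by (intro prod_nonneg) (auto simp: bump_nonneg)
  have near: "norm (x - v) <= del" if "lam v x ~= 0" for v x
  proof -
   have "\<bar>(x - v) \<bullet> c\<bar> <= e" if c: "c \<in> Basis" for c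
   proof -
    have "bump ((x \<bullet> c) / e - (v \<bullet> c) / e) ~= 0"
     using \<open>lam v x ~= 0\<close> c by (auto simp: lam_def)
    then have "\<bar>(x \<bullet> c) / e - (v \<bullet> c) / e\<bar> < 1" using bump_eq_0 by (meson not_less)
    then have "\<bar>((x - v) \<bullet> c) / e\<bar> < 1" by (simp add: inner_diff_left diff_divide_distrib)
    then show ?thesis using e by (simp add: abs_divide divide_simps)
   qed
   then have "norm (x - v) <= (\<Sum>c\<in>(Basis::'a set). e)"
    using norm_le_l1[of "x - v"] by (meson order_trans sum_mono)
   then show ?thesis using d by (simp add: e_def d_def)
  qed
  have tot: "(\<Sum>v\<in>vert ` Z. lam v x) = (\<Prod>c\<in>Basis. \<Sum>k\<in>{- int L..int L}. bump (x \<bullet> c / e - of_int k))" for x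
   unfolding lam_def by (rule gs[of "%c t. bump (x \<bullet> c / e - t)"])
  have le1: "(\<Sum>v\<in>V. lam v x) <= 1" for x
  proof -
   have "(\<Sum>v\<in>V. lam v x) <= (\<Sum>v\<in>vert ` Z. lam v x)"
    unfolding V_def by (rule sum_mono2) (auto simp: nn finZ)
   also have "... <= 1" unfolding tot
    by (rule prod_le_1) (auto intro!: sum_nonneg sum_bump_le_1 simp: bump_nonneg)
   finally show ?thesis .
  qed
  have eq1: "(\<Sum>v\<in>V. lam v x) = 1" if x: "norm x <= r" for x
  proof -
   have "(\<Sum>v\<in>V. lam v x) = (\<Sum>v\<in>vert ` Z. lam v x)"
    unfolding V_def
   proof (rule sum.mono_neutral_left)
    show "\<forall>v\<in>vert ` Z - vert ` Z \<inter> cball 0 (r + del). lam v x = 0"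
    proof (rule ballI, rule ccontr)
     fix v assume v: "v \<in> vert ` Z - vert ` Z \<inter> cball 0 (r + del)" "lam v x ~= 0"
     have "norm v <= norm x + norm (x - v)" by norm
     then show False using v near[of v x] x by auto
    qed
   qed (use finZ in auto)
   also have "... = 1" unfolding tot
   proof (rule prod.neutral, rule ballI)
    fix c :: 'a assume c: "c \<in> Basis"
    have "\<bar>x \<bullet> c\<bar> <= r" using Basis_le_norm[OF c, of x] x by linarith
    then have "\<bar>x \<bullet> c\<bar> / e <= r / e" using e by (intro divide_right_mono) auto
    then have "\<bar>x \<bullet> c / e\<bar> <= L" using L e by (simp add: abs_divide)
    then show "(\<Sum>k\<in>{- int L..int L}. bump (x \<bullet> c / e - of_int k)) = 1" by (rule sum_bump_eq_1)
   qed
   finally show ?thesis .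
  qed
  have der: "(lam v has_derivative (%h. \<Sum>c\<in>Basis. (h \<bullet> c / e * b (?u x v c)) *
    (?P x v c))) (at x)" for v x
   unfolding lam_def[abs_def]
  proof (rule has_derivative_prod)
   fix c :: 'a assume "c \<in> Basis"
   have 1: "((%x. x \<bullet> c / e - v \<bullet> c / e) has_derivative (%h. h \<bullet> c / e)) (at x)"
    using e by (auto intro!: derivative_eq_intros)
   show "((%x. bump (?u x v c)) has_derivative (%h. h \<bullet> c / e * b (?u x v c))) (at x)"
    using has_derivative_compose[OF 1 db[unfolded has_field_derivative_def]]
    by (simp add: mult.commute)
  qed
  have derb: "(\<Sum>v\<in>V. \<bar>frechet_derivative (lam v) (at x) h\<bar>) <= d * d * B / del * norm h" for x h
  proof -
   have "(\<Sum>v\<in>V. \<bar>frechet_derivative (lam v) (at x) h\<bar>)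
    <= (\<Sum>v\<in>vert ` Z. \<Sum>c\<in>Basis. norm h / e * (\<bar>b (?u x v c)\<bar> *
       (?P x v c)))"
   proof (rule order_trans[OF sum_mono2[of "vert ` Z" V] sum_mono])
    fix v assume "v \<in> vert ` Z"
    have "\<bar>frechet_derivative (lam v) (at x) h\<bar> =
      \<bar>\<Sum>c\<in>Basis. (h \<bullet> c / e * b (?u x v c)) *
       (?P x v c)\<bar>"
     unfolding frechet_derivative_at[OF der[of v x], symmetric] ..
    also have "... <= (\<Sum>c\<in>Basis. norm h / e * (\<bar>b (?u x v c)\<bar> *
       (?P x v c)))"
    proof (rule order_trans[OF sum_abs sum_mono])
     fix c :: 'a assume c: "c \<in> Basis"
     have p: "0 <= (?P x v c)"
      by (intro prod_nonneg) (auto simp: bump_nonneg)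
     have "\<bar>h \<bullet> c\<bar> / e <= norm h / e" using Basis_le_norm[OF c, of h] e by (simp add: divide_right_mono)
     then have "\<bar>h \<bullet> c\<bar> / e * (\<bar>b (?u x v c)\<bar> * (?P x v c))
      <= norm h / e * (\<bar>b (?u x v c)\<bar> * (?P x v c))"
      using p by (intro mult_right_mono) auto
     then show "\<bar>h \<bullet> c / e * b (?u x v c) * (?P x v c)\<bar>
      <= norm h / e * (\<bar>b (?u x v c)\<bar> * (?P x v c))"
      using p e by (simp add: abs_mult mult.assoc)
    qed
    finally show "\<bar>frechet_derivative (lam v) (at x) h\<bar> <= ..." .
   qed (auto simp: V_def finZ)
   also have "... = (\<Sum>c\<in>Basis. norm h / e * (\<Sum>v\<in>vert ` Z. \<bar>b (?u x v c)\<bar> *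
       (?P x v c)))"
    by (subst sum.swap) (simp add: sum_distrib_left)
   also have "... <= (\<Sum>c\<in>(Basis::'a set). norm h / e * B)"
   proof (intro sum_mono mult_left_mono)
    fix c :: 'a assume c: "c \<in> Basis"
    \<comment> \<open>The factor of direction \<open>c\<close> is replaced by the derivative, in a
      form to which the factorization \<open>gs\<close> applies.\<close>
    define G where "G c' t = (if c' = c then \<bar>b (x \<bullet> c / e - t)\<bar> else bump (x \<bullet> c' / e - t))" for c' t
    have pr: "(\<Prod>c'\<in>Basis. G c' (f c')) = \<bar>b (x \<bullet> c / e - f c)\<bar> * (\<Prod>c'\<in>Basis - {c}. bump (x \<bullet> c' / e - f c'))" for f
     by (subst prod.remove[OF _ c]) (auto simp: G_def intro!: prod.cong)
    have "(\<Sum>v\<in>vert ` Z. \<bar>b (?u x v c)\<bar> * (?P x v c))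
     = (\<Prod>c'\<in>Basis. \<Sum>k\<in>{- int L..int L}. G c' (of_int k))"
     unfolding gs[of G, symmetric] by (simp add: pr)
    also have "... = (\<Sum>k\<in>{- int L..int L}. \<bar>b (x \<bullet> c / e - of_int k)\<bar>) *
      (\<Prod>c'\<in>Basis - {c}. \<Sum>k\<in>{- int L..int L}. bump (x \<bullet> c' / e - of_int k))"
     by (subst prod.remove[OF _ c]) (auto simp: G_def intro!: prod.cong)
    also have "... <= B * 1"
     by (intro mult_mono B prod_le_1 prod_nonneg)
       (auto intro!: sum_nonneg sum_bump_le_1 simp: bump_nonneg less_imp_le[OF B(1)])
    finally show "(\<Sum>v\<in>vert ` Z. \<bar>b (?u x v c)\<bar> *
     (?P x v c)) <= B" by simp
   qed (use e in auto)
   \<comment> \<open>One factor \<open>d\<close> counts the directions, the other comes from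
     \<open>1 / e = d / del\<close>.\<close>
   also have "... = d * d * B / del * norm h" using d del by (simp add: e_def d_def field_simps)
   finally show ?thesis .
  qed
  have test: "test_function (lam v)" for v
   unfolding test_function_def
  proof (intro conjI exI[of _ "cball v del"] allI impI)
   show "smooth (lam v)" unfolding lam_def[abs_def]
   proof (rule smooth_prod)
    fix c :: 'a
    have 1: "((%x. x \<bullet> c / e - v \<bullet> c / e) has_derivative (%h. h \<bullet> c / e)) (at x)" for x
     using e by (auto intro!: derivative_eq_intros)
    show "smooth (%x. bump (?u x v c))"
     by (rule smooth_compose_affine[OF 1 smooth_bump])
   qed
   show "lam v x = 0" if "x \<notin> cball v del" for x
    using near[of v x] that by (auto simp: dist_norm norm_minus_commute)
  qed auto
  have "grid_partition (d * d * B) del r V lam"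
   unfolding grid_partition_def
   by (intro conjI allI impI finV test nn le1 eq1 near derb) (simp_all add: V_def)
  then show ?thesis by (intro exI)
 qed
 then show ?thesis using d B by (intro exI[of _ "d * d * B"]) simp
qed

section \<open>Hausdorff measure\<close>

text \<open>Caratheodory's criterion. The part of \<open>A\<close> outside \<open>F\<close> is
  exhausted by the points at distance at least \<open>r n\<close> from \<open>F\<close>, to which
  \<open>sep\<close> applies; the rest is a union of shells, of which only a tail of a convergent
  series remains.\<close>

lemma metric_outer_measure_closed:
 fixes f :: "'a::metric_space set => ennreal"
 assumes om: "outer_measure_space (Pow UNIV) f"
  and sep: "!!A B d. d > 0 ==> (!!x y. x \<in> A ==> y \<in> B ==> d <= dist x y) ==> f A + f B <= f (A \<union> B)"
  and F: "closed F"
 shows "F \<in> lambda_system UNIV (Pow UNIV) f"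
proof -
 have emp: "f {} = 0" and mono: "!!A B. A \<subseteq> B ==> f A <= f B"
  and dsub: "!!A. disjoint_family A ==> f (\<Union>i::nat. A i) <= (\<Sum>i. f (A i))"
  using om by (auto simp: outer_measure_space_def positive_def increasing_def countably_subadditive_def)
 have csub: "f (\<Union>i::nat. A i) <= (\<Sum>i. f (A i))" for A
 proof -
  have "f (\<Union>i. disjointed A i) <= (\<Sum>i. f (disjointed A i))" by (rule dsub[OF disjoint_family_disjointed])
  also have "... <= (\<Sum>i. f (A i))" by (intro suminf_le mono disjointed_subset summableI)
  finally show ?thesis by (simp add: UN_disjointed_eq)
 qed
 have sub: "f (A \<union> B) <= f A + f B" for A B
 proof -
  have "f (\<Union>i. binaryset A B i) <= (\<Sum>i. f (binaryset A B i))" by (rule csub)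
  also have "... = f A + f B" using binaryset_sums[of f A B] emp by (simp add: sums_iff)
  finally show ?thesis by (simp add: UN_binaryset_eq)
 qed
 have "f (F \<inter> A) + f ((UNIV - F) \<inter> A) <= f A" for A
 proof (cases "f A = \<infinity> \<or> F = {}")
  case True
  then show ?thesis using emp by auto
 next
  case False
  then have fin: "f A < \<infinity>" and ne: "F ~= {}" by (auto simp: top.not_eq_extremum)
  define r where "r n = 1 / real (Suc n)" for n
  have r: "r n > 0" for n by (simp add: r_def)
  have r_anti: "r n < r m" if "m < n" for m n using that by (simp add: r_def frac_less2)
  define G where "G n = {x \<in> A. r n <= infdist x F}" for n
  define R where "R n = {x \<in> A. r (Suc n) <= infdist x F & infdist x F < r n}" for n
  have Rsep: "r (Suc m) - r n <= dist x y" if "x \<in> R m" "y \<in> R n" for m n x y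
  proof -
   have "infdist x F <= infdist y F + dist x y" by (rule infdist_triangle)
   then show ?thesis using that by (auto simp: R_def)
  qed
  \<comment> \<open>Shells whose indices have the same parity are at positive distance from each
    other, so \<open>f\<close> adds up over them and stays below \<open>f A\<close>. Both parities
    together bound the whole series by \<open>f A + f A\<close>.\<close>
  have Rsum: "(\<Sum>i<n. f (R (2 * i + k))) <= f A" for n k
  proof -
   have "(\<Sum>i<n. f (R (2 * i + k))) <= f (\<Union>i<n. R (2 * i + k))"
   proof (induction n)
    case (Suc n)
    have "f (\<Union>i<n. R (2 * i + k)) + f (R (2 * n + k)) <= f ((\<Union>i<n. R (2 * i + k)) \<union> R (2 * n + k))"
    proof (cases n)
     case 0
     then show ?thesis by (simp add: emp)
    next
     case (Suc m)
     show ?thesis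
     proof (rule sep[of "r (2 * m + k + 1) - r (2 * n + k)"])
      show "0 < r (2 * m + k + 1) - r (2 * n + k)" using r_anti[of "2 * m + k + 1" "2 * n + k"] Suc by simp
      fix x y assume "x \<in> (\<Union>i<n. R (2 * i + k))" and y: "y \<in> R (2 * n + k)"
      then obtain i where i: "i < n" "x \<in> R (2 * i + k)" by auto
      have "r (2 * m + k + 1) <= r (Suc (2 * i + k))"
       using r_anti[of "Suc (2 * i + k)" "2 * m + k + 1"] i Suc
       by (cases "i = m") auto
      then show "r (2 * m + k + 1) - r (2 * n + k) <= dist x y" using Rsep[OF i(2) y] by linarith
     qed
    qed
    moreover have "(\<Union>i<n. R (2 * i + k)) \<union> R (2 * n + k) = (\<Union>i<Suc n. R (2 * i + k))"
     by (auto simp: lessThan_Suc)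
    ultimately have "f (\<Union>i<n. R (2 * i + k)) + f (R (2 * n + k)) <= f (\<Union>i<Suc n. R (2 * i + k))" by simp
    moreover have "(\<Sum>i<Suc n. f (R (2 * i + k))) <= f (\<Union>i<n. R (2 * i + k)) + f (R (2 * n + k))"
     using Suc by (simp add: add_right_mono)
    ultimately show ?case by (rule order_trans[rotated])
   qed (simp add: emp)
   also have "... <= f A" by (rule mono) (auto simp: R_def)
   finally show ?thesis .
  qed
  have sumR: "(\<Sum>i. f (R i)) < \<infinity>"
  proof -
   have "(\<Sum>i<n. f (R i)) <= f A + f A" for n
   proof -
    have "(\<Sum>i<n. f (R i)) <= (\<Sum>i<2 * n. f (R i))" by (rule sum_mono2) auto
    also have "... = (\<Sum>i<n. f (R (2 * i + 0))) + (\<Sum>i<n. f (R (2 * i + 1)))"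
     by (induction n) (auto simp: ac_simps)
    also have "... <= f A + f A" by (intro add_mono Rsum)
    finally show ?thesis .
   qed
   then have "(\<Sum>i. f (R i)) <= f A + f A" by (intro suminf_le_const summableI)
   also have "... < \<infinity>" using fin by simp
   finally show ?thesis .
  qed
  have key: "f (F \<inter> A) + f ((UNIV - F) \<inter> A) <= f A + (\<Sum>i. f (R (i + n)))" for n
  proof -
   have "(UNIV - F) \<inter> A \<subseteq> G n \<union> (\<Union>i. R (i + n))"
   proof
    fix x assume x: "x \<in> (UNIV - F) \<inter> A"
    have pos: "infdist x F > 0"
     using x F ne by (metis Diff_iff IntD1 in_closed_iff_infdist_zero infdist_nonneg order_less_le)
    show "x \<in> G n \<union> (\<Union>i. R (i + n))"
    proof (cases "r n <= infdist x F")
     case True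
     then show ?thesis using x by (auto simp: G_def)
    next
     case lt: False
     obtain k where k: "r k < infdist x F"
      using pos reals_Archimedean[of "infdist x F"] by (auto simp: r_def inverse_eq_divide)
     define m where "m = (LEAST m. r m <= infdist x F)"
     have m: "r m <= infdist x F" unfolding m_def by (rule LeastI[of _ k]) (use k in simp)
     have "n < m"
     proof (rule ccontr)
      assume "\<not> n < m"
      then have "r n <= r m" using r_anti[of m n] by (cases "m = n") auto
      then show False using m lt by linarith
     qed
     then obtain j where j: "m = Suc (j + n)" by (metis add.commute less_imp_Suc_add)
     have "infdist x F < r (j + n)" using not_less_Least[of "j + n" "%m. r m <= infdist x F"] j
      by (simp add: m_def[symmetric])
     then have "x \<in> R (j + n)" using m j x by (auto simp: R_def)
     then show ?thesis by blast
    qed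
   qed
   then have "f ((UNIV - F) \<inter> A) <= f (G n) + f (\<Union>i. R (i + n))" by (meson mono order_trans sub)
   also have "... <= f (G n) + (\<Sum>i. f (R (i + n)))" by (intro add_left_mono csub)
   finally have "f (F \<inter> A) + f ((UNIV - F) \<inter> A) <= f (F \<inter> A) + f (G n) + (\<Sum>i. f (R (i + n)))"
    by (simp add: add.assoc add_left_mono)
   also have "f (F \<inter> A) + f (G n) <= f ((F \<inter> A) \<union> G n)"
   proof (rule sep[OF r])
    fix x y assume "x \<in> F \<inter> A" "y \<in> G n"
    then show "r n <= dist x y"
     using infdist_le[of x F y] by (auto simp: G_def dist_commute)
   qed
   also have "f ((F \<inter> A) \<union> G n) <= f A" by (rule mono) (auto simp: G_def)
   finally show ?thesis by (simp add: add_right_mono)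
  qed
  have "(%n. \<Sum>i. f (R (i + n))) \<longlonglongrightarrow> 0"
  proof -
   have fn: "f (R i) ~= \<infinity>" for i
    using fin mono[of "R i" A] by (auto simp: R_def top_unique)
   define g where "g i = enn2real (f (R i))" for i
   have fg: "f (R i) = ennreal (g i)" for i using fn[of i] by (simp add: g_def less_top)
   have gn: "0 <= g i" for i by (simp add: g_def)
   have sg: "summable g" using sumR unfolding fg by (intro summable_suminf_not_top) (auto simp: gn)
   have "(\<Sum>i. f (R (i + n))) = ennreal (\<Sum>i. g (i + n))" for n
    unfolding fg by (intro suminf_ennreal2 gn) (use sg in \<open>simp add: summable_iff_shift\<close>)
   moreover have "(%n. ennreal (\<Sum>i. g (i + n))) \<longlonglongrightarrow> ennreal 0"
    by (intro tendsto_ennrealI suminf_exist_split2 sg)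
   ultimately show ?thesis by simp
  qed
  then have "(%n. f A + (\<Sum>i. f (R (i + n)))) \<longlonglongrightarrow> f A + 0" by (rule tendsto_add[OF tendsto_const])
  then show ?thesis using key by (simp add: LIMSEQ_le_const)
 qed
 moreover have "f A <= f (F \<inter> A) + f ((UNIV - F) \<inter> A)" for A
 proof -
  have "(F \<inter> A) \<union> ((UNIV - F) \<inter> A) = A" by auto
  then show ?thesis using sub[of "F \<inter> A" "(UNIV - F) \<inter> A"] by simp
 qed
 ultimately show ?thesis unfolding lambda_system_def by (auto intro: antisym)
qed

definition hausdorff_outer :: "nat => 'a::metric_space set => ennreal" where
 "hausdorff_outer k A = (SUP d\<in>{0<..}. hausdorff_content d k A)"

text \<open>The empty set has to weigh 0 also for \<open>k = 0\<close>, where the formula would give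
  1.\<close>

definition cover_size :: "nat => 'a::metric_space set => ennreal" where
 "cover_size k E = (if E = {} then 0 else ennreal (unit_ball_vol (real k) * (diameter E / 2) ^ k))"

lemma hausdorff_content_le:
 assumes "A \<subseteq> (\<Union>i. E i)" "!!i. bounded (E i)" "!!i. diameter (E i) <= d"
 shows "hausdorff_content d k A <= (\<Sum>i::nat. cover_size k (E i))"
 unfolding hausdorff_content_def cover_size_def by (rule Inf_lower) (use assms in blast)

lemma hausdorff_content_ge:
 assumes "!!E. A \<subseteq> (\<Union>i. E i) ==> (!!i. bounded (E i)) ==> (!!i. diameter (E i) <= d)
  ==> c <= (\<Sum>i::nat. cover_size k (E i))"
 shows "c <= hausdorff_content d k A"
 unfolding hausdorff_content_def cover_size_def[symmetric] using assms by (intro Inf_greatest) blast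

lemma hausdorff_content_approx:
 assumes "hausdorff_content d k A < c"
 obtains E where "A \<subseteq> (\<Union>i. E i)" "!!i. bounded (E i)" "!!i. diameter (E i) <= d"
  "(\<Sum>i::nat. cover_size k (E i)) < c"
 using assms unfolding hausdorff_content_def cover_size_def[symmetric] Inf_less_iff by blast

lemma hausdorff_outer_le: "(!!d. d > 0 ==> hausdorff_content d k A <= c) ==> hausdorff_outer k A <= c"
 unfolding hausdorff_outer_def by (rule SUP_least) auto

lemma hausdorff_outer_ge: "d > 0 ==> hausdorff_content d k A <= hausdorff_outer k A"
 unfolding hausdorff_outer_def by (rule SUP_upper) auto

lemma hausdorff_content_mono: "A \<subseteq> B ==> hausdorff_content d k A <= hausdorff_content d k B"
 by (rule hausdorff_content_ge, rule hausdorff_content_le) (auto intro: order_trans)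

lemma hausdorff_content_antimono: "d <= d' ==> hausdorff_content d' k A <= hausdorff_content d k A"
 by (rule hausdorff_content_ge, rule hausdorff_content_le) (auto intro: order_trans)

lemma hausdorff_outer_mono: "A \<subseteq> B ==> hausdorff_outer k A <= hausdorff_outer k B"
 by (rule hausdorff_outer_le) (meson hausdorff_content_mono hausdorff_outer_ge order_trans)

lemma hausdorff_content_subadditive:
 assumes d: "d > 0"
 shows "hausdorff_content d k (\<Union>i::nat. A i) <= (\<Sum>i. hausdorff_content d k (A i))"
proof (rule ennreal_le_epsilon)
 fix e :: real assume fin: "(\<Sum>i. hausdorff_content d k (A i)) < top" and e: "0 < e"
 have "EX E. A i \<subseteq> (\<Union>j. E j) & (ALL j. bounded (E j)) & (ALL j. diameter (E j) <= d) &
   (\<Sum>j::nat. cover_size k (E j)) <= hausdorff_content d k (A i) + ennreal (e * (1/2) ^ Suc i)" for i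
 proof -
  have "hausdorff_content d k (A i) ~= \<infinity>"
   using fin by (metis ennreal_suminf_lessD infinity_ennreal_def less_irrefl)
  moreover have "0 < ennreal (e * (1/2) ^ Suc i)" using e by simp
  ultimately have "hausdorff_content d k (A i) < hausdorff_content d k (A i) + ennreal (e * (1/2) ^ Suc i)"
   by (metis add.right_neutral ennreal_add_left_cancel_less infinity_ennreal_def)
  then show ?thesis by (rule hausdorff_content_approx) (meson less_imp_le)
 qed
 then obtain E where E: "!!i. A i \<subseteq> (\<Union>j. E i j)" "!!i j. bounded (E i j)" "!!i j. diameter (E i j) <= d"
  "!!i. (\<Sum>j::nat. cover_size k (E i j)) <= hausdorff_content d k (A i) + ennreal (e * (1/2) ^ Suc i)"
  by metis
 have "(\<Union>i. A i) \<subseteq> (\<Union>n. case_prod E (prod_decode n))"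
 proof
  fix x assume "x \<in> (\<Union>i. A i)"
  then obtain i j where "x \<in> E i j" using E(1) by blast
  then have "x \<in> case_prod E (prod_decode (prod_encode (i, j)))" by simp
  then show "x \<in> (\<Union>n. case_prod E (prod_decode n))" by (rule UN_I[OF UNIV_I])
 qed
 then have "hausdorff_content d k (\<Union>i. A i) <= (\<Sum>n. cover_size k (case_prod E (prod_decode n)))"
  by (rule hausdorff_content_le) (auto simp: E split: prod.split)
 also have "... = (\<Sum>i. \<Sum>j. cover_size k (E i j))"
  using suminf_ennreal_2dimen[of "%i. \<Sum>j. cover_size k (E i j)" "%p. cover_size k (case_prod E p)"]
  by (simp add: comp_def)
 also have "... <= (\<Sum>i. hausdorff_content d k (A i) + ennreal (e * (1/2) ^ Suc i))"
  by (intro suminf_le E(4) summableI)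
 also have "... = (\<Sum>i. hausdorff_content d k (A i)) + (\<Sum>i. ennreal (e * (1/2) ^ Suc i))"
  by (intro suminf_add[symmetric] summableI)
 also have "(\<Sum>i. ennreal (e * (1/2) ^ Suc i)) = ennreal e"
  using sums_mult[OF power_half_series, of e] e by (intro suminf_ennreal_eq) auto
 finally show "hausdorff_content d k (\<Union>i. A i) <= (\<Sum>i. hausdorff_content d k (A i)) + ennreal e" .
qed

lemma hausdorff_content_empty: "d > 0 ==> hausdorff_content d k {} = 0"
 using hausdorff_content_le[of "{}" "%_. {}" d k] by (simp add: cover_size_def)

lemma outer_measure_space_hausdorff: "outer_measure_space (Pow UNIV) (hausdorff_outer k)"
proof -
 have "hausdorff_outer k (\<Union>i. A i) <= (\<Sum>i. hausdorff_outer k (A i))" for A :: "nat => 'a set"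
 proof (rule hausdorff_outer_le)
  fix d :: real assume d: "d > 0"
  show "hausdorff_content d k (\<Union>i. A i) <= (\<Sum>i. hausdorff_outer k (A i))"
   by (rule order_trans[OF hausdorff_content_subadditive[OF d]])
     (intro suminf_le hausdorff_outer_ge d summableI)
 qed
 moreover have "hausdorff_outer k ({} :: 'a set) <= 0"
  by (rule hausdorff_outer_le) (simp add: hausdorff_content_empty)
 ultimately show ?thesis
  by (auto simp: outer_measure_space_def positive_def increasing_def countably_subadditive_def
    intro: hausdorff_outer_mono)
qed

text \<open>A covering set of diameter below \<open>d\<close> cannot meet both sets, so every fine
  cover splits into a cover of \<open>A\<close> and one of \<open>B\<close>.\<close>

lemma hausdorff_outer_separated:
 assumes d: "d > 0" "!!x y. x \<in> A ==> y \<in> B ==> d <= dist x y"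
 shows "hausdorff_outer k A + hausdorff_outer k B <= hausdorff_outer k (A \<union> B)"
proof -
 have small: "hausdorff_content del k A + hausdorff_content del k B <= hausdorff_content del k (A \<union> B)"
  if del: "del > 0" "del < d" for del
 proof (rule hausdorff_content_ge)
  fix E :: "nat => 'a set"
  assume E: "A \<union> B \<subseteq> (\<Union>i. E i)" "!!i. bounded (E i)" "!!i. diameter (E i) <= del"
  define EA where "EA i = (if E i \<inter> A = {} then {} else E i)" for i
  define EB where "EB i = (if E i \<inter> B = {} then {} else E i)" for i
  have "hausdorff_content del k A <= (\<Sum>i. cover_size k (EA i))"
  proof (rule hausdorff_content_le)
   show "A \<subseteq> (\<Union>i. EA i)"
   proof
    fix x assume "x \<in> A"
    moreover from this obtain i where "x \<in> E i" using E(1) by blast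
    ultimately have "x \<in> EA i" by (auto simp: EA_def)
    then show "x \<in> (\<Union>i. EA i)" by blast
   qed
  qed (use E del in \<open>auto simp: EA_def\<close>)
  moreover have "hausdorff_content del k B <= (\<Sum>i. cover_size k (EB i))"
  proof (rule hausdorff_content_le)
   show "B \<subseteq> (\<Union>i. EB i)"
   proof
    fix x assume "x \<in> B"
    moreover from this obtain i where "x \<in> E i" using E(1) by blast
    ultimately have "x \<in> EB i" by (auto simp: EB_def)
    then show "x \<in> (\<Union>i. EB i)" by blast
   qed
  qed (use E del in \<open>auto simp: EB_def\<close>)
  ultimately have "hausdorff_content del k A + hausdorff_content del k B
    <= (\<Sum>i. cover_size k (EA i)) + (\<Sum>i. cover_size k (EB i))" by (rule add_mono)
  also have "... = (\<Sum>i. cover_size k (EA i) + cover_size k (EB i))" by (intro suminf_add summableI)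
  also have "... <= (\<Sum>i. cover_size k (E i))"
  proof (intro suminf_le summableI)
   fix i
   have "EA i = {} \<or> EB i = {}"
   proof (rule ccontr)
    assume "\<not> ?thesis"
    then obtain x y where xy: "x \<in> E i" "x \<in> A" "y \<in> E i" "y \<in> B" by (auto simp: EA_def EB_def split: if_splits)
    then have "dist x y <= diameter (E i)" using E(2) by (intro diameter_bounded_bound)
    then show False using d(2)[of x y] xy E(3)[of i] del by auto
   qed
   then show "cover_size k (EA i) + cover_size k (EB i) <= cover_size k (E i)"
   proof
    assume "EA i = {}"
    then show ?thesis by (simp add: cover_size_def[of k "{}"] EB_def)
   next
    assume "EB i = {}"
    then show ?thesis by (simp add: cover_size_def[of k "{}"] EA_def)
   qed
  qed
  finally show "hausdorff_content del k A + hausdorff_content del k B <= (\<Sum>i. cover_size k (E i))" .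
 qed
 \<comment> \<open>Two independent scales are allowed so that the two suprema can be taken one after
   the other.\<close>
 have all: "hausdorff_content del1 k A + hausdorff_content del2 k B <= hausdorff_outer k (A \<union> B)"
  if del: "del1 > 0" "del2 > 0" for del1 del2
 proof -
  define del where "del = min (min del1 del2) (d / 2)"
  have "del > 0" "del < d" "del <= del1" "del <= del2" using del d by (auto simp: del_def)
  then show ?thesis
   by (meson add_mono hausdorff_content_antimono hausdorff_outer_ge order_trans small)
 qed
 have ne: "{0::real<..} ~= {}" by auto
 have 1: "hausdorff_content del1 k A + hausdorff_outer k B <= hausdorff_outer k (A \<union> B)" if "del1 > 0" for del1
  unfolding hausdorff_outer_def[of k B] ennreal_SUP_add_right[OF ne]
  by (rule SUP_least) (use all that in auto)
 show ?thesis
  unfolding hausdorff_outer_def[of k A] ennreal_SUP_add_left[OF ne, symmetric]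
  by (rule SUP_least) (use 1 in auto)
qed

lemma hausdorff_measure_eq: "hausdorff_measure k = measure_of UNIV (sets borel) (hausdorff_outer k)"
 unfolding hausdorff_measure_def hausdorff_outer_def ..

lemma sets_hausdorff_measure [simp, measurable_cong]:
 "sets (hausdorff_measure k) = sets (borel :: 'a::metric_space measure)"
proof -
 have "sigma_sets UNIV (sets borel) = sets (borel :: 'a measure)"
  by (metis sets.sigma_sets_eq space_borel)
 then show ?thesis by (simp add: hausdorff_measure_eq)
qed

lemma space_hausdorff_measure [simp]: "space (hausdorff_measure k) = UNIV"
 by (simp add: hausdorff_measure_eq space_measure_of_conv)

text \<open>\<open>measure_of\<close> returns the given set function only if it is countably
  additive on the sigma-algebra; Caratheodory's construction, started from the closed sets, supplies
  this.\<close>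

lemma emeasure_hausdorff_measure:
 fixes A :: "'a::metric_space set"
 assumes "A \<in> sets borel"
 shows "emeasure (hausdorff_measure k) A = hausdorff_outer k A"
proof -
 let ?L = "lambda_system UNIV (Pow UNIV) (hausdorff_outer k :: 'a set => ennreal)"
 have ms: "measure_space UNIV ?L (hausdorff_outer k)"
  by (rule sigma_algebra.caratheodory_lemma[OF sigma_algebra_Pow outer_measure_space_hausdorff])
 have "Collect closed \<subseteq> ?L"
 proof
  fix F :: "'a set" assume "F \<in> Collect closed"
  then have "closed F" by simp
  show "F \<in> ?L"
   by (rule metric_outer_measure_closed[OF outer_measure_space_hausdorff _ \<open>closed F\<close>])
     (rule hausdorff_outer_separated)
 qed
 then have "sigma_sets UNIV (Collect closed) \<subseteq> ?L"
  using ms by (intro sigma_algebra.sigma_sets_subset) (auto simp: measure_space_def)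
 then have "sets borel \<subseteq> ?L" by (simp add: borel_eq_closed)
 then have "measure_space UNIV (sets borel) (hausdorff_outer k :: 'a set => ennreal)"
  using sets.sigma_algebra_axioms[of "borel :: 'a measure"] by (intro measure_down[OF ms]) simp_all
 then show ?thesis
  unfolding hausdorff_measure_eq using assms
  by (intro emeasure_measure_of_sigma) (auto simp: measure_space_def)
qed

section \<open>Hausdorff measure of affine images and of segments\<close>

lemma hausdorff_outer_translation:
 fixes A :: "'a::real_normed_vector set"
 shows "hausdorff_outer k ((+) c ` A) = hausdorff_outer k A"
proof -
 have le: "hausdorff_outer k ((+) c ` A) <= hausdorff_outer k A" for c and A :: "'a set"
 proof (rule hausdorff_outer_le)
  fix del :: real assume del: "del > 0"
  have "hausdorff_content del k ((+) c ` A) <= hausdorff_content del k A"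
  proof (rule hausdorff_content_ge)
   fix E :: "nat => 'a set"
   assume E: "A \<subseteq> (\<Union>i. E i)" "!!i. bounded (E i)" "!!i. diameter (E i) <= del"
   have d: "diameter ((+) c ` E i) = diameter (E i)" for i
   proof -
    have "(%(x, y). dist x y) ` (((+) c ` E i) \<times> ((+) c ` E i)) = (%(x, y). dist x y) ` (E i \<times> E i)"
     by (force simp: image_iff)
    then show ?thesis by (simp add: diameter_def)
   qed
   have "hausdorff_content del k ((+) c ` A) <= (\<Sum>i. cover_size k ((+) c ` E i))"
    using image_mono[OF E(1), of "(+) c"] E(2,3) d
    by (intro hausdorff_content_le) (auto simp: image_UN intro!: bounded_translation)
   also have "... = (\<Sum>i. cover_size k (E i))"
   proof -
    have "cover_size k ((+) c ` E i) = cover_size k (E i)" for i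
     using d[of i] by (cases "E i = {}") (simp_all add: cover_size_def)
    then show ?thesis by simp
   qed
   finally show "hausdorff_content del k ((+) c ` A) <= (\<Sum>i. cover_size k (E i))" .
  qed
  also have "... <= hausdorff_outer k A" by (rule hausdorff_outer_ge[OF del])
  finally show "hausdorff_content del k ((+) c ` A) <= hausdorff_outer k A" .
 qed
 have "A = (+) (- c) ` ((+) c ` A)" by (simp add: image_image)
 then show ?thesis using le[of c A] le[of "- c" "(+) c ` A"] by auto
qed

lemma hausdorff_content_le_finite:
 assumes "finite F" "A \<subseteq> \<Union>F" "!!X. X \<in> F ==> bounded X" "!!X. X \<in> F ==> diameter X <= d" "0 <= d"
 shows "hausdorff_content d k A <= (\<Sum>X\<in>F. cover_size k X)"
proof -
 obtain f where f: "bij_betw f {..<card F} F"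
  using ex_bij_betw_nat_finite[OF assms(1)] atLeast0LessThan by metis
 define E where "E i = (if i < card F then f i else {})" for i
 have fF: "f i \<in> F" if "i < card F" for i using f that by (auto simp: bij_betw_def)
 have "A \<subseteq> (\<Union>i. E i)"
 proof
  fix x assume "x \<in> A"
  then obtain X where "X \<in> F" "x \<in> X" using assms by blast
  moreover from this obtain i where "i < card F" "f i = X"
   using f unfolding bij_betw_def by (metis imageE lessThan_iff)
  ultimately have "x \<in> E i" by (simp add: E_def)
  then show "x \<in> (\<Union>i. E i)" by blast
 qed
 then have "hausdorff_content d k A <= (\<Sum>i. cover_size k (E i))"
  by (rule hausdorff_content_le) (use fF assms in \<open>auto simp: E_def\<close>)
 also have "... = (\<Sum>i<card F. cover_size k (E i))"
  by (rule suminf_finite) (auto simp: E_def cover_size_def)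
 also have "... = (\<Sum>i<card F. cover_size k (f i))" by (simp add: E_def)
 also have "... = (\<Sum>X\<in>F. cover_size k X)" by (rule sum.reindex_bij_betw[OF f])
 finally show ?thesis .
qed

text \<open>A cube containing \<open>S\<close> is cut into \<open>N ^ d\<close> equal cubes, where
  \<open>d\<close> is the dimension. Their images have diameter at most \<open>M / N\<close>, and
  the powers of \<open>N\<close> cancel in the sum, so the bound is the same at all scales.\<close>

lemma hausdorff_outer_affine_image_finite:
 fixes L :: "'b::euclidean_space => 'a::euclidean_space"
 assumes L: "bounded_linear L" and S: "bounded S"
 shows "hausdorff_outer DIM('b) ((%y. a + L y) ` S) < \<infinity>"
proof -
 let ?d = "DIM('b)"
 obtain B where B: "B > 0" "!!y. y \<in> S ==> norm y <= B" using S by (auto simp: bounded_pos)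
 obtain K where K: "K > 0" "!!y. norm (L y) <= norm y * K" using bounded_linear.pos_bounded[OF L] by blast
 define M where "M = 2 * B * real ?d * K"
 have M: "M > 0" using B K by (simp add: M_def)
 define c where "c = unit_ball_vol (real ?d) * (M / 2) ^ ?d"
 have "hausdorff_content del ?d ((%y. a + L y) ` S) <= ennreal c" if del: "del > 0" for del
 proof -
  obtain N0 :: nat where N0: "M / del <= N0" using real_arch_simple by blast
  define N where "N = Suc N0"
  have N: "N > 0" "M / N <= del"
  proof -
   show "N > 0" by (simp add: N_def)
   have "M / del <= N" using N0 by (simp add: N_def)
   then show "M / N <= del" using del by (simp add: N_def field_simps)
  qed
  define Q where "Q z = {y :: 'b. \<forall>b\<in>Basis. - B + 2 * B * real (z b) / N <= y \<bullet> b & y \<bullet> b <= - B + 2 * B * (real (z b) + 1) / N}" for z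
  define F where "F = (%z. (%y. a + L y) ` Q z) ` ((Basis :: 'b set) \<rightarrow>\<^sub>E {..<N})"
  have finF: "finite F" unfolding F_def by (intro finite_imageI finite_PiE) auto
  have cardF: "card F <= N ^ ?d"
  proof -
   have "card F <= card ((Basis :: 'b set) \<rightarrow>\<^sub>E {..<N})"
    unfolding F_def by (intro card_image_le finite_PiE) auto
   then show ?thesis by (simp add: card_PiE)
  qed
  have dist: "dist x y <= M / N" if X: "X \<in> F" "x \<in> X" "y \<in> X" for X x y
  proof -
   obtain z u v where u: "u \<in> Q z" "x = a + L u" and v: "v \<in> Q z" "y = a + L v"
    using X by (auto simp: F_def)
   have "norm (u - v) <= (\<Sum>b\<in>Basis. \<bar>(u - v) \<bullet> b\<bar>)" by (rule norm_le_l1)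
   also have "... <= (\<Sum>b\<in>(Basis :: 'b set). 2 * B / N)"
   proof (rule sum_mono)
    fix b :: 'b assume b: "b \<in> Basis"
    have "2 * B * (real (z b) + 1) / N = 2 * B * real (z b) / N + 2 * B / N"
     by (simp add: field_simps add_divide_distrib)
    then show "\<bar>(u - v) \<bullet> b\<bar> <= 2 * B / N"
     using u(1) v(1) b unfolding Q_def inner_diff_left by (smt (verit) mem_Collect_eq)
   qed
   finally have n: "norm (u - v) <= real ?d * (2 * B / N)" by simp
   have "dist x y = norm (L (u - v))" using u v by (simp add: dist_norm linear_diff[OF bounded_linear.linear[OF L]])
   also have "... <= norm (u - v) * K" by (rule K)
   also have "... <= real ?d * (2 * B / N) * K" using n K by (intro mult_right_mono) auto
   also have "... = M / N" by (simp add: M_def)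
   finally show ?thesis .
  qed
  have bd: "bounded X" if "X \<in> F" for X
  proof (cases "X = {}")
   case False
   then obtain x where "x \<in> X" by blast
   then show ?thesis using dist[OF that] unfolding bounded_def by (intro exI[of _ x] exI[of _ "M / N"]) simp
  qed simp
  have di: "diameter X <= M / N" if "X \<in> F" for X
   using dist[OF that] M N by (intro diameter_le) (auto simp: dist_norm)
  have cov: "(%y. a + L y) ` S \<subseteq> \<Union>F"
  proof
   fix x assume "x \<in> (%y. a + L y) ` S"
   then obtain y where y: "y \<in> S" "x = a + L y" by auto
   define w where "w b = (y \<bullet> b + B) * N / (2 * B)" for b
   \<comment> \<open>The minimum with \<open>N - 1\<close> takes care of the far face of the cube,
     where the floor would be \<open>N\<close>.\<close>
   define z where "z = restrict (%b. min (nat \<lfloor>w b\<rfloor>) (N - 1)) (Basis :: 'b set)"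
   have "y \<in> Q z" unfolding Q_def
   proof (safe)
    fix b :: 'b assume b: "b \<in> Basis"
    have yb: "\<bar>y \<bullet> b\<bar> <= B" using Basis_le_norm[OF b, of y] B(2)[OF y(1)] by linarith
    have w: "0 <= w b" "w b <= N"
    proof -
     have yB: "0 <= y \<bullet> b + B" "y \<bullet> b + B <= 2 * B" using yb by linarith+
     show "0 <= w b" unfolding w_def using yB(1) B by (intro divide_nonneg_nonneg mult_nonneg_nonneg) auto
     have "(y \<bullet> b + B) * N <= 2 * B * N" using yB(2) by (rule mult_right_mono) simp
     then show "w b <= N" using B by (simp add: w_def pos_divide_le_eq mult.commute)
    qed
    have yw: "y \<bullet> b = - B + 2 * B * w b / N" using B N by (simp add: w_def field_simps)
    have z1: "real (z b) <= w b" using w b by (simp add: z_def min_def) linarith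
    have z2: "w b <= real (z b) + 1"
    proof (cases "nat \<lfloor>w b\<rfloor> <= N - 1")
     case True
     then show ?thesis using b w by (simp add: z_def)
    next
     case False
     then show ?thesis using b w N by (simp add: z_def)
    qed
    show "- B + 2 * B * real (z b) / N <= y \<bullet> b"
     unfolding yw using z1 B N by (intro add_left_mono divide_right_mono mult_left_mono) auto
    show "y \<bullet> b <= - B + 2 * B * (real (z b) + 1) / N"
     unfolding yw using z2 B N by (intro add_left_mono divide_right_mono mult_left_mono) auto
   qed
   moreover have "z \<in> (Basis :: 'b set) \<rightarrow>\<^sub>E {..<N}" using N by (auto simp: z_def)
   ultimately show "x \<in> \<Union>F" unfolding F_def using y by blast
  qed
  have "hausdorff_content del ?d ((%y. a + L y) ` S) <= (\<Sum>X\<in>F. cover_size ?d X)"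
   by (rule hausdorff_content_le_finite[OF finF cov bd]) (use di N del in \<open>auto intro: order_trans\<close>)
  also have "... <= (\<Sum>X\<in>F. ennreal (unit_ball_vol (real ?d) * (M / N / 2) ^ ?d))"
  proof (rule sum_mono)
   fix X assume X: "X \<in> F"
   have "0 <= diameter X" using bd[OF X] by (rule diameter_ge_0)
   then have "unit_ball_vol (real ?d) * (diameter X / 2) ^ ?d <= unit_ball_vol (real ?d) * (M / N / 2) ^ ?d"
    using di[OF X] by (intro mult_left_mono power_mono) auto
   then show "cover_size ?d X <= ennreal (unit_ball_vol (real ?d) * (M / N / 2) ^ ?d)"
    by (auto simp: cover_size_def intro: ennreal_leI)
  qed
  also have "... <= of_nat (N ^ ?d) * ennreal (unit_ball_vol (real ?d) * (M / N / 2) ^ ?d)"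
   using cardF by (simp only: sum_constant) (intro mult_right_mono of_nat_mono, auto)
  also have "... = ennreal (real (N ^ ?d) * (unit_ball_vol (real ?d) * (M / N / 2) ^ ?d))"
   by (subst ennreal_mult) (use M N in \<open>auto simp: ennreal_of_nat_eq_real_of_nat\<close>)
  also have "real (N ^ ?d) * (unit_ball_vol (real ?d) * (M / N / 2) ^ ?d) = c"
  proof -
   have "real N ^ ?d * (M / N / 2) ^ ?d = (M / 2) ^ ?d"
    using N by (simp add: power_mult_distrib[symmetric])
   then show ?thesis by (simp add: c_def mult.left_commute)
  qed
  finally show ?thesis .
 qed
 then have "hausdorff_outer ?d ((%y. a + L y) ` S) <= ennreal c" by (rule hausdorff_outer_le)
 then show ?thesis by (simp add: le_less_trans)
qed

text \<open>The left inverse \<open>g\<close> is Lipschitz and carries a cover of the image back to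
  a cover of the unit cube by balls, whose volumes are comparable to the terms of the cover. As the
  cube has volume 1, the sum cannot be small.\<close>

lemma hausdorff_outer_affine_image_pos:
 fixes L :: "'b::euclidean_space => 'a::euclidean_space"
 assumes g: "bounded_linear g" "!!y. g (L y) = y"
 shows "hausdorff_outer DIM('b) ((%y. a + L y) ` cbox 0 One) > 0"
proof -
 let ?d = "DIM('b)"
 obtain G where G: "G > 0" "!!x. norm (g x) <= norm x * G" using bounded_linear.pos_bounded[OF g(1)] by blast
 have "ennreal (1 / (2 * G) ^ ?d) <= hausdorff_content 1 ?d ((%y. a + L y) ` cbox 0 One)"
 proof (rule hausdorff_content_ge)
  fix E :: "nat => 'a set"
  assume E: "(%y. a + L y) ` cbox 0 One \<subseteq> (\<Union>i. E i)" "!!i. bounded (E i)" "!!i. diameter (E i) <= 1"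
  define p where "p i = (SOME x. x \<in> E i)" for i
  define D where "D i = (if E i = {} then {} else cball (g (p i - a)) (diameter (E i) * G))" for i
  have "cbox 0 One \<subseteq> (\<Union>i. D i)"
  proof
   fix y :: 'b assume "y \<in> cbox 0 One"
   then obtain i where i: "a + L y \<in> E i" using E(1) by blast
   then have p: "p i \<in> E i" unfolding p_def by (rule someI)
   have "dist (g (p i - a)) y = norm (g (p i - (a + L y)))"
    by (simp add: dist_norm linear_diff[OF bounded_linear.linear[OF g(1)]] linear_add[OF bounded_linear.linear[OF g(1)]] g(2) algebra_simps)
   also have "... <= norm (p i - (a + L y)) * G" by (rule G)
   also have "... <= diameter (E i) * G"
    using diameter_bounded_bound[OF E(2) p i] G by (intro mult_right_mono) (auto simp: dist_norm)
   finally have "y \<in> D i" using i by (auto simp: D_def)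
   then show "y \<in> (\<Union>i. D i)" by blast
  qed
  then have "emeasure lborel (cbox 0 (One :: 'b)) <= emeasure lborel (\<Union>i. D i)"
   by (rule emeasure_mono) (auto simp: D_def)
  also have "... <= (\<Sum>i. emeasure lborel (D i))"
   by (rule emeasure_subadditive_countably) (auto simp: D_def)
  also have "... <= (\<Sum>i. ennreal ((2 * G) ^ ?d) * cover_size ?d (E i))"
  proof (intro suminf_le summableI)
   fix i
   have "0 <= diameter (E i)" using E(2) by (rule diameter_ge_0)
   then show "emeasure lborel (D i) <= ennreal ((2 * G) ^ ?d) * cover_size ?d (E i)"
    using G by (auto simp: D_def cover_size_def emeasure_cball ennreal_mult[symmetric]
      power_mult_distrib power_divide intro!: ennreal_leI)
  qed
  also have "... = ennreal ((2 * G) ^ ?d) * (\<Sum>i. cover_size ?d (E i))" by simp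
  finally have 1: "1 <= ennreal ((2 * G) ^ ?d) * (\<Sum>i. cover_size ?d (E i))"
   by (simp add: emeasure_lborel_cbox_eq)
  have "ennreal (1 / (2 * G) ^ ?d) * 1 <= ennreal (1 / (2 * G) ^ ?d) * (ennreal ((2 * G) ^ ?d) * (\<Sum>i. cover_size ?d (E i)))"
   by (rule mult_left_mono[OF 1]) simp
  also have "... = (ennreal (1 / (2 * G) ^ ?d) * ennreal ((2 * G) ^ ?d)) * (\<Sum>i. cover_size ?d (E i))"
   by (simp add: mult.assoc)
  also have "ennreal (1 / (2 * G) ^ ?d) * ennreal ((2 * G) ^ ?d) = 1"
   using G by (subst ennreal_mult[symmetric]) auto
  finally show "ennreal (1 / (2 * G) ^ ?d) <= (\<Sum>i. cover_size ?d (E i))" by simp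
 qed
 also have "... <= hausdorff_outer ?d ((%y. a + L y) ` cbox 0 One)" by (rule hausdorff_outer_ge) simp
 finally have le: "ennreal (1 / (2 * G) ^ ?d) <= hausdorff_outer ?d ((%y. a + L y) ` cbox 0 One)" .
 have "0 < ennreal (1 / (2 * G) ^ ?d)" using G by simp
 then show ?thesis using le by (rule less_le_trans)
qed

text \<open>Integrating \<open>1\<^sub>B(x + y) 1\<^sub>C(y)\<close> against \<open>m\<close> and the Lebesgue measure \<open>l\<close> in the two orders gives
 \<open>m(B) l(C) = l(B) m(-C)\<close>.\<close>

lemma translation_invariant_measure_unique:
 fixes m :: "'b::euclidean_space measure"
 assumes m: "sets m = sets borel" "!!B s. B \<in> sets borel ==> emeasure m ((+) s ` B) = emeasure m B"
  and fin: "!!B. B \<in> sets borel ==> bounded B ==> emeasure m B < \<infinity>"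
  and B: "B \<in> sets borel"
 shows "emeasure m B = emeasure m (cbox 0 One) * emeasure lborel B"
proof -
 note [measurable_cong] = m(1)
 have [measurable]: "B \<in> sets borel" by (rule B)
 have sf: "sigma_finite_measure m"
 proof
  show "EX A. countable A & A \<subseteq> sets m & \<Union>A = space m & (\<forall>a\<in>A. emeasure m a ~= \<infinity>)"
  proof (intro exI[of _ "range (%n::nat. cball 0 (real n))"] conjI ballI)
   show "range (%n::nat. cball 0 (real n)) \<subseteq> sets m" unfolding m(1) by auto
   show "emeasure m a ~= \<infinity>" if "a \<in> range (%n::nat. cball 0 (real n))" for a
   proof -
    obtain n :: nat where "a = cball 0 (real n)" using \<open>a \<in> _\<close> by (rule rangeE)
    then show ?thesis using fin[of a] by simp
   qed
   show "\<Union>(range (%n::nat. cball 0 (real n))) = space m"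
   proof -
    have "x \<in> (\<Union>n::nat. cball 0 (real n))" for x :: 'b
     using real_arch_simple[of "norm x"] by simp
    then show ?thesis using sets_eq_imp_space_eq[OF m(1)] by auto
   qed
  qed simp
 qed
 interpret m: sigma_finite_measure m by (rule sf)
 interpret P: pair_sigma_finite m lborel ..
 \<comment> \<open>The reflected unit cube: its Lebesgue measure is 1, and its reflection is the
   cube in the claim.\<close>
 define C where "C = cbox (- One) (0 :: 'b)"
 have [measurable]: "C \<in> sets borel" by (simp add: C_def)
 define f where "f = (%(x, y). indicator B (x + y) * indicator C y :: ennreal)"
 have f: "f \<in> borel_measurable (m \<Otimes>\<^sub>M lborel)" unfolding f_def by measurable
 have tr: "emeasure m {x. x + y \<in> B} = emeasure m B" for y
 proof -
  have "{x. x + y \<in> B} = (+) (- y) ` B"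
   by (auto simp: image_iff intro!: bexI[of _ "_ + y"])
  then show ?thesis by (simp only: m(2)[OF B])
 qed
 have "(\<integral>\<^sup>+ y. \<integral>\<^sup>+ x. f (x, y) \<partial>m \<partial>lborel) = (\<integral>\<^sup>+ y. emeasure m B * indicator C y \<partial>lborel)"
 proof (rule nn_integral_cong)
  fix y :: 'b
  have "(\<integral>\<^sup>+ x. f (x, y) \<partial>m) = (\<integral>\<^sup>+ x. indicator {x. x + y \<in> B} x \<partial>m) * indicator C y"
   unfolding f_def by (subst nn_integral_multc[symmetric]) (auto simp: indicator_def)
  also have "(\<integral>\<^sup>+ x. indicator {x. x + y \<in> B} x \<partial>m) = emeasure m {x. x + y \<in> B}"
  proof (rule nn_integral_indicator)
   have "{x \<in> space m. x + y \<in> B} \<in> sets m" by measurable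
   then show "{x. x + y \<in> B} \<in> sets m" using sets_eq_imp_space_eq[OF m(1)] by simp
  qed
  finally show "(\<integral>\<^sup>+ x. f (x, y) \<partial>m) = emeasure m B * indicator C y" by (simp add: tr)
 qed
 also have "... = emeasure m B * emeasure lborel C" by (simp add: nn_integral_cmult)
 also have "emeasure lborel C = 1"
  by (simp add: C_def emeasure_lborel_cbox_eq inner_diff_left)
 finally have lhs: "(\<integral>\<^sup>+ y. \<integral>\<^sup>+ x. f (x, y) \<partial>m \<partial>lborel) = emeasure m B" by simp
 have "(\<integral>\<^sup>+ y. \<integral>\<^sup>+ x. f (x, y) \<partial>m \<partial>lborel) = (\<integral>\<^sup>+ x. \<integral>\<^sup>+ y. f (x, y) \<partial>lborel \<partial>m)"
  by (rule P.Fubini[OF f])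
 also have "... = (\<integral>\<^sup>+ x. \<integral>\<^sup>+ y. indicator B y * indicator C (y - x) \<partial>lborel \<partial>m)"
 proof (rule nn_integral_cong)
  fix x
  have "(\<integral>\<^sup>+ y. indicator B y * indicator C (y - x) \<partial>lborel)
    = (\<integral>\<^sup>+ y. indicator B y * indicator C (y - x) \<partial>(distr lborel borel ((+) x)))"
   by (simp add: lborel_distr_plus)
  also have "... = (\<integral>\<^sup>+ y. f (x, y) \<partial>lborel)"
   by (subst nn_integral_distr) (auto simp: f_def)
  finally show "(\<integral>\<^sup>+ y. f (x, y) \<partial>lborel) = (\<integral>\<^sup>+ y. indicator B y * indicator C (y - x) \<partial>lborel)" by simp
 qed
 also have "... = (\<integral>\<^sup>+ y. \<integral>\<^sup>+ x. indicator B y * indicator C (y - x) \<partial>m \<partial>lborel)"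
 proof -
  have "(%(x, y). indicator B y * indicator C (y - x) :: ennreal) \<in> borel_measurable (m \<Otimes>\<^sub>M lborel)"
   by measurable
  from P.Fubini[OF this] show ?thesis by simp
 qed
 also have "... = (\<integral>\<^sup>+ y. indicator B y * emeasure m (cbox 0 One) \<partial>lborel)"
 proof (rule nn_integral_cong)
  fix y :: 'b
  have eq: "{x. y - x \<in> C} = (+) y ` cbox 0 One"
  proof -
   have "y - x \<in> C \<longleftrightarrow> x - y \<in> cbox 0 One" for x
    unfolding C_def mem_box by (intro ball_cong refl) (auto simp: inner_diff_left)
   then have "{x. y - x \<in> C} = {x. x - y \<in> cbox 0 One}" by simp
   also have "... = (+) y ` cbox 0 One"
   proof (intro set_eqI iffI)
    fix x assume "x \<in> {x. x - y \<in> cbox 0 One}"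
    then show "x \<in> (+) y ` cbox 0 One" by (intro image_eqI[of _ _ "x - y"]) simp_all
   qed (elim imageE, simp)
   finally show ?thesis .
  qed
  have mb: "(+) y ` cbox 0 One \<in> sets borel"
   by (intro borel_closed closed_translation) auto
  have "(\<integral>\<^sup>+ x. indicator B y * indicator C (y - x) \<partial>m)
    = indicator B y * (\<integral>\<^sup>+ x. indicator ((+) y ` cbox 0 One) x \<partial>m)"
   by (subst nn_integral_cmult[symmetric])
     (use mb m(1) eq[symmetric] in \<open>auto simp: indicator_def intro!: nn_integral_cong\<close>)
  also have "(\<integral>\<^sup>+ x. indicator ((+) y ` cbox 0 One) x \<partial>m) = emeasure m (cbox 0 One)"
   using mb m by simp
  finally show "(\<integral>\<^sup>+ x. indicator B y * indicator C (y - x) \<partial>m) = indicator B y * emeasure m (cbox 0 One)" .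
 qed
 also have "... = emeasure m (cbox 0 One) * emeasure lborel B"
  by (simp add: nn_integral_multc mult.commute)
 finally show ?thesis using lhs by simp
qed

text \<open>An injective affine map pulls the Hausdorff measure back to a translation invariant
  measure that is finite on bounded sets, hence to a multiple of the Lebesgue measure. The factor is
  left undetermined: for segments it is read off from their length, for triangles only its
  positivity enters.\<close>

lemma hausdorff_measure_affine_param:
 fixes L :: "'b::euclidean_space => 'a::euclidean_space"
 assumes L: "bounded_linear L" and g: "bounded_linear g" "!!y. g (L y) = y"
 obtains \<kappa> where "\<kappa> > 0"
  "!!B. B \<in> sets borel ==> (%y. a + L y) ` B \<in> sets borel"
  "!!B. B \<in> sets borel ==>
   emeasure (hausdorff_measure DIM('b)) ((%y. a + L y) ` B) = ennreal \<kappa> * emeasure lborel B"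
  "!!B f. B \<in> sets borel ==> f \<in> borel_measurable borel ==>
   (LINT x:(%y. a + L y) ` B|hausdorff_measure DIM('b). f x :: real) = \<kappa> * (LINT y:B|lborel. f (a + L y))"
proof -
 let ?H = "hausdorff_measure DIM('b) :: 'a measure"
 define A where "A y = a + L y" for y
 define h where "h x = g (x - a)" for x
 have hA [simp]: "h (A y) = y" for y by (simp add: h_def A_def g)
 have cA: "continuous_on UNIV A" unfolding A_def by (intro continuous_intros linear_continuous_on L)
 have ch: "continuous_on UNIV h" unfolding h_def
  by (intro continuous_on_compose2[OF linear_continuous_on[OF g(1)]] continuous_intros) auto
 have [measurable]: "A \<in> borel_measurable borel" "h \<in> borel_measurable borel"
  using cA ch by (auto intro: borel_measurable_continuous_onI)
 \<comment> \<open>The image plane is the fixed set of a continuous map, hence closed. Images under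
   \<open>A\<close> become preimages under \<open>h\<close> within it, which shows that they are
   Borel.\<close>
 define R where "R = {x. A (h x) = x}"
 have "closed R" unfolding R_def
  by (intro closed_Collect_eq continuous_on_compose2[OF cA ch] continuous_intros) auto
 then have [measurable]: "R \<in> sets borel" by (rule borel_closed)
 have img: "A ` B = R \<inter> h -` B" for B
  by (auto simp: R_def) (metis imageI)
 have imgb: "A ` B \<in> sets borel" if "B \<in> sets borel" for B
  unfolding img using measurable_sets[OF \<open>h \<in> borel_measurable borel\<close> that] by auto
 \<comment> \<open>The pullback is built as the push-forward under \<open>h\<close> of the Hausdorff
   measure restricted to the plane.\<close>
 define m where "m = distr (density ?H (indicator R)) borel h"
 have em: "emeasure m B = emeasure ?H (A ` B)" if B: "B \<in> sets borel" for B
 proof -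
  have hB: "h -` B \<in> sets borel" using measurable_sets[OF \<open>h \<in> borel_measurable borel\<close> B] by simp
  have "emeasure m B = emeasure (density ?H (indicator R)) (h -` B)"
   unfolding m_def using B by (subst emeasure_distr) auto
  also have "... = (\<integral>\<^sup>+x. indicator R x * indicator (h -` B) x \<partial>?H)"
   using hB by (subst emeasure_density) auto
  also have "... = emeasure ?H (R \<inter> h -` B)"
   using hB by (simp add: indicator_inter_arith[symmetric])
  finally show ?thesis by (simp add: img)
 qed
 have fin: "emeasure m B < \<infinity>" if "B \<in> sets borel" "bounded B" for B
  using hausdorff_outer_affine_image_finite[OF L that(2), of a] that imgb[OF that(1)]
  by (simp add: em emeasure_hausdorff_measure A_def[abs_def])
 have tr: "emeasure m ((+) s ` B) = emeasure m B" if B: "B \<in> sets borel" for B s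
 proof -
  have sB: "(+) s ` B \<in> sets borel"
  proof -
   have "(+) s ` B = (%y. y - s) -` B" by (auto simp: image_iff intro!: bexI[of _ "_ - s"])
   moreover have "(%y. y - s) -` B \<inter> space borel \<in> sets borel" by (intro measurable_sets[OF _ B]) simp
   ultimately show ?thesis by simp
  qed
  have "A ` ((+) s ` B) = (+) (L s) ` (A ` B)"
   by (auto simp: A_def image_image linear_add[OF bounded_linear.linear[OF L]] algebra_simps)
  then show ?thesis
   using B sB imgb[OF B] imgb[OF sB]
   by (simp only: em emeasure_hausdorff_measure hausdorff_outer_translation)
 qed
 define \<kappa> where "\<kappa> = enn2real (emeasure m (cbox 0 One))"
 have \<kappa>: "emeasure m (cbox 0 One) = ennreal \<kappa>"
  using fin[of "cbox 0 One"] by (simp add: \<kappa>_def less_top)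
 have "emeasure m (cbox 0 One) > 0"
  using hausdorff_outer_affine_image_pos[OF g, of a] imgb[of "cbox 0 One"]
  by (simp add: em emeasure_hausdorff_measure A_def[abs_def])
 then have pos: "\<kappa> > 0" using \<kappa> by (metis ennreal_neg less_irrefl not_less)
 have mm: "emeasure m B = ennreal \<kappa> * emeasure lborel B" if "B \<in> sets borel" for B
  using translation_invariant_measure_unique[of m B] fin tr that \<kappa> by (simp add: m_def)
 have sm: "sets m = sets borel" by (simp add: m_def)
 have md: "m = density lborel (%_. ennreal \<kappa>)"
 proof (rule measure_eqI)
  show "emeasure m X = emeasure (density lborel (%_. ennreal \<kappa>)) X" if "X \<in> sets m" for X
   using that sm by (simp add: mm emeasure_density_const)
 qed (simp add: m_def)
 have int: "(LINT x:A ` B|?H. f x) = \<kappa> * (LINT y:B|lborel. f (A y))"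
  if B: "B \<in> sets borel" and f [measurable]: "f \<in> borel_measurable borel" for B and f :: "'a => real"
 proof -
  have [measurable]: "B \<in> sets borel" by (rule B)
  define k where "k y = indicator B y * f (A y)" for y
  have [measurable]: "k \<in> borel_measurable borel" unfolding k_def by measurable
  have "(LINT x:A ` B|?H. f x) = (\<integral>x. indicator R x *\<^sub>R k (h x) \<partial>?H)"
   unfolding set_lebesgue_integral_def
  proof (rule Bochner_Integration.integral_cong[OF refl])
   fix x show "indicator (A ` B) x *\<^sub>R f x = indicator R x *\<^sub>R k (h x)"
    by (auto simp: img k_def R_def indicator_def)
  qed
  also have "... = (\<integral>x. k (h x) \<partial>density ?H (%x. ennreal (indicator R x)))"
   by (subst integral_density) auto
  also have "(%x. ennreal (indicator R x)) = indicator R" by (auto simp: indicator_def)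
  also have "(\<integral>x. k (h x) \<partial>density ?H (indicator R)) = (\<integral>y. k y \<partial>m)"
   unfolding m_def by (subst integral_distr) auto
  also have "... = (\<integral>y. \<kappa> *\<^sub>R k y \<partial>lborel)"
   unfolding md using pos by (subst integral_density) auto
  also have "... = \<kappa> * (LINT y:B|lborel. f (A y))"
   by (simp add: set_lebesgue_integral_def k_def)
  finally show ?thesis .
 qed
 show thesis
 proof (rule that[OF pos])
  show "(%y. a + L y) ` B \<in> sets borel" if "B \<in> sets borel" for B
   using imgb[OF that] by (simp add: A_def[abs_def])
  show "emeasure ?H ((%y. a + L y) ` B) = ennreal \<kappa> * emeasure lborel B" if "B \<in> sets borel" for B
   using mm[OF that] em[OF that] by (simp add: A_def[abs_def])
  show "(LINT x:(%y. a + L y) ` B|?H. f x) = \<kappa> * (LINT y:B|lborel. f (a + L y))"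
   if "B \<in> sets borel" "f \<in> borel_measurable borel" for B f
   using int[OF that] by (simp add: A_def[abs_def])
 qed
qed

text \<open>In the parameter space the set is convex of too small a dimension, so it has empty
  interior and is Lebesgue null.\<close>

lemma hausdorff_measure_lowdim:
 fixes L :: "'b::euclidean_space => 'a::euclidean_space"
 assumes L: "bounded_linear L" and g: "bounded_linear g" "!!y. g (L y) = y"
  and X: "X \<subseteq> range (%y. a + L y)" "compact X" "convex X" "aff_dim X < int DIM('b)"
 shows "emeasure (hausdorff_measure DIM('b)) X = 0"
proof -
 define Y where "Y = g ` ((+) (- a) ` X)"
 have XY: "X = (%y. a + L y) ` Y"
 proof
  show "X \<subseteq> (%y. a + L y) ` Y"
  proof
   fix x assume x: "x \<in> X"
   then obtain y where y: "x = a + L y" using X(1) by blast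
   then have "y = g (- a + x)" using g by simp
   then have "y \<in> Y" using x by (auto simp: Y_def)
   then show "x \<in> (%y. a + L y) ` Y" using y by blast
  qed
  show "(%y. a + L y) ` Y \<subseteq> X"
  proof
   fix x assume "x \<in> (%y. a + L y) ` Y"
   then obtain z where z: "z \<in> X" "x = a + L (g (- a + z))" by (auto simp: Y_def)
   from z(1) obtain y where "z = a + L y" using X(1) by blast
   then show "x \<in> X" using z g by simp
  qed
 qed
 have lg: "linear g" by (rule bounded_linear.linear[OF g(1)])
 have cY: "convex Y" unfolding Y_def by (intro convex_linear_image lg convex_translation X)
 have "compact Y" unfolding Y_def
  by (intro compact_continuous_image compact_translation X linear_continuous_on g)
 then have bY: "Y \<in> sets borel" by (simp add: borel_closed compact_imp_closed)
 have "aff_dim Y <= aff_dim ((+) (- a) ` X)" unfolding Y_def by (rule aff_dim_linear_image_le[OF lg])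
 also have "... = aff_dim X" by (rule aff_dim_translation_eq)
 finally have "interior Y = {}" using X(4) by (intro low_dim_interior) simp
 then have "negligible Y" using negligible_convex_interior[OF cY] by simp
 then have "emeasure lborel Y = 0"
  using bY by (simp add: negligible_iff_null_sets null_sets_def)
 moreover obtain k where "emeasure (hausdorff_measure DIM('b)) ((%y. a + L y) ` Y) = ennreal k * emeasure lborel Y"
  using hausdorff_measure_affine_param[OF L g] bY by metis
 ultimately show ?thesis using XY by simp
qed

text \<open>Here the exact value matters, since the energy weighs edges by it. Cutting into
  \<open>N\<close> equal pieces gives the upper bound. For the lower one a cover is projected
  orthogonally onto the line of the segment, where each piece fits into an interval no longer than
  its diameter.\<close>

lemma hausdorff_measure_segment:
 fixes p q :: "'a::euclidean_space"
 shows "emeasure (hausdorff_measure 1) (closed_segment p q) = ennreal (dist p q)"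
proof (cases "p = q")
 case True
 have "hausdorff_content del 1 {p} <= 0" if "del > 0" for del
  using hausdorff_content_le_finite[of "{{p}}" "{p}" del 1] that by (simp add: cover_size_def)
 then have "hausdorff_outer 1 {p} <= 0" by (rule hausdorff_outer_le)
 then show ?thesis using True by (simp add: emeasure_hausdorff_measure)
next
 case False
 define d where "d = dist p q"
 have d: "d > 0" using False by (simp add: d_def)
 have cs: "cover_size 1 E = ennreal (diameter E)" if "bounded E" for E :: "'a set"
  using diameter_ge_0[OF that] by (simp add: cover_size_def)
 have "hausdorff_outer 1 (closed_segment p q) <= ennreal d"
 proof (rule hausdorff_outer_le)
  fix del :: real assume del: "del > 0"
  obtain N0 :: nat where N0: "d / del <= N0" using real_arch_simple by blast
  define N where "N = Suc N0"
  have N: "N > 0" "d / N <= del"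
  proof -
   show "N > 0" by (simp add: N_def)
   have "d / del <= N" using N0 by (simp add: N_def)
   then show "d / N <= del" using del by (simp add: N_def field_simps)
  qed
  define Q where "Q i = (%s. p + s *\<^sub>R (q - p)) ` {real i / N..(real i + 1) / N}" for i
  have dist: "dist x y <= d / N" if xy: "x \<in> Q i" "y \<in> Q i" for x y i
  proof -
   from xy(1) obtain s where s: "x = p + s *\<^sub>R (q - p)" "s \<in> {real i / N..(real i + 1) / N}"
    unfolding Q_def by (rule imageE)
   from xy(2) obtain t where t: "y = p + t *\<^sub>R (q - p)" "t \<in> {real i / N..(real i + 1) / N}"
    unfolding Q_def by (rule imageE)
   note st = s t
   have "(real i + 1) / N = real i / N + 1 / N" by (simp add: add_divide_distrib)
   then have "\<bar>s - t\<bar> <= 1 / N" using st by (simp add: abs_le_iff)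
   moreover have "dist x y = \<bar>s - t\<bar> * d"
    by (simp add: st dist_norm d_def scaleR_left_diff_distrib[symmetric] norm_minus_commute)
   ultimately show ?thesis using d by (simp add: mult_right_mono[of _ "1 / N" d, simplified])
  qed
  have bd: "bounded (Q i)" for i
   unfolding Q_def by (intro compact_imp_bounded compact_continuous_image continuous_intros) auto
  have di: "diameter (Q i) <= d / N" for i
   using dist d N by (intro diameter_le) (auto simp: dist_norm)
  have cov: "closed_segment p q \<subseteq> \<Union>(Q ` {..<N})"
  proof
   fix x assume "x \<in> closed_segment p q"
   then obtain s where s: "x = p + s *\<^sub>R (q - p)" "0 <= s" "s <= 1"
    by (auto simp: closed_segment_def algebra_simps)
   define i where "i = min (nat \<lfloor>s * N\<rfloor>) (N - 1)"
   have sN: "0 <= s * N" "s * N <= N" using s N by (auto simp: mult_left_le_one_le)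
   have "real i <= s * N" using sN N by (simp add: i_def min_def) linarith
   moreover have "s * N <= real i + 1"
   proof (cases "nat \<lfloor>s * N\<rfloor> <= N - 1")
    case True
    then have "real i = real_of_int \<lfloor>s * N\<rfloor>" using sN by (simp add: i_def)
    then show ?thesis by linarith
   next
    case False
    then have "i = N - 1" by (simp add: i_def)
    then show ?thesis using sN N by simp
   qed
   ultimately have "s \<in> {real i / N..(real i + 1) / N}" using N by (simp add: field_simps)
   then have "x \<in> Q i" using s by (auto simp: Q_def)
   moreover have "i < N" using N by (simp add: i_def)
   ultimately show "x \<in> \<Union>(Q ` {..<N})" by blast
  qed
  have "hausdorff_content del 1 (closed_segment p q) <= (\<Sum>X\<in>Q ` {..<N}. cover_size 1 X)"
   by (rule hausdorff_content_le_finite[OF _ cov]) (use bd di N del in \<open>auto intro: order_trans\<close>)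
  also have "... <= (\<Sum>i<N. cover_size 1 (Q i))" using sum_image_le[of "{..<N}" "cover_size 1" Q] by (simp add: comp_def)
  also have "... <= (\<Sum>i<N. ennreal (d / N))"
   using di by (intro sum_mono) (simp only: cs[OF bd] ennreal_leI)
  also have "... = ennreal (\<Sum>i<N. d / N)" using d by (intro sum_ennreal) simp
  also have "(\<Sum>i<N. d / N) = d" using N by simp
  finally show "hausdorff_content del 1 (closed_segment p q) <= ennreal d" .
 qed
 moreover have "ennreal d <= hausdorff_content 1 1 (closed_segment p q)"
 proof (rule hausdorff_content_ge)
  fix E :: "nat => 'a set"
  assume E: "closed_segment p q \<subseteq> (\<Union>i. E i)" "!!i. bounded (E i)" "!!i. diameter (E i) <= 1"
  define u where "u = (q - p) /\<^sub>R d"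
  have u: "norm u = 1" using d by (simp add: u_def d_def dist_norm norm_minus_commute)
  define T where "T i = (%x. (x - p) \<bullet> u) ` E i" for i
  define J where "J i = (if E i = {} then {} else {Inf (T i)..Sup (T i)})" for i
  have TE: "\<bar>s - t\<bar> <= diameter (E i)" if st: "s \<in> T i" "t \<in> T i" for i s t
  proof -
   obtain x y where xy: "x \<in> E i" "y \<in> E i" "s = (x - p) \<bullet> u" "t = (y - p) \<bullet> u"
    using st by (auto simp: T_def)
   have "\<bar>s - t\<bar> = \<bar>(x - y) \<bullet> u\<bar>" by (simp add: xy inner_diff_left)
   also have "... <= norm (x - y) * norm u" by (rule Cauchy_Schwarz_ineq2)
   also have "... <= diameter (E i)"
    using diameter_bounded_bound[OF E(2) xy(1,2)] u by (simp add: dist_norm)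
   finally show ?thesis .
  qed
  have bT: "bounded (T i)" for i
  proof -
  have "T i = (%x. x \<bullet> u) ` ((%x. x - p) ` E i)" by (simp add: T_def image_image)
  then show ?thesis
   using bounded_linear_image[OF bounded_translation_minus[OF E(2)[of i], of p] bounded_linear_inner_left[of u]] by simp
 qed
  have "{0..d} \<subseteq> (\<Union>i. J i)"
  proof
   fix s assume s: "s \<in> {0..d}"
   have "p + (s / d) *\<^sub>R (q - p) \<in> closed_segment p q"
    unfolding closed_segment_def using s d
    by (auto intro!: exI[of _ "s / d"] simp: algebra_simps)
   then obtain i where i: "p + (s / d) *\<^sub>R (q - p) \<in> E i" using E(1) by blast
   have "(q - p) \<bullet> u = d"
    using d by (simp add: u_def d_def dist_norm norm_minus_commute power2_norm_eq_inner[symmetric] power2_eq_square)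
   then have "((p + (s / d) *\<^sub>R (q - p)) - p) \<bullet> u = s" using d by simp
   then have "s \<in> T i" unfolding T_def using i by (metis imageI)
   then have "s \<in> J i"
    using i bounded_imp_bdd_above[OF bT[of i]] bounded_imp_bdd_below[OF bT[of i]]
    by (auto simp: J_def intro: cInf_lower cSup_upper)
   then show "s \<in> (\<Union>i. J i)" by blast
  qed
  then have "emeasure lborel {0..d} <= emeasure lborel (\<Union>i. J i)"
   by (rule emeasure_mono) (auto simp: J_def)
  also have "... <= (\<Sum>i. emeasure lborel (J i))"
   by (rule emeasure_subadditive_countably) (auto simp: J_def)
  also have "... <= (\<Sum>i. cover_size 1 (E i))"
  proof (intro suminf_le summableI)
   fix i
   show "emeasure lborel (J i) <= cover_size 1 (E i)"
   proof (cases "E i = {}")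
    case False
    then have ne: "T i ~= {}" by (simp add: T_def)
    have "Sup (T i) <= Inf (T i) + diameter (E i)"
    proof (rule cSup_least[OF ne])
     fix s assume s: "s \<in> T i"
     have "s - diameter (E i) <= Inf (T i)"
     proof (rule cInf_greatest[OF ne])
      fix t assume "t \<in> T i"
      then show "s - diameter (E i) <= t" using TE[OF s, of t] abs_ge_self[of "s - t"] by linarith
     qed
     then show "s <= Inf (T i) + diameter (E i)" by simp
    qed
    then show ?thesis using False E(2) unfolding cs[OF E(2)]
     by (auto simp: J_def emeasure_lborel_Icc_eq intro: ennreal_leI)
   qed (simp add: J_def)
  qed
  finally show "ennreal d <= (\<Sum>i. cover_size 1 (E i))" using d by simp
 qed
 moreover have "hausdorff_content 1 1 (closed_segment p q) <= hausdorff_outer 1 (closed_segment p q)"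
  by (rule hausdorff_outer_ge) simp
 ultimately have "hausdorff_outer 1 (closed_segment p q) = ennreal d" by (metis antisym order_trans)
 then show ?thesis by (simp add: emeasure_hausdorff_measure d_def)
qed

section \<open>Signed measures\<close>

lemma vector_measure_empty:
 assumes "vector_measure n" shows "n {} = 0"
proof -
 have "(%i::nat. n {}) sums n (\<Union>i::nat. {})"
  by (rule assms[unfolded vector_measure_def, rule_format]) (auto simp: disjoint_family_on_def)
 then show ?thesis by (metis summable_const_iff sums_summable)
qed

lemma vector_measure_Un:
 assumes "vector_measure n" "A \<in> sets borel" "B \<in> sets borel" "A \<inter> B = {}"
 shows "n (A \<union> B) = n A + n B"
proof -
 have "range (binaryset A B) \<subseteq> sets borel" using assms by (auto simp: binaryset_def)
 moreover have "disjoint_family (binaryset A B)"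
  using assms by (auto simp: disjoint_family_on_def binaryset_def)
 ultimately have "(%i. n (binaryset A B i)) sums n (A \<union> B)"
  using assms(1) unfolding vector_measure_def UN_binaryset_eq[symmetric] by blast
 moreover have "(%i. n (binaryset A B i)) sums (n A + n B)"
  by (rule binaryset_sums) (rule vector_measure_empty[OF assms(1)])
 ultimately show ?thesis by (rule sums_unique2)
qed

lemma vector_measure_Diff:
 assumes "vector_measure n" "A \<in> sets borel" "B \<in> sets borel" "B \<subseteq> A"
 shows "n (A - B) = n A - n B"
proof -
 have "n A = n (B \<union> (A - B))" using assms by (simp add: Un_absorb1)
 also have "... = n B + n (A - B)" using assms by (intro vector_measure_Un) auto
 finally show ?thesis by simp
qed

lemma vector_measure_linear:
 assumes "vector_measure n" "bounded_linear f"
 shows "vector_measure (%A. f (n A))"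
 using assms unfolding vector_measure_def by (auto intro: bounded_linear.sums)

text \<open>If the values inside a set are unbounded, this persists in one half of a suitable
  splitting, while the other half has value at least 1 in modulus. The discarded halves are
  disjoint, so their values would have to tend to 0.\<close>

lemma signed_measure_bounded:
 fixes nu :: "'a::euclidean_space set => real"
 assumes v: "vector_measure nu"
 shows "EX M. \<forall>B\<in>sets borel. \<bar>nu B\<bar> <= M"
proof (rule ccontr)
 assume contr: "\<not> ?thesis"
 define bad where "bad A \<longleftrightarrow> A \<in> sets borel & (ALL M. \<exists>B\<in>sets borel. B \<subseteq> A & \<bar>nu B\<bar> > M)" for A
 have b0: "bad UNIV" using contr by (auto simp: bad_def not_le)
 have step: "EX A'. bad A' & A' \<subseteq> A & 1 <= \<bar>nu (A - A')\<bar>" if "bad A" for A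
 proof -
  \<comment> \<open>This margin makes the values of both \<open>B\<close> and \<open>A - B\<close>
    at least 1 in modulus, so whichever half is kept, the other can be discarded.\<close>
  obtain B where B: "B \<in> sets borel" "B \<subseteq> A" "\<bar>nu B\<bar> > \<bar>nu A\<bar> + 1"
   using \<open>bad A\<close> unfolding bad_def by blast
  have A: "A \<in> sets borel" using that by (simp add: bad_def)
  have d: "nu (A - B) = nu A - nu B" by (rule vector_measure_Diff[OF v A B(1,2)])
  have "bad B \<or> bad (A - B)"
  proof (rule ccontr)
   assume "\<not> (bad B \<or> bad (A - B))"
   then obtain M1 M2 where M: "!!C. C \<in> sets borel ==> C \<subseteq> B ==> \<bar>nu C\<bar> <= M1"
    "!!C. C \<in> sets borel ==> C \<subseteq> A - B ==> \<bar>nu C\<bar> <= M2"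
    using A B unfolding bad_def by (meson not_less sets.Diff)
   obtain C where C: "C \<in> sets borel" "C \<subseteq> A" "\<bar>nu C\<bar> > M1 + M2"
    using \<open>bad A\<close> unfolding bad_def by blast
   have "nu C = nu (C \<inter> B \<union> (C - B))" by (simp add: Int_Diff_Un)
   also have "... = nu (C \<inter> B) + nu (C - B)" using C B by (intro vector_measure_Un[OF v]) auto
   finally have eq: "nu C = nu (C \<inter> B) + nu (C - B)" .
   have "\<bar>nu (C \<inter> B)\<bar> <= M1" by (rule M(1)) (use C B in auto)
   moreover have "\<bar>nu (C - B)\<bar> <= M2" by (rule M(2)) (use C B in auto)
   ultimately show False
    using C(3) eq abs_triangle_ineq[of "nu (C \<inter> B)" "nu (C - B)"] by linarith
  qed
  then show ?thesis
  proof
   assume "bad B" then show ?thesis using B d by (intro exI[of _ B]) auto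
  next
   assume "bad (A - B)"
   moreover have "A - (A - B) = B" using B by auto
   ultimately show ?thesis using B by (intro exI[of _ "A - B"]) auto
  qed
 qed
 have "EX F. \<forall>n::nat. bad (F n) & (F (Suc n) \<subseteq> F n & 1 <= \<bar>nu (F n - F (Suc n))\<bar>)"
 proof (rule dependent_nat_choice[where P = "%_. bad" and Q = "%_ A A'. A' \<subseteq> A & 1 <= \<bar>nu (A - A')\<bar>"])
  show "EX A. bad A" using b0 by (rule exI)
 qed (rule step)
 then obtain F where "\<forall>n::nat. bad (F n) & (F (Suc n) \<subseteq> F n & 1 <= \<bar>nu (F n - F (Suc n))\<bar>)"
  by (elim exE)
 then have F: "!!n. bad (F n)" "!!n::nat. F (Suc n) \<subseteq> F n & 1 <= \<bar>nu (F n - F (Suc n))\<bar>" by simp_all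
 define D where "D n = F n - F (Suc n)" for n
 have anti: "F n \<subseteq> F m" if "m <= n" for m n
  by (rule lift_Suc_antimono_le[OF _ that]) (use F(2) in blast)
 have "D m \<inter> D n = {}" if "m < n" for m n
  using anti[of "Suc m" n] that by (auto simp: D_def)
 then have "disjoint_family D" unfolding disjoint_family_on_def
  by (metis Int_commute linorder_neq_iff)
 moreover have "range D \<subseteq> sets borel" using F(1) by (auto simp: D_def bad_def)
 ultimately have "(%n. nu (D n)) sums nu (\<Union>n. D n)"
  by (intro v[unfolded vector_measure_def, rule_format])
 then have "summable (%n. nu (D n))" by (rule sums_summable)
 then have "(%n. nu (D n)) \<longlonglongrightarrow> 0" by (rule summable_LIMSEQ_zero)
 then have "\<forall>\<^sub>F n in sequentially. \<bar>nu (D n)\<bar> < 1"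
  by (intro order_tendstoD(2)[OF tendsto_rabs_zero]) simp_all
 then have "EX n. \<bar>nu (D n)\<bar> < 1" by (rule eventually_happens'[OF sequentially_bot])
 then obtain n where "\<bar>nu (D n)\<bar> < 1" ..
 then show False using F(2)[of n] by (simp add: D_def)
qed

definition pos_part :: "('a::euclidean_space set => real) => 'a set => ennreal" where
 "pos_part n A = (SUP B\<in>{B \<in> sets borel. B \<subseteq> A}. ennreal (n B))"

lemma ennreal_add_le: "ennreal (a + b) <= ennreal a + ennreal b"
proof (cases "0 <= a & 0 <= b")
 case False
 then consider "a < 0" | "b < 0" by linarith
 then show ?thesis
 proof cases
  case 1
  then show ?thesis by (simp add: ennreal_neg ennreal_leI)
 next
  case 2
  then show ?thesis by (simp add: ennreal_neg ennreal_leI)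
 qed
qed simp

lemma ennreal_sum_le: "ennreal (\<Sum>i\<in>I. f i) <= (\<Sum>i\<in>I. ennreal (f i))"
 by (induction I rule: infinite_finite_induct) (auto intro: order_trans[OF ennreal_add_le] add_left_mono)

text \<open>Yields one inequality of countable additivity by induction on partial sums; the other
  one comes from cutting a competitor \<open>B\<close> along the partition.\<close>

lemma pos_part_superadditive:
 assumes v: "vector_measure n" and X: "X \<in> sets borel" and Y: "Y \<in> sets borel" and XY: "X \<inter> Y = {}"
 shows "pos_part n X + pos_part n Y <= pos_part n (X \<union> Y)"
proof -
 have le: "ennreal (n B) + ennreal (n C) <= pos_part n (X \<union> Y)"
  if B: "B \<in> sets borel" "B \<subseteq> X" and C: "C \<in> sets borel" "C \<subseteq> Y" for B C
 proof -
  have up: "ennreal (n D) <= pos_part n (X \<union> Y)" if "D \<in> sets borel" "D \<subseteq> X \<union> Y" for D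
   unfolding pos_part_def by (rule SUP_upper) (use that in auto)
  \<comment> \<open>\<open>ennreal\<close> truncates negative values to 0, so a set of negative
    value is simply dropped from the union.\<close>
  consider "0 <= n B" "0 <= n C" | "n B < 0" | "n C < 0" by linarith
  then show ?thesis
  proof cases
   case 1
   have "n (B \<union> C) = n B + n C" using B C XY by (intro vector_measure_Un[OF v]) auto
   then have "ennreal (n B) + ennreal (n C) = ennreal (n (B \<union> C))" using 1 by simp
   also have "... <= pos_part n (X \<union> Y)" using B C by (intro up) auto
   finally show ?thesis .
  next
   case 2
   then show ?thesis using up[of C] C by (simp add: ennreal_neg le_supI2)
  next
   case 3
   then show ?thesis using up[of B] B by (simp add: ennreal_neg le_supI1)
  qed
 qed
 have ne: "{B \<in> sets borel. B \<subseteq> Z} ~= {}" for Z :: "'a set" by auto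
 have 1: "ennreal (n B) + pos_part n Y <= pos_part n (X \<union> Y)" if "B \<in> sets borel" "B \<subseteq> X" for B
  unfolding pos_part_def[of n Y] ennreal_SUP_add_right[OF ne]
  by (rule SUP_least) (use le that in auto)
 show ?thesis
  unfolding pos_part_def[of n X] ennreal_SUP_add_left[OF ne, symmetric]
  by (rule SUP_least) (use 1 in auto)
qed

lemma positive_part_measure_space:
 fixes nu :: "'a::euclidean_space set => real"
 assumes v: "vector_measure nu"
 shows "measure_space UNIV (sets borel) (pos_part nu)"
proof -
 have mono: "pos_part nu A <= pos_part nu B" if "A \<subseteq> B" for A B
  unfolding pos_part_def by (rule SUP_subset_mono) (use that in auto)
 have "positive (sets borel) (pos_part nu)"
 proof -
  have "{B \<in> sets borel. B \<subseteq> {}} = {{} :: 'a set}" by auto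
  then show ?thesis by (simp add: positive_def pos_part_def vector_measure_empty[OF v])
 qed
 moreover have "countably_additive (sets borel) (pos_part nu)"
 proof (rule countably_additiveI)
  fix A :: "nat => 'a set"
  assume A: "range A \<subseteq> sets borel" "disjoint_family A"
  have fin: "(\<Sum>i<n. pos_part nu (A i)) <= pos_part nu (\<Union>i<n. A i)" for n
  proof (induction n)
   case (Suc n)
   have "(\<Sum>i<Suc n. pos_part nu (A i)) <= pos_part nu (\<Union>i<n. A i) + pos_part nu (A n)"
    using Suc by (simp add: add_right_mono)
   also have "... <= pos_part nu ((\<Union>i<n. A i) \<union> A n)"
    using A by (intro pos_part_superadditive[OF v])
     (auto simp: disjoint_family_on_def, metis disjoint_iff less_irrefl)
   also have "... = pos_part nu (\<Union>i<Suc n. A i)" by (simp add: lessThan_Suc Un_commute)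
   finally show ?case .
  qed simp
  show "(\<Sum>i. pos_part nu (A i)) = pos_part nu (\<Union>i. A i)"
  proof (rule antisym)
   show "(\<Sum>i. pos_part nu (A i)) <= pos_part nu (\<Union>i. A i)"
    by (rule suminf_le_const[OF summableI]) (rule order_trans[OF fin mono], auto)
   show "pos_part nu (\<Union>i. A i) <= (\<Sum>i. pos_part nu (A i))"
    unfolding pos_part_def[of nu "\<Union>i. A i"]
   proof (rule SUP_least)
    fix B assume "B \<in> {B \<in> sets borel. B \<subseteq> (\<Union>i. A i)}"
    then have B: "B \<in> sets borel" "B \<subseteq> (\<Union>i. A i)" by auto
    have "range (%i. B \<inter> A i) \<subseteq> sets borel" using A B by auto
    moreover have "disjoint_family (%i. B \<inter> A i)" using A by (auto simp: disjoint_family_on_def)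
    moreover have "(\<Union>i. B \<inter> A i) = B" using B by auto
    ultimately have "(%i. nu (B \<inter> A i)) sums nu B"
     using v unfolding vector_measure_def by metis
    then have "(%n. ennreal (\<Sum>i<n. nu (B \<inter> A i))) \<longlonglongrightarrow> ennreal (nu B)"
     unfolding sums_def by (rule tendsto_ennrealI)
    then show "ennreal (nu B) <= (\<Sum>i. pos_part nu (A i))"
    proof (rule LIMSEQ_le_const2, intro exI allI impI)
     fix n :: nat
     have "ennreal (\<Sum>i<n. nu (B \<inter> A i)) <= (\<Sum>i<n. ennreal (nu (B \<inter> A i)))" by (rule ennreal_sum_le)
     also have "... <= (\<Sum>i<n. pos_part nu (A i))"
      unfolding pos_part_def using A B by (intro sum_mono SUP_upper) auto
     also have "... <= (\<Sum>i. pos_part nu (A i))" by (intro sum_le_suminf summableI) auto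
     finally show "ennreal (\<Sum>i<n. nu (B \<inter> A i)) <= (\<Sum>i. pos_part nu (A i))" .
    qed
   qed
  qed
 qed
 moreover have "sigma_algebra UNIV (sets (borel :: 'a measure))"
  by (metis sets.sigma_algebra_axioms space_borel)
 ultimately show ?thesis by (simp add: measure_space_def)
qed

lemma positive_part_measure:
 fixes n :: "'a::euclidean_space set => real"
 shows sets_positive_part_measure: "sets (positive_part_measure n) = sets borel"
  and space_positive_part_measure: "space (positive_part_measure n) = UNIV"
  and emeasure_positive_part_measure: "vector_measure n ==> A \<in> sets borel ==>
   emeasure (positive_part_measure n) A = pos_part n A"
  and finite_positive_part_measure: "vector_measure n ==> finite_measure (positive_part_measure n)"
proof -
 have eq: "positive_part_measure n = measure_of UNIV (sets borel) (pos_part n)"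
  unfolding positive_part_measure_def pos_part_def ..
 have sig: "sigma_sets UNIV (sets borel) = sets (borel :: 'a measure)"
  by (metis sets.sigma_sets_eq space_borel)
 show s: "sets (positive_part_measure n) = sets borel" unfolding eq by (simp add: sig)
 show sp: "space (positive_part_measure n) = UNIV" unfolding eq by (simp add: space_measure_of_conv)
 show e: "emeasure (positive_part_measure n) A = pos_part n A" if "vector_measure n" "A \<in> sets borel" for A
  unfolding eq
  using positive_part_measure_space[OF that(1)] that(2)
  by (intro emeasure_measure_of_sigma) (auto simp: measure_space_def)
 show "finite_measure (positive_part_measure n)" if v: "vector_measure n"
 proof
  obtain M where M: "!!B. B \<in> sets borel ==> \<bar>n B\<bar> <= M" using signed_measure_bounded[OF v] by blast
  have "pos_part n UNIV <= ennreal M"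
   unfolding pos_part_def using M by (intro SUP_least) (auto intro!: ennreal_leI simp: abs_le_iff)
  then show "emeasure (positive_part_measure n) (space (positive_part_measure n)) ~= \<infinity>"
   unfolding sp by (subst e[OF v]) (auto simp: top_unique)
 qed
qed

lemma vector_measure_uminus: "vector_measure n ==> vector_measure (%A. - n A)"
 using vector_measure_linear[of n "%x. - x"] bounded_linear_minus[OF bounded_linear_ident] by simp

definition total_variation :: "('a::euclidean_space set => real) => real" where
 "total_variation n = measure (positive_part_measure n) UNIV
   + measure (positive_part_measure (%A. - n A)) UNIV"

lemma integrable_bounded_continuous:
 fixes f :: "'a::euclidean_space => real"
 assumes "finite_measure M" "sets M = sets borel" "continuous_on UNIV f" "!!x. \<bar>f x\<bar> <= B"
 shows "integrable M f"
 using assms(4) borel_measurable_continuous_onI[OF assms(3)]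
 by (intro finite_measure.integrable_const_bound[OF assms(1), of _ B])
   (auto simp: measurable_cong_sets[OF assms(2) refl])

lemma positive_part_measure_support:
 assumes v: "vector_measure n" and K: "compact K" "!!A. A \<in> sets borel ==> A \<inter> K = {} ==> n A = 0"
 shows "AE x in positive_part_measure n. x \<in> K"
proof (rule AE_I)
 have b: "- K \<in> sets borel" using K by (simp add: borel_closed compact_imp_closed borel_comp)
 show "- K \<in> sets (positive_part_measure n)" by (simp add: sets_positive_part_measure b)
 show "emeasure (positive_part_measure n) (- K) = 0"
 proof -
  have "pos_part n (- K) <= 0" unfolding pos_part_def by (rule SUP_least) (use K(2) in \<open>auto simp: disjoint_eq_subset_Compl\<close>)
  then show ?thesis by (simp add: emeasure_positive_part_measure[OF v b])
 qed
qed (auto simp: space_positive_part_measure)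

lemma signed_integral_0 [simp]: "signed_integral n (%x. 0) = 0"
 by (simp add: signed_integral_def)

lemma signed_integral_scale: "signed_integral n (%x. c * f x) = c * signed_integral n f"
 by (simp add: signed_integral_def right_diff_distrib)

lemma signed_integral_sum:
 assumes v: "vector_measure n"
  and f: "!!i. i \<in> I ==> continuous_on UNIV (f i)" "!!i x. i \<in> I ==> \<bar>f i x\<bar> <= B i"
 shows "signed_integral n (%x. \<Sum>i\<in>I. f i x) = (\<Sum>i\<in>I. signed_integral n (f i))"
proof -
 have "(\<integral>x. (\<Sum>i\<in>I. f i x) \<partial>positive_part_measure n) = (\<Sum>i\<in>I. \<integral>x. f i x \<partial>positive_part_measure n)"
  if "vector_measure n" for n :: "'a set => real"
  by (intro Bochner_Integration.integral_sum integrable_bounded_continuous[OF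
     finite_positive_part_measure[OF that] sets_positive_part_measure])
    (use f in auto)
 then show ?thesis
  using v vector_measure_uminus[OF v] by (simp add: signed_integral_def sum_subtractf)
qed

text \<open>The functions are bounded jointly, by the supremum of their sum on the support. For a
  partition of unity this gives one bound for all grids.\<close>

lemma sum_signed_integral_bound:
 fixes f :: "'i => 'a::euclidean_space => real"
 assumes v: "vector_measure n"
  and K: "compact K" "!!A. A \<in> sets borel ==> A \<inter> K = {} ==> n A = 0"
  and f: "!!i. i \<in> I ==> continuous_on UNIV (f i)" "!!i x. i \<in> I ==> \<bar>f i x\<bar> <= b i"
  and B: "!!x. x \<in> K ==> (\<Sum>i\<in>I. \<bar>f i x\<bar>) <= B"
 shows "(\<Sum>i\<in>I. \<bar>signed_integral n (f i)\<bar>) <= B * total_variation n"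
proof -
 have 1: "(\<Sum>i\<in>I. \<bar>\<integral>x. f i x \<partial>positive_part_measure n\<bar>) <= B * measure (positive_part_measure n) UNIV"
  if v: "vector_measure n" and K': "!!A. A \<in> sets borel ==> A \<inter> K = {} ==> n A = 0"
  for n :: "'a set => real"
 proof -
  interpret finite_measure "positive_part_measure n" by (rule finite_positive_part_measure[OF v])
  have int: "integrable (positive_part_measure n) (%x. \<bar>f i x\<bar>)" if "i \<in> I" for i
   using f[OF that] by (intro integrable_abs integrable_bounded_continuous[OF
     finite_positive_part_measure[OF v] sets_positive_part_measure]) auto
  have "(\<Sum>i\<in>I. \<bar>\<integral>x. f i x \<partial>positive_part_measure n\<bar>) <= (\<Sum>i\<in>I. \<integral>x. \<bar>f i x\<bar> \<partial>positive_part_measure n)"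
   by (intro sum_mono integral_abs_bound)
  also have "... = (\<integral>x. (\<Sum>i\<in>I. \<bar>f i x\<bar>) \<partial>positive_part_measure n)"
   by (subst Bochner_Integration.integral_sum) (auto intro: int)
  also have "... <= (\<integral>x. B \<partial>positive_part_measure n)"
  proof (rule integral_mono_AE)
   show "AE x in positive_part_measure n. (\<Sum>i\<in>I. \<bar>f i x\<bar>) <= B"
    using positive_part_measure_support[OF v K(1), OF K'] by (rule eventually_mono) (auto intro: B)
  qed (simp_all add: int)
  also have "... = B * measure (positive_part_measure n) UNIV"
   by (simp add: space_positive_part_measure mult.commute)
  finally show ?thesis .
 qed
 have "(\<Sum>i\<in>I. \<bar>signed_integral n (f i)\<bar>) <= (\<Sum>i\<in>I. \<bar>\<integral>x. f i x \<partial>positive_part_measure n\<bar>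
   + \<bar>\<integral>x. f i x \<partial>positive_part_measure (%A. - n A)\<bar>)"
  unfolding signed_integral_def by (intro sum_mono abs_triangle_ineq4)
 also have "... = (\<Sum>i\<in>I. \<bar>\<integral>x. f i x \<partial>positive_part_measure n\<bar>)
   + (\<Sum>i\<in>I. \<bar>\<integral>x. f i x \<partial>positive_part_measure (%A. - n A)\<bar>)" by (rule sum.distrib)
 also have "... <= B * measure (positive_part_measure n) UNIV
   + B * measure (positive_part_measure (%A. - n A)) UNIV"
 proof (rule add_mono)
  show "(\<Sum>i\<in>I. \<bar>\<integral>x. f i x \<partial>positive_part_measure n\<bar>) <= B * measure (positive_part_measure n) UNIV"
   by (rule 1[OF v]) (rule K(2))
  show "(\<Sum>i\<in>I. \<bar>\<integral>x. f i x \<partial>positive_part_measure (%A. - n A)\<bar>)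
    <= B * measure (positive_part_measure (%A. - n A)) UNIV"
   by (rule 1[OF vector_measure_uminus[OF v]]) (simp add: K(2))
 qed
 finally show ?thesis by (simp add: total_variation_def distrib_left)
qed

section \<open>Line and triangle integrals\<close>

lemma test_form_smooth: "test_form k w ==> smooth (%x. w x v)"
 by (simp add: test_form_def)

lemma test_form_covector: "test_form k w ==> covector k (w x)"
 by (simp add: test_form_def)

lemma covector_cong:
 assumes "covector k a" "!!i. i < k ==> v i = w i" shows "a v = a w"
proof -
 have "ALL v w. (\<forall>i<k. v i = w i) --> a v = a w" using assms(1)[unfolded covector_def] by (rule conjunct1)
 then show ?thesis using assms(2) by simp
qed

lemma covector_1: "covector 1 a ==> a v = a (%_. v 0)"
 by (rule covector_cong) auto

lemma covector_1_linear:
 assumes "covector 1 a" shows "linear (%u. a (%_. u))"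
proof -
 have "ALL v. \<forall>i<1. linear (%u. a (v(i := u)))" using assms[unfolded covector_def, THEN conjunct2, THEN conjunct1] .
 then have "linear (%u. a ((%_. 0)(0 := u)))" by simp
 moreover have "a ((%_. 0)(0 := u)) = a (%_. u)" for u by (rule covector_cong[OF assms]) auto
 ultimately show ?thesis by simp
qed

text \<open>The tangent \<open>q - p\<close> is not normalized, so the length of the segment is
  already included.\<close>

definition line_int :: "'a::euclidean_space form => 'a => 'a => real" where
 "line_int w p q = (LINT s:{0..1}|lborel. w (p + s *\<^sub>R (q - p)) (%_. q - p))"

definition std_triangle :: "(real \<times> real) set" where
 "std_triangle = {y. 0 <= fst y & 0 <= snd y & fst y + snd y <= 1}"

text \<open>Integrated over the parameter triangle and not over the image set, so that collinear
  vertices are allowed and the order of the vertices carries the orientation.\<close>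

definition tri_int :: "'a::euclidean_space form => 'a => 'a => 'a => real" where
 "tri_int w p q r = (LINT y:std_triangle|lborel.
   w (p + fst y *\<^sub>R (q - p) + snd y *\<^sub>R (r - p)) (%i. if i = 0 then q - p else r - p))"

definition dform :: "('a::euclidean_space => real) => 'a form" where
 "dform f = exterior_derivative 0 (%x v. f x)"

lemma dform_eq: "dform f x v = frechet_derivative f (at x) (v 0)"
 by (simp add: dform_def exterior_derivative_def)

lemma compact_std_triangle: "compact std_triangle"
proof -
 have "closed std_triangle" unfolding std_triangle_def
  by (intro closed_Collect_conj closed_Collect_le continuous_intros)
 moreover have "std_triangle \<subseteq> cbox (0, 0) (1, 1)"
  by (auto simp: std_triangle_def cbox_Pair_eq)
 ultimately show ?thesis by (meson bounded_cbox bounded_subset compact_eq_bounded_closed)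
qed

lemma set_integral_Icc_FTC:
 fixes F :: "real => real"
 assumes "a <= b" "!!x. (F has_real_derivative f x) (at x)" "continuous_on UNIV f"
 shows "(LINT x:{a..b}|lborel. f x) = F b - F a"
 unfolding set_lebesgue_integral_def
 using integral_FTC_Icc_real[OF assms(1), of F f] assms(2,3)
 by (simp add: mult.commute continuous_on_eq_continuous_at)

lemma line_int_dform:
 assumes "smooth f"
 shows "line_int (dform f) p q = f q - f p"
proof -
 have 1: "((%s. f (p + s *\<^sub>R (q - p))) has_real_derivative dform f (p + s *\<^sub>R (q - p)) (%_. q - p)) (at s)" for s
 proof -
  have "((%s. p + s *\<^sub>R (q - p)) has_derivative (%h. h *\<^sub>R (q - p))) (at s)"
   by (auto intro!: derivative_eq_intros)
  from has_derivative_compose[OF this smooth_has_derivative[OF assms]]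
  have "((%s. f (p + s *\<^sub>R (q - p))) has_derivative
    (%h. frechet_derivative f (at (p + s *\<^sub>R (q - p))) (h *\<^sub>R (q - p)))) (at s)" .
  moreover have "linear (frechet_derivative f (at x))" for x
   using smooth_has_derivative[OF assms] by (rule has_derivative_linear)
  ultimately show ?thesis
   by (simp add: has_field_derivative_def dform_eq linear_scale mult_commute_abs)
 qed
 have "continuous_on UNIV (%s. dform f (p + s *\<^sub>R (q - p)) (%_. q - p))"
  unfolding dform_eq
  by (rule continuous_on_compose2[OF smooth_continuous[OF smooth_frechet_derivative[OF assms]]])
    (auto intro!: continuous_intros)
 from set_integral_Icc_FTC[OF _ 1 this, of 0 1] show ?thesis by (simp add: line_int_def)
qed

text \<open>Fubini on the triangle: the slice at height \<open>t\<close> is the interval from 0 to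
  \<open>1 - t\<close>, where the fundamental theorem applies.\<close>

lemma triangle_integral_FTC:
 fixes G F :: "real => real => real"
 assumes d: "!!s t. ((%s. G s t) has_real_derivative F s t) (at s)"
  and c: "continuous_on UNIV (%y. F (fst y) (snd y))"
 shows "(LINT y:std_triangle|lborel. F (fst y) (snd y)) = (LINT t:{0..1}|lborel. G (1 - t) t - G 0 t)"
proof -
 define f where "f s t = indicator std_triangle (s, t) *\<^sub>R F s t" for s t
 have "integrable lborel (%y. indicator std_triangle y *\<^sub>R F (fst y) (snd y))"
  by (rule borel_integrable_compact[OF compact_std_triangle]) (rule continuous_on_subset[OF c], simp)
 then have i: "integrable (lborel \<Otimes>\<^sub>M lborel) (case_prod f)"
  by (simp add: lborel_prod f_def case_prod_beta')
 have "(LINT y:std_triangle|lborel. F (fst y) (snd y)) = (\<integral>y. case_prod f y \<partial>(lborel \<Otimes>\<^sub>M lborel))"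
  by (simp add: set_lebesgue_integral_def lborel_prod f_def case_prod_beta')
 also have "... = (\<integral>t. (\<integral>s. f s t \<partial>lborel) \<partial>lborel)"
  by (rule lborel_pair.integral_snd[OF i, symmetric])
 also have "... = (\<integral>t. indicator {0..1} t *\<^sub>R (G (1 - t) t - G 0 t) \<partial>lborel)"
 proof (rule Bochner_Integration.integral_cong[OF refl])
  fix t :: real
  show "(\<integral>s. f s t \<partial>lborel) = indicator {0..1} t *\<^sub>R (G (1 - t) t - G 0 t)"
  proof (cases "t \<in> {0..1}")
   case True
   have "f s t = indicator {0..1 - t} s *\<^sub>R F s t" for s
    using True by (auto simp: f_def std_triangle_def indicator_def)
   then have "(\<integral>s. f s t \<partial>lborel) = (LINT s:{0..1 - t}|lborel. F s t)"
    by (simp add: set_lebesgue_integral_def)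
   also have "... = G (1 - t) t - G 0 t"
   proof (rule set_integral_Icc_FTC)
    show "continuous_on UNIV (%s. F s t)"
    proof -
     have "continuous_on UNIV (%s. (s, t))"
      by (intro continuous_on_Pair continuous_on_id continuous_on_const)
     from continuous_on_compose2[OF c this] show ?thesis by simp
    qed
   qed (use True d in auto)
   finally show ?thesis using True by simp
  next
   case False
   then have "f s t = 0" for s by (auto simp: f_def std_triangle_def indicator_def)
   then show ?thesis using False by simp
  qed
 qed
 finally show ?thesis by (simp add: set_lebesgue_integral_def)
qed

lemma triangle_integral_swap:
 fixes F :: "real => real => real"
 assumes c: "continuous_on UNIV (%y. F (fst y) (snd y))"
 shows "(LINT y:std_triangle|lborel. F (fst y) (snd y)) = (LINT y:std_triangle|lborel. F (snd y) (fst y))"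
proof -
 define f where "f y = indicator std_triangle y *\<^sub>R F (fst y) (snd y)" for y
 have "integrable lborel f" unfolding f_def
  by (rule borel_integrable_compact[OF compact_std_triangle]) (rule continuous_on_subset[OF c], simp)
 then have m: "f \<in> borel_measurable (lborel \<Otimes>\<^sub>M lborel)"
  by (simp add: lborel_prod)
 have "(\<integral>(x, y). f (y, x) \<partial>(lborel \<Otimes>\<^sub>M lborel)) = integral\<^sup>L (lborel \<Otimes>\<^sub>M lborel) f"
  by (rule lborel_pair.integral_product_swap[OF m])
 then have "(\<integral>y. f (snd y, fst y) \<partial>lborel) = (\<integral>y. f y \<partial>lborel)"
  by (simp add: lborel_prod case_prod_beta')
 moreover have "f (snd y, fst y) = indicator std_triangle y *\<^sub>R F (snd y) (fst y)" for y
  by (auto simp: f_def std_triangle_def indicator_def)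
 ultimately have "(\<integral>y. indicator std_triangle y *\<^sub>R F (snd y) (fst y) \<partial>lborel) = (\<integral>y. f y \<partial>lborel)"
  by (simp only:)
 then show ?thesis by (simp only: set_lebesgue_integral_def f_def)
qed

lemma set_integral_reflect:
 fixes h :: "real => real"
 shows "(LINT t:{0..1}|lborel. h (1 - t)) = (LINT t:{0..1}|lborel. h t)"
proof -
 have "(\<integral>t. indicator {0..1} t *\<^sub>R h t \<partial>lborel) = \<bar>- 1\<bar> *\<^sub>R (\<integral>t. indicator {0..1} (1 + - 1 * t) *\<^sub>R h (1 + - 1 * t) \<partial>lborel)"
  by (rule lborel_integral_real_affine) simp
 moreover have "indicator {0..1} (1 + - 1 * t) = (indicator {0..1} t :: real)" for t :: real
  by (auto simp: indicator_def)
 ultimately show ?thesis by (simp add: set_lebesgue_integral_def)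
qed

lemma set_integrable_Icc_continuous:
 fixes h :: "real => real"
 assumes "continuous_on UNIV h" shows "set_integrable lborel {a..b} h"
 unfolding set_integrable_def
 by (rule borel_integrable_compact) (auto intro: continuous_on_subset[OF assms])

text \<open>In the parameters \<open>d om\<close> becomes a difference of two partial derivatives.
  Each is integrated along its own variable, the second after exchanging the coordinates. The two
  legs give two line integrals; the two integrals along the hypotenuse combine into the third
  because \<open>r - q = w - u\<close>.\<close>

lemma stokes_triangle:
 fixes om :: "'a::euclidean_space form"
 assumes om: "test_form 1 om"
 shows "tri_int (exterior_derivative 1 om) p q r = line_int om p q + line_int om q r - line_int om p r"
proof -
 define u where "u = q - p"
 define w where "w = r - p"
 define al where "al x = om x (%_. u)" for x
 define \<beta> where "\<beta> x = om x (%_. w)" for x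
 define A where "A s t = p + s *\<^sub>R u + t *\<^sub>R w" for s t
 have sm: "smooth al" "smooth \<beta>" unfolding al_def[abs_def] \<beta>_def[abs_def] by (rule test_form_smooth[OF om])+
 have cv: "covector 1 (om x)" for x using om by (rule test_form_covector)
 have ext: "exterior_derivative 1 om x (%i. if i = 0 then u else w)
   = frechet_derivative \<beta> (at x) u - frechet_derivative al (at x) w" for x
 proof -
  have 1: "(%y. om y (%j. if j < 0 then (if j = 0 then u else w) else (if Suc j = 0 then u else w))) = \<beta>"
   by (auto simp: \<beta>_def)
  have 2: "(%y. om y (%j. if j < 1 then (if j = 0 then u else w) else (if Suc j = 0 then u else w))) = al"
   unfolding al_def by (rule ext, rule covector_cong[OF cv]) auto
  show ?thesis unfolding exterior_derivative_def using 1 2 by (simp add: atMost_Suc)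
 qed
 have dA: "((%s. A s t) has_derivative (%h. h *\<^sub>R u)) (at s)" "((%t. A s t) has_derivative (%h. h *\<^sub>R w)) (at t)" for s t
  unfolding A_def by (auto intro!: derivative_eq_intros)
 have lin: "linear (frechet_derivative f (at x))" if "smooth f" for f :: "'a => real" and x
  using smooth_has_derivative[OF that] by (rule has_derivative_linear)
 have d\<beta>: "((%s. \<beta> (A s t)) has_real_derivative frechet_derivative \<beta> (at (A s t)) u) (at s)" for s t
  using has_derivative_compose[OF dA(1) smooth_has_derivative[OF sm(2)]]
  by (simp add: has_field_derivative_def linear_scale[OF lin[OF sm(2)]] mult_commute_abs)
 have dal: "((%t. al (A s t)) has_real_derivative frechet_derivative al (at (A s t)) w) (at t)" for s t
  using has_derivative_compose[OF dA(2) smooth_has_derivative[OF sm(1)]]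
  by (simp add: has_field_derivative_def linear_scale[OF lin[OF sm(1)]] mult_commute_abs)
 have cA: "continuous_on UNIV (%y. A (fst y) (snd y))" "continuous_on UNIV (%y. A (snd y) (fst y))"
  unfolding A_def by (intro continuous_intros)+
 have cf: "continuous_on UNIV (%x. frechet_derivative f (at x) v)" if "smooth f" for f :: "'a => real" and v
  by (intro smooth_continuous smooth_frechet_derivative that)
 have cc: "continuous_on UNIV (%t. f (A (a t) (b t)))"
  if "smooth f" "continuous_on UNIV a" "continuous_on UNIV b" for f :: "'a => real" and a b :: "real => real"
  unfolding A_def
  by (rule continuous_on_compose2[OF smooth_continuous[OF that(1), of UNIV]]) (auto intro!: continuous_intros that)
 have c\<beta>: "continuous_on UNIV (%y. frechet_derivative \<beta> (at (A (fst y) (snd y))) u)"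
  by (rule continuous_on_compose2[OF cf[OF sm(2)] cA(1)]) simp
 have cal: "continuous_on UNIV (%y. frechet_derivative al (at (A (fst y) (snd y))) w)"
  by (rule continuous_on_compose2[OF cf[OF sm(1)] cA(1)]) simp
 have cal': "continuous_on UNIV (%y. frechet_derivative al (at (A (snd y) (fst y))) w)"
  by (rule continuous_on_compose2[OF cf[OF sm(1)] cA(2)]) simp
 have "tri_int (exterior_derivative 1 om) p q r = (LINT y:std_triangle|lborel.
   frechet_derivative \<beta> (at (A (fst y) (snd y))) u - frechet_derivative al (at (A (fst y) (snd y))) w)"
  unfolding tri_int_def u_def[symmetric] w_def[symmetric] ext A_def ..
 also have "... = (LINT y:std_triangle|lborel. frechet_derivative \<beta> (at (A (fst y) (snd y))) u)
   - (LINT y:std_triangle|lborel. frechet_derivative al (at (A (fst y) (snd y))) w)"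
  by (rule set_integral_diff(2); unfold set_integrable_def; rule borel_integrable_compact[OF compact_std_triangle])
    (rule continuous_on_subset[OF c\<beta>] continuous_on_subset[OF cal], simp)+
 also have "(LINT y:std_triangle|lborel. frechet_derivative \<beta> (at (A (fst y) (snd y))) u)
   = (LINT t:{0..1}|lborel. \<beta> (A (1 - t) t) - \<beta> (A 0 t))"
  by (rule triangle_integral_FTC[OF d\<beta> c\<beta>])
 also have "... = (LINT t:{0..1}|lborel. \<beta> (A (1 - t) t)) - line_int om p r"
 proof -
  have "(LINT t:{0..1}|lborel. \<beta> (A 0 t)) = line_int om p r"
   by (simp add: line_int_def \<beta>_def A_def w_def)
  then show ?thesis
   by (subst set_integral_diff(2)) (auto intro!: set_integrable_Icc_continuous cc sm continuous_intros)
 qed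
 also have "(LINT y:std_triangle|lborel. frechet_derivative al (at (A (fst y) (snd y))) w)
   = (LINT y:std_triangle|lborel. frechet_derivative al (at (A (snd y) (fst y))) w)"
  by (rule triangle_integral_swap[OF cal])
 also have "... = (LINT t:{0..1}|lborel. al (A t (1 - t)) - al (A t 0))"
  by (rule triangle_integral_FTC[OF _ cal', of "%s t. al (A t s)"]) (rule dal)
 also have "... = (LINT t:{0..1}|lborel. al (A t (1 - t))) - line_int om p q"
 proof -
  have "(LINT t:{0..1}|lborel. al (A t 0)) = line_int om p q"
   by (simp add: line_int_def al_def A_def u_def)
  then show ?thesis
   by (subst set_integral_diff(2)) (auto intro!: set_integrable_Icc_continuous cc sm continuous_intros)
 qed
 also have "(LINT t:{0..1}|lborel. al (A t (1 - t))) = (LINT t:{0..1}|lborel. al (A (1 - t) t))"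
  using set_integral_reflect[of "%t. al (A t (1 - t))"] by simp
 finally have 1: "tri_int (exterior_derivative 1 om) p q r =
   ((LINT t:{0..1}|lborel. \<beta> (A (1 - t) t)) - (LINT t:{0..1}|lborel. al (A (1 - t) t)))
    + line_int om p q - line_int om p r" by simp
 have "line_int om q r = (LINT t:{0..1}|lborel. \<beta> (A (1 - t) t) - al (A (1 - t) t))"
 proof -
  have "om (q + s *\<^sub>R (r - q)) (%_. r - q) = \<beta> (A (1 - s) s) - al (A (1 - s) s)" for s
  proof -
   have "q + s *\<^sub>R (r - q) = A (1 - s) s" by (simp add: A_def u_def w_def algebra_simps)
   moreover have "r - q = w - u" by (simp add: u_def w_def)
   ultimately show ?thesis
    using linear_diff[OF covector_1_linear[OF cv]] by (simp add: al_def \<beta>_def)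
  qed
  then show ?thesis by (simp add: line_int_def)
 qed
 also have "... = (LINT t:{0..1}|lborel. \<beta> (A (1 - t) t)) - (LINT t:{0..1}|lborel. al (A (1 - t) t))"
  by (rule set_integral_diff(2)) (auto intro!: set_integrable_Icc_continuous cc sm continuous_intros)
 finally show ?thesis using 1 by simp
qed

section \<open>Orientations and simplices\<close>

lemma simple_vector_norm_1: "simple_vector_norm 1 v = norm (v 0)"
proof -
 have "{p. p permutes {..<1::nat}} = {id}" by (auto simp: lessThan_Suc permutes_sing)
 then show ?thesis by (simp add: simple_vector_norm_def norm_eq_sqrt_inner)
qed

lemma simple_vector_norm_2:
 "simple_vector_norm 2 v = sqrt ((v 0 \<bullet> v 0) * (v 1 \<bullet> v 1) - (v 0 \<bullet> v 1)\<^sup>2)"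
proof -
 have s: "{..<2::nat} = {0, 1}" by auto
 have "{p. p permutes {..<2::nat}} = {id, Transposition.transpose 0 1}"
  unfolding s by (auto simp: permutes_doubleton_iff)
 moreover have "id ~= Transposition.transpose 0 (1::nat)"
  by (metis id_apply transpose_apply_first zero_neq_one)
 ultimately show ?thesis
  by (simp add: simple_vector_norm_def s sign_swap_id inner_commute power2_eq_square)
qed

definition pair_vec :: "'a => 'a => nat => 'a" where "pair_vec x y = (%i. if i = 0 then x else y)"

lemma pair_vec_simps [simp]: "pair_vec x y 0 = x" "pair_vec x y (Suc i) = y"
 by (simp_all add: pair_vec_def)

lemma covector_2:
 assumes "covector 2 al"
 shows "al v = al (pair_vec (v 0) (v 1))"
  "al (pair_vec (a *\<^sub>R x + b *\<^sub>R y) (c *\<^sub>R x + d *\<^sub>R y)) = (a * d - b * c) * al (pair_vec x y)"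
proof -
 show "al v = al (pair_vec (v 0) (v 1))"
  by (rule covector_cong[OF assms]) (auto simp: less_2_cases_iff)
 have lin: "linear (%u. al (v(i := u)))" if "i < 2" for v i
  using assms[unfolded covector_def, THEN conjunct2, THEN conjunct1] that by simp
 have p0: "(pair_vec 0 y)(0 := x) = pair_vec x y" for x y :: 'a by (auto simp: pair_vec_def)
 have l0: "linear (%x. al (pair_vec x y))" for y
  using lin[where i = 0 and v = "pair_vec 0 y"] unfolding p0 by simp
 have p1: "al ((pair_vec x 0)(1 := y)) = al (pair_vec x y)" for x y :: 'a
  by (rule covector_cong[OF assms]) (auto simp: less_2_cases_iff)
 have l1: "linear (%y. al (pair_vec x y))" for x
  using lin[where i = 1 and v = "pair_vec x 0"] unfolding p1 by simp
 have "ALL v. \<forall>i<2. \<forall>j<2. i ~= j --> v i = v j --> al v = 0"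
  using assms[unfolded covector_def, THEN conjunct2, THEN conjunct2] .
 from this[rule_format, of 0 1] have z: "al (pair_vec x x) = 0" for x by simp
 have anti: "al (pair_vec y x) = - al (pair_vec x y)" for x y
 proof -
  have "al (pair_vec (x + y) (x + y)) = al (pair_vec x x) + al (pair_vec x y) + al (pair_vec y x) + al (pair_vec y y)"
   by (simp add: linear_add[OF l0] linear_add[OF l1])
  then show ?thesis using z[of "x + y"] z[of x] z[of y] by linarith
 qed
 show "al (pair_vec (a *\<^sub>R x + b *\<^sub>R y) (c *\<^sub>R x + d *\<^sub>R y)) = (a * d - b * c) * al (pair_vec x y)"
  by (simp add: linear_add[OF l0] linear_add[OF l1] linear_scale[OF l0] linear_scale[OF l1] z anti[of y x]
    algebra_simps)
qed

lemma in_span_doubleton: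
 fixes x :: "'a::real_vector"
 assumes "x \<in> span {y, z}" obtains k l where "x = k *\<^sub>R y + l *\<^sub>R z"
proof -
 obtain k where "x - k *\<^sub>R y \<in> span {z}" using assms by (auto simp: span_breakdown_eq)
 then obtain l where "x - k *\<^sub>R y = l *\<^sub>R z" by (auto simp: span_singleton)
 then show thesis using that[of k l] by (simp add: algebra_simps)
qed

lemma affine_hull_differences:
 fixes S :: "'a::euclidean_space set"
 assumes "a \<in> S"
 shows "{x - y | x y. x \<in> affine hull S & y \<in> affine hull S} = span ((%x. x - a) ` (S - {a}))" (is "?D = ?V")
proof -
 have h: "affine hull S = (+) a ` ?V"
  using affine_hull_span2[OF assms] by (simp add: algebra_simps)
 show ?thesis
 proof
  show "?D \<subseteq> ?V"
  proof
   fix z assume "z \<in> ?D"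
   then obtain v w where "v \<in> ?V" "w \<in> ?V" "z = (a + v) - (a + w)" unfolding h by blast
   then show "z \<in> ?V" by (simp add: span_diff)
  qed
  show "?V \<subseteq> ?D"
  proof
   fix v assume v: "v \<in> ?V"
   have "a + v \<in> affine hull S" "a \<in> affine hull S" using v assms h by (auto simp: hull_inc)
   moreover have "v = (a + v) - a" by simp
   ultimately show "v \<in> ?D" by blast
  qed
 qed
qed

text \<open>A change of basis multiplies the Gram determinant by the square of its determinant. Both
  Gram determinants are 1, so the determinant is a sign. Edges and triangles are the only simplices
  that occur below.\<close>

lemma orients_unique:
 fixes sg :: "'a::euclidean_space set"
 assumes k: "k = 1 \<or> k = 2" and o: "orients k t sg" "orients k t' sg"
 obtains s :: real where "s = 1 \<or> s = -1" "!!al. covector k al ==> al t' = s * al t"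
proof -
 have sp: "span (t' ` {..<k}) = span (t ` {..<k})" using o by (simp add: orients_def)
 from k show thesis
 proof
  assume [simp]: "k = 1"
  have "t' 0 \<in> span (t ` {..<k})" unfolding sp[symmetric] by (rule span_base) auto
  then obtain c where c: "t' 0 = c *\<^sub>R t 0" by (auto simp: lessThan_Suc span_singleton)
  have "norm (t' 0) = 1" "norm (t 0) = 1"
   using o(2)[unfolded orients_def \<open>k = 1\<close> simple_vector_norm_1, THEN conjunct1]
    o(1)[unfolded orients_def \<open>k = 1\<close> simple_vector_norm_1, THEN conjunct1] .
  then have "\<bar>c\<bar> = 1" using c by simp
  then have "c = 1 \<or> c = -1" by linarith
  moreover have "al t' = c * al t" if al: "covector k al" for al
   using covector_1[of al t'] covector_1[of al t] linear_scale[OF covector_1_linear[of al]] al c by simp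
  ultimately show thesis by (rule that)
 next
  assume [simp]: "k = 2"
  have im: "f ` {..<k} = {f 0, f 1}" for f :: "nat => 'a" by (auto simp: less_2_cases_iff)
  have "t' 0 \<in> span {t 0, t 1}" "t' 1 \<in> span {t 0, t 1}"
   unfolding im[symmetric] sp[symmetric] by (auto intro: span_base)
  then obtain a b c d where ab: "t' 0 = a *\<^sub>R t 0 + b *\<^sub>R t 1" and cd: "t' 1 = c *\<^sub>R t 0 + d *\<^sub>R t 1"
   by (metis in_span_doubleton)
  define G where "G v = (v 0 \<bullet> v 0) * (v 1 \<bullet> v 1) - (v 0 \<bullet> v 1)\<^sup>2" for v :: "nat => 'a"
  have "sqrt (G t) = 1" "sqrt (G t') = 1"
   using o(1)[unfolded orients_def \<open>k = 2\<close> simple_vector_norm_2, THEN conjunct1]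
    o(2)[unfolded orients_def \<open>k = 2\<close> simple_vector_norm_2, THEN conjunct1] unfolding G_def .
  then have "G t = 1" "G t' = 1" by simp_all
  moreover have "G t' = (a * d - b * c)\<^sup>2 * G t"
   unfolding G_def ab cd
   by (simp add: inner_add_left inner_add_right inner_commute[of "t (Suc 0)" "t 0"] power2_eq_square algebra_simps)
  ultimately have "(a * d - b * c)\<^sup>2 = 1" by simp
  then have "a * d - b * c = 1 \<or> a * d - b * c = -1" by (simp add: power2_eq_1_iff)
  moreover have "al t' = (a * d - b * c) * al t" if al: "covector k al" for al
   using covector_2(1)[of al t'] covector_2(1)[of al t] covector_2(2)[of al a "t 0" b "t 1" c d] al
   unfolding ab cd by simp
  ultimately show thesis by (rule that)
 qed
qed

lemma segment_differences:
 fixes p q :: "'a::euclidean_space"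
 shows "{x - y | x y. x \<in> affine hull closed_segment p q & y \<in> affine hull closed_segment p q} = span {q - p}"
proof -
 have "affine hull closed_segment p q = affine hull {p, q}"
  by (simp add: segment_convex_hull affine_hull_convex_hull)
 moreover have "span ((%x. x - p) ` ({p, q} - {p})) = span {q - p}"
  by (cases "p = q") (auto simp: insert_Diff_if)
 ultimately show ?thesis using affine_hull_differences[of p "{p, q}"] by simp
qed

text \<open>A unit vector along the segment points from one end to the other; the ends are named
  accordingly.\<close>

lemma oriented_segment:
 fixes s :: "'a::euclidean_space set"
 assumes "1 simplex s" "orients 1 t s"
 obtains p q where "p ~= q" "s = closed_segment p q" "t 0 = (q - p) /\<^sub>R dist p q"
proof -
 obtain C where C: "card C = 2" "s = convex hull C" using assms(1) by (auto simp: simplex_def)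
 then obtain p q where pq: "C = {p, q}" "p ~= q" by (auto simp: card_2_iff)
 have s: "s = closed_segment p q" by (simp add: C pq segment_convex_hull)
 have "q - p \<in> span {t 0}"
  using assms(2) segment_differences[of p q] unfolding orients_def s
  by (simp add: lessThan_Suc span_base)
 then obtain c where c: "q - p = c *\<^sub>R t 0" by (auto simp: span_singleton)
 have n: "norm (t 0) = 1" using assms(2) unfolding orients_def simple_vector_norm_1 by (rule conjunct1)
 have c0: "c ~= 0" using c pq(2) by auto
 have "dist p q = norm (q - p)" by (simp add: dist_norm norm_minus_commute)
 also have "... = \<bar>c\<bar>" unfolding c using n by simp
 finally have d: "dist p q = \<bar>c\<bar>" .
 show thesis
 proof (cases "c > 0")
  case True
  then have "inverse \<bar>c\<bar> * c = 1" by simp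
  then have "t 0 = (q - p) /\<^sub>R dist p q" by (simp only: c d scaleR_scaleR scaleR_one)
  then show ?thesis by (rule that[OF pq(2) s])
 next
  case False
  have "(p - q) /\<^sub>R dist q p = - ((q - p) /\<^sub>R dist p q)"
   by (simp add: dist_commute scaleR_diff_right)
  also have "... = t 0"
  proof -
   have "inverse \<bar>c\<bar> * c = - 1" using False c0 by (simp add: abs_if)
   then show ?thesis by (simp only: c d scaleR_scaleR scaleR_minus_left scaleR_one minus_minus)
  qed
  finally have "t 0 = (p - q) /\<^sub>R dist q p" ..
  moreover have "s = closed_segment q p" unfolding s by (rule closed_segment_commute)
  ultimately show ?thesis using pq(2) by (intro that[of q p]) simp_all
 qed
qed

lemma segment_simplex: "p ~= q ==> 1 simplex closed_segment p (q :: 'a::euclidean_space)"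
 unfolding simplex_def segment_convex_hull by (intro exI[of _ "{p, q}"]) (auto simp: affine_independent_2)

lemma segment_orients:
 fixes p q :: "'a::euclidean_space"
 assumes "p ~= q"
 shows "orients 1 (%_. (q - p) /\<^sub>R dist p q) (closed_segment p q)"
proof -
 have "span {(q - p) /\<^sub>R dist p q} = span {q - p}"
  using assms by (intro span_eq[THEN iffD2])
   (auto simp: span_singleton intro!: image_eqI[of _ _ "inverse (dist p q)"] image_eqI[of _ _ "dist p q"])
 then show ?thesis
  using assms simple_vector_norm_1[of "%_. (q - p) /\<^sub>R dist p q"] segment_differences[of p q]
  by (simp add: orients_def lessThan_Suc dist_norm norm_minus_commute)
qed

lemma segment_integral:
 fixes p q :: "'a::euclidean_space"
 assumes pq: "p ~= q" and \<tau>: "\<tau> 0 = (q - p) /\<^sub>R dist p q" and w: "test_form 1 w"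
 shows "(LINT x:closed_segment p q|hausdorff_measure 1. w x \<tau>) = line_int w p q"
proof -
 define L where "L s = s *\<^sub>R (q - p)" for s
 define g where "g x = (x \<bullet> (q - p)) / ((q - p) \<bullet> (q - p))" for x
 have L: "bounded_linear L" unfolding L_def by (rule bounded_linear_scaleR_left)
 have g: "bounded_linear g" "!!y. g (L y) = y"
 proof -
  show "bounded_linear g" unfolding g_def divide_inverse
   by (intro bounded_linear_mult_const bounded_linear_inner_left)
  show "g (L y) = y" for y using pq by (simp add: g_def L_def)
 qed
 obtain k where k: "k > 0"
  "!!B. B \<in> sets borel ==> emeasure (hausdorff_measure DIM(real)) ((%y. p + L y) ` B) = ennreal k * emeasure lborel B"
  "!!B f. B \<in> sets borel ==> f \<in> borel_measurable borel ==>
   (LINT x:(%y. p + L y) ` B|hausdorff_measure DIM(real). f x :: real) = k * (LINT y:B|lborel. f (p + L y))"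
  using hausdorff_measure_affine_param[OF L g] by metis
 have seg: "(%y. p + L y) ` {0..1} = closed_segment p q"
  unfolding closed_segment_image_interval L_def by (auto simp: algebra_simps)
 \<comment> \<open>The undetermined factor of the parametrization is fixed by the known measure of
   the segment.\<close>
 have "ennreal (dist p q) = ennreal k"
  using k(2)[of "{0..1}"] seg hausdorff_measure_segment[of p q] by simp
 then have kd: "k = dist p q" using k(1) by simp
 have "(%x. w x \<tau>) \<in> borel_measurable borel"
  by (intro borel_measurable_continuous_onI smooth_continuous test_form_smooth[OF w])
 from k(3)[OF _ this, of "{0..1}"]
 have "(LINT x:closed_segment p q|hausdorff_measure 1. w x \<tau>) = k * (LINT y:{0..1}|lborel. w (p + L y) \<tau>)"
  using seg by simp
 also have "... = (LINT y:{0..1}|lborel. k * w (p + L y) \<tau>)" by simp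
 also have "(%y. k * w (p + L y) \<tau>) = (%y. w (p + y *\<^sub>R (q - p)) (%_. q - p))"
 proof
  fix y
  have cv: "covector 1 (w x)" for x using w by (rule test_form_covector)
  have "w (p + L y) \<tau> = w (p + L y) (%_. (q - p) /\<^sub>R dist p q)" using covector_1[OF cv, of _ \<tau>] \<tau> by simp
  then show "k * w (p + L y) \<tau> = w (p + y *\<^sub>R (q - p)) (%_. q - p)"
   using pq by (simp add: linear_scale[OF covector_1_linear[OF cv]] kd L_def)
 qed
 finally show ?thesis by (simp add: line_int_def)
qed

text \<open>The factor \<open>k\<close> between the integral over the set and the parametrized
  integral combines the undetermined factor of the Hausdorff measure with a determinant. Its being
  non-zero is enough, since multiplicities can be rescaled.\<close>

lemma oriented_triangle:
 fixes a b c :: "'a::euclidean_space"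
 assumes ind: "!!s t. s *\<^sub>R (b - a) + t *\<^sub>R (c - a) = 0 ==> s = 0 & t = 0"
 shows "{x - y | x y. x \<in> affine hull (convex hull {a, b, c}) & y \<in> affine hull (convex hull {a, b, c})}
   = span {b - a, c - a}"
  and "orients 2 ta (convex hull {a, b, c}) ==>
   EX k. k ~= 0 & (ALL om. test_form 2 om -->
    (LINT x:convex hull {a, b, c}|hausdorff_measure 2. om x ta) = k * tri_int om a b c)"
proof -
 define u where "u = b - a"
 define w where "w = c - a"
 have ind': "s = 0 & t = 0" if "s *\<^sub>R u + t *\<^sub>R w = 0" for s t using ind that by (simp add: u_def w_def)
 have ne: "a ~= b" "a ~= c" using ind[of 1 0] ind[of 0 1] by auto
 have "(%x. x - a) ` ({a, b, c} - {a}) = {b - a, c - a}" using ne by auto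
 then show D: "{x - y | x y. x \<in> affine hull (convex hull {a, b, c}) & y \<in> affine hull (convex hull {a, b, c})}
   = span {b - a, c - a}"
  using affine_hull_differences[of a "{a, b, c}"] by (simp add: affine_hull_convex_hull)
 assume o: "orients 2 ta (convex hull {a, b, c})"
 have im: "ta ` {..<2} = {ta 0, ta 1}" by (auto simp: less_2_cases_iff)
 have "u \<in> span {ta 0, ta 1}" "w \<in> span {ta 0, ta 1}"
  using o D unfolding orients_def im u_def w_def by (auto intro: span_base)
 then obtain u0 u1 w0 w1 where u: "u = u0 *\<^sub>R ta 0 + u1 *\<^sub>R ta 1" and w: "w = w0 *\<^sub>R ta 0 + w1 *\<^sub>R ta 1"
  by (metis in_span_doubleton)
 \<comment> \<open>The determinant of the edge vectors in the orienting basis; it could vanish only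
   for dependent edges.\<close>
 define e where "e = u0 * w1 - u1 * w0"
 have e: "e ~= 0"
 proof
  assume "e = 0"
  then have "w0 *\<^sub>R u + (- u0) *\<^sub>R w = 0" "w1 *\<^sub>R u + (- u1) *\<^sub>R w = 0"
   by (simp_all add: u w e_def algebra_simps)
  then have "u0 = 0" "u1 = 0" using ind'[of w0 "- u0"] ind'[of w1 "- u1"] by auto
  then have "u = 0" by (simp add: u)
  then show False using ind'[of 1 0] by simp
 qed
 define L where "L y = fst y *\<^sub>R u + snd y *\<^sub>R w" for y :: "real \<times> real"
 have L: "bounded_linear L" unfolding L_def
  by (intro bounded_linear_add bounded_linear_compose[OF bounded_linear_scaleR_left]
    bounded_linear_fst bounded_linear_snd)
 have lL: "linear L" using L by (rule bounded_linear.linear)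
 have "inj L" unfolding linear_injective_0[OF lL]
  using ind' by (auto simp: L_def prod_eq_iff)
 then obtain g where "linear g" "g \<circ> L = id" using linear_injective_left_inverse[OF lL] by blast
 then have g: "bounded_linear g" "!!y. g (L y) = y"
  by (auto simp: linear_conv_bounded_linear fun_eq_iff)
 obtain \<kappa> where \<kappa>: "\<kappa> > 0"
  "!!B f. B \<in> sets borel ==> f \<in> borel_measurable borel ==>
   (LINT x:(%y. a + L y) ` B|hausdorff_measure DIM(real \<times> real). f x :: real) = \<kappa> * (LINT y:B|lborel. f (a + L y))"
  using hausdorff_measure_affine_param[OF L g] by metis
 have tri: "(%y. a + L y) ` std_triangle = convex hull {a, b, c}"
  unfolding convex_hull_3_alt by (force simp: std_triangle_def L_def u_def w_def image_iff algebra_simps)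
 have st: "std_triangle \<in> sets borel" using compact_std_triangle by (simp add: borel_closed compact_imp_closed)
 show "EX k. k ~= 0 & (ALL om. test_form 2 om -->
    (LINT x:convex hull {a, b, c}|hausdorff_measure 2. om x ta) = k * tri_int om a b c)"
 proof (intro exI[of _ "\<kappa> / e"] conjI allI impI)
  show "\<kappa> / e ~= 0" using \<kappa> e by simp
  fix om :: "'a form" assume om: "test_form 2 om"
  have cv: "covector 2 (om x)" for x using om by (rule test_form_covector)
  have "(%x. om x ta) \<in> borel_measurable borel"
   by (intro borel_measurable_continuous_onI smooth_continuous test_form_smooth[OF om])
  from \<kappa>(2)[OF st this]
  have "(LINT x:convex hull {a, b, c}|hausdorff_measure 2. om x ta) = \<kappa> * (LINT y:std_triangle|lborel. om (a + L y) ta)"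
   using tri by (simp add: numeral_2_eq_2)
  note int = this
  have "om x (pair_vec u w) = e * om x ta" for x
   using covector_2[OF cv, of x] unfolding u w e_def by metis
  moreover have "(%i::nat. if i = 0 then b - a else c - a) = pair_vec u w"
   by (simp add: pair_vec_def u_def w_def)
  ultimately have "tri_int om a b c = (LINT y:std_triangle|lborel. e * om (a + L y) ta)"
   by (simp add: tri_int_def u_def[symmetric] w_def[symmetric] L_def add.assoc)
  then show "(LINT x:convex hull {a, b, c}|hausdorff_measure 2. om x ta) = \<kappa> / e * tri_int om a b c"
   using e int by simp
 qed
qed

text \<open>Gram-Schmidt applied to the two edge vectors.\<close>

lemma triangle_orients:
 fixes a b c :: "'a::euclidean_space"
 assumes ind: "!!s t. s *\<^sub>R (b - a) + t *\<^sub>R (c - a) = 0 ==> s = 0 & t = 0"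
 obtains ta where "orients 2 ta (convex hull {a, b, c})"
proof -
 define u where "u = b - a"
 define w where "w = c - a"
 have ind': "s = 0 & t = 0" if "s *\<^sub>R u + t *\<^sub>R w = 0" for s t using ind that by (simp add: u_def w_def)
 have u0: "u ~= 0" using ind'[of 1 0] by auto
 define e where "e = u /\<^sub>R norm u"
 have e: "norm e = 1" using u0 by (simp add: e_def)
 define v where "v = w - (w \<bullet> e) *\<^sub>R e"
 have v0: "v ~= 0"
 proof
  assume "v = 0"
  then have "(- ((w \<bullet> e) / norm u)) *\<^sub>R u + 1 *\<^sub>R w = 0" by (simp add: v_def e_def divide_inverse)
  from ind'[OF this] show False by simp
 qed
 define f where "f = v /\<^sub>R norm v"
 have f: "norm f = 1" using v0 by (simp add: f_def)
 have ef: "e \<bullet> f = 0" using e by (simp add: f_def v_def inner_diff_right inner_commute norm_eq_1)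
 have "span {e, f} = span {u, w}"
 proof (rule span_eq[THEN iffD2], intro conjI subsetI)
  fix x assume "x \<in> {e, f}"
  moreover have "e \<in> span {u, w}" unfolding e_def by (intro span_scale span_base) simp
  moreover from this have "f \<in> span {u, w}" unfolding f_def v_def
   by (intro span_scale span_diff) (auto intro: span_base)
  ultimately show "x \<in> span {u, w}" by auto
 next
  fix x assume "x \<in> {u, w}"
  moreover have "u = norm u *\<^sub>R e" using u0 by (simp add: e_def)
  moreover have "norm u *\<^sub>R e \<in> span {e, f}" by (intro span_scale span_base) simp
  moreover have "w = (w \<bullet> e) *\<^sub>R e + norm v *\<^sub>R f" using v0 by (simp add: f_def v_def)
  moreover have "(w \<bullet> e) *\<^sub>R e + norm v *\<^sub>R f \<in> span {e, f}" by (intro span_add span_scale span_base) simp_all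
  ultimately show "x \<in> span {e, f}" by auto
 qed
 moreover have "pair_vec e f ` {..<2} = {e, f}" by (auto simp: pair_vec_def image_iff less_2_cases_iff)
 moreover have "simple_vector_norm 2 (pair_vec e f) = 1"
  using e f ef by (simp add: simple_vector_norm_2 pair_vec_def norm_eq_1)
 moreover have "{x - y | x y. x \<in> affine hull (convex hull {a, b, c}) & y \<in> affine hull (convex hull {a, b, c})}
   = span {b - a, c - a}"
  by (rule oriented_triangle(1)) (rule ind)
 ultimately have "orients 2 (pair_vec e f) (convex hull {a, b, c})"
  unfolding orients_def by (simp only: u_def w_def)
 then show thesis by (rule that)
qed

text \<open>Triangles are parametrized, and tested for degeneracy, through their two edge vectors;
  this connects that form with affine independence of the vertices.\<close>

lemma triangle_simplex_iff:
 fixes a b c :: "'a::euclidean_space"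
 shows "(\<not> affine_dependent {a, b, c} & card {a, b, c} = 3) \<longleftrightarrow>
  (ALL s t. s *\<^sub>R (b - a) + t *\<^sub>R (c - a) = 0 --> s = 0 & t = 0)" (is "?A \<longleftrightarrow> ?B")
proof -
 have fin3: "finite {a, b, c}" by simp
 show ?thesis
 proof
 assume A: ?A
 then have d: "a ~= b" "a ~= c" "b ~= c" by (auto simp: card_insert_if split: if_splits)
 show ?B
 proof (intro allI impI)
  fix s t assume st: "s *\<^sub>R (b - a) + t *\<^sub>R (c - a) = 0"
  define U where "U x = (if x = a then - s - t else if x = b then s else t)" for x
  have U: "sum U {a, b, c} = 0" using d by (simp add: U_def)
  have "(\<Sum>v\<in>{a, b, c}. U v *\<^sub>R v) = s *\<^sub>R (b - a) + t *\<^sub>R (c - a)"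
   using d by (simp add: U_def algebra_simps)
  with st have U': "(\<Sum>v\<in>{a, b, c}. U v *\<^sub>R v) = 0" by simp
  have "\<forall>v\<in>{a, b, c}. U v = 0"
  proof (rule ccontr)
   assume "\<not> (\<forall>v\<in>{a, b, c}. U v = 0)"
   then have "\<exists>v\<in>{a, b, c}. U v ~= 0" by simp
   with U U' have "EX U. sum U {a, b, c} = 0 & (\<exists>v\<in>{a, b, c}. U v ~= 0) & (\<Sum>v\<in>{a, b, c}. U v *\<^sub>R v) = 0"
    by (intro exI[of _ U] conjI)
   then have "affine_dependent {a, b, c}" unfolding affine_dependent_explicit_finite[OF fin3] .
   then show False using A by simp
  qed
  then have "U b = 0" "U c = 0" by auto
  then show "s = 0 & t = 0" using d by (simp add: U_def)
 qed
next
 assume B: ?B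
 have d: "a ~= b" "a ~= c" using B[rule_format, of 1 0] B[rule_format, of 0 1] by auto
 have bc: "b ~= c" using B[rule_format, of 1 "-1"] by auto
 have "\<not> affine_dependent {a, b, c}"
 proof
  assume "affine_dependent {a, b, c}"
  then obtain U v where U: "sum U {a, b, c} = 0" "v \<in> {a, b, c}" "U v ~= 0" "(\<Sum>v\<in>{a, b, c}. U v *\<^sub>R v) = 0"
   unfolding affine_dependent_explicit_finite[OF fin3] by blast
  have a: "U a = - U b - U c" using U(1) d bc by simp
  have "U b *\<^sub>R (b - a) + U c *\<^sub>R (c - a) = 0"
   using U(4) d bc by (simp add: a algebra_simps)
  then have "U b = 0 & U c = 0" using B by blast
  then show False using U(2,3) a by auto
 qed
 then show ?A using d bc by simp
 qed
qed

section \<open>Integration against sums and differences of measures\<close>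

lemma nn_integral_sum_measure:
 assumes [measurable_cong]: "sets a = sets borel" "sets b = sets borel" "sets c = sets borel"
  and e: "!!A. A \<in> sets borel ==> emeasure a A + emeasure b A = emeasure c A"
  and f: "f \<in> borel_measurable borel"
 shows "(\<integral>\<^sup>+x. f x \<partial>a) + (\<integral>\<^sup>+x. f x \<partial>b) = (\<integral>\<^sup>+x. f x \<partial>c)"
 using f
proof (induction f rule: borel_measurable_induct)
 case (cong f g)
 then have "f = g" by auto
 then show ?case using cong by simp
next
 case (set A)
 then show ?case using assms(1-3) e by simp
next
 case (mult u k)
 then have [measurable]: "u \<in> borel_measurable borel" by simp
 show ?case using mult.IH by (simp add: nn_integral_cmult distrib_left[symmetric])
next
 case (add u v)
 then have [measurable]: "u \<in> borel_measurable borel" "v \<in> borel_measurable borel" by auto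
 show ?case using add.IH by (simp add: nn_integral_add ac_simps)
next
 case (seq U)
 then have [measurable]: "!!i. U i \<in> borel_measurable borel" by simp
 have inc: "incseq (%i. \<integral>\<^sup>+x. U i x \<partial>m)" for m
  using seq(3) by (auto simp: incseq_def le_fun_def intro!: nn_integral_mono)
 have mc: "(\<integral>\<^sup>+x. (SUP i. U i) x \<partial>m) = (SUP i. \<integral>\<^sup>+x. U i x \<partial>m)" if [measurable_cong]: "sets m = sets borel" for m
 proof -
  have "(SUP i. U i) x = (SUP i. U i x)" for x by (simp add: Sup_apply image_image)
  then show ?thesis using seq(3) by (simp add: nn_integral_monotone_convergence_SUP)
 qed
 show ?case unfolding mc[OF assms(1)] mc[OF assms(2)] mc[OF assms(3)]
  by (subst ennreal_SUP_add[OF inc inc, symmetric]) (simp add: seq.IH)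
qed

lemma integral_sum_measure:
 fixes f :: "'a::euclidean_space => real"
 assumes s: "sets a = sets borel" "sets b = sets borel" "sets c = sets borel"
  and e: "!!A. A \<in> sets borel ==> emeasure a A + emeasure b A = emeasure c A"
  and i: "integrable a f" "integrable b f" "integrable c f"
 shows "(\<integral>x. f x \<partial>a) + (\<integral>x. f x \<partial>b) = (\<integral>x. f x \<partial>c)"
proof -
 have [measurable]: "f \<in> borel_measurable borel"
  using i(1) by (simp add: borel_measurable_integrable measurable_cong_sets[OF s(1) refl, symmetric])
 have fin: "(\<integral>\<^sup>+x. ennreal (f x) \<partial>m) < \<infinity>" "(\<integral>\<^sup>+x. ennreal (- f x) \<partial>m) < \<infinity>" if "integrable m f" for m
  using integrableD(2)[OF that] integrableD(3)[OF that] by (auto simp: top.not_eq_extremum)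
 have "(\<integral>\<^sup>+x. ennreal (f x) \<partial>c) = (\<integral>\<^sup>+x. ennreal (f x) \<partial>a) + (\<integral>\<^sup>+x. ennreal (f x) \<partial>b)"
  "(\<integral>\<^sup>+x. ennreal (- f x) \<partial>c) = (\<integral>\<^sup>+x. ennreal (- f x) \<partial>a) + (\<integral>\<^sup>+x. ennreal (- f x) \<partial>b)"
  using nn_integral_sum_measure[OF s e, of "%x. ennreal (f x)"]
   nn_integral_sum_measure[OF s e, of "%x. ennreal (- f x)"] by simp_all
 then show ?thesis
  using fin[OF i(1)] fin[OF i(2)]
  by (simp add: real_lebesgue_integral_def[OF i(1)] real_lebesgue_integral_def[OF i(2)]
    real_lebesgue_integral_def[OF i(3)] enn2real_plus)
qed

lemma vector_measure_diff:
 assumes m: "finite_measure m1" "finite_measure m2" "sets m1 = sets borel" "sets m2 = sets borel"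
 shows "vector_measure (%A. measure m1 A - measure m2 A)"
 unfolding vector_measure_def
 using finite_measure.finite_measure_UNION[OF m(1)] finite_measure.finite_measure_UNION[OF m(2)] m(3,4)
 by (auto intro!: sums_diff)

lemma integral_split_density:
 fixes f :: "'a::euclidean_space => real"
 assumes m: "finite_measure m" "sets m = sets borel" and Y: "Y \<in> sets borel"
  and f: "continuous_on UNIV f" "!!x. \<bar>f x\<bar> <= B"
 shows "(\<integral>x. f x \<partial>density m (indicator Y)) + (\<integral>x. f x \<partial>density m (indicator (- Y))) = (\<integral>x. f x \<partial>m)"
  "finite_measure (density m (indicator Y))"
proof -
 note [measurable_cong] = m(2)
 have [measurable]: "Y \<in> sets borel" by (rule Y)
 interpret finite_measure m by (rule m)
 have ed: "emeasure (density m (indicator Z)) A = emeasure m (Z \<inter> A)" if "Z \<in> sets borel" "A \<in> sets borel" for Z A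
  using that m(2) by (simp add: emeasure_density indicator_inter_arith[symmetric] nn_integral_indicator)
 have fin: "finite_measure (density m (indicator Z))" if "Z \<in> sets borel" for Z
  by (rule finite_measureI)
    (use ed[OF that, of UNIV] sets_eq_imp_space_eq[OF m(2)] in \<open>simp add: emeasure_finite\<close>)
 show "finite_measure (density m (indicator Y))" by (rule fin[OF Y])
 show "(\<integral>x. f x \<partial>density m (indicator Y)) + (\<integral>x. f x \<partial>density m (indicator (- Y))) = (\<integral>x. f x \<partial>m)"
 proof (rule integral_sum_measure)
  fix A :: "'a set" assume A: "A \<in> sets borel"
  have "emeasure m (Y \<inter> A) + emeasure m (- Y \<inter> A) = emeasure m ((Y \<inter> A) \<union> (- Y \<inter> A))"
   using A Y m(2) by (intro plus_emeasure) auto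
  also have "(Y \<inter> A) \<union> (- Y \<inter> A) = A" by auto
  finally show "emeasure (density m (indicator Y)) A + emeasure (density m (indicator (- Y))) A = emeasure m A"
   using A Y by (simp add: ed)
 next
  have i: "integrable (density m (indicator Z)) f" if "Z \<in> sets borel" for Z
   by (rule integrable_bounded_continuous[OF fin[OF that] _ f]) (simp add: m(2))
  show "integrable (density m (indicator Y)) f" by (rule i[OF Y])
  show "integrable (density m (indicator (- Y))) f" using Y by (intro i) simp
  show "integrable m f" by (rule integrable_bounded_continuous[OF m f])
 qed (simp_all add: m(2))
qed

text \<open>Weak limits arise as differences of two finite measures that may overlap, while
  \<open>signed_integral\<close> refers to the Jordan decomposition. On a Hahn set \<open>Y\<close>
  the positive part is the difference of the restricted measures; exchanging the measures and
  passing to the complement treats the negative part.\<close>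

lemma signed_integral_diff:
 fixes f :: "'a::euclidean_space => real"
 assumes m: "finite_measure m1" "finite_measure m2" "sets m1 = sets borel" "sets m2 = sets borel"
  and f: "continuous_on UNIV f" "!!x. \<bar>f x\<bar> <= B"
 shows "signed_integral (%A. measure m1 A - measure m2 A) f = (\<integral>x. f x \<partial>m1) - (\<integral>x. f x \<partial>m2)"
proof -
 obtain Y where Y: "Y \<in> sets borel" "!!X. X \<in> sets borel ==> X \<subseteq> Y ==> emeasure m2 X <= emeasure m1 X"
  "!!X. X \<in> sets borel ==> X \<inter> Y = {} ==> emeasure m1 X <= emeasure m2 X"
  using finite_unsigned_Hahn_decomposition[OF m(1,2)] m(3,4) by auto
 have key: "(\<integral>x. f x \<partial>positive_part_measure (%A. measure m1 A - measure m2 A)) =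
   (\<integral>x. f x \<partial>density m1 (indicator Y)) - (\<integral>x. f x \<partial>density m2 (indicator Y))"
  if m: "finite_measure m1" "finite_measure m2" "sets m1 = sets borel" "sets m2 = sets borel"
   and Y: "Y \<in> sets borel" "!!X. X \<in> sets borel ==> X \<subseteq> Y ==> emeasure m2 X <= emeasure m1 X"
    "!!X. X \<in> sets borel ==> X \<inter> Y = {} ==> emeasure m1 X <= emeasure m2 X"
  for m1 m2 :: "'a measure" and Y
 proof -
  interpret m1: finite_measure m1 by (rule m)
  interpret m2: finite_measure m2 by (rule m)
  note [measurable_cong] = m(3,4)
  have [measurable]: "Y \<in> sets borel" by (rule Y)
  let ?n = "%A. measure m1 A - measure m2 A"
  have v: "vector_measure ?n" by (rule vector_measure_diff[OF m])
  have pp: "pos_part ?n A = ennreal (measure m1 (Y \<inter> A) - measure m2 (Y \<inter> A))" if A: "A \<in> sets borel" for A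
   unfolding pos_part_def
  proof (rule antisym[OF SUP_least SUP_upper])
   fix B assume "B \<in> {B \<in> sets borel. B \<subseteq> A}"
   then have B: "B \<in> sets borel" "B \<subseteq> A" by auto
   have sp: "measure m B = measure m (Y \<inter> B) + measure m (B - Y)" if "finite_measure m" "sets m = sets borel" for m
   proof -
    have "measure m ((Y \<inter> B) \<union> (B - Y)) = measure m (Y \<inter> B) + measure m (B - Y)"
     using that B Y by (intro finite_measure.finite_measure_Union) auto
    then show ?thesis by (metis Int_Diff_Un inf_commute)
   qed
   have "measure m1 (B - Y) <= measure m2 (B - Y)"
    using Y(3)[of "B - Y"] B Y(1) by (simp add: m1.emeasure_eq_measure m2.emeasure_eq_measure Diff_Int_distrib2)
   moreover have "measure m2 (Y \<inter> A - B) <= measure m1 (Y \<inter> A - B)"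
    using Y(2)[of "Y \<inter> A - B"] A B Y(1)
    by (auto simp add: m1.emeasure_eq_measure m2.emeasure_eq_measure)
   moreover have "measure m (Y \<inter> A - B) = measure m (Y \<inter> A) - measure m (Y \<inter> B)"
    if "finite_measure m" "sets m = sets borel" for m
   proof -
    have "Y \<inter> A - B = Y \<inter> A - Y \<inter> B" by auto
    then show ?thesis using that A B Y by (auto intro!: finite_measure.finite_measure_Diff)
   qed
   ultimately show "ennreal (measure m1 B - measure m2 B) <= ennreal (measure m1 (Y \<inter> A) - measure m2 (Y \<inter> A))"
    using sp m by (intro ennreal_leI) auto
  qed (use A Y in auto)
  have ed: "emeasure (density m (indicator Y)) A = emeasure m (Y \<inter> A)"
   if "A \<in> sets borel" "sets m = sets borel" for A m
   using that Y(1) by (simp add: emeasure_density indicator_inter_arith[symmetric] nn_integral_indicator)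
  \<comment> \<open>Stated as an identity between sums, because measures cannot be
    subtracted.\<close>
  have "(\<integral>x. f x \<partial>positive_part_measure ?n) + (\<integral>x. f x \<partial>density m2 (indicator Y))
    = (\<integral>x. f x \<partial>density m1 (indicator Y))"
  proof (rule integral_sum_measure)
   fix A :: "'a set" assume A: "A \<in> sets borel"
   have "measure m2 (Y \<inter> A) <= measure m1 (Y \<inter> A)"
    using Y(2)[of "Y \<inter> A"] A Y(1) by (auto simp: m1.emeasure_eq_measure m2.emeasure_eq_measure)
   then show "emeasure (positive_part_measure ?n) A + emeasure (density m2 (indicator Y)) A
     = emeasure (density m1 (indicator Y)) A"
    using A m by (simp add: emeasure_positive_part_measure[OF v A] pp[OF A] ed
      m1.emeasure_eq_measure m2.emeasure_eq_measure ennreal_plus[symmetric] del: ennreal_plus)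
  next
   show "integrable (positive_part_measure ?n) f"
    by (rule integrable_bounded_continuous[OF finite_positive_part_measure[OF v] sets_positive_part_measure f])
   show "integrable (density m2 (indicator Y)) f"
    by (rule integrable_bounded_continuous[OF integral_split_density(2)[OF m(2,4) Y(1) f] _ f]) (simp add: m)
   show "integrable (density m1 (indicator Y)) f"
    by (rule integrable_bounded_continuous[OF integral_split_density(2)[OF m(1,3) Y(1) f] _ f]) (simp add: m)
  qed (simp_all add: m sets_positive_part_measure)
  then show ?thesis by simp
 qed
 have k1: "(\<integral>x. f x \<partial>positive_part_measure (%A. measure m1 A - measure m2 A)) =
   (\<integral>x. f x \<partial>density m1 (indicator Y)) - (\<integral>x. f x \<partial>density m2 (indicator Y))"
  by (rule key[OF m Y])
 have k2: "(\<integral>x. f x \<partial>positive_part_measure (%A. measure m2 A - measure m1 A)) =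
   (\<integral>x. f x \<partial>density m2 (indicator (- Y))) - (\<integral>x. f x \<partial>density m1 (indicator (- Y)))"
 proof (rule key)
  show "emeasure m1 X <= emeasure m2 X" if "X \<in> sets borel" "X \<subseteq> - Y" for X
   using that by (intro Y(3)) auto
  show "emeasure m2 X <= emeasure m1 X" if "X \<in> sets borel" "X \<inter> - Y = {}" for X
   using that by (intro Y(2)) auto
 qed (use m Y(1) in auto)
 show ?thesis
  using k1 k2 integral_split_density(1)[OF m(1,3) Y(1) f] integral_split_density(1)[OF m(2,4) Y(1) f]
  by (simp add: signed_integral_def)
qed

section \<open>Common refinements of polyhedral chains\<close>

text \<open>The half-spaces that define the polytopes cut a large box into cells. Each cell lies on
  one side of every cutting hyperplane, so it meets each polytope in one of its own faces.
  Triangulating the complex of all faces therefore triangulates all polytopes at the same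
  time.\<close>

lemma common_triangulation:
 fixes \<Sigma> :: "'a::euclidean_space set set"
 assumes "finite \<Sigma>" "!!sg. sg \<in> \<Sigma> ==> polytope sg"
 obtains T where "simplicial_complex T" "!!sg. sg \<in> \<Sigma> ==> sg = \<Union>{t \<in> T. t \<subseteq> sg}"
proof -
 have ex: "EX F. finite F & sg = \<Inter>F & (\<forall>h\<in>F. EX a b. a ~= 0 & h = {x. a \<bullet> x <= b})" if "sg \<in> \<Sigma>" for sg
  using polytope_imp_polyhedron[OF assms(2)[OF that]] unfolding polyhedron_def .
 define F where "F sg = (SOME F. finite F & sg = \<Inter>F & (\<forall>h\<in>F. EX a b. a ~= 0 & h = {x. a \<bullet> x <= b}))" for sg :: "'a set"
 have F': "finite (F sg) & sg = \<Inter>(F sg) & (\<forall>h\<in>F sg. EX a b. a ~= 0 & h = {x. a \<bullet> x <= b})" if "sg \<in> \<Sigma>" for sg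
  unfolding F_def by (rule someI_ex[OF ex[OF that]])
 have F: "finite (F sg)" "sg = \<Inter>(F sg)" if "sg \<in> \<Sigma>" for sg
  using F'[OF that] by blast+
 define p where "p h = (SOME p. h = {x. fst p \<bullet> x <= snd p})" for h :: "'a set"
 define a where "a h = fst (p h)" for h
 define b where "b h = snd (p h)" for h
 have ab: "h = {x. a h \<bullet> x <= b h}" if s: "sg \<in> \<Sigma>" and h: "h \<in> F sg" for sg h
 proof -
  obtain a0 b0 where "h = {x. a0 \<bullet> x <= b0}" using F'[OF s] h by blast
  then have "h = {x. fst (a0, b0) \<bullet> x <= snd (a0, b0)}" by simp
  then show ?thesis unfolding a_def b_def p_def by (rule someI)
 qed
 define I where "I = (%h. (a h, b h)) ` (\<Union>sg\<in>\<Sigma>. F sg)"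
 have finI: "finite I" using F(1) assms(1) by (auto simp: I_def)
 have "bounded (\<Union>\<Sigma>)"
  using assms by (intro bounded_Union) (auto simp: polytope_imp_bounded)
 then obtain c where c: "\<Union>\<Sigma> \<subseteq> cbox (- c) c" by (rule bounded_subset_cbox_symmetric)
 let ?S = "%\<G>. \<forall>X\<in>\<G>. \<forall>x\<in>X. \<forall>y\<in>X. ALL a b. (a, b) \<in> I --> a \<bullet> x <= b & a \<bullet> y <= b \<or> b <= a \<bullet> x & b <= a \<bullet> y"
 obtain \<G> where G: "\<Union>\<G> = cbox (- c) c" "finite \<G>" "\<forall>X\<in>\<G>. polytope X" "\<forall>X\<in>\<G>. \<forall>Y\<in>\<G>. X \<inter> Y face_of X"
  "?S \<G>"
 proof -
  have "EX \<G>. \<Union>\<G> = \<Union>{cbox (- c) c} & finite \<G> & (\<forall>C\<in>\<G>. EX D. D \<in> {cbox (- c) c} & C \<subseteq> D) &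
     (\<forall>C\<in>{cbox (- c) c}. \<forall>x\<in>C. EX D. D \<in> \<G> & x \<in> D & D \<subseteq> C) &
     (\<forall>X\<in>\<G>. polytope X) & (\<forall>X\<in>\<G>. aff_dim X <= int DIM('a)) &
     (\<forall>X\<in>\<G>. \<forall>Y\<in>\<G>. X \<inter> Y face_of X) &
     (?S \<G>)"
   by (rule cell_subdivision_lemma[of "{cbox (- c) c}" "int DIM('a)" I])
     (simp_all add: finI aff_dim_le_DIM polytope_interval face_of_refl)
  then obtain \<G> where "\<Union>\<G> = \<Union>{cbox (- c) c}" "finite \<G>" "\<forall>X\<in>\<G>. polytope X" "\<forall>X\<in>\<G>. \<forall>Y\<in>\<G>. X \<inter> Y face_of X"
   "?S \<G>"
   by (elim exE conjE)
  then show thesis by (intro that) simp_all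
 qed
 \<comment> \<open>All faces are included, because a polytope of lower dimension meets the cells in
   proper faces only.\<close>
 define M where "M = (\<Union>X\<in>\<G>. {f. f face_of X})"
 have finM: "finite M" using G(2,3) by (auto simp: M_def finite_polytope_faces)
 have polyM: "polytope C" if "C \<in> M" for C using that G(3) face_of_polytope_polytope by (auto simp: M_def)
 have faceM: "C \<inter> D face_of C" if CD: "C \<in> M" "D \<in> M" for C D
 proof -
  obtain X Y where XY: "X \<in> \<G>" "Y \<in> \<G>" "C face_of X" "D face_of Y" using CD by (auto simp: M_def)
  then have "X \<inter> Y face_of X" "X \<inter> Y face_of Y" using G(4) by (auto simp: Int_commute)
  then show ?thesis using face_of_Int_subface XY(3,4) by blast
 qed
 have cut: "X \<inter> sg face_of X" if X: "X \<in> \<G>" and sg: "sg \<in> \<Sigma>" for X sg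
 proof -
  have cX: "convex X" using G(3) X by (simp add: polytope_imp_convex)
  have half: "X \<inter> h face_of X" if h: "h \<in> F sg" for h
  proof -
   have hm: "x \<in> h \<longleftrightarrow> a h \<bullet> x <= b h" for x
    using arg_cong[OF ab[OF sg h], of "%S. x \<in> S"] by (simp only: mem_Collect_eq)
   show ?thesis
   proof (cases "\<forall>x\<in>X. a h \<bullet> x <= b h")
   case True
   then have "X \<inter> h = X" using hm by auto
   then show ?thesis using cX by (simp add: face_of_refl)
  next
   case False
   then obtain x0 where x0: "x0 \<in> X" "a h \<bullet> x0 > b h" by (auto simp: not_le)
   have "(a h, b h) \<in> I" using sg h by (auto simp: I_def)
   have ge: "a h \<bullet> y >= b h" if "y \<in> X" for y
    using G(5)[rule_format, OF X x0(1) that \<open>(a h, b h) \<in> I\<close>] x0(2) by linarith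
   have eq: "X \<inter> h = X \<inter> {x. a h \<bullet> x = b h}" using hm ge by (auto intro: antisym)
   show ?thesis unfolding eq by (rule face_of_Int_supporting_hyperplane_ge[OF cX ge])
  qed
  qed
  show ?thesis
  proof (cases "F sg = {}")
   case True
   then have "sg = UNIV" using F(2)[OF sg] by simp
   then show ?thesis using cX by (simp add: face_of_refl)
  next
   case False
   have "X \<inter> sg = \<Inter>((%h. X \<inter> h) ` F sg)" using F(2)[OF sg] False by auto
   moreover have "\<Inter>((%h. X \<inter> h) ` F sg) face_of X"
    by (rule face_of_Inter) (use False half in auto)
   ultimately show ?thesis by simp
  qed
 qed
 obtain T where T: "simplicial_complex T" "!!C. C \<in> M ==> EX F. finite F & F \<subseteq> T & C = \<Union>F"
  using simplicial_subdivision_of_cell_complex[OF finM polyM faceM] by metis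
 show thesis
 proof (rule that[OF T(1)])
  fix sg assume sg: "sg \<in> \<Sigma>"
  show "sg = \<Union>{t \<in> T. t \<subseteq> sg}"
  proof (intro subset_antisym subsetI)
   fix x assume x: "x \<in> sg"
   then have "x \<in> \<Union>\<G>" using c sg G(1) by blast
   then obtain X where X: "X \<in> \<G>" "x \<in> X" by blast
   have "X \<inter> sg \<in> M" using cut[OF X(1) sg] X(1) by (auto simp: M_def)
   from T(2)[OF this] obtain F' where F': "F' \<subseteq> T" "X \<inter> sg = \<Union>F'" by (elim exE conjE)
   have "x \<in> \<Union>F'" unfolding F'(2)[symmetric] using x X by simp
   then obtain t where t: "t \<in> F'" "x \<in> t" by (rule UnionE)
   have "t \<in> T" using F'(1) t(1) by (rule subsetD)
   moreover have "t \<subseteq> sg" using Union_upper[OF t(1)] unfolding F'(2)[symmetric] by simp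
   ultimately show "x \<in> \<Union>{t \<in> T. t \<subseteq> sg}" using t(2) by (intro UnionI[of t]) simp_all
  qed blast
 qed
qed

lemma affine_param_facts:
 fixes L :: "'b::euclidean_space => 'a::euclidean_space"
 assumes L: "bounded_linear L" and g: "bounded_linear g" "!!y. g (L y) = y" and B: "compact B"
 shows "emeasure (hausdorff_measure DIM('b)) ((%y. a + L y) ` B) < \<infinity>"
  and "!!X. X \<subseteq> (%y. a + L y) ` B ==> compact X ==> convex X ==> aff_dim X < int DIM('b) ==>
   emeasure (hausdorff_measure DIM('b)) X = 0"
proof -
 obtain k where k: "!!B. B \<in> sets borel ==>
   emeasure (hausdorff_measure DIM('b)) ((%y. a + L y) ` B) = ennreal k * emeasure lborel B"
  using hausdorff_measure_affine_param[OF L g] by metis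
 have "B \<in> sets borel" using B by (simp add: borel_closed compact_imp_closed)
 moreover have "emeasure lborel B < \<infinity>" using B by (intro emeasure_bounded_finite compact_imp_bounded)
 ultimately show "emeasure (hausdorff_measure DIM('b)) ((%y. a + L y) ` B) < \<infinity>"
  by (simp add: k ennreal_mult_less_top)
 show "emeasure (hausdorff_measure DIM('b)) X = 0"
  if "X \<subseteq> (%y. a + L y) ` B" "compact X" "convex X" "aff_dim X < int DIM('b)" for X
  by (rule hausdorff_measure_lowdim[OF L g, of X a]) (use that in auto)
qed

lemma triangle_param:
 fixes a b c :: "'a::euclidean_space"
 assumes ind: "!!s t. s *\<^sub>R (b - a) + t *\<^sub>R (c - a) = 0 ==> s = 0 & t = 0"
 obtains L :: "real \<times> real => 'a" and g where "bounded_linear L" "bounded_linear g" "ALL y. g (L y) = y"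
  "(%y. a + L y) ` std_triangle = convex hull {a, b, c}"
proof -
 define L where "L y = fst y *\<^sub>R (b - a) + snd y *\<^sub>R (c - a)" for y :: "real \<times> real"
 have L: "bounded_linear L" unfolding L_def
  by (intro bounded_linear_add bounded_linear_compose[OF bounded_linear_scaleR_left]
    bounded_linear_fst bounded_linear_snd)
 have lL: "linear L" using L by (rule bounded_linear.linear)
 have "inj L" unfolding linear_injective_0[OF lL]
  using ind by (auto simp: L_def prod_eq_iff)
 then obtain g where "linear g" "g \<circ> L = id" using linear_injective_left_inverse[OF lL] by blast
 then have g: "bounded_linear g" "!!y. g (L y) = y"
  by (auto simp: linear_conv_bounded_linear fun_eq_iff)
 have tri: "(%y. a + L y) ` std_triangle = convex hull {a, b, c}"
  unfolding convex_hull_3_alt by (force simp: std_triangle_def L_def image_iff algebra_simps)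
 show thesis by (rule that[OF L g(1) _ tri]) (simp add: g(2))
qed

lemma simplex_2_cases:
 assumes "2 simplex (sg :: 'a::euclidean_space set)"
 obtains a b c where "sg = convex hull {a, b, c}"
  "ALL s t. s *\<^sub>R (b - a) + t *\<^sub>R (c - a) = 0 --> s = 0 & t = 0"
proof -
 obtain C where C: "\<not> affine_dependent C" "card C = 3" "sg = convex hull C"
  using assms by (auto simp: simplex_def)
 obtain a b c where abc: "C = {a, b, c}" using C(2) by (auto simp: card_3_iff)
 then have "ALL s t. s *\<^sub>R (b - a) + t *\<^sub>R (c - a) = 0 --> s = 0 & t = 0"
  using C triangle_simplex_iff[of a b c] by simp
 then show thesis by (intro that[of a b c]) (use C abc in auto)
qed

lemma simplex_hausdorff:
 fixes sg :: "'a::euclidean_space set"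
 assumes k: "k = 1 \<or> k = 2" and sg: "int k simplex sg"
 shows "emeasure (hausdorff_measure k) sg < \<infinity>"
  and "!!X. X \<subseteq> sg ==> compact X ==> convex X ==> aff_dim X < int k ==> emeasure (hausdorff_measure k) X = 0"
proof -
 have "emeasure (hausdorff_measure k) sg < \<infinity> & (ALL X. X \<subseteq> sg --> compact X --> convex X -->
   aff_dim X < int k --> emeasure (hausdorff_measure k) X = 0)"
  using k
 proof
  assume k1: "k = 1"
  obtain C where C: "card C = 2" "sg = convex hull C" using sg k1 by (auto simp: simplex_def)
  then obtain p q where pq: "C = {p, q}" "p ~= q" by (auto simp: card_2_iff)
  have seg: "sg = (%s. p + s *\<^sub>R (q - p)) ` {0..1}"
   unfolding C pq segment_convex_hull[symmetric] closed_segment_image_interval by (auto simp: algebra_simps)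
  have g: "bounded_linear (%x. (x \<bullet> (q - p)) / ((q - p) \<bullet> (q - p)))"
   unfolding divide_inverse by (intro bounded_linear_mult_const bounded_linear_inner_left)
  have gL: "((y *\<^sub>R (q - p)) \<bullet> (q - p)) / ((q - p) \<bullet> (q - p)) = y" for y using pq(2) by simp
  note f = affine_param_facts[OF bounded_linear_scaleR_left g gL compact_Icc[of 0 1], where a = p]
  show ?thesis unfolding k1 seg using f by simp
 next
  assume k2: "k = 2"
  then have "2 simplex sg" using sg by simp
  then obtain a b c where abc: "sg = convex hull {a, b, c}"
   "ALL s t. s *\<^sub>R (b - a) + t *\<^sub>R (c - a) = 0 --> s = 0 & t = 0" by (rule simplex_2_cases)
  obtain L :: "real \<times> real => 'a" and g where Lg: "bounded_linear L" "bounded_linear g" "ALL y. g (L y) = y"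
   "(%y. a + L y) ` std_triangle = convex hull {a, b, c}" by (rule triangle_param[OF abc(2)[rule_format]])
  note f = affine_param_facts[OF Lg(1,2) Lg(3)[rule_format] compact_std_triangle, where a = a, unfolded Lg(4) abc(1)[symmetric]]
  show ?thesis using f by (simp add: k2 numeral_2_eq_2)
 qed
 then show "emeasure (hausdorff_measure k) sg < \<infinity>"
  and "!!X. X \<subseteq> sg ==> compact X ==> convex X ==> aff_dim X < int k ==> emeasure (hausdorff_measure k) X = 0"
  by simp_all
qed

lemma orients_subset:
 fixes s :: "'a::euclidean_space set"
 assumes "orients k ta s" "int k simplex s" "int k simplex t" "t \<subseteq> s"
 shows "orients k ta t"
proof -
 have "t ~= {}" using assms(3) by auto
 have "affine hull t = affine hull s"
 proof (rule affine_dim_equal)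
  show "aff_dim (affine hull t) = aff_dim (affine hull s)"
   using assms by (simp add: aff_dim_affine_hull aff_dim_simplex)
 qed (use assms \<open>t ~= {}\<close> in \<open>auto simp: affine_affine_hull hull_mono\<close>)
 then show ?thesis using assms(1) by (simp add: orients_def)
qed

text \<open>Simplices of lower dimension and intersections of two different
  \<open>k\<close>-simplices are convex sets of dimension below \<open>k\<close> inside
  \<open>sg\<close>, hence null.\<close>

lemma simplicial_decomposition:
 fixes sg :: "'a::euclidean_space set" and f :: "'a => real"
 assumes k: "k = 1 \<or> k = 2" and sg: "int k simplex sg" and T: "simplicial_complex T" "sg = \<Union>{t \<in> T. t \<subseteq> sg}"
  and f: "continuous_on UNIV f"
 shows "(LINT x:sg|hausdorff_measure k. f x) =
   (\<Sum>t\<in>{t \<in> T. int k simplex t & t \<subseteq> sg}. LINT x:t|hausdorff_measure k. f x)"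
proof -
 let ?H = "hausdorff_measure k :: 'a measure"
 let ?K = "{t \<in> T. int k simplex t & t \<subseteq> sg}"
 have finT: "finite T" and simp_T: "!!t. t \<in> T ==> EX n. n simplex t"
  and face: "!!s t. s \<in> T ==> t \<in> T ==> s \<inter> t face_of s"
  using T(1) by (auto simp: simplicial_complex_def)
 have poly: "polytope t" if "t \<in> T" for t using simp_T[OF that] simplex_imp_polytope by blast
 have comp: "compact t" "convex t" if "t \<in> T" for t
  using poly[OF that] by (simp_all add: polytope_imp_compact polytope_imp_convex)
 have bor: "t \<in> sets ?H" if "t \<in> T" for t
  using comp[OF that] by (simp add: borel_closed compact_imp_closed)
 have csg: "compact sg" "sg \<in> sets ?H"
  using simplex_imp_polytope[OF sg] by (simp_all add: polytope_imp_compact borel_closed compact_imp_closed)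
 have fin: "emeasure ?H t < \<infinity>" if "t \<in> ?K" for t using that simplex_hausdorff(1)[OF k] by blast
 have null: "emeasure ?H X = 0" if "X \<subseteq> sg" "compact X" "convex X" "aff_dim X < int k" for X
  by (rule simplex_hausdorff(2)[OF k sg that])
 have ae: "AE x in ?H. x \<in> s & x \<in> t --> s = t" if st: "s \<in> ?K" "t \<in> ?K" for s t
 proof (cases "s = t")
  case False
  have "emeasure ?H (s \<inter> t) = 0"
  proof (rule null)
   show "aff_dim (s \<inter> t) < int k"
   \<comment> \<open>The common face is proper in at least one of the two simplices, and both have
     dimension \<open>k\<close>.\<close>
   proof (cases "s \<inter> t = s")
    case True
    then have "t \<inter> s ~= t" using False by auto
    moreover have "t \<inter> s face_of t" using face st by blast
    ultimately have "aff_dim (t \<inter> s) < aff_dim t" using comp st by (intro face_of_aff_dim_lt) auto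
    then show ?thesis using st aff_dim_simplex[of "int k" t] by (simp add: Int_commute)
   next
    case neq: False
    moreover have "s \<inter> t face_of s" using face st by blast
    ultimately have "aff_dim (s \<inter> t) < aff_dim s" using comp st by (intro face_of_aff_dim_lt) auto
    then show ?thesis using st aff_dim_simplex[of "int k" s] by simp
   qed
  qed (use st comp in \<open>auto intro!: compact_Int convex_Int\<close>)
  then have "AE x in ?H. x \<notin> s \<inter> t"
   using bor st by (intro AE_not_in) (auto simp: null_sets_def)
  then show ?thesis by (rule eventually_mono) auto
 qed simp
 have si: "set_integrable ?H t f" if t: "t \<in> ?K" for t
 proof -
  have "continuous_on t f" using f by (rule continuous_on_subset) simp
  then have "bounded (f ` t)" using comp(1) t by (intro compact_imp_bounded compact_continuous_image) auto
  then obtain B where B: "!!x. x \<in> t ==> \<bar>f x\<bar> <= B" unfolding bounded_iff real_norm_def by blast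
  show ?thesis unfolding set_integrable_def
  proof (rule integrableI_bounded_set_indicator[where B = B])
   show "t \<in> sets ?H" using bor t by blast
   show "emeasure ?H t < \<infinity>" by (rule fin[OF t])
   show "AE x in ?H. x \<in> t --> norm (f x) <= B" by (rule AE_I2) (use B in auto)
  qed (use borel_measurable_continuous_onI[OF f] in simp)
 qed
 define U where "U = \<Union>?K"
 have "(LINT x:sg|?H. f x) = (LINT x:U|?H. f x)"
  unfolding set_lebesgue_integral_def
 proof (rule integral_cong_AE)
  have "AE x in ?H. \<forall>t\<in>{t \<in> T. t \<subseteq> sg & \<not> int k simplex t}. x \<notin> t"
  proof (rule AE_finite_allI)
   fix t assume "t \<in> {t \<in> T. t \<subseteq> sg & \<not> int k simplex t}"
   then have t: "t \<in> T" "t \<subseteq> sg" "\<not> int k simplex t" by auto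
   obtain n where n: "n simplex t" using simp_T[OF t(1)] by blast
   have "aff_dim t <= aff_dim sg" using t by (simp add: aff_dim_subset)
   then have "aff_dim t < int k" using n t(3) sg by (auto simp: aff_dim_simplex less_le)
   then have "emeasure ?H t = 0" using t comp by (intro null) auto
   then show "AE x in ?H. x \<notin> t" using bor t by (intro AE_not_in) (auto simp: null_sets_def)
  qed (use finT in simp)
  then show "AE x in ?H. indicat_real sg x *\<^sub>R f x = indicat_real U x *\<^sub>R f x"
  proof (rule eventually_mono)
   fix x assume x: "\<forall>t\<in>{t \<in> T. t \<subseteq> sg & \<not> int k simplex t}. x \<notin> t"
   have "x \<in> U" if "x \<in> sg"
   proof -
    have "x \<in> \<Union>{t \<in> T. t \<subseteq> sg}" using that T(2) by blast
    then show ?thesis using x by (auto simp: U_def)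
   qed
   moreover have "x \<in> sg" if "x \<in> U" using that by (auto simp: U_def)
   ultimately have "x \<in> sg \<longleftrightarrow> x \<in> U" by blast
   then show "indicat_real sg x *\<^sub>R f x = indicat_real U x *\<^sub>R f x" by (simp add: indicator_def)
  qed
  have [measurable]: "f \<in> borel_measurable borel" by (rule borel_measurable_continuous_onI[OF f])
  have "U \<in> sets ?H" unfolding U_def by (intro sets.finite_Union) (use finT bor in auto)
  then have [measurable]: "U \<in> sets borel" "sg \<in> sets borel" using csg by simp_all
  show "(%x. indicat_real sg x *\<^sub>R f x) \<in> borel_measurable ?H"
   "(%x. indicat_real U x *\<^sub>R f x) \<in> borel_measurable ?H" by measurable
 qed
 also have "... = (\<Sum>t\<in>?K. LINT x:t|?H. f x)"
 proof -
  have U: "U = (\<Union>t\<in>?K. t)" by (simp add: U_def)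
  show ?thesis unfolding U
   by (rule set_integral_finite_UN_AE) (use finT ae bor si in simp_all)
 qed
 finally show ?thesis .
qed

lemma sum_list_map_nth: "sum_list (map f xs) = (\<Sum>i<length xs. f (xs ! i))"
 by (simp add: sum_list_sum_nth atLeast0LessThan)

lemma measure_simplicial_decomposition:
 fixes s :: "'a::euclidean_space set"
 assumes k: "k = 1 \<or> k = 2" and s: "int k simplex s" and T: "simplicial_complex T" "s = \<Union>{t \<in> T. t \<subseteq> s}"
 shows "(\<Sum>t\<in>{t \<in> T. int k simplex t & t \<subseteq> s}. emeasure (hausdorff_measure k) t) = emeasure (hausdorff_measure k) s"
proof -
 let ?H = "hausdorff_measure k :: 'a measure"
 have e: "emeasure ?H t = ennreal (measure ?H t)" if "int k simplex t" for t
  using simplex_hausdorff(1)[OF k that] by (intro emeasure_eq_ennreal_measure) simp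
 have l: "(LINT x:t|?H. 1) = measure ?H t" if "int k simplex t" for t
 proof -
  have "t \<in> sets ?H" using simplex_imp_polytope[OF that]
   by (simp add: polytope_imp_compact borel_closed compact_imp_closed)
  then show ?thesis by (simp add: set_lebesgue_integral_def)
 qed
 have "measure ?H s = (\<Sum>t\<in>{t \<in> T. int k simplex t & t \<subseteq> s}. measure ?H t)"
  using simplicial_decomposition[OF k s T continuous_on_const[of UNIV 1]] by (simp add: l s)
 then show ?thesis by (simp add: e s)
qed

text \<open>Polyhedral chains must have disjoint relative interiors, whereas the constructions
  produce overlapping simplices. Over a common triangulation the multiplicities on each small
  simplex are added with signs; evenness and subadditivity of the cost keep it from rising.\<close>

lemma refine_chain:
 fixes D :: "('a::euclidean_space, 'm::finite) chain"
 assumes k: "k = 1 \<or> k = 2"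
  and D: "!!\<sigma> \<tau> \<theta>. (\<sigma>, \<tau>, \<theta>) \<in> set D ==> int k simplex \<sigma> & orients k \<tau> \<sigma>"
 obtains P where "polyhedral_chain k P" "current_eq k (current_of_chain k D) (current_of_chain k P)"
  "ALL C. (ALL \<theta>. 0 <= C \<theta>) --> C 0 = 0 --> (ALL \<theta>. C (- \<theta>) = C \<theta>) --> (ALL h \<theta>. C (h + \<theta>) <= C h + C \<theta>) -->
   (\<Sum>(\<sigma>, \<tau>, \<theta>)\<leftarrow>P. ennreal (C \<theta>) * emeasure (hausdorff_measure k) \<sigma>)
   <= (\<Sum>(\<sigma>, \<tau>, \<theta>)\<leftarrow>D. ennreal (C \<theta>) * emeasure (hausdorff_measure k) \<sigma>)"
proof -
 let ?H = "hausdorff_measure k :: 'a measure"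
 define n where "n = length D"
 define sg where "sg i = fst (D ! i)" for i
 define ta where "ta i = fst (snd (D ! i))" for i
 define th where "th i = snd (snd (D ! i))" for i
 have Dn: "D ! i = (sg i, ta i, th i)" for i by (simp add: sg_def ta_def th_def)
 have Di: "int k simplex sg i" "orients k (ta i) (sg i)" if "i < n" for i
  using D[of "sg i" "ta i" "th i"] nth_mem[of i D] that by (simp_all add: Dn n_def)
 obtain T where T: "simplicial_complex T" "!!\<sigma>. \<sigma> \<in> sg ` {..<n} ==> \<sigma> = \<Union>{t \<in> T. t \<subseteq> \<sigma>}"
  by (rule common_triangulation[of "sg ` {..<n}"]) (use Di(1) simplex_imp_polytope in auto)
 have Ti: "sg i = \<Union>{t \<in> T. t \<subseteq> sg i}" if "i < n" for i by (rule T(2)) (use that in simp)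
 have finT: "finite T" using T(1) by (simp add: simplicial_complex_def)
 define K where "K i = {t \<in> T. int k simplex t & t \<subseteq> sg i}" for i
 define TT where "TT = (\<Union>i<n. K i)"
 have finTT: "finite TT" using finT by (auto simp: TT_def K_def)
 obtain ts where ts: "set ts = TT" "distinct ts" using finite_distinct_list[OF finTT] by blast
 \<comment> \<open>A small simplex may lie in several members of \<open>D\<close>. One of them is
   selected to orient it, and the sign \<open>s i t\<close> compares the others with that
   choice.\<close>
 define io where "io t = (SOME i. i < n & t \<in> K i)" for t
 have io: "io t < n" "t \<in> K (io t)" if "t \<in> TT" for t
 proof -
  have "EX i. i < n & t \<in> K i" using that by (auto simp: TT_def)
  then have "io t < n & t \<in> K (io t)" unfolding io_def by (rule someI_ex)
  then show "io t < n" "t \<in> K (io t)" by simp_all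
 qed
 have orK: "orients k (ta i) t" if "i < n" "t \<in> K i" for i t
  using orients_subset[OF Di(2)[OF that(1)] Di(1)[OF that(1)], of t] that(2) by (simp add: K_def)
 define s where "s i t = (SOME s. (s = 1 \<or> s = -1) &
   (ALL al. covector k al --> al (ta i) = s * al (ta (io t))))" for i t
 have s: "s i t = 1 \<or> s i t = -1" "covector k al ==> al (ta i) = s i t * al (ta (io t))"
  if i: "i < n" and t: "t \<in> K i" for i t al
 proof -
  have tT: "t \<in> TT" using i t by (auto simp: TT_def)
  have "\<exists>s::real. (s = 1 \<or> s = -1) & (ALL al. covector k al --> al (ta i) = s * al (ta (io t)))"
   by (rule orients_unique[OF k orK[OF io[OF tT]] orK[OF i t]]) auto
  then have *: "(s i t = 1 \<or> s i t = -1) & (ALL al. covector k al --> al (ta i) = s i t * al (ta (io t)))"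
   unfolding s_def by (rule someI_ex)
  show "s i t = 1 \<or> s i t = -1" using * by simp
  show "covector k al ==> al (ta i) = s i t * al (ta (io t))" using * by simp
 qed
 define \<theta>' where "\<theta>' t = (\<Sum>i\<in>{i\<in>{..<n}. t \<in> K i}. s i t *\<^sub>R th i)" for t
 define P where "P = map (%t. (t, ta (io t), \<theta>' t)) ts"
 have K_TT: "{t \<in> TT. t \<in> K i} = K i" if "i < n" for i using that by (auto simp: TT_def)
 have swap: "(\<Sum>t\<in>TT. \<Sum>i\<in>{i\<in>{..<n}. t \<in> K i}. g i t) = (\<Sum>i<n. \<Sum>t\<in>K i. g i t)"
  for g :: "nat => 'a set => 'c::comm_monoid_add"
 proof -
  have "(\<Sum>t\<in>TT. \<Sum>i\<in>{i\<in>{..<n}. t \<in> K i}. g i t) = (\<Sum>i<n. \<Sum>t\<in>{t \<in> TT. t \<in> K i}. g i t)"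
   by (rule sum.swap_restrict) (use finTT in auto)
  also have "... = (\<Sum>i<n. \<Sum>t\<in>K i. g i t)" by (rule sum.cong[OF refl]) (simp add: K_TT)
  finally show ?thesis .
 qed
 have sumP: "sum_list (map f P) = (\<Sum>t\<in>TT. f (t, ta (io t), \<theta>' t))" for f :: "_ => 'c::comm_monoid_add"
  unfolding P_def map_map comp_def by (simp add: sum_list_distinct_conv_sum_set[OF ts(2)] ts(1))
 have sumD: "sum_list (map f D) = (\<Sum>i<n. f (sg i, ta i, th i))" for f :: "_ => 'c::comm_monoid_add"
  unfolding sum_list_map_nth n_def Dn ..
 have pc: "polyhedral_chain k P"
  unfolding polyhedral_chain_def
 proof (intro conjI allI impI)
  show "\<forall>(\<sigma>, \<tau>, \<theta>)\<in>set P. int k simplex \<sigma> & orients k \<tau> \<sigma>"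
   using io orK ts(1) by (auto simp: P_def K_def)
  fix i j assume ij: "i < length P" "j < length P" "i ~= j"
  define t where "t = ts ! i"
  define u where "u = ts ! j"
  have tu: "t ~= u" "t \<in> TT" "u \<in> TT"
   using ij ts by (auto simp: P_def t_def u_def nth_eq_iff_index_eq simp flip: ts(1))
  have tuT: "t \<in> T" "u \<in> T" using tu(2,3) by (auto simp: TT_def K_def)
  have f: "t \<inter> u face_of t" "t \<inter> u face_of u"
   using T(1) tuT unfolding simplicial_complex_def by (simp_all, metis Int_commute)
  have "rel_interior t \<inter> rel_interior u = {}"
  proof (cases "t \<inter> u = t")
   case True
   then have "t \<inter> u ~= u" using tu(1) by auto
   then have "(t \<inter> u) \<inter> rel_interior u = {}" by (rule face_of_disjoint_rel_interior[OF f(2)])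
   then show ?thesis using rel_interior_subset[of t] True by auto
  next
   case False
   then have "(t \<inter> u) \<inter> rel_interior t = {}" by (rule face_of_disjoint_rel_interior[OF f(1)])
   then show ?thesis using rel_interior_subset[of u] rel_interior_subset[of t] by auto
  qed
  then show "rel_interior (fst (P ! i)) \<inter> rel_interior (fst (P ! j)) = {}"
   using ij by (simp add: P_def t_def u_def)
 qed
 have ce: "current_eq k (current_of_chain k D) (current_of_chain k P)"
  unfolding current_eq_def
 proof (intro allI impI)
  fix j and w :: "'a form" assume w: "test_form k w"
  have c: "continuous_on UNIV (%x. w x \<tau>)" for \<tau> by (intro smooth_continuous test_form_smooth[OF w])
  have "current_of_chain k P j w = (\<Sum>t\<in>TT. \<theta>' t $ j * (LINT x:t|?H. w x (ta (io t))))"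
   by (simp add: current_of_chain_def sumP)
  also have "... = (\<Sum>t\<in>TT. \<Sum>i\<in>{i\<in>{..<n}. t \<in> K i}. th i $ j * (LINT x:t|?H. w x (ta i)))"
  proof (rule sum.cong[OF refl])
   fix t assume "t \<in> TT"
   have "\<theta>' t $ j * (LINT x:t|?H. w x (ta (io t)))
     = (\<Sum>i\<in>{i\<in>{..<n}. t \<in> K i}. (s i t * th i $ j) * (LINT x:t|?H. w x (ta (io t))))"
    by (simp add: \<theta>'_def sum_distrib_right)
   also have "... = (\<Sum>i\<in>{i\<in>{..<n}. t \<in> K i}. th i $ j * (LINT x:t|?H. w x (ta i)))"
   proof (rule sum.cong[OF refl])
    fix i assume "i \<in> {i\<in>{..<n}. t \<in> K i}"
    then have "w x (ta i) = s i t * w x (ta (io t))" for x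
     using s(2)[of i t "w x"] test_form_covector[OF w] by simp
    then show "(s i t * th i $ j) * (LINT x:t|?H. w x (ta (io t))) = th i $ j * (LINT x:t|?H. w x (ta i))"
     by simp
   qed
   finally show "\<theta>' t $ j * (LINT x:t|?H. w x (ta (io t)))
     = (\<Sum>i\<in>{i\<in>{..<n}. t \<in> K i}. th i $ j * (LINT x:t|?H. w x (ta i)))" .
  qed
  also have "... = (\<Sum>i<n. \<Sum>t\<in>K i. th i $ j * (LINT x:t|?H. w x (ta i)))" by (rule swap)
  also have "... = (\<Sum>i<n. th i $ j * (LINT x:sg i|?H. w x (ta i)))"
   by (rule sum.cong[OF refl])
     (simp add: simplicial_decomposition[OF k Di(1) T(1) Ti c] K_def sum_distrib_left)
  also have "... = current_of_chain k D j w"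
   by (simp add: current_of_chain_def sumD)
  finally show "current_of_chain k D j w = current_of_chain k P j w" ..
 qed
 have en: "(\<Sum>(\<sigma>, \<tau>, \<theta>)\<leftarrow>P. ennreal (C \<theta>) * emeasure ?H \<sigma>) <= (\<Sum>(\<sigma>, \<tau>, \<theta>)\<leftarrow>D. ennreal (C \<theta>) * emeasure ?H \<sigma>)"
  if C: "ALL \<theta>. 0 <= C \<theta>" "C 0 = 0" "ALL \<theta>. C (- \<theta>) = C \<theta>" "ALL h \<theta>. C (h + \<theta>) <= C h + C \<theta>" for C
 proof -
  have Csum: "C (\<Sum>i\<in>I. f i) <= (\<Sum>i\<in>I. C (f i))" if "finite I" for I :: "nat set" and f
   using that
  proof (induction I)
   case (insert i I)
   then show ?case using C(4)[rule_format, of "f i" "sum f I"] by simp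
  qed (simp add: C)
  have "(\<Sum>(\<sigma>, \<tau>, \<theta>)\<leftarrow>P. ennreal (C \<theta>) * emeasure ?H \<sigma>) = (\<Sum>t\<in>TT. ennreal (C (\<theta>' t)) * emeasure ?H t)"
   by (simp add: sumP)
  also have "... <= (\<Sum>t\<in>TT. \<Sum>i\<in>{i\<in>{..<n}. t \<in> K i}. ennreal (C (th i)) * emeasure ?H t)"
  proof (rule sum_mono)
   fix t assume t: "t \<in> TT"
   have "C (\<theta>' t) <= (\<Sum>i\<in>{i\<in>{..<n}. t \<in> K i}. C (s i t *\<^sub>R th i))"
    unfolding \<theta>'_def by (rule Csum) simp
   also have "... = (\<Sum>i\<in>{i\<in>{..<n}. t \<in> K i}. C (th i))"
   proof (rule sum.cong[OF refl])
    fix i assume "i \<in> {i\<in>{..<n}. t \<in> K i}"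
    then have "s i t = 1 \<or> s i t = -1" using s(1)[of i t] by simp
    then show "C (s i t *\<^sub>R th i) = C (th i)" using C(3) by auto
   qed
   finally have "ennreal (C (\<theta>' t)) <= ennreal (\<Sum>i\<in>{i\<in>{..<n}. t \<in> K i}. C (th i))" by (rule ennreal_leI)
   also have "... = (\<Sum>i\<in>{i\<in>{..<n}. t \<in> K i}. ennreal (C (th i)))" by (rule sum_ennreal[symmetric]) (simp add: C)
   finally have "ennreal (C (\<theta>' t)) * emeasure ?H t <= (\<Sum>i\<in>{i\<in>{..<n}. t \<in> K i}. ennreal (C (th i))) * emeasure ?H t"
    by (rule mult_right_mono) simp
   then show "ennreal (C (\<theta>' t)) * emeasure ?H t <= (\<Sum>i\<in>{i\<in>{..<n}. t \<in> K i}. ennreal (C (th i)) * emeasure ?H t)"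
    by (simp add: sum_distrib_right)
  qed
  also have "... = (\<Sum>i<n. \<Sum>t\<in>K i. ennreal (C (th i)) * emeasure ?H t)" by (rule swap)
  also have "... = (\<Sum>i<n. ennreal (C (th i)) * emeasure ?H (sg i))"
  proof (rule sum.cong[OF refl])
   fix i assume "i \<in> {..<n}"
   then have i: "i < n" by simp
   show "(\<Sum>t\<in>K i. ennreal (C (th i)) * emeasure ?H t) = ennreal (C (th i)) * emeasure ?H (sg i)"
    unfolding sum_distrib_left[symmetric] K_def
    by (simp only: measure_simplicial_decomposition[OF k Di(1)[OF i] T(1) Ti[OF i]])
  qed
  also have "... = (\<Sum>(\<sigma>, \<tau>, \<theta>)\<leftarrow>D. ennreal (C \<theta>) * emeasure ?H \<sigma>)" by (simp add: sumD)
  finally show ?thesis .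
 qed
 show thesis by (rule that[OF pc ce]) (intro allI impI, rule en)
qed

text \<open>The working form of chains: lists of segments that may overlap, cross or degenerate,
  added by concatenation. They are refined only where a polyhedral chain is required.\<close>

definition cl1 :: "('a::euclidean_space \<times> 'a \<times> (real^'m::finite)) list => ('a, 'm) current" where
 "cl1 L = (%j w. \<Sum>(p, q, t)\<leftarrow>L. t $ j * line_int w p q)"

definition cl2 :: "('a::euclidean_space \<times> 'a \<times> 'a \<times> (real^'m::finite)) list => ('a, 'm) current" where
 "cl2 L = (%j w. \<Sum>(p, q, r, t)\<leftarrow>L. t $ j * tri_int w p q r)"

lemma line_int_refl [simp]:
 assumes "test_form 1 w" shows "line_int w p p = 0"
proof -
 have "w x (%_. 0) = 0" for x
  using linear_0[OF covector_1_linear[OF test_form_covector[OF assms]]] .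
 then show ?thesis by (simp add: line_int_def)
qed

lemma tri_int_degenerate:
 assumes om: "test_form 2 om" and st: "s *\<^sub>R (q - p) + t *\<^sub>R (r - p) = 0" "s ~= 0 \<or> t ~= 0"
 shows "tri_int om p q r = 0"
proof -
 define u where "u = q - p"
 define w where "w = r - p"
 have cv: "covector 2 (om x)" for x using om by (rule test_form_covector)
 have "om x (pair_vec u w) = 0" for x
 proof (cases "s = 0")
  case False
  have "u = (- t / s) *\<^sub>R w"
  proof -
   have "s *\<^sub>R u = - (t *\<^sub>R w)" using st(1) by (simp add: u_def w_def eq_neg_iff_add_eq_0)
   then have "inverse s *\<^sub>R (s *\<^sub>R u) = inverse s *\<^sub>R (- (t *\<^sub>R w))" by simp
   then show ?thesis using False by (simp add: divide_inverse mult.commute)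
  qed
  then show ?thesis using covector_2(2)[OF cv, of x "- t / s" w 0 w 1 0] by simp
 next
  case True
  then have "w = 0" using st by (simp add: w_def)
  then show ?thesis using covector_2(2)[OF cv, of x 1 u 0 u 0 0] by simp
 qed
 moreover have "(%i::nat. if i = 0 then q - p else r - p) = pair_vec u w"
  by (simp add: pair_vec_def u_def w_def)
 ultimately show ?thesis by (simp add: tri_int_def)
qed

abbreviation list_cost :: "(real^'m => real) => ('a::metric_space \<times> 'a \<times> (real^'m)) list => ennreal" where
 "list_cost C L \<equiv> \<Sum>(p, q, th)\<leftarrow>L. ennreal (C th * dist p q)"

text \<open>Degenerate edges are dropped first, as no simplex represents them and their integrals
  vanish. The energy estimate is an inequality because overlapping edges get merged.\<close>

lemma cl1_polyhedral:
 fixes L :: "('a::euclidean_space \<times> 'a \<times> (real^'m::finite)) list"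
 obtains P where "polyhedral_chain 1 P" "current_eq 1 (cl1 L) (current_of_chain 1 P)"
  "ALL C. multi_material_cost C --> discrete_energy C P <= (list_cost C L)"
proof -
 define L' where "L' = filter (%(p, q, t). p ~= q) L"
 define D where "D = map (%(p, q, t). (closed_segment p q, %_::nat. (q - p) /\<^sub>R dist p q, t)) L'"
 have D: "int 1 simplex s & orients 1 ta s" if "(s, ta, t) \<in> set D" for s ta t
  using that segment_simplex segment_orients by (auto simp: D_def L'_def)
 obtain P where P: "polyhedral_chain 1 P" "current_eq 1 (current_of_chain 1 D) (current_of_chain 1 P)"
  "ALL C. (ALL t. 0 <= C t) --> C 0 = 0 --> (ALL t. C (- t) = C t) --> (ALL h t. C (h + t) <= C h + C t) -->
   (\<Sum>(s, ta, t)\<leftarrow>P. ennreal (C t) * emeasure (hausdorff_measure 1) s)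
   <= (\<Sum>(s, ta, t)\<leftarrow>D. ennreal (C t) * emeasure (hausdorff_measure 1) s)"
  by (rule refine_chain[of 1 D]) (use D in simp_all)
 show thesis
 proof (rule that[OF P(1)])
  have "cl1 L j w = current_of_chain 1 D j w" if w: "test_form 1 w" for j w
  proof -
   have lz: "line_int w p p = 0" for p by (rule line_int_refl[OF w])
   have "(\<Sum>(p, q, t)\<leftarrow>L. t $ j * line_int w p q) = (\<Sum>(p, q, t)\<leftarrow>L'. t $ j * line_int w p q)"
    unfolding L'_def by (induction L) (auto simp: lz)
   also have "... = current_of_chain 1 D j w"
    unfolding current_of_chain_def D_def map_map comp_def
   proof (rule arg_cong[of _ _ sum_list], rule map_cong[OF refl])
    fix e assume "e \<in> set L'"
    then obtain p q t where e: "e = (p, q, t)" "p ~= q" by (auto simp: L'_def)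
    then show "(case e of (p, q, t) => t $ j * line_int w p q) =
     (case case e of (p, q, t) => (closed_segment p q, %_::nat. (q - p) /\<^sub>R dist p q, t) of
      (s, ta, t) => t $ j * (LINT x:s|hausdorff_measure 1. w x ta))"
     using segment_integral[OF e(2) refl w] by simp
   qed
   finally show ?thesis by (simp add: cl1_def)
  qed
  then show "current_eq 1 (cl1 L) (current_of_chain 1 P)" using P(2) by (simp add: current_eq_def)
  show "ALL C. multi_material_cost C --> discrete_energy C P <= (list_cost C L)"
  proof (intro allI impI)
   fix C :: "real^'m => real" assume C: "multi_material_cost C"
   have "discrete_energy C P <= (\<Sum>(s, ta, t)\<leftarrow>D. ennreal (C t) * emeasure (hausdorff_measure 1) s)"
    unfolding discrete_energy_def using P(3) C by (simp add: multi_material_cost_def)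
   also have "... = (list_cost C L')"
    unfolding D_def map_map comp_def
    by (rule arg_cong[of _ _ sum_list], rule map_cong[OF refl])
      (use C in \<open>auto simp: hausdorff_measure_segment[unfolded One_nat_def] ennreal_mult multi_material_cost_def\<close>)
   also have "... <= (list_cost C L)"
    unfolding L'_def by (induction L) (auto intro!: add_left_mono add_increasing)
   finally show "discrete_energy C P <= (list_cost C L)" .
  qed
 qed
qed

lemma cl2_polyhedral:
 fixes L :: "('a::euclidean_space \<times> 'a \<times> 'a \<times> (real^'m::finite)) list"
 shows "polyhedral_current 2 (cl2 L)"
proof -
 have ex: "EX D. (\<forall>(sg, ta, th)\<in>set D. int 2 simplex sg & orients 2 ta sg) &
   (ALL j w. test_form 2 w --> cl2 L j w = current_of_chain 2 D j w)"
 proof (induction L)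
  case Nil
  show ?case by (rule exI[of _ "[]"]) (simp add: cl2_def current_of_chain_def)
 next
  case (Cons e L)
  then obtain D where D: "\<forall>(sg, ta, th)\<in>set D. int 2 simplex sg & orients 2 ta sg"
   "ALL j w. test_form 2 w --> cl2 L j w = current_of_chain 2 D j w" by (elim exE conjE)
  obtain p q r th where e: "e = (p, q, r, th)" by (metis prod_cases4)
  have cons: "cl2 (e # L) j w = th $ j * tri_int w p q r + cl2 L j w" for j w by (simp add: cl2_def e)
  show ?case
  proof (cases "ALL s t. s *\<^sub>R (q - p) + t *\<^sub>R (r - p) = 0 --> s = 0 & t = 0")
   case False
   then obtain s t where "s *\<^sub>R (q - p) + t *\<^sub>R (r - p) = 0" "s ~= 0 \<or> t ~= 0" by auto
   then have "tri_int w p q r = 0" if "test_form 2 w" for w using tri_int_degenerate[OF that] by simp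
   then show ?thesis using D cons by (intro exI[of _ D]) simp
  next
   case True
   obtain ta where ta: "orients 2 ta (convex hull {p, q, r})"
    by (rule triangle_orients[OF True[rule_format]])
   have "EX c. c ~= 0 & (ALL w. test_form 2 w -->
     (LINT x:convex hull {p, q, r}|hausdorff_measure 2. w x ta) = c * tri_int w p q r)"
    by (rule oriented_triangle(2)[OF _ ta]) (rule True[rule_format])
   then obtain c where c: "c ~= 0" "ALL w. test_form 2 w -->
     (LINT x:convex hull {p, q, r}|hausdorff_measure 2. w x ta) = c * tri_int w p q r"
    by (elim exE conjE)
   have sx: "2 simplex (convex hull {p, q, r})"
    using True triangle_simplex_iff[of p q r] unfolding simplex_def by (intro exI[of _ "{p, q, r}"]) simp
   show ?thesis
   \<comment> \<open>Dividing the multiplicity by \<open>c\<close> undoes the factor between the two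
     kinds of integral.\<close>
   proof (intro exI[of _ "(convex hull {p, q, r}, ta, (1 / c) *\<^sub>R th) # D"] conjI allI impI)
    show "\<forall>(sg, ta, th)\<in>set ((convex hull {p, q, r}, ta, (1 / c) *\<^sub>R th) # D). int 2 simplex sg & orients 2 ta sg"
     using D(1) sx ta by simp
    fix j w assume "test_form 2 (w :: 'a form)"
    then show "cl2 (e # L) j w = current_of_chain 2 ((convex hull {p, q, r}, ta, (1 / c) *\<^sub>R th) # D) j w"
     using D(2) c by (simp add: cons current_of_chain_def)
   qed
  qed
 qed
 then obtain D where D: "\<forall>(sg, ta, th)\<in>set D. int 2 simplex sg & orients 2 ta sg"
   "ALL j w. test_form 2 w --> cl2 L j w = current_of_chain 2 D j w" by (elim exE conjE)
 obtain P where P: "polyhedral_chain 2 P" "current_eq 2 (current_of_chain 2 D) (current_of_chain 2 P)"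
  by (rule refine_chain[of 2 D]) (use D(1) in auto)
 show ?thesis unfolding polyhedral_current_def
  by (rule exI[of _ P]) (use P D(2) in \<open>simp add: current_eq_def\<close>)
qed

text \<open>The passage in the other direction; each simplex yields one edge, so the cost is
  preserved exactly.\<close>

lemma chain_to_list:
 fixes P :: "('a::euclidean_space, 'm::finite) chain"
 assumes "polyhedral_chain 1 P"
 obtains L where "current_eq 1 (current_of_chain 1 P) (cl1 L)"
  "ALL C. (ALL t. 0 <= C t) --> discrete_energy C P = (list_cost C L)"
proof -
 let ?Q = "%P L. current_eq 1 (current_of_chain 1 P) (cl1 L) &
  (ALL C. (ALL t. 0 <= C t) --> discrete_energy C P = (list_cost C L))"
 have "\<forall>(s, \<tau>, t)\<in>set P. int 1 simplex s & orients 1 \<tau> s"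
  using assms by (simp add: polyhedral_chain_def)
 then have "EX L. ?Q P L"
 proof (induction P)
  case Nil
  show ?case by (rule exI[of _ "[]"]) (simp add: current_eq_def cl1_def current_of_chain_def discrete_energy_def)
 next
  case (Cons e P)
  then obtain L where L: "?Q P L" by auto
  obtain s \<tau> t where e: "e = (s, \<tau>, t)" by (metis prod_cases3)
  have "1 simplex s" "orients 1 \<tau> s" using Cons.prems by (simp_all add: e)
  then obtain p q where pq: "p ~= q" "s = closed_segment p q" "\<tau> 0 = (q - p) /\<^sub>R dist p q"
   by (rule oriented_segment)
  show ?case
  proof (intro exI[of _ "(p, q, t) # L"] conjI allI impI)
   show "current_eq 1 (current_of_chain 1 (e # P)) (cl1 ((p, q, t) # L))"
    using L[THEN conjunct1] segment_integral[where \<tau> = \<tau>, OF pq(1) pq(3)] by (simp add: current_eq_def current_of_chain_def cl1_def e pq(2))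
   fix C :: "real^'m => real" assume "ALL t. 0 <= C t"
   then show "discrete_energy C (e # P) = (list_cost C ((p, q, t) # L))"
    using L[THEN conjunct2] by (simp add: discrete_energy_def e pq(2) hausdorff_measure_segment[unfolded One_nat_def] ennreal_mult)
  qed
 qed
 then obtain L where "?Q P L" by (rule exE)
 then show thesis by (elim conjE) (rule that)
qed

section \<open>Mass and flat norm of list chains\<close>

text \<open>A polyhedral current is prescribed on test forms only. Linearity therefore has to be
  read off from a chain, and the combination itself must be a test form.\<close>

lemma current_of_chain_linear:
 assumes c: "polyhedral_current k R" and k: "k = 1 \<or> k = 2"
  and w: "finite I" "!!i. i \<in> I ==> test_form k (w i)" "test_form k (%x v. \<Sum>i\<in>I. a i * w i x v)"
 shows "R j (%x v. \<Sum>i\<in>I. a i * w i x v) = (\<Sum>i\<in>I. a i * R j (w i))"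
proof -
 obtain P where P: "polyhedral_chain k P" "current_eq k R (current_of_chain k P)"
  using c by (auto simp: polyhedral_current_def)
 have lin: "(LINT x:sg|hausdorff_measure k. \<Sum>i\<in>I. a i * w i x t) = (\<Sum>i\<in>I. a i * (LINT x:sg|hausdorff_measure k. w i x t))"
  if s: "int k simplex sg" for sg t
 proof -
  have csg: "compact sg" "sg \<in> sets borel" using simplex_imp_polytope[OF s]
   by (simp_all add: polytope_imp_compact borel_closed compact_imp_closed)
  have si: "set_integrable (hausdorff_measure k) sg (%x. a i * w i x t)" if i: "i \<in> I" for i
  proof -
   have f: "continuous_on UNIV (%x. a i * w i x t)"
    by (intro continuous_on_mult continuous_on_const smooth_continuous test_form_smooth[OF w(2)[OF i]])
   then have "continuous_on sg (%x. a i * w i x t)" by (rule continuous_on_subset) simp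
   then have "bounded ((%x. a i * w i x t) ` sg)" using csg by (intro compact_imp_bounded compact_continuous_image)
   then obtain B where B: "!!x. x \<in> sg ==> \<bar>a i * w i x t\<bar> <= B" unfolding bounded_iff real_norm_def by blast
   show ?thesis unfolding set_integrable_def
   proof (rule integrableI_bounded_set_indicator[where B = B])
    show "emeasure (hausdorff_measure k) sg < \<infinity>" by (rule simplex_hausdorff(1)[OF k s])
    show "AE x in hausdorff_measure k. x \<in> sg --> norm (a i * w i x t) <= B" by (rule AE_I2) (use B in auto)
   qed (use csg borel_measurable_continuous_onI[OF f] in simp_all)
  qed
  have "(LINT x:sg|hausdorff_measure k. \<Sum>i\<in>I. a i * w i x t) = (\<Sum>i\<in>I. LINT x:sg|hausdorff_measure k. a i * w i x t)"
   unfolding set_lebesgue_integral_def scaleR_sum_right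
   by (rule Bochner_Integration.integral_sum) (use si in \<open>simp add: set_integrable_def\<close>)
  then show ?thesis by simp
 qed
 have "R j (%x v. \<Sum>i\<in>I. a i * w i x v) = (\<Sum>(sg, t, th)\<leftarrow>P. th $ j * (LINT x:sg|hausdorff_measure k. \<Sum>i\<in>I. a i * w i x t))"
  using P(2) w(3) by (simp add: current_eq_def current_of_chain_def)
 also have "... = (\<Sum>(sg, t, th)\<leftarrow>P. \<Sum>i\<in>I. a i * (th $ j * (LINT x:sg|hausdorff_measure k. w i x t)))"
 proof (rule arg_cong[of _ _ sum_list], rule map_cong[OF refl])
  fix e assume e: "e \<in> set P"
  obtain sg t th where e': "e = (sg, t, th)" by (metis prod_cases3)
  have "int k simplex sg" using P(1) e by (auto simp: polyhedral_chain_def e')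
  from lin[OF this] show "(case e of (sg, t, th) => th $ j * (LINT x:sg|hausdorff_measure k. \<Sum>i\<in>I. a i * w i x t)) =
   (case e of (sg, t, th) => \<Sum>i\<in>I. a i * (th $ j * (LINT x:sg|hausdorff_measure k. w i x t)))"
   by (simp add: e' sum_distrib_left mult.left_commute)
 qed
 also have "... = (\<Sum>i\<in>I. a i * current_of_chain k P j (w i))"
  unfolding current_of_chain_def
  by (induction P) (auto simp: sum.distrib distrib_left)
 also have "... = (\<Sum>i\<in>I. a i * R j (w i))"
  using P(2) w(2) by (simp add: current_eq_def)
 finally show ?thesis .
qed

lemma set_integral_abs_le:
 fixes f :: "'b::euclidean_space => real"
 assumes f: "continuous_on UNIV f" and B: "!!x. x \<in> S ==> \<bar>f x\<bar> <= B" and S: "compact S" "measure lborel S <= 1" "0 <= B"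
 shows "\<bar>LINT x:S|lborel. f x\<bar> <= B"
proof -
 have "\<bar>LINT x:S|lborel. f x\<bar> <= (\<integral>x. \<bar>indicator S x *\<^sub>R f x\<bar> \<partial>lborel)"
  unfolding set_lebesgue_integral_def by (rule integral_abs_bound)
 also have "... <= (\<integral>x. indicator S x *\<^sub>R B \<partial>lborel)"
 proof (rule integral_mono)
  show "integrable lborel (%x. \<bar>indicator S x *\<^sub>R f x\<bar>)"
   by (intro integrable_abs borel_integrable_compact S continuous_on_subset[OF f]) simp
  show "integrable lborel (%x. indicator S x *\<^sub>R B)"
   by (intro borel_integrable_compact S continuous_on_const)
  show "\<bar>indicator S x *\<^sub>R f x\<bar> <= indicator S x *\<^sub>R B" for x using B[of x] by (simp add: indicator_def)
 qed
 also have "... = measure lborel S * B" by simp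
 also have "... <= 1 * B" by (rule mult_right_mono) (use S in auto)
 finally show ?thesis by simp
qed

lemma form_1_bound:
 fixes w :: "'m::finite => 'a::euclidean_space form"
 assumes w: "!!j. test_form 1 (w j)" and b: "!!t. simple_vector_norm 1 t <= 1 ==> norm (\<chi> j. w j x t) <= 1"
 shows "norm (\<chi> j. w j x (%_. u)) <= norm u"
proof (cases "u = 0")
 case True
 have "w j x (%_. 0) = 0" for j
  using linear_0[OF covector_1_linear[OF test_form_covector[OF w]]] .
 then show ?thesis using True by (simp add: zero_vec_def[symmetric])
next
 case False
 have "w j x (%_. u) = norm u * w j x (%_. u /\<^sub>R norm u)" for j
  using linear_scale[OF covector_1_linear[OF test_form_covector[OF w[of j]]], of x "norm u" "u /\<^sub>R norm u"] False by simp
 then have "(\<chi> j. w j x (%_. u)) = norm u *\<^sub>R (\<chi> j. w j x (%_. u /\<^sub>R norm u))" by (simp add: vec_eq_iff)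
 moreover have "norm (\<chi> j. w j x (%_. u /\<^sub>R norm u)) <= 1"
  by (rule b) (use False in \<open>simp add: simple_vector_norm_1[unfolded One_nat_def]\<close>)
 ultimately show ?thesis by (simp add: mult_left_le)
qed

text \<open>After normalization the comass bound applies, because the Gram determinant of two
  vectors of norm at most 1 is at most 1.\<close>

lemma form_2_bound:
 fixes om :: "'m::finite => 'a::euclidean_space form"
 assumes om: "!!j. test_form 2 (om j)" and b: "!!t. simple_vector_norm 2 t <= 1 ==> norm (\<chi> j. om j x t) <= 1"
 shows "norm (\<chi> j. om j x (pair_vec u w)) <= norm u * norm w"
proof -
 define e where "e = u /\<^sub>R norm u"
 define f where "f = w /\<^sub>R norm w"
 have u: "u = norm u *\<^sub>R e" unfolding e_def by (cases "u = 0") simp_all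
 have w: "w = norm w *\<^sub>R f" unfolding f_def by (cases "w = 0") simp_all
 have "om j x (pair_vec u w) = (norm u * norm w) * om j x (pair_vec e f)" for j
 proof -
  have "pair_vec u w = pair_vec (norm u *\<^sub>R e + 0 *\<^sub>R f) (0 *\<^sub>R e + norm w *\<^sub>R f)"
   unfolding scaleR_zero_left add_0_left add_0_right u[symmetric] w[symmetric] ..
  then show ?thesis
   using covector_2(2)[OF test_form_covector[OF om[of j]], of x "norm u" e 0 f 0 "norm w"] by simp
 qed
 then have eq: "(\<chi> j. om j x (pair_vec u w)) = (norm u * norm w) *\<^sub>R (\<chi> j. om j x (pair_vec e f))"
  by (simp add: vec_eq_iff)
 have ne: "norm e <= 1" "norm f <= 1" unfolding e_def f_def by (cases "u = 0"; simp) (cases "w = 0"; simp)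
 have "(e \<bullet> e) * (f \<bullet> f) <= 1"
  using mult_mono[OF power_le_one[OF norm_ge_zero ne(1), of 2] power_le_one[OF norm_ge_zero ne(2), of 2]]
  by (simp add: power2_norm_eq_inner)
 then have "(e \<bullet> e) * (f \<bullet> f) - (e \<bullet> f)\<^sup>2 <= 1" using zero_le_power2[of "e \<bullet> f"] by linarith
 then have "simple_vector_norm 2 (pair_vec e f) <= 1"
  unfolding simple_vector_norm_2 by (simp add: pair_vec_def)
 then have "norm (\<chi> j. om j x (pair_vec e f)) <= 1" by (rule b)
 then have "(norm u * norm w) * norm (\<chi> j. om j x (pair_vec e f)) <= (norm u * norm w) * 1"
  by (intro mult_left_mono) simp_all
 then show ?thesis by (simp add: eq abs_mult)
qed

lemma sum_vec_inner: "(\<Sum>j\<in>UNIV. t $ j * f j) = (t :: real^'m) \<bullet> (\<chi> j. f j)"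
 by (simp add: inner_vec_def)

lemma abs_sum_list_le: "(!!x. x \<in> set xs ==> \<bar>f x\<bar> <= g x) ==> \<bar>sum_list (map f xs)\<bar> <= (sum_list (map g xs) :: real)"
 by (induction xs) (auto intro: order_trans[OF abs_triangle_ineq] add_mono)

lemma measure_std_triangle: "measure lborel std_triangle <= 1"
proof -
 have "std_triangle \<subseteq> cbox (0, 0) (1, 1)" by (auto simp: std_triangle_def cbox_Pair_eq)
 moreover have "std_triangle \<in> sets lborel" using compact_std_triangle
  by (simp add: borel_closed compact_imp_closed)
 ultimately have "measure lborel std_triangle <= measure lborel (cbox (0::real, 0::real) (1, 1))"
  by (intro measure_mono_fmeasurable) simp_all
 also have "... = 1" by (simp add: content_Pair)
 finally show ?thesis .
qed

definition len :: "('a::real_normed_vector \<times> 'a \<times> 'w::real_normed_vector) list => real" where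
 "len L = (\<Sum>(p, q, t)\<leftarrow>L. norm t * norm (q - p))"

text \<open>The product of two edge lengths, an upper bound for the area that is easier to
  estimate.\<close>

definition area :: "('a::real_normed_vector \<times> 'a \<times> 'a \<times> 'w::real_normed_vector) list => real" where
 "area L = (\<Sum>(p, q, r, t)\<leftarrow>L. norm t * (norm (q - p) * norm (r - p)))"

lemma form_integral_bound:
 fixes w :: "'m::finite => 'a::euclidean_space form" and A :: "'b::euclidean_space => 'a" and t :: "real^'m"
 assumes w: "!!j. test_form k (w j)" and A: "continuous_on UNIV A" and S: "compact S" "measure lborel S <= 1"
  and b: "!!x. norm (\<chi> j. w j x v) <= K" and K: "0 <= K"
 shows "\<bar>\<Sum>j\<in>UNIV. t $ j * (LINT y:S|lborel. w j (A y) v)\<bar> <= norm t * K"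
proof -
 have c: "continuous_on UNIV (%y. w j (A y) v)" for j
  by (rule continuous_on_compose2[OF smooth_continuous[OF test_form_smooth[OF w], where A = UNIV] A]) simp
 have "(LINT y:S|lborel. \<Sum>j\<in>UNIV. t $ j * w j (A y) v) = (\<Sum>j\<in>UNIV. LINT y:S|lborel. t $ j * w j (A y) v)"
  unfolding set_lebesgue_integral_def scaleR_sum_right
  by (rule Bochner_Integration.integral_sum)
    (intro borel_integrable_compact S continuous_on_mult continuous_on_const continuous_on_subset[OF c] subset_UNIV)
 moreover have "\<bar>LINT y:S|lborel. \<Sum>j\<in>UNIV. t $ j * w j (A y) v\<bar> <= norm t * K"
 proof (rule set_integral_abs_le[OF _ _ S])
  show "continuous_on UNIV (%y. \<Sum>j\<in>UNIV. t $ j * w j (A y) v)"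
   by (intro continuous_on_sum continuous_on_mult continuous_on_const c)
  show "\<bar>\<Sum>j\<in>UNIV. t $ j * w j (A y) v\<bar> <= norm t * K" for y
   unfolding sum_vec_inner by (rule order_trans[OF Cauchy_Schwarz_ineq2 mult_left_mono[OF b norm_ge_zero]])
 qed (use K in simp)
 ultimately show ?thesis by simp
qed

lemma mass_cl1_le:
 fixes L :: "('a::euclidean_space \<times> 'a \<times> (real^'m::finite)) list"
 shows "mass 1 (cl1 L) <= ennreal (len L)"
 unfolding mass_def
proof (rule SUP_least)
 fix w :: "'m => 'a form"
 assume "w \<in> {w. (ALL j. test_form 1 (w j)) & (ALL x ta. simple_vector_norm 1 ta <= 1 --> norm (\<chi> j. w j x ta) <= 1)}"
 then have w: "!!j. test_form 1 (w j)" and b: "!!x ta. simple_vector_norm 1 ta <= 1 ==> norm (\<chi> j. w j x ta) <= 1"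
  by simp_all
 have edge: "\<bar>\<Sum>j\<in>UNIV. t $ j * line_int (w j) p q\<bar> <= norm t * norm (q - p)" for p q and t :: "real^'m"
  unfolding line_int_def
 proof (rule form_integral_bound[OF w])
  show "continuous_on UNIV (%s. p + s *\<^sub>R (q - p))" by (intro continuous_intros)
  show "norm (\<chi> j. w j x (%_. q - p)) <= norm (q - p)" for x by (rule form_1_bound[OF w b])
 qed simp_all
 have "(\<Sum>j\<in>UNIV. cl1 L j (w j)) = (\<Sum>(p, q, t)\<leftarrow>L. \<Sum>j\<in>UNIV. t $ j * line_int (w j) p q)"
  unfolding cl1_def by (induction L) (auto simp: sum.distrib)
 also have "\<bar>...\<bar> <= len L"
  unfolding len_def by (rule abs_sum_list_le) (use edge in auto)
 finally show "ennreal \<bar>\<Sum>j\<in>UNIV. cl1 L j (w j)\<bar> <= ennreal (len L)" by (rule ennreal_leI)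
qed

lemma mass_cl2_le:
 fixes L :: "('a::euclidean_space \<times> 'a \<times> 'a \<times> (real^'m::finite)) list"
 shows "mass 2 (cl2 L) <= ennreal (area L)"
 unfolding mass_def
proof (rule SUP_least)
 fix w :: "'m => 'a form"
 assume "w \<in> {w. (ALL j. test_form 2 (w j)) & (ALL x ta. simple_vector_norm 2 ta <= 1 --> norm (\<chi> j. w j x ta) <= 1)}"
 then have w: "!!j. test_form 2 (w j)" and b: "!!x ta. simple_vector_norm 2 ta <= 1 ==> norm (\<chi> j. w j x ta) <= 1"
  by simp_all
 have tri: "\<bar>\<Sum>j\<in>UNIV. t $ j * tri_int (w j) p q r\<bar> <= norm t * (norm (q - p) * norm (r - p))" for p q r and t :: "real^'m"
  unfolding tri_int_def
 proof (rule form_integral_bound[OF w])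
  show "continuous_on UNIV (%y. p + fst y *\<^sub>R (q - p) + snd y *\<^sub>R (r - p))" by (intro continuous_intros)
  show "norm (\<chi> j. w j x (%i. if i = 0 then q - p else r - p)) <= norm (q - p) * norm (r - p)" for x
   using form_2_bound[OF w b, of x "q - p" "r - p"] by (simp add: pair_vec_def)
 qed (simp_all add: compact_std_triangle measure_std_triangle)
 have "(\<Sum>j\<in>UNIV. cl2 L j (w j)) = (\<Sum>(p, q, r, t)\<leftarrow>L. \<Sum>j\<in>UNIV. t $ j * tri_int (w j) p q r)"
  unfolding cl2_def by (induction L) (auto simp: sum.distrib)
 also have "\<bar>...\<bar> <= area L"
  unfolding area_def by (rule abs_sum_list_le) (use tri in auto)
 finally show "ennreal \<bar>\<Sum>j\<in>UNIV. cl2 L j (w j)\<bar> <= ennreal (area L)" by (rule ennreal_leI)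
qed

text \<open>Flat estimates are obtained from explicit fillings: edges count with their length,
  triangles with \<open>area\<close>.\<close>

lemma polyhedral_flat_norm_le:
 fixes Q :: "('a::euclidean_space, 'm::finite) current"
 assumes "!!j w. test_form 1 w ==> Q j w = cl1 R j w + cl2 S j (exterior_derivative 1 w)"
 shows "polyhedral_flat_norm 1 Q <= ennreal (len R + area S)"
proof -
 have s2: "Suc 1 = 2" by simp
 obtain P where P: "polyhedral_chain 1 P" "current_eq 1 (cl1 R) (current_of_chain 1 P)" by (rule cl1_polyhedral)
 have "polyhedral_current 1 (cl1 R)" unfolding polyhedral_current_def using P by (intro exI conjI)
 moreover have "current_eq 1 Q (current_add (cl1 R) (boundary 1 (cl2 S)))"
  using assms by (simp add: current_eq_def current_add_def boundary_def)
 ultimately have "polyhedral_flat_norm 1 Q <= mass 1 (cl1 R) + mass 2 (cl2 S)"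
  unfolding polyhedral_flat_norm_def s2 using cl2_polyhedral[of S] by (intro Inf_lower) blast
 also have "... <= ennreal (len R) + ennreal (area S)" by (intro add_mono mass_cl1_le mass_cl2_le)
 also have "... = ennreal (len R + area S)"
  by (rule ennreal_plus[symmetric]) (auto simp: len_def area_def intro!: sum_list_nonneg)
 finally show ?thesis .
qed

section \<open>Test forms: sums, differentials and exterior derivatives\<close>

lemma covector_sum:
 fixes al :: "'i => (nat => 'a::euclidean_space) => real"
 assumes "!!i. i \<in> I ==> covector k (al i)"
 shows "covector k (%v. \<Sum>i\<in>I. a i * al i v)"
 unfolding covector_def
proof (intro conjI allI impI)
 fix v w :: "nat => 'a" assume vw: "\<forall>i<k. v i = w i"
 show "(\<Sum>i\<in>I. a i * al i v) = (\<Sum>i\<in>I. a i * al i w)"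
 proof (rule sum.cong[OF refl])
  fix i assume "i \<in> I"
  then have "al i v = al i w" using vw by (intro covector_cong[OF assms]) simp_all
  then show "a i * al i v = a i * al i w" by simp
 qed
next
 fix v :: "nat => 'a" and l assume l: "l < k"
 have lin: "linear (%u. al i (v(l := u)))" if "i \<in> I" for i
  using assms[OF that, unfolded covector_def, THEN conjunct2, THEN conjunct1] l by simp
 show "linear (%u. \<Sum>i\<in>I. a i * al i (v(l := u)))"
 proof (rule linearI)
  show "(\<Sum>i\<in>I. a i * al i (v(l := x + y))) = (\<Sum>i\<in>I. a i * al i (v(l := x))) + (\<Sum>i\<in>I. a i * al i (v(l := y)))" for x y
   by (simp add: linear_add[OF lin] distrib_left sum.distrib cong: sum.cong)
  show "(\<Sum>i\<in>I. a i * al i (v(l := c *\<^sub>R x))) = c *\<^sub>R (\<Sum>i\<in>I. a i * al i (v(l := x)))" for c x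
   by (simp add: linear_scale[OF lin] sum_distrib_left mult.left_commute cong: sum.cong)
 qed
next
 fix v :: "nat => 'a" and l l' assume l: "l < k" "l' < k" "l ~= l'" "v l = v l'"
 have "al i v = 0" if "i \<in> I" for i
  using assms[OF that, unfolded covector_def, THEN conjunct2, THEN conjunct2] l by simp
 then show "(\<Sum>i\<in>I. a i * al i v) = 0" by simp
qed

lemma test_form_sum:
 fixes w :: "'i => 'a::euclidean_space form"
 assumes "finite I" "!!i. i \<in> I ==> test_form k (w i)"
 shows "test_form k (%x v. \<Sum>i\<in>I. a i * w i x v)"
 unfolding test_form_def
proof (intro conjI allI)
 show "covector k (%v. \<Sum>i\<in>I. a i * w i x v)" for x
  by (rule covector_sum) (rule test_form_covector[OF assms(2)])
 show "smooth (%x. \<Sum>i\<in>I. a i * w i x v)" for v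
  by (intro smooth_sum smooth_mult smooth_const test_form_smooth[OF assms(2)])
 have "\<forall>i\<in>I. EX K. compact K & (ALL x. x \<notin> K --> w i x = (%v. 0))"
  using assms(2) by (simp add: test_form_def)
 then obtain K where K: "\<forall>i\<in>I. compact (K i) & (ALL x. x \<notin> K i --> w i x = (%v. 0))"
  by (auto dest: bchoice)
 show "EX K. compact K & (ALL x. x \<notin> K --> (%v. \<Sum>i\<in>I. a i * w i x v) = (%v. 0))"
 proof (intro exI[of _ "\<Union>i\<in>I. K i"] conjI allI impI)
  show "compact (\<Union>i\<in>I. K i)" using K assms(1) by (intro compact_UN) auto
  show "(%v. \<Sum>i\<in>I. a i * w i x v) = (%v. 0)" if "x \<notin> (\<Union>i\<in>I. K i)" for x
   using K that by (auto intro!: sum.neutral)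
 qed
qed

lemma test_form_1I:
 assumes "!!x. linear (f x)" "!!u. smooth (%x. f x u)" "compact K" "!!x. x \<notin> K ==> f x = (%u. 0)"
 shows "test_form 1 (%x v. f x (v 0) :: real)"
 unfolding test_form_def covector_def
proof (intro conjI allI impI)
 fix x and v :: "nat => 'a" and i :: nat assume "i < 1"
 then show "linear (%u. f x ((v(i := u)) 0))" using assms(1) by simp
next
 show "EX K. compact K & (ALL x. x \<notin> K --> (%v. f x (v 0)) = (%v. 0))"
  by (intro exI[of _ K] conjI allI impI) (simp_all add: assms(3,4))
qed (auto simp: assms(2))

lemma frechet_derivative_eq_0:
 assumes "closed K" "!!x. x \<notin> K ==> f x = 0" "x \<notin> K"
 shows "frechet_derivative f (at x) = (%_. 0)"
proof -
 have "((%x. 0) has_derivative (%_. 0)) (at x)" by simp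
 then have "(f has_derivative (%_. 0)) (at x)"
  by (rule has_derivative_transform_within_open[of _ _ _ _ "- K"]) (use assms in auto)
 then show ?thesis using frechet_derivative_at by metis
qed

lemma test_form_mult_dform:
 assumes g: "smooth g" and f: "test_function f"
 shows "test_form 1 (%x v. g x * dform f x v)"
proof -
 obtain K where K: "compact K" "!!x. x \<notin> K ==> f x = 0" and s: "smooth f"
  using f by (auto simp: test_function_def)
 have lin: "linear (frechet_derivative f (at x))" for x
  using smooth_has_derivative[OF s] by (rule has_derivative_linear)
 have "test_form 1 (%x v. g x * frechet_derivative f (at x) (v 0))"
 proof (rule test_form_1I)
  show "linear (%u. g x * frechet_derivative f (at x) u)" for x
   by (rule linearI) (simp_all add: linear_add[OF lin] linear_scale[OF lin] distrib_left)
  show "smooth (%x. g x * frechet_derivative f (at x) u)" for u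
   by (intro smooth_mult g smooth_frechet_derivative s)
  show "compact K" by (rule K)
  show "(%u. g x * frechet_derivative f (at x) u) = (%u. 0)" if "x \<notin> K" for x
   using frechet_derivative_eq_0[OF compact_imp_closed[OF K(1)] K(2) that] by simp
 qed
 then show ?thesis by (simp add: dform_eq[abs_def])
qed

lemma test_form_dform: "test_function f ==> test_form 1 (dform f)"
 using test_form_mult_dform[OF smooth_const[of 1]] by simp

lemma exterior_derivative_1_eq:
 fixes w :: "'a::euclidean_space form"
 assumes w: "test_form 1 w"
 shows "exterior_derivative 1 w x v = frechet_derivative (%y. w y (%_. v 1)) (at x) (v 0)
   - frechet_derivative (%y. w y (%_. v 0)) (at x) (v 1)"
proof -
 have cv: "covector 1 (w x)" for x using w by (rule test_form_covector)
 have 1: "(%y. w y (%j. if j < 0 then v j else v (Suc j))) = (%y. w y (%_. v 1))"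
  by (rule ext, rule covector_cong[OF cv]) simp
 have 2: "(%y. w y (%j. if j < 1 then v j else v (Suc j))) = (%y. w y (%_. v 0))"
  by (rule ext, rule covector_cong[OF cv]) simp
 show ?thesis unfolding exterior_derivative_def using 1 2 by (simp add: atMost_Suc)
qed

lemma test_form_exterior_derivative:
 fixes om :: "'a::euclidean_space form"
 assumes om: "test_form 1 om"
 shows "test_form 2 (exterior_derivative 1 om)"
proof -
 define E where "E x a b = frechet_derivative (%y. om y (%_. a)) (at x) b" for x a b
 have e: "exterior_derivative 1 om x v = E x (v 1) (v 0) - E x (v 0) (v 1)" for x v
  by (simp only: exterior_derivative_1_eq[OF om] E_def)
 have hd: "((%y. om y (%_. a)) has_derivative E x a) (at x)" for x a
  unfolding E_def[abs_def] by (rule smooth_has_derivative[OF test_form_smooth[OF om]])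
 have wl: "linear (%u. om y (%_. u))" for y
  by (rule covector_1_linear[OF test_form_covector[OF om]])
 have l2: "linear (E x a)" for x a using hd by (rule has_derivative_linear)
 \<comment> \<open>The slot \<open>a\<close> sits inside the differentiated function, so linearity
   in it comes from uniqueness of derivatives.\<close>
 have l1: "linear (%a. E x a b)" for x b
 proof (rule linearI)
  show "E x (a + a') b = E x a b + E x a' b" for a a'
  proof -
   have "((%y. om y (%_. a + a')) has_derivative (%b. E x a b + E x a' b)) (at x)"
    unfolding linear_add[OF wl] by (intro has_derivative_add hd)
   from has_derivative_unique[OF hd this] show ?thesis by metis
  qed
  show "E x (c *\<^sub>R a) b = c *\<^sub>R E x a b" for c a
  proof -
   have "((%y. om y (%_. c *\<^sub>R a)) has_derivative (%b. c *\<^sub>R E x a b)) (at x)"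
    unfolding linear_scale[OF wl] by (intro has_derivative_scaleR_right hd)
   from has_derivative_unique[OF hd this] show ?thesis by metis
  qed
 qed
 obtain K where K: "compact K" "!!x. x \<notin> K ==> om x = (%v. 0)" using om by (auto simp: test_form_def)
 show ?thesis
  unfolding test_form_def
 proof (intro conjI allI)
  fix x
  show "covector 2 (exterior_derivative 1 om x)"
   unfolding covector_def e
  proof (intro conjI allI impI)
   fix v w :: "nat => 'a" assume "\<forall>i<2. v i = w i"
   then have "v 0 = w 0" "v 1 = w 1" by simp_all
   then show "E x (v 1) (v 0) - E x (v 0) (v 1) = E x (w 1) (w 0) - E x (w 0) (w 1)" by simp
  next
   fix v :: "nat => 'a" and i :: nat assume "i < 2"
   then consider "i = 0" | "i = 1" by (auto simp: less_2_cases_iff)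
   then show "linear (%u. E x ((v(i := u)) 1) ((v(i := u)) 0) - E x ((v(i := u)) 0) ((v(i := u)) 1))"
   proof cases
    case 1
    then show ?thesis using linear_compose_sub[OF l2[of x "v 1"] l1[of x "v 1"]] by simp
   next
    case 2
    then show ?thesis using linear_compose_sub[OF l1[of x "v 0"] l2[of x "v 0"]] by simp
   qed
  next
   fix v :: "nat => 'a" and i j :: nat assume "i < 2" "j < 2" "i ~= j" "v i = v j"
   then have "v 0 = v 1" by (auto simp: less_2_cases_iff)
   then show "E x (v 1) (v 0) - E x (v 0) (v 1) = 0" by simp
  qed
 next
  fix v :: "nat => 'a"
  have "smooth (%x. E x (v 1) (v 0) + (- 1) * E x (v 0) (v 1))"
   unfolding E_def by (intro smooth_add smooth_mult smooth_const smooth_frechet_derivative test_form_smooth[OF om])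
  then show "smooth (%x. exterior_derivative 1 om x v)" by (simp only: e diff_conv_add_uminus mult_minus1)
 next
  show "EX K. compact K & (ALL x. x \<notin> K --> exterior_derivative 1 om x = (%v. 0))"
  proof (intro exI[of _ K] conjI allI impI ext)
   fix x and v :: "nat => 'a" assume x: "x \<notin> K"
   have "E x a b = 0" for a b
    unfolding E_def by (subst frechet_derivative_eq_0[OF compact_imp_closed[OF K(1)] _ x]) (simp_all add: K)
   then show "exterior_derivative 1 om x v = 0" unfolding e by simp
  qed (rule K)
 qed
qed

text \<open>By Stokes' theorem the integral of \<open>d (d f)\<close> over a triangle is the sum of
  the increments of \<open>f\<close> around it, and these cancel.\<close>

lemma polyhedral_2_exact:
 fixes S :: "('a::euclidean_space, 'm::finite) current"
 assumes S: "polyhedral_current 2 S" and f: "test_function f"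
 shows "S j (exterior_derivative 1 (dform f)) = 0"
proof -
 obtain P where P: "polyhedral_chain 2 P" "current_eq 2 S (current_of_chain 2 P)"
  using S by (auto simp: polyhedral_current_def)
 have w: "test_form 1 (dform f)" by (rule test_form_dform[OF f])
 have s: "smooth f" using f by (simp add: test_function_def)
 have t: "test_form 2 (exterior_derivative 1 (dform f))" by (rule test_form_exterior_derivative[OF w])
 have z: "tri_int (exterior_derivative 1 (dform f)) a b c = 0" for a b c
  unfolding stokes_triangle[OF w] by (simp add: line_int_dform[OF s])
 have "S j (exterior_derivative 1 (dform f)) = current_of_chain 2 P j (exterior_derivative 1 (dform f))"
  using P(2) t unfolding current_eq_def by blast
 also have "... = sum_list (map (%e. 0::real) P)"
  unfolding current_of_chain_def
 proof (rule arg_cong[of _ _ sum_list], rule map_cong[OF refl])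
  fix e assume e: "e \<in> set P"
  obtain sg ta th where e': "e = (sg, ta, th)" by (metis prod_cases3)
  have o: "2 simplex sg" "orients 2 ta sg" using P(1) e by (auto simp: polyhedral_chain_def e')
  obtain a b c where abc: "sg = convex hull {a, b, c}"
   "ALL s t. s *\<^sub>R (b - a) + t *\<^sub>R (c - a) = 0 --> s = 0 & t = 0" by (rule simplex_2_cases[OF o(1)])
  have "EX k. k ~= 0 & (ALL w. test_form 2 w -->
    (LINT x:convex hull {a, b, c}|hausdorff_measure 2. w x ta) = k * tri_int w a b c)"
   by (rule oriented_triangle(2)) (use abc o(2) in simp_all)
  then obtain k where "(LINT x:sg|hausdorff_measure 2. exterior_derivative 1 (dform f) x ta)
    = k * tri_int (exterior_derivative 1 (dform f)) a b c"
   using t abc(1) by auto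
  then show "(case e of (sg, ta, th) => th $ j * (LINT x:sg|hausdorff_measure 2. exterior_derivative 1 (dform f) x ta)) = 0"
   by (simp only: e' prod.case z mult_zero_right)
 qed
 finally show ?thesis by simp
qed

text \<open>Exact forms do not see the boundary part of a flat decomposition. So a small flat norm
  means that the boundary equals that of a current of small mass.\<close>

lemma flat_norm_exact_forms:
 fixes P :: "('a::euclidean_space, 'm::finite) current"
 assumes "polyhedral_flat_norm 1 P < e"
 obtains R where "polyhedral_current 1 R" "mass 1 R < e"
  "ALL j f. test_function f --> P j (dform f) = R j (dform f)"
proof -
 have s2: "Suc 1 = 2" by simp
 obtain R S where RS: "mass 1 R + mass 2 S < e" "polyhedral_current 1 R" "polyhedral_current 2 S"
  "current_eq 1 P (current_add R (boundary 1 S))"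
  using assms unfolding polyhedral_flat_norm_def s2 Inf_less_iff by blast
 have "mass 1 R <= mass 1 R + mass 2 S" by simp
 then have "mass 1 R < e" using RS(1) by (rule le_less_trans)
 moreover have "P j (dform f) = R j (dform f)" if f: "test_function f" for j f
 proof -
  have "P j (dform f) = current_add R (boundary 1 S) j (dform f)"
   using RS(4) test_form_dform[OF f] unfolding current_eq_def by blast
  then show ?thesis unfolding current_add_def boundary_def polyhedral_2_exact[OF RS(3) f] by simp
 qed
 ultimately show thesis using that[OF RS(2)] by blast
qed

lemma norm_axis_real_div: "B > 0 ==> norm (axis j (a / B) :: real^'m) = \<bar>a\<bar> / B"
 by (simp add: norm_eq_sqrt_inner inner_axis_axis real_sqrt_divide)

lemma mass_bound:
 fixes R :: "('a::euclidean_space, 'm::finite) current"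
 assumes R: "polyhedral_current 1 R" "mass 1 R < ennreal e" and w: "test_form 1 w"
  and B: "B > 0" "!!x v. \<bar>w x v\<bar> <= B * norm (v 0)"
 shows "\<bar>R j w\<bar> <= B * e"
proof -
 define h where "h = (%x v. \<Sum>i\<in>{()}. (1 / B) * w x v)"
 \<comment> \<open>Mass is tested with tuples of forms: the scaled form sits in slot
   \<open>j\<close>, the zero form elsewhere. The latter is written as an empty sum so that
   linearity evaluates \<open>R\<close> on it.\<close>
 define z where "z i = (if i = j then h else (%x v. \<Sum>i\<in>({}::unit set). 0 * w x v))" for i :: 'm
 have th: "test_form 1 h" unfolding h_def by (rule test_form_sum[OF _ w]) simp
 have t0: "test_form 1 (%x v. \<Sum>i\<in>({}::unit set). 0 * w x v)" by (rule test_form_sum) simp_all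
 have "R j h = (\<Sum>i\<in>{()}. (1 / B) * R j w)"
  unfolding h_def by (rule current_of_chain_linear[OF R(1) disjI1[OF refl] _ w th[unfolded h_def]]) simp
 then have Rh: "R j h = R j w / B" by simp
 have R0: "R i (%x v. \<Sum>i\<in>({}::unit set). 0 * w x v) = 0" for i
 proof -
  have "R i (%x v. \<Sum>i\<in>({}::unit set). 0 * w x v) = (\<Sum>l\<in>({}::unit set). 0 * R i w)"
   by (rule current_of_chain_linear[OF R(1) disjI1[OF refl] _ _ t0]) simp_all
  then show ?thesis by simp
 qed
 have "ennreal \<bar>\<Sum>i\<in>UNIV. R i (z i)\<bar> <= mass 1 R"
  unfolding mass_def
 proof (rule SUP_upper, intro CollectI conjI allI impI)
  show "test_form 1 (z i)" for i using th t0 by (simp add: z_def)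
  fix x :: 'a and t :: "nat => 'a" assume "simple_vector_norm 1 t <= 1"
  then have n: "norm (t 0) <= 1" by (simp only: simple_vector_norm_1)
  have "(\<chi> i. z i x t) = axis j (w x t / B)"
   by (simp add: vec_eq_iff z_def h_def axis_def)
  then have "norm (\<chi> i. z i x t) = \<bar>w x t\<bar> / B" using B(1) by (simp only: norm_axis_real_div)
  also have "... <= B * norm (t 0) / B" using B by (intro divide_right_mono) simp_all
  also have "... <= 1" using n B(1) by simp
  finally show "norm (\<chi> i. z i x t) <= 1" .
 qed
 also have "... < ennreal e" by (rule R(2))
 also have "(\<Sum>i\<in>UNIV. R i (z i)) = (\<Sum>i\<in>UNIV. if i = j then R j h else 0)"
 proof (rule sum.cong[OF refl])
  fix i show "R i (z i) = (if i = j then R j h else 0)"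
   by (cases "i = j") (simp_all only: z_def R0 if_True if_False simp_thms)
 qed
 also have "... = R j w / B" by (simp add: Rh)
 finally have "\<bar>R j w / B\<bar> <= e" by (simp add: ennreal_less_iff)
 then show ?thesis using B(1) by (simp add: pos_divide_le_eq mult.commute)
qed

section \<open>A space-filling curve and weak compactness\<close>

text \<open>Schoenberg's curve is built from a continuous function of period 2 that is 0 on [0, 1/3]
  and 1 on [2/3, 1]; a clipped cosine has these properties.\<close>

definition schoenberg_wave :: "real => real" where
 "schoenberg_wave t = max 0 (min 1 (1 / 2 - cos (pi * t)))"

lemma schoenberg_wave_even_add: "schoenberg_wave (2 * of_int k + t) = schoenberg_wave t"
proof -
 have "cos (pi * (2 * of_int k + t)) = cos (pi * t + of_int k * (2 * pi))" by (simp add: algebra_simps)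
 also have "... = cos (pi * t)" using cos.plus_of_int[of "pi * t" k] by simp
 finally show ?thesis by (simp add: schoenberg_wave_def)
qed

lemma schoenberg_wave_0: assumes "0 <= t" "t <= 1 / 3" shows "schoenberg_wave t = 0"
proof -
 have "cos (pi / 3) <= cos (pi * t)" using assms by (intro cos_monotone_0_pi_le) (auto simp: field_simps)
 then show ?thesis by (simp add: schoenberg_wave_def cos_60)
qed

lemma schoenberg_wave_1: assumes "2 / 3 <= t" "t <= 1" shows "schoenberg_wave t = 1"
proof -
 have "cos (pi * t) <= cos (pi - pi / 3)"
  by (rule cos_monotone_0_pi_le) (use assms mult_right_mono[OF assms(1), of pi] in \<open>auto simp: field_simps\<close>)
 also have "... = - (1 / 2)" by (simp only: cos_pi_minus cos_60)
 finally show ?thesis by (simp add: schoenberg_wave_def)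
qed

text \<open>All ternary digits of \<open>t\<close> are 0 or 2. Multiplication by
  \<open>3 ^ k\<close> turns the first \<open>k\<close> of them into an even integer, which the wave
  ignores, and leaves 2/3 times the bit \<open>e k\<close> plus a tail in [0, 1/3]: the ranges where
  the wave is constant.\<close>

lemma ternary_shift:
 fixes e :: "nat => bool"
 defines "t \<equiv> \<Sum>l. 2 * of_bool (e l) / 3 ^ Suc l :: real"
 shows "schoenberg_wave (3 ^ k * t) = of_bool (e k)" "0 <= t" "t <= 1"
proof -
 define f where "f l = (2 * of_bool (e l) / 3 ^ Suc l :: real)" for l :: nat
 have geo: "(%l. 2 / 3 ^ Suc (l + m)) sums (1 / 3 ^ m :: real)" for m :: nat
 proof -
  have "(%l. (1 / 3) ^ l) sums (1 / (1 - 1 / 3 :: real))" by (rule geometric_sums) simp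
  then have "(%l. 2 / (3 * 3 ^ m) * (1 / 3) ^ l) sums (2 / (3 * 3 ^ m) * (1 / (1 - 1 / 3 :: real)))" by (rule sums_mult)
  moreover have "(%l. 2 / 3 ^ Suc (l + m)) = (%l. 2 / (3 * 3 ^ m) * (1 / 3 :: real) ^ l)"
   by (rule ext) (simp add: power_add power_divide)
  moreover have "2 / (3 * 3 ^ m) * (1 / (1 - 1 / 3 :: real)) = 1 / 3 ^ m" by simp
  ultimately show ?thesis by (simp only:)
 qed
 have fb: "0 <= f l" "f l <= 2 / 3 ^ Suc l" for l by (auto simp: f_def divide_right_mono)
 have sf: "summable (%l. f (l + m))" for m
  by (rule summable_comparison_test'[OF sums_summable[OF geo[of m]], of 0]) (use fb in auto)
 have tail: "0 <= (\<Sum>l. f (l + m))" "(\<Sum>l. f (l + m)) <= 1 / 3 ^ m" for m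
 proof -
  show "0 <= (\<Sum>l. f (l + m))" by (rule suminf_nonneg[OF sf fb(1)])
  have "(\<Sum>l. f (l + m)) <= (\<Sum>l. 2 / 3 ^ Suc (l + m))" by (rule suminf_le[OF fb(2) sf sums_summable[OF geo]])
  also have "... = 1 / 3 ^ m" by (rule sums_unique[OF geo, symmetric])
  finally show "(\<Sum>l. f (l + m)) <= 1 / 3 ^ m" .
 qed
 have tf: "t = (\<Sum>l. f (l + 0))" by (simp add: t_def f_def)
 show "0 <= t" "t <= 1" using tail[of 0] unfolding tf by simp_all
 have sp: "t = (\<Sum>l<k. f l) + f k + (\<Sum>l. f (l + Suc k))"
  using suminf_split_initial_segment[OF sf[of 0], of "Suc k"] by (simp add: tf)
 have "3 ^ k * (\<Sum>l<k. f l) = (\<Sum>l<k. 2 * of_bool (e l) * 3 ^ (k - Suc l))"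
  unfolding sum_distrib_left
 proof (rule sum.cong[OF refl])
  fix l assume "l \<in> {..<k}"
  then have "(3::real) ^ k = 3 ^ Suc l * 3 ^ (k - Suc l)" by (simp add: power_add[symmetric] del: power_Suc)
  then show "3 ^ k * f l = 2 * of_bool (e l) * 3 ^ (k - Suc l)" by (simp add: f_def)
 qed
 also have "... = 2 * of_int (\<Sum>l<k. of_bool (e l) * 3 ^ (k - Suc l))"
  by (simp only: of_int_sum of_int_mult of_int_of_bool of_int_power of_int_numeral sum_distrib_left mult.assoc)
 finally have ev: "3 ^ k * (\<Sum>l<k. f l) = 2 * of_int (\<Sum>l<k. of_bool (e l) * 3 ^ (k - Suc l))" .
 define s where "s = 3 ^ k * (\<Sum>l. f (l + Suc k))"
 have s: "0 <= s" "s <= 1 / 3"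
 proof -
  show "0 <= s" unfolding s_def by (intro mult_nonneg_nonneg tail(1)) simp
  have "3 ^ k * (\<Sum>l. f (l + Suc k)) <= 3 ^ k * (1 / 3 ^ Suc k)" by (intro mult_left_mono tail(2)) simp
  then show "s <= 1 / 3" by (simp add: s_def)
 qed
 have "3 ^ k * t = 2 * of_int (\<Sum>l<k. of_bool (e l) * 3 ^ (k - Suc l)) + (2 * of_bool (e k) / 3 + s)"
  unfolding sp distrib_left ev s_def by (simp add: f_def)
 then have w: "schoenberg_wave (3 ^ k * t) = schoenberg_wave (2 * of_bool (e k) / 3 + s)"
  by (simp only: schoenberg_wave_even_add)
 show "schoenberg_wave (3 ^ k * t) = of_bool (e k)"
  unfolding w using s by (cases "e k") (simp_all add: schoenberg_wave_0 schoenberg_wave_1)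
qed

lemma binary_expansion:
 fixes y :: real assumes "0 <= y" "y < 1"
 obtains e :: "nat => bool" where "(%k. of_bool (e k) / 2 ^ Suc k) sums y"
proof -
 define a where "a k = \<lfloor>2 ^ k * y\<rfloor>" for k :: nat
 define e where "e k = odd (a (Suc k))" for k
 have step: "a (Suc k) = 2 * a k + of_bool (e k)" for k
 proof -
  have "2 ^ Suc k * y = 2 * (2 ^ k * y)" by simp
  then have "2 * a k <= a (Suc k)" "a (Suc k) < 2 * a k + 2"
   unfolding a_def by linarith+
  then show ?thesis
  proof (cases "odd (a (Suc k))")
   case True
   with \<open>2 * a k <= a (Suc k)\<close> \<open>a (Suc k) < 2 * a k + 2\<close> have "a (Suc k) = 2 * a k + 1" by presburger
   then show ?thesis using True by (simp add: e_def)
  next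
   case False
   with \<open>2 * a k <= a (Suc k)\<close> \<open>a (Suc k) < 2 * a k + 2\<close> have "a (Suc k) = 2 * a k" by presburger
   then show ?thesis using False by (simp add: e_def)
  qed
 qed
 have ps: "(\<Sum>k<n. of_bool (e k) / 2 ^ Suc k) = a n / 2 ^ n" for n
 proof (induction n)
  case 0 then show ?case using assms by (simp add: a_def floor_eq_iff)
 next
  case (Suc n)
  then show ?case by (simp add: step add_divide_distrib)
 qed
 have "(%n. real_of_int (a n) / 2 ^ n) \<longlonglongrightarrow> y"
 proof (rule real_tendsto_sandwich)
  show "\<forall>\<^sub>F n in sequentially. y - (1 / 2) ^ n <= a n / 2 ^ n"
  proof (rule always_eventually, rule allI)
   fix n
   have "2 ^ n * y - 1 <= real_of_int (a n)" unfolding a_def by linarith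
   then have "(2 ^ n * y - 1) / 2 ^ n <= a n / 2 ^ n" by (rule divide_right_mono) simp
   then show "y - (1 / 2) ^ n <= a n / 2 ^ n" by (simp add: diff_divide_distrib power_one_over)
  qed
  show "\<forall>\<^sub>F n in sequentially. a n / 2 ^ n <= y"
  proof (rule always_eventually, rule allI)
   fix n
   have "real_of_int (a n) <= 2 ^ n * y" unfolding a_def by linarith
   then show "a n / 2 ^ n <= y" by (simp add: field_simps)
  qed
  have "(%n. y - (1 / 2) ^ n) \<longlonglongrightarrow> y - 0" by (intro tendsto_diff tendsto_const LIMSEQ_realpow_zero) simp_all
  then show "(%n. y - (1 / 2) ^ n) \<longlonglongrightarrow> y" by simp
 qed simp
 then have "(%k. of_bool (e k) / 2 ^ Suc k) sums y" unfolding sums_def ps .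
 then show thesis by (rule that)
qed

lemma space_filling_curve:
 fixes r :: real
 obtains g :: "real => 'a::euclidean_space" and K where "continuous_on UNIV g" "compact K" "range g \<subseteq> K"
  "ALL x. norm x <= r --> (EX t. 0 <= t & t <= 1 & g t = x)"
proof -
 define n where "n = DIM('a)"
 obtain idx where idx: "bij_betw idx (Basis :: 'a set) {..<n}"
  using ex_bij_betw_finite_nat[OF finite_Basis[where ?'a = 'a]] by (auto simp: n_def atLeast0LessThan)
 \<comment> \<open>Larger than \<open>r\<close>, so that normalized coordinates stay strictly below
   1, as the binary expansion requires.\<close>
 define R where "R = \<bar>r\<bar> + 1"
 have R: "R > 0" "r < R" by (auto simp: R_def)
 \<comment> \<open>One parameter stores the bits of all coordinates: coordinate \<open>b\<close>
   reads the positions congruent to \<open>idx b\<close> modulo \<open>n\<close>.\<close>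
 define G where "G b t = (\<Sum>k. schoenberg_wave (3 ^ (k * n + idx b) * t) / 2 ^ Suc k)" for b :: 'a and t :: real
 define g where "g t = (\<Sum>b\<in>Basis. (2 * R * G b t - R) *\<^sub>R b)" for t
 have w01: "0 <= schoenberg_wave t" "schoenberg_wave t <= 1" for t by (auto simp: schoenberg_wave_def)
 have geo: "(%k. 1 / 2 ^ Suc k) sums (1::real)" using power_half_series by (simp add: power_divide power_one_over)
 have wb: "norm (schoenberg_wave t / 2 ^ Suc k) <= 1 / 2 ^ Suc k" for t k
  using w01 by (simp add: divide_right_mono)
 have ul: "uniform_limit UNIV (%m t. \<Sum>k<m. schoenberg_wave (3 ^ (k * n + idx b) * t) / 2 ^ Suc k) (G b) sequentially" for b
  unfolding G_def by (rule Weierstrass_m_test[OF wb sums_summable[OF geo]])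
 have Gc: "continuous_on UNIV (G b)" for b
 proof (rule uniform_limit_theorem[OF _ ul])
  show "\<forall>\<^sub>F m in sequentially. continuous_on UNIV (%t. \<Sum>k<m. schoenberg_wave (3 ^ (k * n + idx b) * t) / 2 ^ Suc k)"
   unfolding schoenberg_wave_def by (intro always_eventually allI continuous_intros) simp_all
 qed simp
 have Gb: "0 <= G b t" "G b t <= 1" for b t
 proof -
  have su: "summable (%k. schoenberg_wave (3 ^ (k * n + idx b) * t) / 2 ^ Suc k)"
   by (rule summable_comparison_test'[OF sums_summable[OF geo], of 0]) (rule wb)
  show "0 <= G b t" unfolding G_def by (rule suminf_nonneg[OF su]) (simp add: w01)
  have "G b t <= (\<Sum>k. 1 / 2 ^ Suc k)" unfolding G_def
   by (rule suminf_le[OF _ su sums_summable[OF geo]]) (rule divide_right_mono[OF w01(2)], simp)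
  also have "... = 1" by (rule sums_unique[OF geo, symmetric])
  finally show "G b t <= 1" .
 qed
 have c: "continuous_on UNIV g" unfolding g_def by (intro continuous_intros Gc)
 have gi: "g t \<bullet> b = 2 * R * G b t - R" if "b \<in> Basis" for t b
  using that by (simp add: g_def inner_sum_left_Basis)
 have rg: "range g \<subseteq> cbox (- (R *\<^sub>R One)) (R *\<^sub>R One)"
 proof
  fix x assume "x \<in> range g"
  then obtain t where x: "x = g t" by blast
  have "- R <= 2 * R * G b t - R" "2 * R * G b t - R <= R" for b
   using Gb[of b t] R(1) mult_left_mono[OF Gb(2)[of b t], of "2 * R"] by auto
  then show "x \<in> cbox (- (R *\<^sub>R One)) (R *\<^sub>R One)" unfolding x mem_box by (auto simp: gi)
 qed
 have su: "ALL x. norm x <= r --> (EX t. 0 <= t & t <= 1 & g t = x)"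
 proof (intro allI impI)
  fix x :: 'a assume x: "norm x <= r"
  define y where "y b = (x \<bullet> b + R) / (2 * R)" for b
  have y: "0 <= y b" "y b < 1" if "b \<in> Basis" for b
   using Basis_le_norm[OF that, of x] x R by (auto simp: y_def field_simps abs_le_iff)
  have "\<forall>b\<in>Basis. \<exists>e :: nat => bool. (%k. of_bool (e k) / 2 ^ Suc k) sums y b"
  proof
   fix b :: 'a assume b: "b \<in> Basis"
   obtain e :: "nat => bool" where "(%k. of_bool (e k) / 2 ^ Suc k) sums y b"
    by (rule binary_expansion[OF y(1)[OF b] y(2)[OF b]])
   then show "\<exists>e :: nat => bool. (%k. of_bool (e k) / 2 ^ Suc k) sums y b" by (intro exI[of _ e])
  qed
  then obtain e :: "'a => nat => bool" where e: "\<forall>b\<in>Basis. (%k. of_bool (e b k) / 2 ^ Suc k) sums y b"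
   by (rule bchoice[THEN exE])
  \<comment> \<open>Position \<open>l\<close> belongs to the coordinate numbered
    \<open>l mod n\<close> and holds its bit number \<open>l div n\<close>.\<close>
  define E where "E l = e (inv_into Basis idx (l mod n)) (l div n)" for l
  define t where "t = (\<Sum>l. 2 * of_bool (E l) / 3 ^ Suc l :: real)"
  have Ek: "E (k * n + idx b) = e b k" if b: "b \<in> Basis" for b k
  proof -
   have "idx b < n" using idx b by (auto simp: bij_betw_def)
   then show ?thesis unfolding E_def
    using bij_betw_inv_into_left[OF idx b] by simp
  qed
  have "G b t = y b" if b: "b \<in> Basis" for b
   unfolding G_def t_def ternary_shift(1) Ek[OF b]
   by (rule sums_unique[OF e[rule_format, OF b], symmetric])
  note Gy = this
  have "g t = x"
   by (rule euclidean_eqI) (use R(1) in \<open>simp add: gi Gy y_def\<close>)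
  then show "EX t. 0 <= t & t <= 1 & g t = x"
   using ternary_shift(2,3)[of E] unfolding t_def by blast
 qed
 show thesis by (rule that[OF c compact_cbox rg su])
qed

text \<open>The section \<open>code\<close> of the curve is an arbitrary choice; it is applied to
  finitely many points for each \<open>h\<close>, while the limit is transported back by the
  continuous curve itself.\<close>

lemma weak_limit_of_points:
 fixes x :: "nat => nat => 'a::euclidean_space" and w :: "nat => nat => real" and N :: "nat => nat"
 assumes w: "ALL h. \<forall>i<N h. 0 <= w h i" and M: "ALL h. (\<Sum>i<N h. w h i) <= M" and x: "ALL h. \<forall>i<N h. norm (x h i) <= r"
 obtains s m K where "strict_mono s" "finite_measure m" "sets m = sets borel" "compact K" "emeasure m (- K) = 0"
  "ALL f. continuous_on UNIV f -->
    ((%h. \<Sum>i<N (s h). w (s h) i * f (x (s h) i)) \<longlonglongrightarrow> (\<integral>x. f x \<partial>m))"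
proof -
 obtain g :: "real => 'a" and K where g: "continuous_on UNIV g" "compact K" "range g \<subseteq> K"
  "ALL x. norm x <= r --> (EX t. 0 <= t & t <= 1 & g t = x)" by (rule space_filling_curve)
 define code where "code x = (SOME t. 0 <= t & t <= 1 & g t = x)" for x
 have code: "0 <= code x" "code x <= 1" "g (code x) = x" if "norm x <= r" for x
  using someI_ex[OF g(4)[rule_format, OF that]] by (simp_all add: code_def)
 \<comment> \<open>At least 1, so that dividing by it is safe whatever \<open>M\<close> is.\<close>
 define Q where "Q = max M 1"
 have Q: "Q > 0" "!!h. (\<Sum>i<N h. w h i) <= Q"
  using M by (auto simp: Q_def le_max_iff_disj)
 \<comment> \<open>Normalized to probability measures, for which tightness yields convergent
   subsequences. The missing mass is parked at the parameter 3, away from the codes in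
   [0, 1].\<close>
 define W where "W h i = (if i < N h then w h i / Q else 1 - (\<Sum>i<N h. w h i) / Q)" for h i
 define pos where "pos h i = (if i < N h then code (x h i) else 3)" for h i
 define pm where "pm h = point_measure {..N h} (%i. ennreal (W h i))" for h
 define \<mu> where "\<mu> h = distr (pm h) borel (pos h)" for h
 have W0: "0 <= W h i" for h i using w Q by (auto simp: W_def pos_divide_le_eq)
 have sumN: "(\<Sum>i\<le>N h. F i) = (\<Sum>i<N h. F i) + F (N h)" for F :: "nat => real" and h
  by (simp add: lessThan_Suc_atMost[symmetric])
 have W1: "(\<Sum>i\<le>N h. W h i) = 1" for h
  unfolding sumN by (simp add: W_def sum_divide_distrib)
 have mp: "pos h \<in> measurable (pm h) borel" for h by (simp add: pm_def)
 have pp: "prob_space (pm h)" for h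
 proof (rule prob_spaceI)
  show "emeasure (pm h) (space (pm h)) = 1"
   unfolding pm_def by (simp add: space_point_measure emeasure_point_measure_finite sum_ennreal W0 W1)
 qed
 have rd: "real_distribution (\<mu> h)" for h
  unfolding real_distribution_def real_distribution_axioms_def \<mu>_def
  using prob_space.prob_space_distr[OF pp mp] by simp
 have ran: "measure (\<mu> h) {-1<..4} = 1" for h
 proof -
  have "pos h i \<in> {-1<..4}" for i
   using code[of "x h i"] x by (auto simp: pos_def intro: order_less_le_trans order_trans)
  then have "pos h -` {-1<..4} \<inter> space (pm h) = space (pm h)" by auto
  then show ?thesis unfolding \<mu>_def by (subst measure_distr[OF mp]) (simp_all add: prob_space.prob_space[OF pp])
 qed
 have "tight \<mu>"
  unfolding tight_def
 proof (intro conjI allI impI rd)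
  fix e :: real assume "e > 0"
  then show "EX a b. a < b & (ALL n. 1 - e < measure (\<mu> n) {a<..b})"
   by (intro exI[of _ "-1"] exI[of _ 4]) (simp add: ran)
 qed
 from tight_imp_convergent_subsubsequence[OF this strict_mono_id]
 obtain s L where s: "strict_mono s" and L: "real_distribution L" and "weak_conv_m (\<mu> \<circ> id \<circ> s) L" by blast
 then have wc: "weak_conv_m (%h. \<mu> (s h)) L" by (simp add: comp_def)
 interpret L: real_distribution L by (rule L)
 \<comment> \<open>Equal to 1 on the codes and 0 at the parked mass; being continuous, it survives
   the weak limit.\<close>
 define cut where "cut t = max 0 (min 1 (2 - t))" for t :: real
 have cut: "0 <= cut t" "cut t <= 1" "continuous_on UNIV cut" "t <= 1 ==> cut t = 1" "cut 3 = 0" for t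
  by (auto simp: cut_def[abs_def] intro!: continuous_intros)
 have gm [measurable]: "g \<in> borel_measurable borel" by (rule borel_measurable_continuous_onI[OF g(1)])
 have cm [measurable]: "cut \<in> borel_measurable borel" by (rule borel_measurable_continuous_onI[OF cut(3)])
 have sL [measurable_cong]: "sets L = sets borel" by simp
 \<comment> \<open>The limit on the line, freed from the parked mass, scaled back by
   \<open>Q\<close> and pushed into space; it lives on \<open>K\<close> because the curve
   does.\<close>
 define m where "m = distr (density L (%t. ennreal (Q * cut t))) borel g"
 have sm: "sets m = sets borel" by (simp add: m_def)
 have fm: "finite_measure m"
 proof (rule finite_measureI)
  have "emeasure m (space m) = (\<integral>\<^sup>+t. ennreal (Q * cut t) \<partial>L)"
   unfolding m_def by (subst emeasure_distr) (auto simp: emeasure_density intro!: nn_integral_cong)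
  also have "... <= (\<integral>\<^sup>+t. ennreal Q \<partial>L)"
   using Q cut by (intro nn_integral_mono ennreal_leI) (simp add: mult_left_le)
  also have "... < \<infinity>" by (simp add: L.emeasure_space_1[simplified] ennreal_mult_less_top)
  finally show "emeasure m (space m) ~= \<infinity>" by simp
 qed
 have Kb: "- K \<in> sets borel" using g(2) by (simp add: compact_imp_closed borel_open open_Compl)
 have mK: "emeasure m (- K) = 0"
 proof -
  have "g -` (- K) = {}" using g(3) by auto
  then show ?thesis unfolding m_def by (subst emeasure_distr[OF _ Kb]) auto
 qed
 have conv: "(%h. \<Sum>i<N (s h). w (s h) i * f (x (s h) i)) \<longlonglongrightarrow> (\<integral>x. f x \<partial>m)"
  if f: "continuous_on UNIV f" for f
 proof -
  have fm [measurable]: "f \<in> borel_measurable borel" by (rule borel_measurable_continuous_onI[OF f])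
  have "bounded (f ` K)" by (intro compact_imp_bounded compact_continuous_image continuous_on_subset[OF f] g(2)) simp
  then obtain B where B: "!!x. x \<in> K ==> \<bar>f x\<bar> <= B" unfolding bounded_iff real_norm_def by blast
  define F where "F t = cut t * f (g t)" for t
  have Fc: "continuous_on UNIV F"
   unfolding F_def by (intro continuous_on_mult cut(3) continuous_on_compose2[OF f g(1)]) simp
  have Fm [measurable]: "F \<in> borel_measurable borel" by (rule borel_measurable_continuous_onI[OF Fc])
  have Fb: "norm (F t) <= B" for t
  proof -
   have "\<bar>f (g t)\<bar> <= B" using B g(3) by blast
   moreover have "cut t * \<bar>f (g t)\<bar> <= 1 * \<bar>f (g t)\<bar>" by (intro mult_right_mono cut) simp
   ultimately show ?thesis using cut(1)[of t] by (simp add: F_def abs_mult)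
  qed
  have lim: "(%h. integral\<^sup>L (\<mu> (s h)) F) \<longlonglongrightarrow> integral\<^sup>L L F"
   by (rule weak_conv_imp_integral_bdd_continuous_conv[OF rd L wc _ Fb])
     (use Fc in \<open>simp add: continuous_on_eq_continuous_at\<close>)
  have intF: "integral\<^sup>L (\<mu> h) F = (\<Sum>i<N h. w h i * f (x h i)) / Q" for h
  proof -
   have "integral\<^sup>L (\<mu> h) F = integral\<^sup>L (pm h) (%i. F (pos h i))"
    unfolding \<mu>_def by (rule integral_distr[OF mp Fm])
   also have "... = (\<Sum>i\<le>N h. W h i * F (pos h i))"
    unfolding pm_def by (subst lebesgue_integral_point_measure_finite) (simp_all add: W0)
   also have "... = (\<Sum>i<N h. W h i * F (pos h i))"
    unfolding sumN by (simp add: pos_def F_def cut(5))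
   also have "... = (\<Sum>i<N h. w h i * f (x h i) / Q)"
    by (rule sum.cong) (use x in \<open>auto simp: W_def pos_def F_def code cut(4)\<close>)
   finally show ?thesis by (simp add: sum_divide_distrib)
  qed
  have "integral\<^sup>L m f = (\<integral>t. f (g t) \<partial>density L (%t. ennreal (Q * cut t)))"
   unfolding m_def by (rule integral_distr) measurable
  also have "... = (\<integral>t. (Q * cut t) *\<^sub>R f (g t) \<partial>L)"
   by (rule integral_density) (use Q cut in auto)
  also have "... = Q * integral\<^sup>L L F" by (simp add: F_def[abs_def] mult.assoc)
  finally have im: "integral\<^sup>L m f = Q * integral\<^sup>L L F" .
  have "(%h. Q * integral\<^sup>L (\<mu> (s h)) F) \<longlonglongrightarrow> Q * integral\<^sup>L L F"
   by (intro tendsto_mult lim tendsto_const)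
  then show ?thesis unfolding im intF using Q(1) by simp
 qed
 show thesis by (rule that[OF s fm sm g(2) mK], intro allI impI, rule conv)
qed

text \<open>Iterated extraction, twice for each coefficient family because positive and negative
  parts are treated separately; convergence already achieved passes to subsequences.\<close>

lemma weak_limit_of_signed_points:
 fixes x :: "nat => nat => 'a::euclidean_space" and a :: "'k => nat => nat => real" and N :: "nat => nat"
 assumes I: "finite I" and M: "\<forall>k\<in>I. ALL h. (\<Sum>i<N h. \<bar>a k h i\<bar>) <= M" and x: "ALL h. \<forall>i<N h. norm (x h i) <= r"
 shows "EX sg. strict_mono sg & (\<forall>k\<in>I. EX m1 m2 K. finite_measure m1 & finite_measure m2 &
  sets m1 = sets borel & sets m2 = sets borel & compact K & emeasure m1 (- K) = 0 & emeasure m2 (- K) = 0 &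
  (ALL f. continuous_on UNIV f -->
    ((%h. \<Sum>i<N (sg h). a k (sg h) i * f (x (sg h) i)) \<longlonglongrightarrow> (\<integral>x. f x \<partial>m1) - (\<integral>x. f x \<partial>m2))))"
  (is "EX sg. _ & (\<forall>k\<in>I. ?C sg k)")
 using I M
proof (induction I)
 case empty
 then show ?case using strict_mono_id by blast
next
 case (insert k I)
 define C where "C sg l \<longleftrightarrow> ?C sg l"
  for sg :: "nat => nat" and l
 have "EX sg. strict_mono sg & (\<forall>l\<in>I. C sg l)" using insert.IH insert.prems unfolding C_def by simp
 then obtain sg where sg: "strict_mono sg" "\<forall>l\<in>I. C sg l" by blast
 have b: "(\<Sum>i<N h. max 0 (s * a k h i)) <= M" if "\<bar>s\<bar> = 1" for h s
 proof -
  have "max 0 (s * a k h i) <= \<bar>a k h i\<bar>" for i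
   using abs_ge_self[of "s * a k h i"] that by (simp add: abs_mult)
  then have "(\<Sum>i<N h. max 0 (s * a k h i)) <= (\<Sum>i<N h. \<bar>a k h i\<bar>)" by (rule sum_mono)
  also have "... <= M" using insert.prems by simp
  finally show ?thesis .
 qed
 obtain sg1 m1 K1 where 1: "strict_mono sg1" "finite_measure m1" "sets m1 = sets borel" "compact K1" "emeasure m1 (- K1) = 0"
  "ALL f. continuous_on UNIV f -->
    ((%h. \<Sum>i<N (sg (sg1 h)). max 0 (1 * a k (sg (sg1 h)) i) * f (x (sg (sg1 h)) i)) \<longlonglongrightarrow> (\<integral>x. f x \<partial>m1))"
  by (rule weak_limit_of_points[where N = "%h. N (sg h)" and x = "%h. x (sg h)" and w = "%h i. max 0 (1 * a k (sg h) i)" and M = M and r = r])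
    (use x b[of 1] in simp_all)
 define t where "t h = sg (sg1 h)" for h
 obtain sg2 m2 K2 where 2: "strict_mono sg2" "finite_measure m2" "sets m2 = sets borel" "compact K2" "emeasure m2 (- K2) = 0"
  "ALL f. continuous_on UNIV f -->
    ((%h. \<Sum>i<N (t (sg2 h)). max 0 ((- 1) * a k (t (sg2 h)) i) * f (x (t (sg2 h)) i)) \<longlonglongrightarrow> (\<integral>x. f x \<partial>m2))"
  by (rule weak_limit_of_points[where N = "%h. N (t h)" and x = "%h. x (t h)" and w = "%h i. max 0 ((- 1) * a k (t h) i)" and M = M and r = r])
    (use x b[of "- 1"] in simp_all)
 define \<rho> where "\<rho> h = t (sg2 h)" for h
 have sm: "strict_mono (%h. sg1 (sg2 h))" using strict_mono_o[OF 1(1) 2(1)] by (simp add: comp_def)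
 have \<rho>: "strict_mono \<rho>" using strict_mono_o[OF sg(1) sm] by (simp add: comp_def \<rho>_def[abs_def] t_def)
 have z: "emeasure m (- (K1 \<union> K2)) = 0" if "emeasure m (- K) = 0" "sets m = sets borel" "K = K1 \<or> K = K2" for m K
 proof -
  have "closed K" using that(3) 1(4) 2(4) by (elim disjE) (simp_all add: compact_imp_closed)
  then have "- K \<in> sets m" unfolding that(2) by (intro borel_open open_Compl)
  then have "emeasure m (- (K1 \<union> K2)) <= emeasure m (- K)" by (rule emeasure_mono[rotated]) (use that(3) in auto)
  then show ?thesis using that(1) by simp
 qed
 have "C \<rho> k"
  unfolding C_def
 proof (rule exI[of _ m1], rule exI[of _ m2], rule exI[of _ "K1 \<union> K2"], intro conjI 1 2 compact_Un allI impI)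
  show "emeasure m1 (- (K1 \<union> K2)) = 0" by (rule z[OF 1(5,3)]) simp
  show "emeasure m2 (- (K1 \<union> K2)) = 0" by (rule z[OF 2(5,3)]) simp
  fix f :: "'a => real" assume f: "continuous_on UNIV f"
  have l1: "(%h. \<Sum>i<N (\<rho> h). max 0 (a k (\<rho> h) i) * f (x (\<rho> h) i)) \<longlonglongrightarrow> (\<integral>x. f x \<partial>m1)"
   using LIMSEQ_subseq_LIMSEQ[OF 1(6)[rule_format, OF f] 2(1)] by (simp add: comp_def \<rho>_def t_def)
  have l2: "(%h. \<Sum>i<N (\<rho> h). max 0 (- a k (\<rho> h) i) * f (x (\<rho> h) i)) \<longlonglongrightarrow> (\<integral>x. f x \<partial>m2)"
   using 2(6)[rule_format, OF f] by (simp add: \<rho>_def)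
  have "(%h. (\<Sum>i<N (\<rho> h). max 0 (a k (\<rho> h) i) * f (x (\<rho> h) i)) - (\<Sum>i<N (\<rho> h). max 0 (- a k (\<rho> h) i) * f (x (\<rho> h) i)))
   = (%h. \<Sum>i<N (\<rho> h). a k (\<rho> h) i * f (x (\<rho> h) i))"
   unfolding sum_subtractf[symmetric] left_diff_distrib[symmetric]
   by (intro ext sum.cong refl arg_cong2[where f = "(*)"]) (simp add: max_def)
  then show "(%h. \<Sum>i<N (\<rho> h). a k (\<rho> h) i * f (x (\<rho> h) i)) \<longlonglongrightarrow> (\<integral>x. f x \<partial>m1) - (\<integral>x. f x \<partial>m2)"
   using tendsto_diff[OF l1 l2] by simp
 qed
 moreover have "C \<rho> l" if l: "l \<in> I" for l
 proof -
  obtain m1 m2 K where m: "finite_measure m1" "finite_measure m2" "sets m1 = sets borel" "sets m2 = sets borel"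
   "compact K" "emeasure m1 (- K) = 0" "emeasure m2 (- K) = 0"
   "ALL f. continuous_on UNIV f -->
    ((%h. \<Sum>i<N (sg h). a l (sg h) i * f (x (sg h) i)) \<longlonglongrightarrow> (\<integral>x. f x \<partial>m1) - (\<integral>x. f x \<partial>m2))"
   using sg(2)[rule_format, OF l] unfolding C_def by auto
  show ?thesis
   unfolding C_def
  proof (rule exI[of _ m1], rule exI[of _ m2], rule exI[of _ K], intro conjI m(1-7) allI impI)
   fix f :: "'a => real" assume "continuous_on UNIV f"
   from LIMSEQ_subseq_LIMSEQ[OF m(8)[rule_format, OF this] sm]
   show "(%h. \<Sum>i<N (\<rho> h). a l (\<rho> h) i * f (x (\<rho> h) i)) \<longlonglongrightarrow> (\<integral>x. f x \<partial>m1) - (\<integral>x. f x \<partial>m2)"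
    by (simp add: comp_def \<rho>_def t_def)
  qed
 qed
 ultimately have "\<forall>l\<in>insert k I. C \<rho> l" by blast
 with \<rho> have "strict_mono \<rho> & (\<forall>l\<in>insert k I. C \<rho> l)" by (rule conjI)
 then show ?case unfolding C_def by (intro exI[of _ \<rho>])
qed

section \<open>Matrix-valued measures as weak limits of chains\<close>

lemma sum_Basis_vec: "(\<Sum>b\<in>(Basis :: ('v::euclidean_space^'n) set). F b) = (\<Sum>i\<in>UNIV. \<Sum>u\<in>Basis. F (axis i u))"
proof -
 have B: "(Basis :: ('v^'n) set) = (%(i, u). axis i u) ` (UNIV \<times> Basis)"
  unfolding Basis_vec_def by auto
 have "inj_on (%(i, u). axis i u :: 'v^'n) (UNIV \<times> Basis)"
  by (auto simp: inj_on_def axis_eq_axis)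
 then show ?thesis unfolding B by (simp add: sum.reindex sum.cartesian_product split_def)
qed

lemma measure_action_vec:
 "measure_action \<mu> v = (\<Sum>i\<in>UNIV. signed_integral (%A. \<mu> A $ i) (%x. v x $ i))"
 for v :: "'a::euclidean_space => real^'n"
 unfolding measure_action_def sum_Basis_vec by (simp add: inner_axis)

lemma measure_action_mat:
 "measure_action \<mu> v = (\<Sum>i\<in>UNIV. \<Sum>j\<in>UNIV. signed_integral (%A. \<mu> A $ i $ j) (%x. v x $ i $ j))"
 for v :: "'a::euclidean_space => real^'m^'n"
 unfolding measure_action_def sum_Basis_vec by (simp add: inner_axis)

lemma current_of_measure_eq:
 "current_of_measure T j w = (\<Sum>i\<in>UNIV. signed_integral (%A. T A $ i $ j) (%x. w x (%_. axis i 1)))"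
 unfolding current_of_measure_def measure_action_vec by (simp add: column_def)

lemma covector_1_inner:
 fixes w :: "(real^'n) form"
 assumes "test_form 1 w"
 shows "w x (%_. u) = u \<bullet> (\<chi> i. w x (%_. axis i 1))"
proof -
 have l: "linear (%u. w x (%_. u))" by (rule covector_1_linear[OF test_form_covector[OF assms]])
 have "w x (%_. u) = w x (%_. \<Sum>i\<in>UNIV. u $ i *\<^sub>R axis i 1)"
  using basis_expansion[of u] by (simp add: scalar_mult_eq_scaleR)
 also have "... = (\<Sum>i\<in>UNIV. u $ i * w x (%_. axis i 1))"
  by (simp add: linear_sum[OF l] linear_scale[OF l])
 finally show ?thesis by (simp add: inner_vec_def)
qed

text \<open>A short edge acts like a point mass at \<open>p\<close> with vector
  \<open>q - p\<close>, up to an error small compared with its length. This turns chains into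
  weighted points.\<close>

lemma line_int_approx:
 fixes w :: "(real^'n) form"
 assumes w: "test_form 1 w" and e: "e > 0"
 obtains del where "del > 0" "ALL p q. norm p <= r --> norm (q - p) < del -->
  \<bar>line_int w p q - (q - p) \<bullet> (\<chi> i. w p (%_. axis i 1))\<bar> <= e * norm (q - p)"
proof -
 define F where "F y = (\<chi> i. w y (%_. axis i 1))" for y
 have c: "continuous_on UNIV F"
  unfolding F_def by (intro continuous_on_vec_lambda smooth_continuous test_form_smooth[OF w])
 have "uniformly_continuous_on (cball 0 (r + 1)) F"
  by (intro compact_uniformly_continuous continuous_on_subset[OF c]) simp_all
 then obtain d where d: "d > 0" "\<forall>y\<in>cball 0 (r + 1). \<forall>p\<in>cball 0 (r + 1). dist p y < d --> dist (F p) (F y) < e"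
  unfolding uniformly_continuous_on_def using e by meson
 have main: "\<bar>line_int w p q - (q - p) \<bullet> F p\<bar> <= e * norm (q - p)" if p: "norm p <= r" "norm (q - p) < min d 1" for p q
 proof -
  define f where "f s = (q - p) \<bullet> F (p + s *\<^sub>R (q - p)) - (q - p) \<bullet> F p" for s :: real
  have c1: "continuous_on UNIV (%s. (q - p) \<bullet> F (p + s *\<^sub>R (q - p)))"
   by (intro continuous_on_inner continuous_on_const continuous_on_compose2[OF c]) (auto intro!: continuous_intros)
  have cf: "continuous_on UNIV f"
   unfolding f_def by (intro continuous_on_diff continuous_on_const c1)
  have "\<bar>LINT s:{0..1}|lborel. f s\<bar> <= e * norm (q - p)"
  proof (rule set_integral_abs_le[OF cf])
   fix s :: real assume s: "s \<in> {0..1}"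
   have n: "norm (s *\<^sub>R (q - p)) <= norm (q - p)" using s by (simp add: mult_left_le_one_le)
   have "p + s *\<^sub>R (q - p) \<in> cball 0 (r + 1)" "p \<in> cball 0 (r + 1)"
    using p n norm_triangle_ineq[of p "s *\<^sub>R (q - p)"] by simp_all
   moreover have "dist (p + s *\<^sub>R (q - p)) p < d" using p n by (simp add: dist_norm)
   ultimately have "dist (F (p + s *\<^sub>R (q - p))) (F p) < e" using d(2) by blast
   then have "norm (F (p + s *\<^sub>R (q - p)) - F p) <= e" by (simp add: dist_norm)
   then have "norm (q - p) * norm (F (p + s *\<^sub>R (q - p)) - F p) <= norm (q - p) * e" by (rule mult_left_mono) simp
   then show "\<bar>f s\<bar> <= e * norm (q - p)"
    unfolding f_def inner_diff_right[symmetric]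
    using Cauchy_Schwarz_ineq2[of "q - p" "F (p + s *\<^sub>R (q - p)) - F p"] by (simp add: mult.commute)
  qed (use e in simp_all)
  moreover have "(LINT s:{0..1}|lborel. f s) = (LINT s:{0..1}|lborel. (q - p) \<bullet> F (p + s *\<^sub>R (q - p))) - (LINT s:{0..1::real}|lborel. (q - p) \<bullet> F p)"
   unfolding f_def by (rule set_integral_diff(2)[OF set_integrable_Icc_continuous[OF c1] set_integrable_Icc_continuous[OF continuous_on_const]])
  moreover have "line_int w p q = (LINT s:{0..1}|lborel. (q - p) \<bullet> F (p + s *\<^sub>R (q - p)))"
   unfolding line_int_def F_def by (subst covector_1_inner[OF w]) (rule refl)
  moreover have "(LINT s:{0..1::real}|lborel. (q - p) \<bullet> F p) = (q - p) \<bullet> F p"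
   by (simp add: set_lebesgue_integral_def content_real)
  ultimately show ?thesis by linarith
 qed
 \<comment> \<open>The bound 1 keeps the edge inside the ball on which uniform continuity is
   used.\<close>
 show thesis by (rule that[of "min d 1"]) (use d main in \<open>simp_all add: F_def\<close>)
qed

lemma vector_measure_matI:
 assumes "!!i j. vector_measure (%A. T A $ i $ j :: real)"
 shows "vector_measure T"
 unfolding vector_measure_def sums_def
proof (intro allI impI vec_tendstoI)
 fix A :: "nat => 'c set" and i j
 assume "range A \<subseteq> sets borel" "disjoint_family A"
 then have "(%l. T (A l) $ i $ j) sums (T (\<Union>l. A l) $ i $ j)"
  using assms[of i j] unfolding vector_measure_def by blast
 then show "(%n. (\<Sum>l<n. T (A l)) $ i $ j) \<longlonglongrightarrow> T (\<Union> (range A)) $ i $ j"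
  by (simp add: sums_def)
qed

text \<open>The starting points of the edges carry one signed weight for each of the finitely many
  matrix entries. The length bound controls the total weights, and since the edges shrink with
  \<open>h\<close>, replacing line integrals by point values costs nothing in the limit.\<close>

lemma chain_weak_limit:
 fixes L :: "nat => ((real^'n) \<times> (real^'n) \<times> (real^'m)) list"
 assumes M: "ALL h. len (L h) <= M"
  and L: "ALL h. \<forall>(p, q, th)\<in>set (L h). norm p <= r & norm (q - p) <= 1 / Suc h"
 obtains s T where "strict_mono s" "vector_measure T" "compactly_supported T"
  "ALL j w. test_form 1 w --> (%h. cl1 (L (s h)) j w) \<longlonglongrightarrow> current_of_measure T j w"
proof -
 define N where "N h = length (L h)" for h
 define x where "x h l = fst (L h ! l)" for h l
 define d where "d h l = fst (snd (L h ! l)) - x h l" for h l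
 define th where "th h l = snd (snd (L h ! l))" for h l
 define a where "a k h l = th h l $ snd k * d h l $ fst k" for k :: "'n \<times> 'm" and h l
 have Ll: "(x h l, x h l + d h l, th h l) = L h ! l" for h l by (simp add: x_def d_def th_def)
 have mem: "norm (x h l) <= r" "norm (d h l) <= 1 / Suc h" if "l < N h" for h l
 proof -
  have "(x h l, x h l + d h l, th h l) \<in> set (L h)" unfolding Ll using that by (simp add: N_def)
  from L[rule_format, OF this] show "norm (x h l) <= r" "norm (d h l) <= 1 / Suc h" by simp_all
 qed
 have slist: "(\<Sum>(p, q, t)\<leftarrow>L h. F p q t) = (\<Sum>l<N h. F (x h l) (x h l + d h l) (th h l))" for h and F :: "real^'n => real^'n => real^'m => real"
  unfolding sum_list_map_nth N_def by (rule sum.cong) (simp_all add: Ll[symmetric])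
 have lenN: "(\<Sum>l<N h. norm (th h l) * norm (d h l)) <= M" for h
  using M[rule_format, of h] unfolding len_def slist by simp
 have ab: "(\<Sum>l<N h. \<bar>a k h l\<bar>) <= M" for k h
 proof -
  have "(\<Sum>l<N h. \<bar>a k h l\<bar>) <= (\<Sum>l<N h. norm (th h l) * norm (d h l))"
   by (rule sum_mono) (simp add: a_def abs_mult mult_mono component_le_norm_cart)
  then show ?thesis using lenN[of h] by linarith
 qed
 let ?M = "%s k m1 m2 K. finite_measure m1 & finite_measure m2 &
  sets m1 = sets borel & sets m2 = sets borel & compact K & emeasure m1 (- K) = 0 & emeasure m2 (- K) = 0 &
  (ALL f. continuous_on UNIV f -->
    ((%h. \<Sum>i<N (s h). a k (s h) i * f (x (s h) i)) \<longlonglongrightarrow> (\<integral>x. f x \<partial>m1) - (\<integral>x. f x \<partial>m2)))"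
 obtain s where s: "strict_mono s" and ex: "\<forall>k\<in>UNIV. EX m1 m2 K. ?M s k m1 m2 K"
 proof -
  have 1: "\<forall>k\<in>UNIV. ALL h. (\<Sum>i<N h. \<bar>a k h i\<bar>) <= M" using ab by blast
  have 2: "ALL h. \<forall>i<N h. norm (x h i) <= r" using mem by blast
  show thesis using weak_limit_of_signed_points[OF finite 1 2] by (elim exE conjE) (rule that)
 qed
 obtain m1 m2 :: "'n \<times> 'm => (real^'n) measure" and K where m: "ALL k. ?M s k (m1 k) (m2 k) (K k)"
  using ex unfolding ball_UNIV choice_iff by (elim exE) (rule that)
 define T :: "(real^'n) set => real^'m^'n" where "T A = (\<chi> i j. measure (m1 (i, j)) A - measure (m2 (i, j)) A)" for A
 have vT: "vector_measure T"
  by (rule vector_measure_matI) (simp add: T_def m vector_measure_diff)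
 have cT: "compactly_supported T"
  unfolding compactly_supported_def
 proof (intro exI[of _ "\<Union>k. K k"] conjI ballI impI)
  show "compact (\<Union>k. K k)" using m by (intro compact_UN) auto
  fix A :: "(real^'n) set" assume A: "A \<in> sets borel" "A \<inter> (\<Union>k. K k) = {}"
  have "measure (m1 k) A = 0 & measure (m2 k) A = 0" for k
  proof -
   have mk: "sets (m1 k) = sets borel" "sets (m2 k) = sets borel" "compact (K k)" "emeasure (m1 k) (- K k) = 0" "emeasure (m2 k) (- K k) = 0"
    using m[rule_format, of k] by simp_all
   have "A \<subseteq> - K k" using A(2) by auto
   moreover have "- K k \<in> sets borel" using mk(3) by (simp add: compact_imp_closed borel_open open_Compl)
   ultimately have "emeasure (m1 k) A <= emeasure (m1 k) (- K k)" "emeasure (m2 k) A <= emeasure (m2 k) (- K k)"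
    using mk(1,2) by (simp_all add: emeasure_mono)
   then show ?thesis using mk(4,5) by (simp add: measure_def)
  qed
  then show "T A = 0" by (simp add: T_def vec_eq_iff)
 qed
 have lim: "(%h. cl1 (L (s h)) j w) \<longlonglongrightarrow> current_of_measure T j w" if w: "test_form 1 w" for j w
 proof -
  define f where "f i y = w y (%_. axis i 1)" for i :: 'n and y
  have fc: "continuous_on UNIV (f i)" for i
   unfolding f_def by (rule smooth_continuous[OF test_form_smooth[OF w]])
  have fb: "EX B. ALL y. \<bar>f i y\<bar> <= B" for i
  proof -
   obtain Q where Q: "compact Q" "!!x. x \<notin> Q ==> w x = (%v. 0)" using w by (auto simp: test_form_def)
   have "bounded (f i ` Q)" by (intro compact_imp_bounded compact_continuous_image continuous_on_subset[OF fc] Q(1)) simp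
   then obtain B where B: "!!y. y \<in> Q ==> \<bar>f i y\<bar> <= B" unfolding bounded_iff real_norm_def by blast
   have "\<bar>f i y\<bar> <= max B 0" for y
    by (cases "y \<in> Q") (use B in \<open>auto simp: f_def Q(2) intro: le_max_iff_disj[THEN iffD2]\<close>)
   then show ?thesis by (intro exI[of _ "max B 0"] allI)
  qed
  define A where "A h = (\<Sum>i\<in>UNIV. \<Sum>l<N h. a (i, j) h l * f i (x h l))" for h
  have cT: "current_of_measure T j w = (\<Sum>i\<in>UNIV. (\<integral>y. f i y \<partial>m1 (i, j)) - (\<integral>y. f i y \<partial>m2 (i, j)))"
   unfolding current_of_measure_eq
  proof (rule sum.cong[OF refl])
   fix i :: 'n
   obtain B where B: "ALL y. \<bar>f i y\<bar> <= B" using fb by blast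
   show "signed_integral (%A. T A $ i $ j) (%x. w x (%_. axis i 1)) = (\<integral>y. f i y \<partial>m1 (i, j)) - (\<integral>y. f i y \<partial>m2 (i, j))"
    using signed_integral_diff[of "m1 (i, j)" "m2 (i, j)" "f i" B] m fc B by (simp add: T_def f_def[abs_def])
  qed
  have limA: "(%h. A (s h)) \<longlonglongrightarrow> current_of_measure T j w"
   unfolding A_def cT by (intro tendsto_sum) (use m fc in blast)
  have Aeq: "A h = (\<Sum>l<N h. th h l $ j * (d h l \<bullet> (\<chi> i. f i (x h l))))" for h
   unfolding A_def a_def by (subst sum.swap) (simp add: inner_vec_def sum_distrib_left mult.assoc)
  have ceq: "cl1 (L h) j w = (\<Sum>l<N h. th h l $ j * line_int w (x h l) (x h l + d h l))" for h
   unfolding cl1_def slist ..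
  have M0: "0 <= M" using lenN[of 0] sum_nonneg[of "{..<N 0}" "%l. norm (th 0 l) * norm (d 0 l)"] by auto
  have "(%h. cl1 (L h) j w - A h) \<longlonglongrightarrow> 0"
  proof (rule LIMSEQ_I)
   fix e :: real assume e: "0 < e"
   define e' where "e' = e / (M + 1)"
   have e': "e' > 0" using e M0 by (simp add: e'_def)
   obtain del where del: "del > 0" "ALL p q. norm p <= r --> norm (q - p) < del -->
    \<bar>line_int w p q - (q - p) \<bullet> (\<chi> i. w p (%_. axis i 1))\<bar> <= e' * norm (q - p)"
    by (rule line_int_approx[OF w e'])
   obtain n where n: "1 / Suc n < del" using reals_Archimedean[OF del(1)] by (auto simp: inverse_eq_divide)
   show "EX no. \<forall>h\<ge>no. norm (cl1 (L h) j w - A h - 0) < e"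
   proof (intro exI[of _ n] allI impI)
    fix h assume h: "n <= h"
    then have hn: "1 / Suc h <= 1 / Suc n" by (intro divide_left_mono) simp_all
    have "\<bar>cl1 (L h) j w - A h\<bar> <= (\<Sum>l<N h. e' * (norm (th h l) * norm (d h l)))"
     unfolding Aeq ceq sum_subtractf[symmetric] right_diff_distrib[symmetric]
    proof (rule order_trans[OF sum_abs], rule sum_mono)
     fix l assume "l \<in> {..<N h}"
     then have l: "norm (x h l) <= r" "norm (d h l) < del" using mem[of l h] hn n by auto
     have "\<bar>line_int w (x h l) (x h l + d h l) - d h l \<bullet> (\<chi> i. f i (x h l))\<bar> <= e' * norm (d h l)"
      using del(2)[rule_format, of "x h l" "x h l + d h l"] l by (simp add: f_def)
     then have "\<bar>th h l $ j\<bar> * \<bar>line_int w (x h l) (x h l + d h l) - d h l \<bullet> (\<chi> i. f i (x h l))\<bar> <= norm (th h l) * (e' * norm (d h l))"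
      by (intro mult_mono component_le_norm_cart) simp_all
     then show "\<bar>th h l $ j * (line_int w (x h l) (x h l + d h l) - d h l \<bullet> (\<chi> i. f i (x h l)))\<bar>
      <= e' * (norm (th h l) * norm (d h l))" by (simp add: abs_mult mult.left_commute)
    qed
    also have "... <= e' * M" unfolding sum_distrib_left[symmetric] using lenN e' by (intro mult_left_mono) simp_all
    also have "... < e' * (M + 1)" using e' by simp
    also have "... = e" using M0 by (simp add: e'_def)
    finally show "norm (cl1 (L h) j w - A h - 0) < e" by simp
   qed
  qed
  from tendsto_add[OF LIMSEQ_subseq_LIMSEQ[OF this s] limA] show ?thesis by (simp add: comp_def)
 qed
 show thesis by (rule that[OF s vT cT], intro allI impI, rule lim)
qed

section \<open>Fluxes in terms of components\<close>

lemma C_k_bounded_linear: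
 assumes L: "bounded_linear L"
 shows "C_k k f ==> C_k k (%x. L (f x))"
proof (induction k arbitrary: f)
 case 0
 then show ?case by (simp add: bounded_linear.continuous_on[OF L])
next
 case (Suc k)
 have d: "(f has_derivative frechet_derivative f (at x)) (at x)" for x
  using Suc.prems by (simp add: frechet_derivative_works[symmetric])
 have d': "((%x. L (f x)) has_derivative (%h. L (frechet_derivative f (at x) h))) (at x)" for x
  using bounded_linear.has_derivative[OF L d] .
 show ?case by (rule C_k_SucI[OF d']) (rule Suc.IH, use Suc.prems in simp)
qed

lemma smooth_bounded_linear: "bounded_linear L ==> smooth f ==> smooth (%x. L (f x))"
 by (simp add: smooth_def C_k_bounded_linear)

lemma frechet_derivative_bounded_linear:
 assumes "bounded_linear L" "smooth f"
 shows "frechet_derivative (%x. L (f x)) (at x) v = L (frechet_derivative f (at x) v)"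
 using frechet_derivative_at[OF bounded_linear.has_derivative[OF assms(1) smooth_has_derivative[OF assms(2)]]]
 by (simp add: fun_eq_iff)

lemma test_function_bounded_linear:
 assumes "bounded_linear L" "test_function f"
 shows "test_function (%x. L (f x))"
proof -
 obtain K where K: "compact K" "ALL x. x \<notin> K --> f x = 0" and s: "smooth f"
  using assms(2) by (auto simp: test_function_def)
 show ?thesis
  unfolding test_function_def
  by (intro conjI exI[of _ K] smooth_bounded_linear[OF assms(1) s] K(1))
    (simp add: K(2) linear_0[OF bounded_linear.linear[OF assms(1)]])
qed

text \<open>The boundary of a flux is minus its divergence, hence the order of the two
  measures.\<close>

definition demand_of :: "((real^'n) set => real^'m) => ((real^'n) set => real^'m) => 'm => (real^'n => real) => real" where
 "demand_of \<mu>m \<mu>p j f = signed_integral (%A. \<mu>p A $ j) f - signed_integral (%A. \<mu>m A $ j) f"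

lemma current_of_measure_dform:
 "current_of_measure T j (dform f) = (\<Sum>i\<in>UNIV. signed_integral (%A. T A $ i $ j) (%x. frechet_derivative f (at x) (axis i 1)))"
 by (simp add: current_of_measure_eq dform_eq)

text \<open>Test functions with a single non-zero component separate the materials, and each
  resulting equation evaluates one column of \<open>T\<close> on exact 1-forms.\<close>

lemma multi_material_flux_iff:
 fixes T :: "(real^'n) set => real^'m^'n"
 shows "multi_material_flux T \<mu>m \<mu>p \<longleftrightarrow> vector_measure T & compactly_supported T &
  (ALL j f. test_function f --> current_of_measure T j (dform f) = demand_of \<mu>m \<mu>p j f)"
proof -
 have bl: "bounded_linear (%y :: real^'m. y $ j)" for j by (rule bounded_linear_vec_nth)
 have ba: "bounded_linear (%t. axis j t :: real^'m)" for j
 proof -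
  have "(%t. axis j t :: real^'m) = (%t. t *\<^sub>R axis j 1)" by (rule ext) (simp add: vec_eq_iff axis_def)
  from back_subst[of bounded_linear, OF bounded_linear_scaleR_left this[symmetric]] show ?thesis .
 qed
 have div: "divergence T \<Phi> = - (\<Sum>j\<in>UNIV. current_of_measure T j (dform (%x. \<Phi> x $ j)))" if "test_function \<Phi>" for \<Phi>
 proof -
  have s: "smooth \<Phi>" using that by (simp add: test_function_def)
  show ?thesis
   unfolding divergence_def measure_action_mat current_of_measure_dform frechet_derivative_bounded_linear[OF bl s]
   by (subst sum.swap) simp
 qed
 have dem: "measure_action \<mu>m \<Phi> - measure_action \<mu>p \<Phi> = - (\<Sum>j\<in>UNIV. demand_of \<mu>m \<mu>p j (%x. \<Phi> x $ j))" for \<Phi>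
  by (simp add: measure_action_vec demand_of_def sum_subtractf)
 have "(\<forall>\<Phi>. test_function \<Phi> --> divergence T \<Phi> = measure_action \<mu>m \<Phi> - measure_action \<mu>p \<Phi>) \<longleftrightarrow>
  (ALL j f. test_function f --> current_of_measure T j (dform f) = demand_of \<mu>m \<mu>p j f)" (is "?l \<longleftrightarrow> ?r")
 proof
  assume l: ?l
  show ?r
  proof (intro allI impI)
   fix j and f :: "real^'n => real" assume f: "test_function f"
   have t: "test_function (%x. axis j (f x) :: real^'m)" by (rule test_function_bounded_linear[OF ba f])
   have a: "(%x. axis j (f x) $ k) = (if k = j then f else (%x. 0))" for k by (cases "k = j") (simp_all add: axis_def)
   have d0: "current_of_measure T k (dform (%x. 0)) = 0" for k
    by (simp add: current_of_measure_dform)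
   have m0: "demand_of \<mu>m \<mu>p k (%x. 0) = 0" for k by (simp add: demand_of_def)
   have "(\<Sum>k\<in>UNIV. current_of_measure T k (dform (%x. axis j (f x) $ k))) = (\<Sum>k\<in>UNIV. demand_of \<mu>m \<mu>p k (%x. axis j (f x) $ k))"
    using l[rule_format, OF t] unfolding div[OF t] dem by simp
   moreover have "(\<Sum>k\<in>UNIV. current_of_measure T k (dform (%x. axis j (f x) $ k))) = (\<Sum>k\<in>UNIV. if k = j then current_of_measure T j (dform f) else 0)"
    by (rule sum.cong) (simp_all add: a d0)
   moreover have "(\<Sum>k\<in>UNIV. demand_of \<mu>m \<mu>p k (%x. axis j (f x) $ k)) = (\<Sum>k\<in>UNIV. if k = j then demand_of \<mu>m \<mu>p j f else 0)"
    by (rule sum.cong) (simp_all add: a m0)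
   ultimately show "current_of_measure T j (dform f) = demand_of \<mu>m \<mu>p j f" by simp
  qed
 next
  assume r: ?r
  show ?l
  proof (intro allI impI)
   fix \<Phi> :: "real^'n => real^'m" assume t: "test_function \<Phi>"
   show "divergence T \<Phi> = measure_action \<mu>m \<Phi> - measure_action \<mu>p \<Phi>"
    unfolding div[OF t] dem using r test_function_bounded_linear[OF bl t] by simp
  qed
 qed
 then show ?thesis unfolding multi_material_flux_def by simp
qed

section \<open>The demand as a functional and its discretizations\<close>

definition bounded_continuous :: "('a::euclidean_space => real) => bool" where
 "bounded_continuous f \<longleftrightarrow> continuous_on UNIV f & (EX B. ALL x. \<bar>f x\<bar> <= B)"

lemma test_function_bounded_continuous:
 assumes "test_function f" shows "bounded_continuous f"
proof -
 obtain K where K: "compact K" "!!x. x \<notin> K ==> f x = 0" and s: "smooth f"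
  using assms by (auto simp: test_function_def)
 have "bounded (f ` K)" by (intro compact_imp_bounded compact_continuous_image smooth_continuous[OF s] K(1))
 then obtain B where B: "!!y. y \<in> K ==> \<bar>f y\<bar> <= B" unfolding bounded_iff real_norm_def by blast
 have "\<bar>f y\<bar> <= max B 0" for y
  by (cases "y \<in> K") (use B K(2) in \<open>auto intro: le_max_iff_disj[THEN iffD2]\<close>)
 then show ?thesis unfolding bounded_continuous_def using smooth_continuous[OF s] by (intro conjI exI[of _ "max B 0"] allI)
qed

lemma bounded_continuous_const: "bounded_continuous (%x. c)"
 unfolding bounded_continuous_def by (intro conjI continuous_on_const exI[of _ "\<bar>c\<bar>"] allI) simp

text \<open>What is used of the two measures, one functional for each material: finite linearity, a
  total mass bound that only sees the ball of radius \<open>r0\<close>, and vanishing on constants,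
  which expresses compatibility. Families are indexed by points because the indices in use are grid
  points.\<close>

locale demand =
 fixes nu :: "'m::finite => ('a::euclidean_space => real) => real" and r0 N :: real
 assumes nu_sum: "finite I ==> (!!i. i \<in> I ==> bounded_continuous (f i)) ==>
   nu j (%x. \<Sum>i\<in>(I :: 'a set). c i * f i x) = (\<Sum>i\<in>I. c i * nu j (f i))"
  and nu_bound: "finite I ==> (!!i. i \<in> I ==> bounded_continuous (f i)) ==>
   (!!x. norm x <= r0 ==> (\<Sum>i\<in>I. \<bar>f i x\<bar>) <= B) ==> (\<Sum>i\<in>I. \<bar>nu j (f i)\<bar>) <= B * N"
  and nu_1: "nu j (%x. 1) = 0" and r0: "r0 >= 1" and N: "N >= 0"
begin

lemma nu_diff:
 assumes "bounded_continuous f" "bounded_continuous g"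
 shows "nu j (%x. f x - g x) = nu j f - nu j g" "bounded_continuous (%x. f x - g x)"
proof -
 \<comment> \<open>Indices are points, so a second index besides 0 has to be found in the
   space.\<close>
 obtain b :: 'a where "b \<in> Basis" using nonempty_Basis by blast
 then have ab: "0 ~= b" using nonzero_Basis by blast
 have "nu j (%x. \<Sum>i\<in>{0, b}. (if i = 0 then 1 else - 1) * (if i = 0 then f else g) x)
  = (\<Sum>i\<in>{0, b}. (if i = 0 then 1 else - 1) * nu j (if i = 0 then f else g))"
  by (rule nu_sum) (use assms in auto)
 then show "nu j (%x. f x - g x) = nu j f - nu j g" using ab by simp
 obtain A B where A: "ALL x. \<bar>f x\<bar> <= A" and B: "ALL x. \<bar>g x\<bar> <= B" using assms by (auto simp: bounded_continuous_def)
 have "\<bar>f x - g x\<bar> <= A + B" for x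
  by (rule order_trans[OF abs_triangle_ineq4 add_mono[OF A[rule_format] B[rule_format]]])
 then show "bounded_continuous (%x. f x - g x)"
  using assms unfolding bounded_continuous_def by (auto intro: continuous_on_diff)
qed

lemma nu_abs_le:
 assumes "bounded_continuous f" "!!x. norm x <= r0 ==> \<bar>f x\<bar> <= B"
 shows "\<bar>nu j f\<bar> <= B * N"
 using nu_bound[of "{0 :: 'a}" "%_. f" B j] assms by simp

lemma nu_cong:
 assumes "bounded_continuous f" "bounded_continuous g" "!!x. norm x <= r0 ==> f x = g x"
 shows "nu j f = nu j g"
 using nu_abs_le[OF nu_diff(2)[OF assms(1,2)], of 0 j] nu_diff(1)[OF assms(1,2), of j] assms(3) by simp

text \<open>A discretization at scale \<open>d\<close>: point masses of total variation at most
  \<open>N\<close>, whose error on \<open>f\<close> is \<open>N\<close> times the oscillation of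
  \<open>f\<close> over distance \<open>d\<close>. Constants have oscillation 0, so the masses
  balance exactly.\<close>

definition near_demand :: "real => 'a set => ('m => 'a => real) => bool" where
 "near_demand d V c \<longleftrightarrow> finite V & V \<subseteq> cball 0 (r0 + 1) & (ALL j. (\<Sum>v\<in>V. \<bar>c j v\<bar>) <= N) &
   (ALL j f e. bounded_continuous f --> (ALL x v. norm x <= r0 --> norm (x - v) <= d --> \<bar>f v - f x\<bar> <= e) -->
    \<bar>(\<Sum>v\<in>V. c j v * f v) - nu j f\<bar> <= e * N)"

lemma near_demand_sum: assumes "near_demand d V c" shows "(\<Sum>v\<in>V. c j v) = 0"
proof -
 have "\<bar>(\<Sum>v\<in>V. c j v * 1) - nu j (%x. 1)\<bar> <= 0 * N"
  using assms[unfolded near_demand_def, THEN conjunct2, THEN conjunct2, THEN conjunct2, rule_format, of "%x. 1" 0 j]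
  by (simp add: bounded_continuous_const)
 then show ?thesis by (simp add: nu_1)
qed

text \<open>Pairing the weights with \<open>f\<close> amounts to applying \<open>nu j\<close> to the
  interpolation of \<open>f\<close> by the partition of unity, which differs from \<open>f\<close>
  by at most the oscillation where \<open>nu\<close> looks. Grid points beyond \<open>r0 + 1\<close>
  have weight 0, since their functions vanish there.\<close>

lemma grid_near_demand:
 assumes g: "grid_partition C d r V lam" and r: "r0 <= r" "d <= 1"
 shows "near_demand d {v\<in>V. norm v <= r0 + 1} (%j v. nu j (lam v))"
  "!!v j. norm v > r0 + 1 ==> nu j (lam v) = 0"
proof -
 have fV: "finite V" and tf: "!!v. test_function (lam v)" and l0: "!!v x. 0 <= lam v x"
  and le1: "!!x. (\<Sum>v\<in>V. lam v x) <= 1" and eq1: "!!x. norm x <= r ==> (\<Sum>v\<in>V. lam v x) = 1"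
  and sp: "!!v x. lam v x ~= 0 ==> norm (x - v) <= d"
  using g unfolding grid_partition_def by blast+
 have bc: "bounded_continuous (lam v)" for v by (rule test_function_bounded_continuous[OF tf])
 show far: "nu j (lam v) = 0" if v: "norm v > r0 + 1" for v j
 proof -
  have "lam v x = 0" if "norm x <= r0" for x
  proof (rule ccontr)
   assume "lam v x ~= 0"
   then have "norm (x - v) <= 1" using sp r(2) by fastforce
   then have "norm v <= norm x + 1" using norm_triangle_ineq2[of v x] by (simp add: norm_minus_commute)
   then show False using v that by simp
  qed
  then have "\<bar>nu j (lam v)\<bar> <= 0 * N" by (intro nu_abs_le[OF bc]) simp
  then show ?thesis by simp
 qed
 define V' where "V' = {v\<in>V. norm v <= r0 + 1}"
 have VV: "(\<Sum>v\<in>V'. F v) = (\<Sum>v\<in>V. F v)" if "!!v. norm v > r0 + 1 ==> F v = 0" for F :: "'a => real"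
  by (rule sum.mono_neutral_left[OF fV]) (use that in \<open>auto simp: V'_def not_le\<close>)
 show "near_demand d V' (%j v. nu j (lam v))"
  unfolding near_demand_def
 proof (intro conjI allI impI)
  show "finite V'" "V' \<subseteq> cball 0 (r0 + 1)" using fV by (auto simp: V'_def)
  fix j
  have "(\<Sum>v\<in>V'. \<bar>nu j (lam v)\<bar>) = (\<Sum>v\<in>V. \<bar>nu j (lam v)\<bar>)" by (rule VV) (simp add: far)
  also have "... <= 1 * N" by (rule nu_bound[OF fV bc]) (simp add: l0 le1)
  finally show "(\<Sum>v\<in>V'. \<bar>nu j (lam v)\<bar>) <= N" by simp
  fix f :: "'a => real" and e
  assume f: "bounded_continuous f" "ALL x v. norm x <= r0 --> norm (x - v) <= d --> \<bar>f v - f x\<bar> <= e"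
  define \<psi> where "\<psi> x = (\<Sum>v\<in>V. f v * lam v x)" for x
  have "(\<Sum>v\<in>V'. nu j (lam v) * f v) = (\<Sum>v\<in>V. f v * nu j (lam v))"
   by (subst VV) (simp_all add: far mult.commute)
  also have "... = nu j \<psi>" unfolding \<psi>_def by (rule nu_sum[symmetric, OF fV bc])
  finally have 1: "(\<Sum>v\<in>V'. nu j (lam v) * f v) = nu j \<psi>" .
  have b\<psi>: "bounded_continuous \<psi>"
   unfolding bounded_continuous_def
  proof (intro conjI exI[of _ "\<Sum>v\<in>V. \<bar>f v\<bar>"] allI)
   show "continuous_on UNIV \<psi>" unfolding \<psi>_def
    using bc by (intro continuous_on_sum continuous_on_mult continuous_on_const) (simp add: bounded_continuous_def)
   fix x
   have "lam v x <= 1" if "v \<in> V" for v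
    using member_le_sum[OF that _ fV, of "%v. lam v x"] l0 le1[of x] by simp
   then have "\<bar>f v * lam v x\<bar> <= \<bar>f v\<bar>" if "v \<in> V" for v
    using that l0[of v x] by (simp add: abs_mult mult_left_le)
   then show "\<bar>\<psi> x\<bar> <= (\<Sum>v\<in>V. \<bar>f v\<bar>)"
    unfolding \<psi>_def by (intro order_trans[OF sum_abs] sum_mono)
  qed
  have "\<bar>nu j (%x. \<psi> x - f x)\<bar> <= e * N"
  proof (rule nu_abs_le[OF nu_diff(2)[OF b\<psi> f(1)]])
   fix x :: 'a assume x: "norm x <= r0"
   have "\<psi> x - f x = (\<Sum>v\<in>V. (f v - f x) * lam v x)"
    using eq1[of x] x r(1) by (simp add: \<psi>_def left_diff_distrib sum_subtractf sum_distrib_left[symmetric])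
   also have "\<bar>...\<bar> <= (\<Sum>v\<in>V. e * lam v x)"
   proof (rule order_trans[OF sum_abs], rule sum_mono)
    fix v
    show "\<bar>(f v - f x) * lam v x\<bar> <= e * lam v x"
     using f(2) x sp[of v x] l0[of v x] by (cases "lam v x = 0") (auto simp: abs_mult intro: mult_right_mono)
   qed
   also have "... = e" using eq1[of x] x r(1) by (simp add: sum_distrib_left[symmetric])
   finally show "\<bar>\<psi> x - f x\<bar> <= e" .
  qed
  then show "\<bar>(\<Sum>v\<in>V'. nu j (lam v) * f v) - nu j f\<bar> <= e * N"
   unfolding 1 by (simp only: nu_diff(1)[OF b\<psi> f(1)])
 qed
qed

end

lemma demand_demand_of:
 fixes \<mu>m \<mu>p :: "(real^'n) set => real^'m"
 assumes vm: "vector_measure \<mu>m" and cm: "compactly_supported \<mu>m"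
  and vp: "vector_measure \<mu>p" and cp: "compactly_supported \<mu>p" and comp: "compatible \<mu>m \<mu>p"
 obtains r0 N where "demand (demand_of \<mu>m \<mu>p) r0 N"
proof -
 obtain Km where Km: "compact Km" "!!A. A \<in> sets borel ==> A \<inter> Km = {} ==> \<mu>m A = 0"
  using cm by (auto simp: compactly_supported_def)
 obtain Kp where Kp: "compact Kp" "!!A. A \<in> sets borel ==> A \<inter> Kp = {} ==> \<mu>p A = 0"
  using cp by (auto simp: compactly_supported_def)
 have "bounded (Km \<union> Kp)" using Km(1) Kp(1) by (simp add: compact_imp_bounded)
 then obtain b where b: "\<forall>x\<in>Km \<union> Kp. norm x <= b" unfolding bounded_iff by blast
 define r0 where "r0 = max b 1"
 have bl: "bounded_linear (%y :: real^'m. y $ j)" for j by (rule bounded_linear_vec_nth)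
 have vmj: "vector_measure (%A. \<mu>m A $ j)" and vpj: "vector_measure (%A. \<mu>p A $ j)" for j
  using vector_measure_linear[OF vm bl] vector_measure_linear[OF vp bl] .
 \<comment> \<open>Summed over the materials to have one bound for all of them.\<close>
 define N where "N = (\<Sum>j\<in>UNIV. total_variation (%A. \<mu>p A $ j) + total_variation (%A. \<mu>m A $ j))"
 have tv0: "0 <= total_variation \<nu>" for \<nu> :: "(real^'n) set => real" by (simp add: total_variation_def)
 have tvN: "total_variation (%A. \<mu>p A $ j) + total_variation (%A. \<mu>m A $ j) <= N" for j
  unfolding N_def by (rule member_le_sum) (simp_all add: tv0)
 have "demand (demand_of \<mu>m \<mu>p) r0 N"
 proof
  fix I :: "(real^'n) set" and f :: "real^'n => real^'n => real" and c j
  assume I: "finite I" and f: "!!i. i \<in> I ==> bounded_continuous (f i)"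
  have "\<forall>i\<in>I. EX b. ALL x. \<bar>f i x\<bar> <= b" using f unfolding bounded_continuous_def by blast
  then obtain B where B: "\<forall>i\<in>I. ALL x. \<bar>f i x\<bar> <= B i" by (rule bchoice[THEN exE])
  have "signed_integral \<nu> (%x. \<Sum>i\<in>I. c i * f i x) = (\<Sum>i\<in>I. c i * signed_integral \<nu> (f i))"
   if "vector_measure \<nu>" for \<nu>
   unfolding signed_integral_scale[symmetric]
  proof (rule signed_integral_sum[OF that])
   show "continuous_on UNIV (%x. c i * f i x)" if "i \<in> I" for i
    using f[OF that] by (intro continuous_on_mult continuous_on_const) (simp add: bounded_continuous_def)
   show "\<bar>c i * f i x\<bar> <= \<bar>c i\<bar> * B i" if "i \<in> I" for i x
    using B that by (simp add: abs_mult mult_left_mono)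
  qed
  then show "demand_of \<mu>m \<mu>p j (%x. \<Sum>i\<in>I. c i * f i x) = (\<Sum>i\<in>I. c i * demand_of \<mu>m \<mu>p j (f i))"
   by (simp add: demand_of_def vmj vpj right_diff_distrib sum_subtractf)
 next
  fix I :: "(real^'n) set" and f :: "real^'n => real^'n => real" and B j
  assume I: "finite I" and f: "!!i. i \<in> I ==> bounded_continuous (f i)"
   and fB: "!!x. norm x <= r0 ==> (\<Sum>i\<in>I. \<bar>f i x\<bar>) <= B"
  have "\<forall>i\<in>I. EX b. ALL x. \<bar>f i x\<bar> <= b" using f unfolding bounded_continuous_def by blast
  then obtain b' where b': "\<forall>i\<in>I. ALL x. \<bar>f i x\<bar> <= b' i" by (rule bchoice[THEN exE])
  have fc: "continuous_on UNIV (f i)" if "i \<in> I" for i using f[OF that] by (simp add: bounded_continuous_def)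
  have nK: "norm x <= r0" if "x \<in> Km \<union> Kp" for x using b that by (simp add: r0_def le_max_iff_disj)
  have "norm (0 :: real^'n) <= r0" by (simp add: r0_def le_max_iff_disj)
  from order_trans[OF sum_nonneg fB[OF this]] have B0: "0 <= B" by simp
  have p: "(\<Sum>i\<in>I. \<bar>signed_integral (%A. \<mu>p A $ j) (f i)\<bar>) <= B * total_variation (%A. \<mu>p A $ j)"
  proof (rule sum_signed_integral_bound[OF vpj Kp(1) _ fc])
   show "\<mu>p A $ j = 0" if "A \<in> sets borel" "A \<inter> Kp = {}" for A using Kp(2)[OF that] by simp
   show "\<bar>f i x\<bar> <= b' i" if "i \<in> I" for i x using b' that by blast
   show "(\<Sum>i\<in>I. \<bar>f i x\<bar>) <= B" if "x \<in> Kp" for x by (rule fB[OF nK]) (use that in simp)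
  qed
  have m: "(\<Sum>i\<in>I. \<bar>signed_integral (%A. \<mu>m A $ j) (f i)\<bar>) <= B * total_variation (%A. \<mu>m A $ j)"
  proof (rule sum_signed_integral_bound[OF vmj Km(1) _ fc])
   show "\<mu>m A $ j = 0" if "A \<in> sets borel" "A \<inter> Km = {}" for A using Km(2)[OF that] by simp
   show "\<bar>f i x\<bar> <= b' i" if "i \<in> I" for i x using b' that by blast
   show "(\<Sum>i\<in>I. \<bar>f i x\<bar>) <= B" if "x \<in> Km" for x by (rule fB[OF nK]) (use that in simp)
  qed
  have "(\<Sum>i\<in>I. \<bar>demand_of \<mu>m \<mu>p j (f i)\<bar>) <= (\<Sum>i\<in>I. \<bar>signed_integral (%A. \<mu>p A $ j) (f i)\<bar> + \<bar>signed_integral (%A. \<mu>m A $ j) (f i)\<bar>)"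
   unfolding demand_of_def by (rule sum_mono) (rule abs_triangle_ineq4)
  also have "... <= B * (total_variation (%A. \<mu>p A $ j) + total_variation (%A. \<mu>m A $ j))"
   using add_mono[OF p m] by (simp only: sum.distrib distrib_left)
  also have "... <= B * N" using B0 tvN by (rule mult_left_mono[rotated])
  finally show "(\<Sum>i\<in>I. \<bar>demand_of \<mu>m \<mu>p j (f i)\<bar>) <= B * N" .
 next
  fix j
  have ma: "measure_action \<mu> (%x. axis j 1) = signed_integral (%A. \<mu> A $ j) (%x. 1)" for \<mu> :: "(real^'n) set => real^'m"
  proof -
   have "measure_action \<mu> (%x. axis j 1) = (\<Sum>i\<in>UNIV. if i = j then signed_integral (%A. \<mu> A $ j) (%x. 1) else 0)"
    unfolding measure_action_vec by (rule sum.cong) (simp_all add: axis_def)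
   then show ?thesis by simp
  qed
  have "measure_action \<mu>m (%x. axis j 1) = measure_action \<mu>p (%x. axis j 1)"
   using comp by (simp add: compatible_def)
  then show "demand_of \<mu>m \<mu>p j (%x. 1) = 0" by (simp add: demand_of_def ma)
 qed (simp_all add: r0_def N_def sum_nonneg tv0)
 then show thesis by (rule that)
qed

section \<open>Approximation of a flux by discrete fluxes with controlled boundary\<close>

text \<open>The boundary is paired with arbitrary functions on arbitrary points. This makes it
  purely combinatorial: indicator potentials and compositions with the projection onto a ball are
  allowed.\<close>

definition bd :: "('p \<times> 'p \<times> (real^'m)) list => 'm => ('p => real) => real" where
 "bd L j f = (\<Sum>(p, q, t)\<leftarrow>L. t $ j * (f q - f p))"

lemma bd_append [simp]: "bd (L @ L') j f = bd L j f + bd L' j f"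
 by (simp add: bd_def)

lemma len_append [simp]: "len (L @ L') = len L + len L'"
 by (simp add: len_def)

lemma len_nonneg: "0 <= len L"
 unfolding len_def by (induction L) auto

lemma cl1_dform: "smooth f ==> cl1 L j (dform f) = bd L j f"
 by (simp add: cl1_def bd_def line_int_dform)

lemma sum_list_concat_map: "sum_list (map f (concat (map g xs))) = (\<Sum>x\<leftarrow>xs. sum_list (map f (g x)) :: 'b::comm_monoid_add)"
 by (induction xs) auto

lemma norm_vec_le_sum: "norm (x :: real^'m) <= (\<Sum>j\<in>UNIV. \<bar>x $ j\<bar>)"
 by (rule norm_le_l1_cart)

lemma sum_list_sum_swap: "(\<Sum>x\<leftarrow>xs. \<Sum>i\<in>I. f x i) = (\<Sum>i\<in>I. \<Sum>x\<leftarrow>xs. f x i :: real)"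
 by (induction xs) (simp_all add: sum.distrib)

text \<open>With the signs of the values as coefficients, the sum is a single value of
  \<open>R\<close>, so the number of forms does not enter the bound.\<close>

lemma mass_bound_sum:
 fixes R :: "('a::euclidean_space, 'm::finite) current"
 assumes R: "polyhedral_current 1 R" "mass 1 R < ennreal e" and I: "finite I"
  and w: "!!i. i \<in> I ==> test_form 1 (w i)"
  and B: "B > 0" "!!x v. (\<Sum>i\<in>I. \<bar>w i x v\<bar>) <= B * norm (v 0)"
 shows "(\<Sum>i\<in>I. \<bar>R j (w i)\<bar>) <= B * e"
proof -
 define s where "s i = sgn (R j (w i))" for i
 have t: "test_form 1 (%x v. \<Sum>i\<in>I. s i * w i x v)" by (rule test_form_sum[OF I w])
 have "(\<Sum>i\<in>I. \<bar>R j (w i)\<bar>) = (\<Sum>i\<in>I. s i * R j (w i))" by (simp add: s_def abs_sgn mult.commute)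
 also have "... = R j (%x v. \<Sum>i\<in>I. s i * w i x v)"
  by (rule current_of_chain_linear[OF R(1) disjI1[OF refl] I w t, symmetric])
 also have "... <= B * e"
 proof (rule order_trans[OF abs_ge_self mass_bound[OF R t B(1)]])
  fix x :: 'a and v :: "nat => 'a"
  have "\<bar>\<Sum>i\<in>I. s i * w i x v\<bar> <= (\<Sum>i\<in>I. \<bar>w i x v\<bar>)"
   by (rule order_trans[OF sum_abs], rule sum_mono) (simp add: s_def abs_mult abs_sgn_eq)
  then show "\<bar>\<Sum>i\<in>I. s i * w i x v\<bar> <= B * norm (v 0)" using B(2)[of x v] by linarith
 qed
 finally show ?thesis .
qed

lemma dform_mult:
 assumes "smooth f" "smooth g"
 shows "dform (%x. f x * g x) x v = f x * dform g x v + g x * dform f x v"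
proof -
 have "((%x. f x * g x) has_derivative (%h. f x * frechet_derivative g (at x) h + frechet_derivative f (at x) h * g x)) (at x)"
  by (rule has_derivative_mult[OF smooth_has_derivative[OF assms(1)] smooth_has_derivative[OF assms(2)]])
 from frechet_derivative_at[OF this] show ?thesis by (simp add: dform_eq fun_eq_iff mult.commute)
qed

lemma dform_sum:
 assumes "!!i. i \<in> I ==> smooth (f i)"
 shows "dform (%x. \<Sum>i\<in>I. f i x) x v = (\<Sum>i\<in>I. dform (f i) x v)"
proof -
 have "((%x. \<Sum>i\<in>I. f i x) has_derivative (%h. \<Sum>i\<in>I. frechet_derivative (f i) (at x) h)) (at x)"
  by (rule has_derivative_sum[OF smooth_has_derivative[OF assms]])
 from frechet_derivative_at[OF this] show ?thesis by (simp add: dform_eq fun_eq_iff)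
qed

lemma polyhedral_current_zero:
 fixes R :: "('a::euclidean_space, 'm::finite) current"
 assumes R: "polyhedral_current 1 R" and w: "test_form 1 w" "!!x v. w x v = 0"
 shows "R j w = 0"
proof -
 have z: "w = (%x v. \<Sum>i\<in>({}::unit set). 0 * w x v)" by (simp add: fun_eq_iff w(2))
 have "R j (%x v. \<Sum>i\<in>({}::unit set). 0 * w x v) = (\<Sum>i\<in>({}::unit set). 0 * R j w)"
  by (rule current_of_chain_linear[OF R disjI1[OF refl]]) (use w(1) z in simp_all)
 then show ?thesis using z by simp
qed

lemma polyhedral_current_sum:
 fixes R :: "('a::euclidean_space, 'm::finite) current"
 assumes R: "polyhedral_current 1 R" and I: "finite I" and w: "!!i. i \<in> I ==> test_form 1 (w i)"
  and h: "!!x v. h x v = (\<Sum>i\<in>I. w i x v)"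
 shows "R j h = (\<Sum>i\<in>I. R j (w i))"
proof -
 have t: "test_form 1 (%x v. \<Sum>i\<in>I. 1 * w i x v)" by (rule test_form_sum[OF I w])
 have "h = (%x v. \<Sum>i\<in>I. 1 * w i x v)" by (simp add: fun_eq_iff h)
 moreover have "R j (%x v. \<Sum>i\<in>I. 1 * w i x v) = (\<Sum>i\<in>I. 1 * R j (w i))"
  by (rule current_of_chain_linear[OF R disjI1[OF refl] I w t])
 ultimately show ?thesis by simp
qed

text \<open>Each endpoint is joined to the grid points around it with the weights of the partition
  of unity; as these sum to 1, the remaining boundary sits on the grid. The length involves the sum
  of the multiplicities and not \<open>len L\<close>, so the mesh has to be chosen after
  \<open>L\<close>.\<close>

lemma snap_to_grid:
 fixes L :: "('a::euclidean_space \<times> 'a \<times> (real^'m::finite)) list"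
 assumes V: "finite V" and l: "ALL v x. 0 <= lam v x" "ALL v x. lam v x ~= 0 --> norm (x - v) <= d"
  and one: "\<forall>(p, q, t)\<in>set L. (\<Sum>v\<in>V. lam v p) = (1::real) & (\<Sum>v\<in>V. lam v q) = 1"
 obtains W where "ALL j f. bd W j f = bd L j f - (\<Sum>v\<in>V. bd L j (lam v) * f v)"
  "len W <= 2 * d * (\<Sum>(p, q, t)\<leftarrow>L. norm t)"
proof -
 obtain vs where vs: "set vs = V" "distinct vs" using finite_distinct_list[OF V] by blast
 have sv: "(\<Sum>v\<leftarrow>vs. F v) = (\<Sum>v\<in>V. F v)" for F :: "'a => real"
  using sum_list_distinct_conv_sum_set[OF vs(2)] vs(1) by simp
 define W where "W = concat (map (%(p, q, t). map (%v. (v, q, lam v q *\<^sub>R t)) vs @ map (%v. (v, p, - (lam v p *\<^sub>R t))) vs) L)"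
 have 1: "bd W j f = bd L j f - (\<Sum>v\<in>V. bd L j (lam v) * f v)" for j f
  unfolding W_def using one
 proof (induction L)
  case Nil then show ?case by (simp add: bd_def)
 next
  case (Cons e L)
  obtain p q t where e: "e = (p, q, t)" by (metis prod_cases3)
  have e1: "(\<Sum>v\<in>V. lam v p) = 1" "(\<Sum>v\<in>V. lam v q) = 1" using Cons.prems e by auto
  have "(\<Sum>v\<in>V. lam v q * (f q - f v)) - (\<Sum>v\<in>V. lam v p * (f p - f v)) = f q - f p - (\<Sum>v\<in>V. (lam v q - lam v p) * f v)"
   by (simp add: right_diff_distrib left_diff_distrib sum_subtractf sum_distrib_right[symmetric] e1)
  then have "t $ j * ((\<Sum>v\<in>V. lam v q * (f q - f v)) - (\<Sum>v\<in>V. lam v p * (f p - f v)))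
    = t $ j * (f q - f p) - (\<Sum>v\<in>V. t $ j * (lam v q - lam v p) * f v)"
   unfolding right_diff_distrib[of "t $ j" "f q - f p", symmetric] mult.assoc sum_distrib_left[symmetric]
   by (simp only: right_diff_distrib[of "t $ j", symmetric])
  moreover have "bd (map (%v. (v, q, lam v q *\<^sub>R t)) vs @ map (%v. (v, p, - (lam v p *\<^sub>R t))) vs) j f
    = t $ j * ((\<Sum>v\<in>V. lam v q * (f q - f v)) - (\<Sum>v\<in>V. lam v p * (f p - f v)))"
  proof -
   have "bd (map (%v. (v, q, lam v q *\<^sub>R t)) vs @ map (%v. (v, p, - (lam v p *\<^sub>R t))) vs) j f
    = (\<Sum>v\<in>V. lam v q * t $ j * (f q - f v)) - (\<Sum>v\<in>V. lam v p * t $ j * (f p - f v))"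
    by (simp add: bd_def comp_def sv sum_negf[symmetric])
   then show ?thesis
    unfolding right_diff_distrib[of "t $ j" "sum _ _"] sum_distrib_left by (simp only: mult_ac)
  qed
  ultimately show ?case using Cons
   by (simp add: e bd_def distrib_right sum.distrib)
 qed
 have ln: "len W <= 2 * d * (\<Sum>(p, q, t)\<leftarrow>L. norm t)"
  unfolding W_def using one
 proof (induction L)
  case Nil then show ?case by (simp add: len_def)
 next
  case (Cons e L)
  obtain p q t where e: "e = (p, q, t)" by (metis prod_cases3)
  have e1: "(\<Sum>v\<in>V. lam v p) = 1" "(\<Sum>v\<in>V. lam v q) = 1" using Cons.prems e by auto
  have s: "(\<Sum>v\<in>V. lam v x * norm t * norm (x - v)) <= d * norm t" if "(\<Sum>v\<in>V. lam v x) = 1" for x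
  proof -
   have "(\<Sum>v\<in>V. lam v x * norm t * norm (x - v)) <= (\<Sum>v\<in>V. lam v x * (norm t * d))"
   proof (rule sum_mono)
    fix v show "lam v x * norm t * norm (x - v) <= lam v x * (norm t * d)"
     using l by (cases "lam v x = 0") (auto intro!: mult_left_mono simp: mult.assoc)
   qed
   also have "... = norm t * d" by (simp only: sum_distrib_right[symmetric] that mult_1)
   finally show ?thesis by (simp add: mult.commute)
  qed
  have "len (map (%v. (v, q, lam v q *\<^sub>R t)) vs @ map (%v. (v, p, - (lam v p *\<^sub>R t))) vs)
   = (\<Sum>v\<in>V. lam v q * norm t * norm (q - v)) + (\<Sum>v\<in>V. lam v p * norm t * norm (p - v))"
   using l by (simp add: len_def comp_def sv)
  also have "... <= 2 * d * norm t" using s[OF e1(1)] s[OF e1(2)] by simp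
  finally show ?case using Cons by (simp add: e distrib_left)
 qed
 show thesis by (rule that[of W]) (use 1 ln in simp_all)
qed

lemma test_function_mult_smooth:
 assumes "test_function f" "smooth g" shows "test_function (%x. f x * g x :: real)"
proof -
 obtain K where K: "compact K" "ALL x. x \<notin> K --> f x = 0" and s: "smooth f"
  using assms(1) by (auto simp: test_function_def)
 show ?thesis
  unfolding test_function_def by (intro conjI exI[of _ K] smooth_mult[OF s assms(2)] K(1)) (simp add: K(2))
qed

lemma test_function_sum:
 assumes "finite I" "!!i. i \<in> I ==> test_function (f i)" shows "test_function (%x. \<Sum>i\<in>I. f i x :: real)"
proof -
 have "\<forall>i\<in>I. EX K. compact K & (ALL x. x \<notin> K --> f i x = 0)" using assms(2) by (simp add: test_function_def)
 then obtain K where K: "\<forall>i\<in>I. compact (K i) & (ALL x. x \<notin> K i --> f i x = 0)" by (rule bchoice[THEN exE])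
 show ?thesis
  unfolding test_function_def
 proof (intro conjI exI[of _ "\<Union>i\<in>I. K i"] allI impI)
  show "smooth (%x. \<Sum>i\<in>I. f i x)" using assms(2) by (intro smooth_sum) (simp add: test_function_def)
  show "compact (\<Union>i\<in>I. K i)" using K assms(1) by (intro compact_UN) auto
  show "(\<Sum>i\<in>I. f i x) = 0" if "x \<notin> (\<Union>i\<in>I. K i)" for x
   using K that by (intro sum.neutral) auto
 qed
qed

text \<open>
 The distributional boundary \<open>x\<close> of a current of small mass, tested against the grid, is the boundary of
 a short graph: the edges \<open>(w, v)\<close> carry \<open>R (chi lam\<^sub>w d lam\<^sub>v)\<close>, and what is left over by the cutoff \<open>chi\<close>
 and by the approximation of \<open>x\<close> is sent to the origin.
\<close>
lemma small_mass_boundary: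
 fixes R :: "('a::euclidean_space, 'm::finite) current"
 assumes C: "C > 0" and r: "r >= 1" and del: "del > 0" "del <= 1"
  and gX: "grid_partition C r r X xi" and gV: "grid_partition C del (3 * r + 1) V lam"
  and R: "polyhedral_current 1 R" "mass 1 R < ennreal eps" and eps: "eps > 0"
 defines "chi \<equiv> %y. \<Sum>u\<in>X. xi u y"
 assumes x: "ALL j. (\<Sum>v\<in>V. x j v) = 0"
  and xR: "ALL j. (\<Sum>v\<in>V. \<bar>x j v - R j (dform (%y. chi y * lam v y))\<bar>) <= eps / (3 * r + 2)"
 obtains W where "ALL j ph. bd W j ph = (\<Sum>v\<in>V. x j v * ph v)" "len W <= real CARD('m) * (7 * C + 1) * eps"
proof -
 have X: "finite X" "!!u. test_function (xi u)" "!!u y. 0 <= xi u y" "!!y. (\<Sum>u\<in>X. xi u y) <= 1"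
  "X \<subseteq> cball 0 (r + r)" "!!u y. xi u y ~= 0 ==> norm (y - u) <= r"
  "!!y h. (\<Sum>u\<in>X. \<bar>frechet_derivative (xi u) (at y) h\<bar>) <= C / r * norm h"
  using gX unfolding grid_partition_def by blast+
 have V: "finite V" "!!v. test_function (lam v)" "!!v y. 0 <= lam v y" "!!y. (\<Sum>v\<in>V. lam v y) <= 1"
  "V \<subseteq> cball 0 (3 * r + 1 + del)" "!!v y. lam v y ~= 0 ==> norm (y - v) <= del"
  "!!y h. (\<Sum>v\<in>V. \<bar>frechet_derivative (lam v) (at y) h\<bar>) <= C / del * norm h"
  "!!y. norm y <= 3 * r + 1 ==> (\<Sum>v\<in>V. lam v y) = 1"
  using gV unfolding grid_partition_def by blast+
 have sX: "smooth (xi u)" and sV: "smooth (lam v)" for u v using X(2) V(2) by (simp_all add: test_function_def)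
 have tchi: "test_function chi" unfolding chi_def by (rule test_function_sum[OF X(1,2)])
 have schi: "smooth chi" using tchi by (simp add: test_function_def)
 have chi01: "0 <= chi y" "chi y <= 1" for y using X(3,4) by (simp_all add: chi_def sum_nonneg)
 \<comment> \<open>The points of \<open>X\<close> lie within \<open>2 r\<close>, and their functions
   reach \<open>r\<close> further.\<close>
 have chi0: "chi y = 0" if "norm y > 3 * r" for y
  unfolding chi_def
 proof (rule sum.neutral, rule ballI)
  fix u assume "u \<in> X"
  then have "norm u <= r + r" using X(5) by auto
  then have "\<not> norm (y - u) <= r" using that norm_triangle_sub[of y u] by auto
  then show "xi u y = 0" using X(6) by blast
 qed
 have dchi: "\<bar>dform chi y h\<bar> <= C / r * norm (h 0)" for y h
 proof -
  have "dform chi y h = (\<Sum>u\<in>X. frechet_derivative (xi u) (at y) (h 0))"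
   unfolding chi_def dform_sum[OF sX] by (simp add: dform_eq)
  then show ?thesis using order_trans[OF sum_abs X(7)] by simp
 qed
 have dl0: "dform (lam v) y h = 0" if "norm (y - v) > del" for v y h
 proof -
  have "lam v x = 0" if "x \<notin> cball v del" for x
   by (rule ccontr) (use that V(6)[of v x] in \<open>simp add: dist_norm norm_minus_commute\<close>)
  then show ?thesis
   unfolding dform_eq by (subst frechet_derivative_eq_0[of "cball v del"])
    (use that in \<open>simp_all add: dist_norm norm_minus_commute\<close>)
 qed
 have ds0: "(\<Sum>v\<in>V. dform (lam v) y h) = 0" if y: "norm y <= 3 * r" for y h
 proof -
  have "((%y. 1 :: real) has_derivative (%h. 0)) (at y)" by simp
  then have "((%y. \<Sum>v\<in>V. lam v y) has_derivative (%h. 0)) (at y)"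
   by (rule has_derivative_transform_within_open[of _ _ _ _ "ball 0 (3 * r + 1)"]) (use y V(8) in auto)
  from frechet_derivative_at[OF this] have "dform (%y. \<Sum>v\<in>V. lam v y) y h = 0"
   by (simp add: dform_eq fun_eq_iff)
  then show ?thesis by (simp add: dform_sum[OF sV])
 qed
 \<comment> \<open>By the product rule \<open>d (chi lam_v)\<close> is
   \<open>\<zeta> v + \<xi> v\<close>, and \<open>\<zeta> v\<close> is the sum of the
   \<open>om w v\<close> over the grid points \<open>w\<close>.\<close>
 define om where "om w v = (%y h. (chi y * lam w y) * dform (lam v) y h)" for w v
 define \<zeta> where "\<zeta> v = (%y h. chi y * dform (lam v) y h)" for v
 define \<xi> where "\<xi> v = (%y h. lam v y * dform chi y h)" for v
 have tom: "test_form 1 (om w v)" for w v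
  unfolding om_def by (rule test_form_mult_dform[OF smooth_mult[OF schi sV] V(2)])
 have t\<zeta>: "test_form 1 (\<zeta> v)" for v unfolding \<zeta>_def by (rule test_form_mult_dform[OF schi V(2)])
 have t\<xi>: "test_form 1 (\<xi> v)" for v unfolding \<xi>_def by (rule test_form_mult_dform[OF sV tchi])
 define \<rho> where "\<rho> j w v = R j (om w v)" for j w v
 define y where "y j v = x j v - R j (\<zeta> v)" for j v
 have R\<zeta>: "R j (\<zeta> v) = (\<Sum>w\<in>V. \<rho> j w v)" for j v
  unfolding \<rho>_def
 proof (rule polyhedral_current_sum[OF R(1) V(1) tom])
  show "\<zeta> v z h = (\<Sum>w\<in>V. om w v z h)" for z h
   by (cases "norm z <= 3 * r")
     (simp_all add: \<zeta>_def om_def sum_distrib_left[symmetric] sum_distrib_right[symmetric] V(8) chi0 not_le)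
 qed
 \<comment> \<open>Where \<open>chi\<close> lives, the \<open>lam v\<close> sum to 1 in a whole
   neighbourhood, so their differentials cancel; this is why the grid partition is taken with radius
   \<open>3 * r + 1\<close>.\<close>
 have \<rho>0: "(\<Sum>v\<in>V. \<rho> j w v) = 0" for j w
 proof -
  have "R j (%z h. \<Sum>v\<in>V. om w v z h) = (\<Sum>v\<in>V. \<rho> j w v)"
   unfolding \<rho>_def by (rule polyhedral_current_sum[OF R(1) V(1) tom]) simp
  moreover have "R j (%z h. \<Sum>v\<in>V. om w v z h) = 0"
  proof (rule polyhedral_current_zero[OF R(1)])
   show "test_form 1 (%z h. \<Sum>v\<in>V. om w v z h)" using test_form_sum[OF V(1) tom, of "%_. 1" "%_. w"] by simp
   show "(\<Sum>v\<in>V. om w v z h) = 0" for z h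
    by (cases "norm z <= 3 * r") (simp_all add: om_def sum_distrib_left[symmetric] ds0 chi0 not_le)
  qed
  ultimately show ?thesis by simp
 qed
 have y0: "(\<Sum>v\<in>V. y j v) = 0" for j
 proof -
  have "(\<Sum>v\<in>V. R j (\<zeta> v)) = (\<Sum>w\<in>V. \<Sum>v\<in>V. \<rho> j w v)" unfolding R\<zeta> by (rule sum.swap)
  then show ?thesis using x by (simp add: y_def sum_subtractf \<rho>0)
 qed
 have \<rho>near: "\<rho> j w v = 0" if "norm (v - w) > 2 * del" for j w v
  unfolding \<rho>_def
 proof (rule polyhedral_current_zero[OF R(1) tom])
  fix z h
  have "norm (z - w) > del \<or> norm (z - v) > del"
   using that norm_triangle_ineq4[of "z - w" "z - v"] by (auto simp: algebra_simps)
  then have "lam w z = 0 \<or> dform (lam v) z h = 0" using V(6) dl0 by fastforce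
  then show "om w v z h = 0" by (auto simp: om_def)
 qed
 have \<rho>sum: "(\<Sum>w\<in>V. \<Sum>v\<in>V. \<bar>\<rho> j w v\<bar>) <= C / del * eps" for j
 proof -
  have "(\<Sum>i\<in>V \<times> V. \<bar>R j ((%(w, v). om w v) i)\<bar>) <= C / del * eps"
  proof (rule mass_bound_sum[OF R])
   fix z and h :: "nat => 'a"
   have "(\<Sum>i\<in>V \<times> V. \<bar>(%(w, v). om w v) i z h\<bar>) = (\<Sum>w\<in>V. lam w z * chi z * (\<Sum>v\<in>V. \<bar>dform (lam v) z h\<bar>))"
    unfolding sum.cartesian_product[symmetric] split_def sum_distrib_left
    by (simp add: sum.cartesian_product split_def om_def abs_mult V(3) chi01 mult_ac)
   also have "... = (\<Sum>w\<in>V. lam w z) * (chi z * (\<Sum>v\<in>V. \<bar>dform (lam v) z h\<bar>))"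
    by (simp add: sum_distrib_right mult.assoc)
   also have "... <= 1 * (1 * (C / del * norm (h 0)))"
    using V(7)[of z "h 0"] by (intro mult_mono V(4) chi01 mult_nonneg_nonneg sum_nonneg V(3)) (simp_all add: dform_eq)
   finally show "(\<Sum>i\<in>V \<times> V. \<bar>(%(w, v). om w v) i z h\<bar>) <= C / del * norm (h 0)" by simp
  qed (use V(1) tom C del in auto)
  then show ?thesis by (simp add: \<rho>_def sum.cartesian_product split_def)
 qed
 have ysum: "(\<Sum>v\<in>V. \<bar>y j v\<bar>) <= eps / (3 * r + 2) + C / r * eps" for j
 proof -
  have dec: "R j (dform (%y. chi y * lam v y)) = R j (\<zeta> v) + R j (\<xi> v)" for v
  proof -
   have "R j (dform (%y. chi y * lam v y)) = (\<Sum>b\<in>UNIV. R j (if b then \<zeta> v else \<xi> v))"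
   proof (rule polyhedral_current_sum[OF R(1) finite])
    show "test_form 1 (if b then \<zeta> v else \<xi> v)" for b by (cases b) (simp_all only: t\<zeta> t\<xi> if_True if_False)
   qed (simp add: UNIV_bool dform_mult[OF schi sV] \<zeta>_def \<xi>_def)
   then show ?thesis by (simp add: UNIV_bool)
  qed
  have "(\<Sum>v\<in>V. \<bar>R j (\<xi> v)\<bar>) <= C / r * eps"
  proof (rule mass_bound_sum[OF R V(1) t\<xi>])
   fix z and h :: "nat => 'a"
   have "(\<Sum>v\<in>V. \<bar>\<xi> v z h\<bar>) = (\<Sum>v\<in>V. lam v z) * \<bar>dform chi z h\<bar>"
    by (simp add: \<xi>_def abs_mult V(3) sum_distrib_right)
   also have "... <= 1 * (C / r * norm (h 0))" by (intro mult_mono V(4) dchi) simp_all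
   finally show "(\<Sum>v\<in>V. \<bar>\<xi> v z h\<bar>) <= C / r * norm (h 0)" by simp
  qed (use C r in simp)
  moreover have "(\<Sum>v\<in>V. \<bar>y j v\<bar>) <= (\<Sum>v\<in>V. \<bar>x j v - R j (dform (%y. chi y * lam v y))\<bar> + \<bar>R j (\<xi> v)\<bar>)"
   by (rule sum_mono) (simp add: y_def dec)
  ultimately show ?thesis using xR[rule_format, of j] by (simp add: sum.distrib)
 qed
 obtain vs where vs: "set vs = V" "distinct vs" using finite_distinct_list[OF V(1)] by blast
 have sv: "(\<Sum>v\<leftarrow>vs. F v) = (\<Sum>v\<in>V. F v)" for F :: "'a => real"
  using sum_list_distinct_conv_sum_set[OF vs(2)] vs(1) by simp
 define W2 where "W2 = concat (map (%w. map (%v. (w, v, \<chi> j. \<rho> j w v)) vs) vs)"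
 \<comment> \<open>The remainder has total weight 0, so joining it to the origin creates no boundary
   there. These edges may have length \<open>3 r + 2\<close>, but the cutoff contributes weights of
   order \<open>C / r * eps\<close>, so the product stays bounded in \<open>r\<close>; the tolerance
   \<open>eps / (3 r + 2)\<close> in the hypothesis compensates in the same way.\<close>
 define W3 where "W3 = map (%v. (0 :: 'a, v, \<chi> j. y j v)) vs"
 have b3: "bd W3 j ph = (\<Sum>v\<in>V. y j v * ph v)" for j ph
  by (simp add: W3_def bd_def comp_def sv right_diff_distrib sum_subtractf sum_distrib_right[symmetric] y0)
 have b2: "bd W2 j ph = (\<Sum>v\<in>V. R j (\<zeta> v) * ph v)" for j ph
 proof -
  have "bd W2 j ph = (\<Sum>w\<in>V. \<Sum>v\<in>V. \<rho> j w v * (ph v - ph w))"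
   by (simp add: W2_def bd_def sum_list_concat_map comp_def sv)
  \<comment> \<open>The starting points drop out because the weights leaving \<open>w\<close> sum to
    0.\<close>
  also have "... = (\<Sum>w\<in>V. \<Sum>v\<in>V. \<rho> j w v * ph v)"
   by (simp add: right_diff_distrib sum_subtractf sum_distrib_right[symmetric] \<rho>0)
  also have "... = (\<Sum>v\<in>V. R j (\<zeta> v) * ph v)"
   unfolding R\<zeta> sum_distrib_right by (rule sum.swap)
  finally show ?thesis .
 qed
 have n: "norm (\<chi> j. f j) <= (\<Sum>j\<in>UNIV. \<bar>f j\<bar>)" for f :: "'m => real"
  using norm_vec_le_sum[of "\<chi> j. f j"] by simp
 have "len W3 = (\<Sum>v\<in>V. norm (\<chi> j. y j v) * norm v)"
  by (simp add: W3_def len_def comp_def sv)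
 also have "... <= (\<Sum>v\<in>V. (\<Sum>j\<in>UNIV. \<bar>y j v\<bar>) * (3 * r + 2))"
 proof (rule sum_mono)
  fix v assume "v \<in> V"
  then have "norm v <= 3 * r + 2" using V(5) del by auto
  then show "norm (\<chi> j. y j v) * norm v <= (\<Sum>j\<in>UNIV. \<bar>y j v\<bar>) * (3 * r + 2)"
   using r by (intro mult_mono n sum_nonneg) auto
 qed
 also have "... = (\<Sum>j\<in>UNIV. \<Sum>v\<in>V. \<bar>y j v\<bar>) * (3 * r + 2)"
  unfolding sum_distrib_right[symmetric] by (subst sum.swap) (rule refl)
 also have "... <= (\<Sum>j\<in>(UNIV :: 'm set). eps / (3 * r + 2) + C / r * eps) * (3 * r + 2)"
  using r by (intro mult_right_mono sum_mono ysum) simp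
 also have "... = real CARD('m) * (eps + C * eps * ((3 * r + 2) / r))"
 proof -
  have "3 * r + 2 ~= 0" using r by simp
  then have e: "(eps / (3 * r + 2) + C / r * eps) * (3 * r + 2) = eps + C * eps * ((3 * r + 2) / r)"
   unfolding distrib_right by simp
  show ?thesis by (simp only: sum_constant mult.assoc e[unfolded mult.assoc])
 qed
 \<comment> \<open>\<open>(3 r + 2) / r\<close> is at most 5 because \<open>r\<close> is at least
   1.\<close>
 also have "... <= real CARD('m) * (eps + C * eps * 5)"
  using r C eps by (intro mult_left_mono add_left_mono) (simp_all add: field_simps)
 finally have l3: "len W3 <= real CARD('m) * (eps + C * eps * 5)" .
 have "len W2 = (\<Sum>w\<in>V. \<Sum>v\<in>V. norm (\<chi> j. \<rho> j w v) * norm (v - w))"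
  by (simp add: W2_def len_def sum_list_concat_map comp_def sv)
 \<comment> \<open>The edges are no longer than \<open>2 del\<close>, which cancels the factor
   \<open>C / del\<close> of their total weight.\<close>
 also have "... <= (\<Sum>w\<in>V. \<Sum>v\<in>V. (\<Sum>j\<in>UNIV. \<bar>\<rho> j w v\<bar>) * (2 * del))"
 proof (intro sum_mono)
  fix w v
  show "norm (\<chi> j. \<rho> j w v) * norm (v - w) <= (\<Sum>j\<in>UNIV. \<bar>\<rho> j w v\<bar>) * (2 * del)"
  proof (cases "norm (v - w) > 2 * del")
   case True
   have "(\<chi> j. \<rho> j w v) = 0" by (simp add: vec_eq_iff \<rho>near[OF True])
   then show ?thesis by (simp add: \<rho>near[OF True])
  next
   case False
   then show ?thesis using del by (intro mult_mono n sum_nonneg) auto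
  qed
 qed
 also have "... = (\<Sum>j\<in>UNIV. \<Sum>w\<in>V. \<Sum>v\<in>V. \<bar>\<rho> j w v\<bar>) * (2 * del)"
 proof -
  have "(\<Sum>w\<in>V. \<Sum>v\<in>V. \<Sum>j\<in>UNIV. \<bar>\<rho> j w v\<bar>) = (\<Sum>w\<in>V. \<Sum>j\<in>UNIV. \<Sum>v\<in>V. \<bar>\<rho> j w v\<bar>)"
   by (rule sum.cong[OF refl]) (rule sum.swap)
  also have "... = (\<Sum>j\<in>UNIV. \<Sum>w\<in>V. \<Sum>v\<in>V. \<bar>\<rho> j w v\<bar>)" by (rule sum.swap)
  finally show ?thesis by (simp only: sum_distrib_right[symmetric])
 qed
 also have "... <= (\<Sum>j\<in>(UNIV :: 'm set). C / del * eps) * (2 * del)"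
  using del by (intro mult_right_mono sum_mono \<rho>sum) simp
 also have "... = real CARD('m) * (2 * C * eps)" using del by simp
 finally have l2: "len W2 <= real CARD('m) * (2 * C * eps)" .
 show thesis
 proof (rule that[of "W2 @ W3"])
  show "ALL j ph. bd (W2 @ W3) j ph = (\<Sum>v\<in>V. x j v * ph v)"
   by (simp add: b2 b3 sum.distrib[symmetric] y_def distrib_right[symmetric])
  show "len (W2 @ W3) <= real CARD('m) * (7 * C + 1) * eps" using l2 l3 by (simp add: algebra_simps)
 qed
qed

text \<open>Two corrections are combined: \<open>W1\<close> moves the boundary of \<open>L\<close>
  onto the grid, \<open>W2\<close> repairs its difference to the discretized demand. The second one
  is short because, on the exact forms of the grid, the difference to the flux is nearly that of a
  polyhedral current \<open>R\<close> of small mass.\<close>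

lemma (in demand) flux_near_grid:
 fixes S :: "('a, 'm) current"
 assumes S: "!!j f. test_function f ==> S j (dform f) = nu j f"
  and P: "current_eq 1 P (cl1 L)" and fl: "flat_norm 1 (current_diff P S) < ennreal eps" and eps: "eps > 0"
  and C: "C > 0" "\<forall>del>0. ALL r. \<exists>(V :: 'a set) lam. grid_partition C del r V lam"
  and h: "h > 0"
 obtains W V c del where "0 < del" "del <= h" "near_demand del V c"
  "ALL j f. bd L j f - bd W j f = (\<Sum>v\<in>V. c j v * f v)" "len W <= (real CARD('m) * (7 * C + 1) + 2) * eps"
proof -
 define M where "M = (\<Sum>(p, q, th)\<leftarrow>L. norm th)"
 have M0: "0 <= M" unfolding M_def by (induction L) auto
 \<comment> \<open>Small against the total multiplicity \<open>M\<close> of the given chain, so that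
   snapping costs at most \<open>2 * eps\<close>. This is where a constant independent of the mesh
   is essential.\<close>
 define del where "del = min (min h 1) (eps / (1 + M))"
 have del: "0 < del" "del <= 1" "del <= h" "del * M <= eps"
 proof -
  show "0 < del" "del <= 1" "del <= h" using h eps M0 by (auto simp: del_def)
  have "del * (1 + M) <= eps / (1 + M) * (1 + M)" using M0 by (intro mult_right_mono) (simp_all add: del_def)
  then have "del * (1 + M) <= eps" using M0 by simp
  then show "del * M <= eps" using \<open>0 < del\<close> by (simp add: distrib_left)
 qed
 have "finite ((%(p, q, th). norm p + norm q) ` set L)" by simp
 then obtain b where b: "\<forall>x\<in>(%(p, q, th). norm p + norm q) ` set L. x <= b"
  by (metis bdd_above_finite bdd_above_def)
 \<comment> \<open>A cutoff of this radius is 1 at all vertices of \<open>L\<close> and on the ball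
   that the demand sees, so multiplying by it changes neither pairing.\<close>
 define r where "r = max r0 b"
 have r: "r >= 1" "r0 <= r" using r0 by (auto simp: r_def)
 have Lr: "norm p <= r" "norm q <= r" if "(p, q, th) \<in> set L" for p q th
 proof -
  have "norm p + norm q <= b" using b that by force
  then show "norm p <= r" "norm q <= r" unfolding r_def using norm_ge_zero[of p] norm_ge_zero[of q] by linarith+
 qed
 obtain X xi where gX: "grid_partition C r r (X :: 'a set) xi" using C(2) r by fastforce
 obtain V lam where gV: "grid_partition C del (3 * r + 1) (V :: 'a set) lam" using C(2) del(1) by blast
 define chi where "chi = (%y. \<Sum>u\<in>X. xi u y)"
 have tX: "test_function (xi u)" and fX: "finite X" and chi1: "norm y <= r ==> chi y = 1" for u y
  using gX unfolding grid_partition_def chi_def by blast+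
 have tV: "test_function (lam v)" and fV: "finite V" and one: "norm y <= 3 * r + 1 ==> (\<Sum>v\<in>V. lam v y) = 1"
  and l0: "0 <= lam v y" and sp: "lam v y ~= 0 ==> norm (y - v) <= del" for v y
  using gV unfolding grid_partition_def by blast+
 have tc: "test_function (%y. chi y * lam v y)" for v
  unfolding chi_def
  by (rule test_function_mult_smooth[OF test_function_sum[OF fX tX]]) (use tV in \<open>simp add: test_function_def\<close>)
 define x where "x j v = bd L j (lam v) - nu j (lam v)" for j v
 have xeq: "cl1 L j (dform (%y. chi y * lam v y)) - S j (dform (%y. chi y * lam v y)) = x j v" for j v
 proof -
  have "cl1 L j (dform (%y. chi y * lam v y)) = bd L j (%y. chi y * lam v y)"
   using tc by (intro cl1_dform) (simp add: test_function_def)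
  also have "... = bd L j (lam v)"
   unfolding bd_def
  proof (rule arg_cong[of _ _ sum_list], rule map_cong[OF refl])
   fix e assume e: "e \<in> set L"
   obtain p q th where e': "e = (p, q, th)" by (metis prod_cases3)
   have "chi p = 1" "chi q = 1" using Lr e unfolding e' by (blast intro: chi1)+
   then show "(case e of (p, q, th) => th $ j * (chi q * lam v q - chi p * lam v p)) = (case e of (p, q, th) => th $ j * (lam v q - lam v p))"
    by (simp add: e')
  qed
  finally have 1: "cl1 L j (dform (%y. chi y * lam v y)) = bd L j (lam v)" .
  have "nu j (%y. chi y * lam v y) = nu j (lam v)"
   by (rule nu_cong[OF test_function_bounded_continuous[OF tc] test_function_bounded_continuous[OF tV]])
     (use r in \<open>simp add: chi1\<close>)
  then show ?thesis by (simp add: 1 S[OF tc] x_def)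
 qed
 have nd: "near_demand del {v\<in>V. norm v <= r0 + 1} (%j v. nu j (lam v))"
  and far: "!!v j. norm v > r0 + 1 ==> nu j (lam v) = 0"
  by (rule grid_near_demand[OF gV]; use r del in simp)+
 have VV: "(\<Sum>v\<in>{v\<in>V. norm v <= r0 + 1}. nu j (lam v) * F v) = (\<Sum>v\<in>V. nu j (lam v) * F v)" for F :: "'a => real" and j
  by (rule sum.mono_neutral_left[OF fV]) (use far in \<open>auto simp: not_le\<close>)
 have xsum: "(\<Sum>v\<in>V. x j v) = 0" for j
 proof -
  have "(\<Sum>v\<in>V. bd L j (lam v)) = bd L j (%y. \<Sum>v\<in>V. lam v y)"
   unfolding bd_def sum_list_sum_swap[symmetric]
   by (simp add: split_def sum_distrib_left[symmetric] sum_subtractf)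
  also have "... = sum_list (map (%_. 0) L)"
   unfolding bd_def
  proof (rule arg_cong[of _ _ sum_list], rule map_cong[OF refl])
   fix e assume e: "e \<in> set L"
   obtain p q th where e': "e = (p, q, th)" by (metis prod_cases3)
   have "norm p <= 3 * r + 1" "norm q <= 3 * r + 1" using Lr e r unfolding e' by fastforce+
   then show "(case e of (p, q, th) => th $ j * ((\<Sum>v\<in>V. lam v q) - (\<Sum>v\<in>V. lam v p))) = 0" by (simp add: e' one)
  qed
  finally show ?thesis using near_demand_sum[OF nd, of j] VV[of j "%_. 1"] by (simp add: x_def sum_subtractf)
 qed
 \<comment> \<open>\<open>flat_norm\<close> refers to representing sequences. One member is enough,
   provided its flat norm is small and it is close to the limit on the finitely many forms of the
   grid.\<close>
 obtain Ps l where Ps: "represents 1 Ps (current_diff P S)" "(%i. polyhedral_flat_norm 1 (Ps i)) \<longlonglongrightarrow> l" "l < ennreal eps"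
  using fl unfolding flat_norm_def Inf_less_iff by blast
 have lim: "(%i. Ps i j (dform (%y. chi y * lam v y))) \<longlonglongrightarrow> x j v" for j v
 proof -
  have t: "test_form 1 (dform (%y. chi y * lam v y))" by (rule test_form_dform[OF tc])
  have "(%i. Ps i j (dform (%y. chi y * lam v y))) \<longlonglongrightarrow> current_diff P S j (dform (%y. chi y * lam v y))"
   using Ps(1) t unfolding represents_def by blast
  also have "current_diff P S j (dform (%y. chi y * lam v y)) = x j v"
   unfolding current_diff_def xeq[symmetric] using P t unfolding current_eq_def by simp
  finally show ?thesis .
 qed
 define d where "d i = (\<Sum>j\<in>UNIV. \<Sum>v\<in>V. \<bar>x j v - Ps i j (dform (%y. chi y * lam v y))\<bar>)" for i
 have "d \<longlonglongrightarrow> (\<Sum>j\<in>(UNIV :: 'm set). \<Sum>v\<in>V. \<bar>x j v - x j v\<bar>)"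
  unfolding d_def by (intro tendsto_sum tendsto_rabs tendsto_diff tendsto_const lim)
 then have "d \<longlonglongrightarrow> 0" by simp
 moreover have e3: "eps / (3 * r + 2) > 0" using eps r by simp
 ultimately have "\<forall>\<^sub>F i in sequentially. d i < eps / (3 * r + 2)" by (rule order_tendstoD(2))
 moreover have "\<forall>\<^sub>F i in sequentially. polyhedral_flat_norm 1 (Ps i) < ennreal eps"
  using Ps(2,3) by (rule order_tendstoD(2))
 ultimately have "\<forall>\<^sub>F i in sequentially. d i < eps / (3 * r + 2) & polyhedral_flat_norm 1 (Ps i) < ennreal eps"
  by (rule eventually_conj)
 then obtain i where i: "d i < eps / (3 * r + 2)" "polyhedral_flat_norm 1 (Ps i) < ennreal eps"
  by (auto dest!: eventually_happens)
 obtain R where R: "polyhedral_current 1 R" "mass 1 R < ennreal eps"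
  "ALL j f. test_function f --> Ps i j (dform f) = R j (dform f)" by (rule flat_norm_exact_forms[OF i(2)])
 have xR: "(\<Sum>v\<in>V. \<bar>x j v - R j (dform (%y. chi y * lam v y))\<bar>) <= eps / (3 * r + 2)" for j
 proof -
  have "(\<Sum>v\<in>V. \<bar>x j v - R j (dform (%y. chi y * lam v y))\<bar>) <= d i"
   unfolding d_def R(3)[rule_format, OF tc]
   by (rule member_le_sum[of j UNIV "%j. \<Sum>v\<in>V. \<bar>x j v - R j (dform (%y. chi y * lam v y))\<bar>"]) (simp_all add: sum_nonneg)
  then show ?thesis using i(1) by simp
 qed
 obtain W2 where W2: "ALL j f. bd W2 j f = (\<Sum>v\<in>V. x j v * f v)" "len W2 <= real CARD('m) * (7 * C + 1) * eps"
  by (rule small_mass_boundary[OF C(1) r(1) del(1,2) gX gV R(1,2) eps, of x])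
    (use xsum xR in \<open>simp_all add: chi_def\<close>)
 have on: "\<forall>(p, q, th)\<in>set L. (\<Sum>v\<in>V. lam v p) = 1 & (\<Sum>v\<in>V. lam v q) = 1"
 proof (rule ballI)
  fix e assume e: "e \<in> set L"
  obtain p q th where e': "e = (p, q, th)" by (metis prod_cases3)
  have "norm p <= 3 * r + 1" "norm q <= 3 * r + 1" using Lr e r unfolding e' by fastforce+
  then show "case e of (p, q, th) => (\<Sum>v\<in>V. lam v p) = 1 & (\<Sum>v\<in>V. lam v q) = 1" by (simp add: e' one)
 qed
 obtain W1 where W1: "ALL j f. bd W1 j f = bd L j f - (\<Sum>v\<in>V. bd L j (lam v) * f v)" "len W1 <= 2 * del * M"
 proof -
  have l0': "ALL v x. 0 <= lam v x" and sp': "ALL v x. lam v x ~= 0 --> norm (x - v) <= del" using l0 sp by blast+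
  show thesis by (rule snap_to_grid[OF fV l0' sp' on, folded M_def]) (rule that)
 qed
 show thesis
 proof (rule that[OF del(1,3) nd])
  show "ALL j f. bd L j f - bd (W1 @ W2) j f = (\<Sum>v\<in>{v\<in>V. norm v <= r0 + 1}. nu j (lam v) * f v)"
  proof (intro allI)
   fix j f
   have "bd (W1 @ W2) j f = bd L j f - (\<Sum>v\<in>V. bd L j (lam v) * f v) + (\<Sum>v\<in>V. x j v * f v)"
    by (simp only: bd_append W1(1)[rule_format] W2(1)[rule_format])
   moreover have "(\<Sum>v\<in>V. x j v * f v) = (\<Sum>v\<in>V. bd L j (lam v) * f v) - (\<Sum>v\<in>V. nu j (lam v) * f v)"
    by (simp only: x_def left_diff_distrib sum_subtractf)
   ultimately show "bd L j f - bd (W1 @ W2) j f = (\<Sum>v\<in>{v\<in>V. norm v <= r0 + 1}. nu j (lam v) * f v)"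
    using VV[of j f] by linarith
  qed
  have "len (W1 @ W2) <= 2 * eps + real CARD('m) * (7 * C + 1) * eps" using W1(2) W2(2) del(4) unfolding len_append mult.assoc by linarith
  then show "len (W1 @ W2) <= (real CARD('m) * (7 * C + 1) + 2) * eps" by (simp add: distrib_right)
 qed
qed

section \<open>Cycle cancelling and projection for lists of edges\<close>

abbreviation in_ball :: "real => ('a::real_normed_vector \<times> 'a \<times> 'w) list => bool" where
 "in_ball R L \<equiv> \<forall>(p, q, th)\<in>set L. norm p <= R & norm q <= R"

definition neg_list :: "('p \<times> 'p \<times> (real^'m)) list => ('p \<times> 'p \<times> (real^'m)) list" where
 "neg_list = map (%(p, q, t). (p, q, - t))"

lemma neg_list_simps [simp]:
 "bd (neg_list L) j f = - bd L j f" "len (neg_list L') = len L'" "cl1 (neg_list L'') j w = - cl1 L'' j w"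
 by (simp_all add: neg_list_def bd_def len_def cl1_def comp_def split_def uminus_sum_list_map[symmetric, unfolded comp_def])

lemma cl1_append [simp]: "cl1 (L @ L') j w = cl1 L j w + cl1 L' j w"
 by (simp add: cl1_def)

abbreviation reduced :: "real => 'p \<times> 'p \<times> (real^'m) => 'p \<times> 'p \<times> (real^'m) => bool" where
 "reduced N \<equiv> %(p, q, t) (p', q', t'). p' = p & q' = q & preceq t' t & (ALL j. \<bar>t' $ j\<bar> <= N)"

text \<open>The materials are reduced independently, with a factor in [0, 1] for each edge and
  component. As \<open>preceq\<close> compares componentwise, the whole vector decreases even though
  its direction may change.\<close>

lemma list_flow_reduction:
 fixes A :: "('p \<times> 'p \<times> (real^'m)) list"
 assumes b: "ALL j f. bd A j f = (\<Sum>v\<in>V. c j v * f v)" and N: "ALL j. (\<Sum>v\<in>V. \<bar>c j v\<bar>) <= N"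
 obtains A' where "ALL j f. bd A' j f = (\<Sum>v\<in>V. c j v * f v)"
  "list_all2 (reduced N) A A'"
proof -
 define s where "s i = fst (A ! i)" for i
 define t where "t i = fst (snd (A ! i))" for i
 define \<theta> where "\<theta> i = snd (snd (A ! i))" for i
 have A: "A ! i = (s i, t i, \<theta> i)" for i by (simp add: s_def t_def \<theta>_def)
 let ?E = "%j a. (\<forall>i<length A. 0 <= a i & a i <= 1 & \<bar>a i * \<theta> i $ j\<bar> <= N) &
  (ALL f. (\<Sum>i<length A. a i * \<theta> i $ j * (f (t i) - f (s i))) = (\<Sum>v\<in>V. c j v * f v))"
 have ex: "ALL j. EX a. ?E j a"
 proof (rule allI)
  fix j
  have 1: "(\<Sum>i<length A. \<theta> i $ j * (f (t i) - f (s i))) = (\<Sum>v\<in>V. c j v * f v)" for f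
   using b[rule_format, of j f] unfolding bd_def sum_list_map_nth by (simp add: A)
  show "EX a. ?E j a"
  proof (rule flow_reduction[where \<theta> = "%i. \<theta> i $ j" and s = s and t = t, OF finite_lessThan 1 N[rule_format]])
   fix a assume "!!i. i \<in> {..<length A} ==> 0 <= a i & a i <= 1 & \<bar>a i * \<theta> i $ j\<bar> <= N"
    "!!f. (\<Sum>i<length A. a i * \<theta> i $ j * (f (t i) - f (s i))) = (\<Sum>v\<in>V. c j v * f v)"
   then show "EX a. ?E j a" by (intro exI[of _ a]) simp
  qed
 qed
 obtain a where a: "ALL j. ?E j (a j)"
  using ex unfolding choice_iff by (elim exE) (rule that)
 define A' where "A' = map (%i. (s i, t i, \<chi> j. a j i * \<theta> i $ j)) [0..<length A]"
 show thesis
 proof (rule that[of A'])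
  show "ALL j f. bd A' j f = (\<Sum>v\<in>V. c j v * f v)"
  proof (intro allI)
   fix j f
   have "bd A' j f = (\<Sum>i<length A. a j i * \<theta> i $ j * (f (t i) - f (s i)))"
    unfolding bd_def A'_def by (simp add: comp_def interv_sum_list_conv_sum_set_nat atLeast0LessThan)
   then show "bd A' j f = (\<Sum>v\<in>V. c j v * f v)" using a by simp
  qed
  have "preceq (\<chi> j. a j i * \<theta> i $ j) (\<theta> i)" if "i < length A" for i
  proof -
   have "0 <= a j i" "a j i <= 1" for j using a that by blast+
   then show ?thesis
    unfolding preceq_def by (auto simp: sgn_mult mult.assoc abs_mult mult_left_le_one_le)
  qed
  moreover have "\<bar>(\<chi> j. a j i * \<theta> i $ j) $ j\<bar> <= N" if "i < length A" for i j
   using a that by simp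
  ultimately show "list_all2 (reduced N) A A'"
   by (intro list_all2_all_nthI) (simp_all add: A'_def A)
 qed
qed

text \<open>The nearest-point projection does not increase lengths, and it fixes a discretized
  demand contained in the ball.\<close>

definition push :: "real => ('a::euclidean_space \<times> 'a \<times> 'w) list => ('a \<times> 'a \<times> 'w) list" where
 "push R = map (%(p, q, t). (closest_point (cball 0 R) p, closest_point (cball 0 R) q, t))"

lemma push_norm:
 assumes "R >= 0" "(p, q, t) \<in> set (push R L)"
 shows "norm p <= R" "norm q <= R"
proof -
 have "closest_point (cball 0 R) x \<in> cball 0 R" for x :: 'a
  by (rule closest_point_in_set) (use assms(1) in auto)
 then show "norm p <= R" "norm q <= R" using assms(2) unfolding push_def by auto
qed

lemma push_dist:
 assumes "R >= 0" shows "dist (closest_point (cball 0 R) p) (closest_point (cball 0 R) q) <= dist p (q :: 'a::euclidean_space)"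
 by (rule closest_point_lipschitz) (use assms in auto)

lemma reduce_cost:
 assumes "list_all2 (reduced N) L L'" "R >= 0"
 shows "len (push R L') <= len L"
  "multi_material_cost C ==> (list_cost C (push R L')) <= (list_cost C L)"
  "(p, q, t) \<in> set (push R L') ==> \<bar>t $ j\<bar> <= N"
proof -
 have n: "norm t' <= norm t" if "preceq t' t" for t t' :: "real^'m"
  using that by (intro norm_le_componentwise_cart) (simp add: preceq_def)
 show "len (push R L') <= len L"
  using assms(1)
 proof (induction rule: list_all2_induct)
  case Nil then show ?case by (simp add: push_def len_def)
 next
  case (Cons e L e' L')
  obtain p q t where e: "e = (p, q, t)" by (metis prod_cases3)
  obtain t' where e': "e' = (p, q, t')" "preceq t' t" using Cons(1) unfolding e by (auto split: prod.splits)
  have "norm t' * norm (closest_point (cball 0 R) q - closest_point (cball 0 R) p) <= norm t * norm (q - p)"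
   using push_dist[OF assms(2), of q p] by (intro mult_mono n[OF e'(2)]) (simp_all add: dist_norm)
  then show ?case using Cons.IH by (simp add: push_def len_def e e')
 qed
 show "(list_cost C (push R L')) <= (list_cost C L)"
  if C: "multi_material_cost C"
  using assms(1)
 proof (induction rule: list_all2_induct)
  case Nil then show ?case by (simp add: push_def)
 next
  case (Cons e L e' L')
  obtain p q t where e: "e = (p, q, t)" by (metis prod_cases3)
  obtain t' where e': "e' = (p, q, t')" "preceq t' t" using Cons(1) unfolding e by (auto split: prod.splits)
  have "C t' <= C t" "0 <= C t" using C e'(2) unfolding multi_material_cost_def by blast+
  then have "C t' * dist (closest_point (cball 0 R) p) (closest_point (cball 0 R) q) <= C t * dist p q"
   by (intro mult_mono push_dist[OF assms(2)]) simp_all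
  then have "ennreal (C t' * dist (closest_point (cball 0 R) p) (closest_point (cball 0 R) q)) <= ennreal (C t * dist p q)"
   by (rule ennreal_leI)
  from add_mono[OF this Cons.IH] show ?case by (simp add: push_def e e')
 qed
 show "\<bar>t $ j\<bar> <= N" if mem: "(p, q, t) \<in> set (push R L')"
 proof -
  obtain p' q' where "(p', q', t) \<in> set L'" using mem by (auto simp: push_def)
  then obtain i where "i < length L'" "L' ! i = (p', q', t)" by (auto simp: in_set_conv_nth)
  then show ?thesis using list_all2_nthD2[OF assms(1), of i] by (auto split: prod.splits)
 qed
qed

text \<open>Only \<open>L\<close> and \<open>- W\<close> together have the discretized boundary, so
  they are reduced as one list and separated afterwards by position. The edges from \<open>L\<close>
  thus keep their cost bound, those from \<open>W\<close> their length bound.\<close>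

lemma (in demand) reduced_flux:
 assumes nd: "near_demand d V c" and b: "ALL j f. bd L j f - bd W j f = (\<Sum>v\<in>V. c j v * f v)"
 obtains L' W' where "ALL j f. bd L' j f - bd W' j f = (\<Sum>v\<in>V. c j v * f v)"
  "\<forall>(p, q, t)\<in>set L'. norm p <= r0 + 1 & norm q <= r0 + 1 & (ALL j. \<bar>t $ j\<bar> <= N)"
  "in_ball (r0 + 1) W'" "len W' <= len W"
  "ALL C. multi_material_cost C --> (list_cost C L') <= (list_cost C L)"
proof -
 have R0: "r0 + 1 >= 0" using r0 by simp
 have b1: "ALL j f. bd (L @ neg_list W) j f = (\<Sum>v\<in>V. c j v * f v)" using b by simp
 have N1: "ALL j. (\<Sum>v\<in>V. \<bar>c j v\<bar>) <= N" using nd by (simp add: near_demand_def)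
 obtain A where A: "ALL j f. bd A j f = (\<Sum>v\<in>V. c j v * f v)"
  "list_all2 (reduced N) (L @ neg_list W) A"
  by (rule list_flow_reduction[OF b1 N1])
 obtain L1 W1 where LW: "A = L1 @ W1"
  "list_all2 (reduced N) L L1"
  "list_all2 (reduced N) (neg_list W) W1"
  using A(2)[unfolded list_all2_append1] by (elim exE conjE) (rule that)
 have pb: "bd (push (r0 + 1) K) j f = bd K j (%x. f (closest_point (cball 0 (r0 + 1)) x))" for K :: "('a \<times> 'a \<times> (real^'m)) list" and j f
  by (simp add: bd_def push_def comp_def split_def)
 have V: "closest_point (cball 0 (r0 + 1)) v = v" if "v \<in> V" for v
  using nd that by (intro closest_point_self) (auto simp: near_demand_def)
 have W: "(p, q, - t) \<in> set (push (r0 + 1) W1)" if "(p, q, t) \<in> set (neg_list (push (r0 + 1) W1))" for p q t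
  using that by (auto simp: neg_list_def)
 show thesis
 proof (rule that[of "push (r0 + 1) L1" "neg_list (push (r0 + 1) W1)"])
  show "ALL j f. bd (push (r0 + 1) L1) j f - bd (neg_list (push (r0 + 1) W1)) j f = (\<Sum>v\<in>V. c j v * f v)"
  proof (intro allI)
   fix j f
   have "bd (push (r0 + 1) L1) j f - bd (neg_list (push (r0 + 1) W1)) j f = bd A j (%x. f (closest_point (cball 0 (r0 + 1)) x))"
    by (simp add: pb LW(1))
   also have "... = (\<Sum>v\<in>V. c j v * f (closest_point (cball 0 (r0 + 1)) v))" by (rule A(1)[rule_format])
   also have "... = (\<Sum>v\<in>V. c j v * f v)" by (rule sum.cong) (simp_all add: V)
   finally show "bd (push (r0 + 1) L1) j f - bd (neg_list (push (r0 + 1) W1)) j f = (\<Sum>v\<in>V. c j v * f v)" .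
  qed
  show "\<forall>(p, q, t)\<in>set (push (r0 + 1) L1). norm p <= r0 + 1 & norm q <= r0 + 1 & (ALL j. \<bar>t $ j\<bar> <= N)"
   using push_norm[OF R0] reduce_cost(3)[OF LW(2) R0] by fastforce
  show "\<forall>(p, q, t)\<in>set (neg_list (push (r0 + 1) W1)). norm p <= r0 + 1 & norm q <= r0 + 1"
   using push_norm[OF R0] W by fastforce
  show "len (neg_list (push (r0 + 1) W1)) <= len W" using reduce_cost(1)[OF LW(3) R0] by simp
  show "ALL C. multi_material_cost C --> (list_cost C (push (r0 + 1) L1)) <= (list_cost C L)"
   using reduce_cost(2)[OF LW(2) R0] by blast
 qed
qed

text \<open>Lower semicontinuity and compactness give a positive lower bound on the unit sphere. A
  vector of norm at least 1 dominates its direction in the order \<open>preceq\<close>, and its norm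
  is bounded through \<open>N\<close>. For a shorter one about \<open>1 / |th|\<close> copies reach
  the sphere, and subadditivity divides the bound among them.\<close>

lemma cost_lower_bound:
 fixes C :: "real^'m => real"
 assumes C: "multi_material_cost C"
 obtains K where "K > 0" "ALL th. (ALL j. \<bar>th $ j\<bar> <= N) --> norm th <= K * C th"
proof -
 have nn: "0 <= C th" and z: "C th = 0 \<longleftrightarrow> th = 0" and sub: "C (h + th) <= C h + C th" and mono: "preceq h th ==> C h <= C th" for h th
  using C unfolding multi_material_cost_def by blast+
 have z0: "C 0 = 0" using z[of 0] by simp
 have lsc: "lower_semicontinuous C" using C unfolding multi_material_cost_def by blast
 have "EX n. ALL u. norm u = 1 --> 1 / Suc n <= C u"
 proof (rule ccontr)
  assume "\<not> ?thesis"
  then have "ALL n. EX u. norm u = 1 & C u < 1 / Suc n" by (auto simp: not_le)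
  then obtain u where u: "ALL n. norm (u n) = 1 & C (u n) < 1 / Suc n" by (rule choice[THEN exE])
  have "ALL n. u n \<in> sphere 0 1" using u by simp
  then obtain l s where l: "l \<in> sphere 0 1" "strict_mono s" "(u \<circ> s) \<longlonglongrightarrow> l"
   using compact_sphere[of "0 :: real^'m" 1] unfolding compact_def by blast
  have "l ~= 0" using l(1) by auto
  then have Cl: "C l > 0" using nn[of l] z[of l] by simp
  define a where "a = C l / 2"
  have a: "0 < a" "a < C l" using Cl by (simp_all add: a_def)
  have "ereal a < Liminf (at l) (%y. ereal (C y))"
   using a(2) lsc unfolding lower_semicontinuous_def by (meson ereal_less(1) less_ereal.simps(1) less_le_trans)
  then have "\<forall>\<^sub>F y in at l. ereal a < ereal (C y)" by (rule less_LiminfD)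
  \<comment> \<open>The definition of semicontinuity concerns punctured neighbourhoods; the point
    \<open>l\<close> itself is covered by \<open>a < C l\<close>.\<close>
  then have "\<forall>\<^sub>F y in nhds l. a < C y" unfolding eventually_at_filter
   by (rule eventually_mono) (metis a(2) UNIV_I less_ereal.simps(1))
  then have "\<forall>\<^sub>F n in sequentially. a < C ((u \<circ> s) n)" by (rule eventually_compose_filterlim[OF _ l(3)])
  moreover have "\<forall>\<^sub>F n in sequentially. 1 / Suc n < a" using a(1) by real_asymp
  ultimately have "\<forall>\<^sub>F n in sequentially. False"
  proof eventually_elim
   case (elim n)
   have "C (u (s n)) < 1 / Suc (s n)" using u by blast
   also have "... <= 1 / Suc n" using seq_suble[OF l(2), of n] by (intro divide_left_mono) simp_all
   finally show False using elim by simp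
  qed
  then show False by simp
 qed
 then obtain n where n: "ALL u. norm u = 1 --> 1 / Suc n <= C u" by blast
 define c where "c = 1 / real (Suc n)"
 have c: "c > 0" "norm u = 1 ==> c <= C u" for u using n by (simp_all add: c_def)
 have mult: "C (of_nat k *\<^sub>R th) <= of_nat k * C th" for k :: nat and th
 proof (induction k)
  case 0 then show ?case by (simp add: z0)
 next
  case (Suc k)
  then show ?case using sub[of th "of_nat k *\<^sub>R th"] by (simp add: scaleR_add_left distrib_right)
 qed
 define T where "T = real CARD('m) * \<bar>N\<bar>"
 have pre: "preceq u (s *\<^sub>R th)" if "u = th /\<^sub>R norm th" "th ~= 0" "1 <= s * norm th" for u th :: "real^'m" and s
 proof -
  have t: "norm th > 0" using that(2) by simp
  have s0: "s > 0"
  proof (rule ccontr)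
   assume "\<not> s > 0"
   then have "s * norm th <= 0" using t by (intro mult_nonpos_nonneg) simp_all
   then show False using that(3) by simp
  qed
  have i: "inverse (norm th) <= s" using that(3) t by (simp add: inverse_eq_divide pos_divide_le_eq)
  show ?thesis unfolding preceq_def that(1)
  proof (intro allI conjI)
   fix j
   show "0 <= sgn ((th /\<^sub>R norm th) $ j) * sgn ((s *\<^sub>R th) $ j)"
    using t s0 zero_le_square[of "sgn (th $ j)"] by (simp add: sgn_mult)
   have "inverse (norm th) * \<bar>th $ j\<bar> <= s * \<bar>th $ j\<bar>" by (rule mult_right_mono[OF i]) simp
   then show "\<bar>(th /\<^sub>R norm th) $ j\<bar> <= \<bar>(s *\<^sub>R th) $ j\<bar>" using s0 by (simp add: abs_mult)
  qed
 qed
 have main: "norm th <= ((T + 2) / c) * C th" if th: "ALL j. \<bar>th $ j\<bar> <= N" for th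
 proof (cases "th = 0")
  case True then show ?thesis by (simp add: z0)
 next
  case False
  define u where "u = th /\<^sub>R norm th"
  have u1: "norm u = 1" using False by (simp add: u_def)
  have T0: "0 <= T" by (simp add: T_def)
  have "norm th <= (\<Sum>j\<in>(UNIV :: 'm set). \<bar>N\<bar>)"
   by (rule order_trans[OF norm_vec_le_sum], rule sum_mono) (use th in \<open>meson abs_ge_self order_trans\<close>)
  then have tT: "norm th <= T" by (simp add: T_def)
  show ?thesis
  proof (cases "norm th >= 1")
   case True
   have "c <= C u" by (rule c(2)[OF u1])
   also have "... <= C th" using pre[OF u_def False, of 1] True by (intro mono) simp
   finally have "1 <= C th / c" using c(1) by simp
   then have "(T + 2) * 1 <= (T + 2) * (C th / c)" using T0 by (intro mult_left_mono) simp_all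
   then show ?thesis using tT by simp
  next
   case False': False
   \<comment> \<open>At most \<open>2 / |th|\<close>, because \<open>1 / |th|\<close> is at least 1
     here.\<close>
   define k where "k = nat \<lceil>1 / norm th\<rceil>"
   have t0: "norm th > 0" using False by simp
   have k: "1 / norm th <= real k" "real k <= 2 / norm th"
   proof -
    show "1 / norm th <= real k" unfolding k_def by (rule real_nat_ceiling_ge)
    have "real k = real_of_int \<lceil>1 / norm th\<rceil>" unfolding k_def using t0 by simp
    moreover have "1 <= 1 / norm th" using False' t0 by (simp add: pos_le_divide_eq)
    moreover have "2 / norm th = 1 / norm th + 1 / norm th" by simp
    ultimately show "real k <= 2 / norm th" using ceiling_correct[of "1 / norm th"] by linarith
   qed
   have "c <= C u" by (rule c(2)[OF u1])
   also have "... <= C (of_nat k *\<^sub>R th)"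
    using k(1) t0 by (intro mono pre[OF u_def False]) (simp add: pos_divide_le_eq)
   also have "... <= real k * C th" by (rule mult)
   also have "... <= 2 / norm th * C th" by (rule mult_right_mono[OF k(2) nn])
   finally have "norm th <= 2 / c * C th" using c(1) t0 by (simp add: field_simps)
   also have "... <= (T + 2) / c * C th" using T0 c(1) by (intro mult_right_mono divide_right_mono nn) simp_all
   finally show ?thesis .
  qed
 qed
 have "0 <= T" by (simp add: T_def)
 then have "0 < (T + 2) / c" using c(1) by simp
 then show thesis by (rule that) (intro allI impI, rule main)
qed

section \<open>Flat compactness\<close>

definition halve :: "('a::real_normed_vector \<times> 'a \<times> 'w) list => ('a \<times> 'a \<times> 'w) list" where
 "halve L = concat (map (%(p, q, t). [(p, midpoint p q, t), (midpoint p q, q, t)]) L)"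

text \<open>The two ends and the midpoint span a degenerate triangle, so Stokes' theorem has no
  interior term.\<close>

lemma line_int_midpoint:
 fixes w :: "'a::euclidean_space form"
 assumes "test_form 1 w"
 shows "line_int w p (midpoint p q) + line_int w (midpoint p q) q = line_int w p q"
proof -
 have "2 *\<^sub>R (midpoint p q - p) + (- 1) *\<^sub>R (q - p) = 0"
  by (simp add: midpoint_def scaleR_diff_right scaleR_2)
 from tri_int_degenerate[OF test_form_exterior_derivative[OF assms] this]
 have "tri_int (exterior_derivative 1 w) p (midpoint p q) q = 0" by simp
 then show ?thesis using stokes_triangle[OF assms, of p "midpoint p q" q] by simp
qed

lemma halve:
 fixes L :: "('a::euclidean_space \<times> 'a \<times> (real^'m)) list"
 shows "bd (halve L) j f = bd L j f" "len (halve L) = len L"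
  "test_form 1 w ==> cl1 (halve L) j w = cl1 L j w"
  "\<forall>(p, q, t)\<in>set L. norm p <= R & norm q <= R & norm (q - p) <= d ==>
    \<forall>(p, q, t)\<in>set (halve L). norm p <= R & norm q <= R & norm (q - p) <= d / 2"
proof -
 have m: "norm (midpoint p q - p) = norm (q - p) / 2" "norm (q - midpoint p q) = norm (q - p) / 2" for p q :: 'a
 proof -
  have "2 *\<^sub>R (midpoint p q - p) = q - p" "2 *\<^sub>R (q - midpoint p q) = q - p"
   by (simp_all add: midpoint_def scaleR_diff_right scaleR_2)
  then have "norm (2 *\<^sub>R (midpoint p q - p)) = norm (q - p)" "norm (2 *\<^sub>R (q - midpoint p q)) = norm (q - p)"
   by (simp_all only:)
  then show "norm (midpoint p q - p) = norm (q - p) / 2" "norm (q - midpoint p q) = norm (q - p) / 2"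
   by simp_all
 qed
 show "bd (halve L) j f = bd L j f"
  unfolding halve_def bd_def by (induction L) (auto simp: right_diff_distrib)
 show "len (halve L) = len L"
  unfolding halve_def len_def by (induction L) (auto simp: m)
 show "cl1 (halve L) j w = cl1 L j w" if "test_form 1 w"
  unfolding halve_def cl1_def
  by (induction L) (auto simp: distrib_left[symmetric] line_int_midpoint[OF that] simp flip: add.assoc)
 show "\<forall>(p, q, t)\<in>set (halve L). norm p <= R & norm q <= R & norm (q - p) <= d / 2"
  if "\<forall>(p, q, t)\<in>set L. norm p <= R & norm q <= R & norm (q - p) <= d"
 proof -
  have "norm (midpoint p q) <= R" if "norm p <= R" "norm q <= R" for p q :: 'a
   using that norm_triangle_ineq[of p q] by (simp add: midpoint_def)
  then show ?thesis using that by (auto simp: halve_def m)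
 qed
qed

text \<open>Weak limits and grid decompositions need short edges, and repeated halving provides them
  without affecting the values on test forms, the boundary or the length.\<close>

lemma subdivide:
 fixes L :: "('a::euclidean_space \<times> 'a \<times> (real^'m)) list"
 assumes L: "in_ball R L" and e: "e > 0"
 obtains L' where "ALL j f. bd L' j f = bd L j f" "len L' = len L"
  "ALL j w. test_form 1 w --> cl1 L' j w = cl1 L j w"
  "\<forall>(p, q, t)\<in>set L'. norm p <= R & norm q <= R & norm (q - p) <= e"
proof -
 let ?Q = "%n L'. (ALL j f. bd L' j f = bd L j f) & len L' = len L & (ALL j w. test_form 1 w --> cl1 L' j w = cl1 L j w) &
  (\<forall>(p, q, t)\<in>set L'. norm p <= R & norm q <= R & norm (q - p) <= 2 * R / 2 ^ n)"
 have "EX L'. ?Q n L'" for n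
 proof (induction n)
  case 0
  have "norm (q - p) <= 2 * R" if "norm p <= R" "norm q <= R" for p q :: 'a
   using that norm_triangle_ineq4[of q p] by simp
  then show ?case using L by (intro exI[of _ L]) auto
 next
  case (Suc n)
  then obtain L' where L': "ALL j f. bd L' j f = bd L j f" "len L' = len L" "ALL j w. test_form 1 w --> cl1 L' j w = cl1 L j w"
   "\<forall>(p, q, t)\<in>set L'. norm p <= R & norm q <= R & norm (q - p) <= 2 * R / 2 ^ n" by blast
  show ?case
  proof (intro exI[of _ "halve L'"] conjI allI impI)
   show "bd (halve L') j f = bd L j f" for j f by (simp only: halve(1) L'(1))
   show "len (halve L') = len L" by (simp only: halve(2) L'(2))
   show "cl1 (halve L') j w = cl1 L j w" if "test_form 1 w" for j w
    by (simp only: halve(3)[OF that] L'(3)[rule_format, OF that])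
   show "\<forall>(p, q, t)\<in>set (halve L'). norm p <= R & norm q <= R & norm (q - p) <= 2 * R / 2 ^ Suc n"
    using halve(4)[OF L'(4)] by simp
  qed
 qed
 note ex = this
 have "(%n. 2 * R / 2 ^ n) \<longlonglongrightarrow> 0" by real_asymp
 then have "\<forall>\<^sub>F n in sequentially. 2 * R / 2 ^ n < e" using e by (rule order_tendstoD(2))
 then obtain n where n: "2 * R / 2 ^ n < e" by (auto dest!: eventually_happens)
 obtain L' where L': "ALL j f. bd L' j f = bd L j f" "len L' = len L" "ALL j w. test_form 1 w --> cl1 L' j w = cl1 L j w"
  "\<forall>(p, q, t)\<in>set L'. norm p <= R & norm q <= R & norm (q - p) <= 2 * R / 2 ^ n" using ex[of n] by (elim exE conjE) (rule that)
 show thesis by (rule that[OF L'(1-3)]) (use L'(4) n in force)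
qed

text \<open>Choosing signs turns the sum of the increments into the increment of a single function,
  to which the mean value inequality applies.\<close>

lemma grid_partition_lipschitz:
 assumes "grid_partition C del r V lam" "C > 0" "del > 0"
 shows "(\<Sum>v\<in>V. \<bar>lam v q - lam v p\<bar>) <= C / del * norm (q - p)"
proof -
 have t: "test_function (lam v)" and d: "(\<Sum>v\<in>V. \<bar>frechet_derivative (lam v) (at x) h\<bar>) <= C / del * norm h" for v x h
  using assms(1) unfolding grid_partition_def by blast+
 define s where "s v = sgn (lam v q - lam v p)" for v
 have hd: "((%x. \<Sum>v\<in>V. s v * lam v x) has_derivative (%h. \<Sum>v\<in>V. s v * frechet_derivative (lam v) (at x) h)) (at x within UNIV)" for x
  using t by (intro has_derivative_sum has_derivative_mult_right smooth_has_derivative) (simp add: test_function_def)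
 have "norm ((\<Sum>v\<in>V. s v * lam v q) - (\<Sum>v\<in>V. s v * lam v p)) <= C / del * norm (q - p)"
 proof (rule differentiable_bound[OF convex_UNIV hd])
  fix x
  show "onorm (%h. \<Sum>v\<in>V. s v * frechet_derivative (lam v) (at x) h) <= C / del"
  proof (rule onorm_le)
   fix h
   have "\<bar>\<Sum>v\<in>V. s v * frechet_derivative (lam v) (at x) h\<bar> <= (\<Sum>v\<in>V. \<bar>frechet_derivative (lam v) (at x) h\<bar>)"
    by (rule order_trans[OF sum_abs], rule sum_mono) (simp add: s_def abs_mult abs_sgn_eq)
   then show "norm (\<Sum>v\<in>V. s v * frechet_derivative (lam v) (at x) h) <= C / del * norm h" using d[of x h] by simp
  qed
 qed simp_all
 moreover have "(\<Sum>v\<in>V. s v * lam v q) - (\<Sum>v\<in>V. s v * lam v p) = (\<Sum>v\<in>V. \<bar>lam v q - lam v p\<bar>)"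
  unfolding sum_subtractf[symmetric] right_diff_distrib[symmetric]
  by (rule sum.cong) (simp_all add: s_def abs_sgn mult.commute)
 ultimately show ?thesis by (simp add: sum_nonneg)
qed

lemma norm_sum_list_le: "(!!x. x \<in> set xs ==> norm (f x) <= g x) ==> norm (sum_list (map f xs)) <= sum_list (map g xs)"
 by (induction xs) (auto intro: order_trans[OF norm_triangle_ineq] add_mono)

text \<open>
 Cone every edge of \<open>A\<close> off to the grid: with \<open>w\<close> a grid point near \<open>p\<close> and \<open>G x = (\<Sum>v. lam\<^sub>v x * line_int om x v)\<close>,
 Stokes' theorem gives \<open>line_int om p q = (\<Sum>v. (lam\<^sub>v q - lam\<^sub>v p) * line_int om w v) + G p - G q\<close> up to the integrals of \<open>d om\<close>
 over the triangles \<open>p q v\<close> and \<open>w p v\<close>.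
\<close>
lemma grid_decomposition:
 fixes A :: "('a::euclidean_space \<times> 'a \<times> (real^'m::finite)) list"
 assumes g: "grid_partition C del R V lam" and C: "C > 0" "del > 0"
  and A: "\<forall>(p, q, t)\<in>set A. norm p <= R & norm q <= R & norm (q - p) <= del" and M: "len A <= M"
  and b: "ALL j f. bd A j f = (\<Sum>w\<in>U. c j w * f w)" and U: "finite U" "U \<subseteq> cball 0 R" and N: "ALL j. (\<Sum>w\<in>U. \<bar>c j w\<bar>) <= N"
 shows "EX s G T. (ALL j om. test_form 1 om --> cl1 A j om = (\<Sum>w\<in>V. \<Sum>v\<in>V. s (w, v) $ j * line_int om w v)
    + cl1 G j om + cl2 T j (exterior_derivative 1 om)) &
   len G <= real CARD('m) * N * del & area T <= M * del * (2 + 3 * C) & (\<forall>i\<in>V \<times> V. norm (s i) <= C / del * M)"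
proof -
 have V: "finite V" "!!v y. 0 <= lam v y" "!!y. (\<Sum>v\<in>V. lam v y) <= 1" "!!v y. lam v y ~= 0 ==> norm (y - v) <= del"
  "!!y. norm y <= R ==> (\<Sum>v\<in>V. lam v y) = 1"
  using g unfolding grid_partition_def by blast+
 have lip: "(\<Sum>v\<in>V. \<bar>lam v q - lam v p\<bar>) <= C / del * norm (q - p)" for p q by (rule grid_partition_lipschitz[OF g C])
 have "\<exists>w\<in>V. norm (p - w) <= del" if "norm p <= R" for p
 proof (rule ccontr)
  assume "\<not> ?thesis"
  then have "(\<Sum>v\<in>V. lam v p) = 0" using V(4) by (intro sum.neutral) blast
  then show False using V(5)[OF that] by simp
 qed
 then obtain near where near: "!!p. norm p <= R ==> near p \<in> V" "!!p. norm p <= R ==> norm (p - near p) <= del" by metis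
 obtain vs where vs: "set vs = V" "distinct vs" using finite_distinct_list[OF V(1)] by blast
 obtain us where us: "set us = U" "distinct us" using finite_distinct_list[OF U(1)] by blast
 have sv: "(\<Sum>v\<leftarrow>vs. F v) = (\<Sum>v\<in>V. F v)" and su: "(\<Sum>v\<leftarrow>us. F v) = (\<Sum>v\<in>U. F v)" for F :: "'a => real"
  using sum_list_distinct_conv_sum_set[OF vs(2)] sum_list_distinct_conv_sum_set[OF us(2)] vs(1) us(1) by simp_all
 \<comment> \<open>With \<open>p\<close> rounded to one grid point and only the change of the
   weights along the edge recorded, there is one coefficient for each pair of grid points, however
   many edges \<open>A\<close> has.\<close>
 define s where "s = (%(w, v). \<Sum>(p, q, t)\<leftarrow>A. (if near p = w then lam v q - lam v p else 0) *\<^sub>R t)"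
 define TE where "TE = (%(p, q, t). map (%v. (p, q, v, lam v q *\<^sub>R t)) vs @ map (%v. (near p, p, v, (lam v q - lam v p) *\<^sub>R (t :: real^'m))) vs)"
 define T where "T = concat (map TE A)"
 \<comment> \<open>The endpoint terms add up to minus the boundary of \<open>A\<close> tested with
   \<open>H\<close>. By hypothesis this involves the points of \<open>U\<close> only, hence edges of
   length at most \<open>del\<close> and multiplicities controlled by \<open>N\<close>.\<close>
 define G where "G = concat (map (%w. map (%v. (w, v, - (lam v w *\<^sub>R (\<chi> j. c j w)))) vs) us)"
 have "cl1 A j om = (\<Sum>w\<in>V. \<Sum>v\<in>V. s (w, v) $ j * line_int om w v) + cl1 G j om + cl2 T j (exterior_derivative 1 om)"
  if om: "test_form 1 om" for j om
 proof -
  define H where "H y = (\<Sum>v\<in>V. lam v y * line_int om y v)" for y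
  have edge: "t $ j * line_int om p q = (\<Sum>w\<in>V. \<Sum>v\<in>V. ((if near p = w then lam v q - lam v p else 0) *\<^sub>R t) $ j * line_int om w v)
    - t $ j * (H q - H p) + cl2 (TE (p, q, t)) j (exterior_derivative 1 om)"
   if "norm p <= R" "norm q <= R" for p q t
  proof -
   define d where "d v = lam v q - lam v p" for v
   \<comment> \<open>The weights at \<open>p\<close> and at \<open>q\<close> both sum to 1; this
     removes the edge from \<open>near p\<close> to \<open>p\<close>.\<close>
   have d0: "(\<Sum>v\<in>V. d v) = 0" by (simp add: d_def sum_subtractf V(5) that)
   have f1: "cl2 (TE (p, q, t)) j (exterior_derivative 1 om) = t $ j * ((\<Sum>v\<in>V. lam v q * tri_int (exterior_derivative 1 om) p q v)
     + (\<Sum>v\<in>V. d v * tri_int (exterior_derivative 1 om) (near p) p v))"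
    by (simp add: TE_def cl2_def comp_def sv d_def distrib_left sum_distrib_left mult_ac)
   have f2: "(\<Sum>v\<in>V. lam v q * tri_int (exterior_derivative 1 om) p q v) = line_int om p q + H q - (\<Sum>v\<in>V. lam v q * line_int om p v)"
    unfolding stokes_triangle[OF om] H_def
    by (simp add: distrib_left right_diff_distrib sum.distrib sum_subtractf sum_distrib_right[symmetric] V(5) that)
   have f3: "(\<Sum>v\<in>V. d v * tri_int (exterior_derivative 1 om) (near p) p v)
     = (\<Sum>v\<in>V. lam v q * line_int om p v) - H p - (\<Sum>v\<in>V. d v * line_int om (near p) v)"
   proof -
    have "(\<Sum>v\<in>V. d v * tri_int (exterior_derivative 1 om) (near p) p v)
     = (\<Sum>v\<in>V. d v) * line_int om (near p) p + (\<Sum>v\<in>V. d v * line_int om p v) - (\<Sum>v\<in>V. d v * line_int om (near p) v)"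
     unfolding stokes_triangle[OF om]
     by (simp add: distrib_left right_diff_distrib sum.distrib sum_subtractf sum_distrib_right)
    moreover have "(\<Sum>v\<in>V. d v * line_int om p v) = (\<Sum>v\<in>V. lam v q * line_int om p v) - H p"
     by (simp add: H_def d_def left_diff_distrib sum_subtractf)
    ultimately show ?thesis using d0 by simp
   qed
   have f4: "(\<Sum>w\<in>V. \<Sum>v\<in>V. ((if near p = w then d v else 0) *\<^sub>R t) $ j * line_int om w v) = t $ j * (\<Sum>v\<in>V. d v * line_int om (near p) v)"
   proof -
    have "(\<Sum>w\<in>V. \<Sum>v\<in>V. ((if near p = w then d v else 0) *\<^sub>R t) $ j * line_int om w v)
     = (\<Sum>w\<in>V. if near p = w then t $ j * (\<Sum>v\<in>V. d v * line_int om (near p) v) else 0)"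
     by (rule sum.cong[OF refl]) (simp add: sum_distrib_left mult_ac)
    then show ?thesis by (simp add: V(1) near(1) that)
   qed
   show ?thesis unfolding d_def[symmetric] f4 f1 f2 f3 by (simp add: right_diff_distrib distrib_left)
  qed
  have "cl1 B j om = (\<Sum>w\<in>V. \<Sum>v\<in>V. (\<Sum>(p, q, t)\<leftarrow>B. (if near p = w then lam v q - lam v p else 0) *\<^sub>R t) $ j * line_int om w v)
    - bd B j H + cl2 (concat (map TE B)) j (exterior_derivative 1 om)"
   if "in_ball R B" for B
   using that
  proof (induction B)
   case Nil then show ?case by (simp add: cl1_def bd_def cl2_def)
  next
   case (Cons e B)
   obtain p q t where e: "e = (p, q, t)" by (metis prod_cases3)
   have pq: "norm p <= R" "norm q <= R" using Cons.prems e by auto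
   have IH: "cl1 B j om = (\<Sum>w\<in>V. \<Sum>v\<in>V. (\<Sum>(p, q, t)\<leftarrow>B. (if near p = w then lam v q - lam v p else 0) *\<^sub>R t) $ j * line_int om w v)
    - bd B j H + cl2 (concat (map TE B)) j (exterior_derivative 1 om)" using Cons by simp
   have 1: "cl1 (e # B) j om = t $ j * line_int om p q + cl1 B j om" "bd (e # B) j H = t $ j * (H q - H p) + bd B j H"
    "cl2 (concat (map TE (e # B))) j z = cl2 (TE (p, q, t)) j z + cl2 (concat (map TE B)) j z" for z
    by (simp_all add: cl1_def bd_def cl2_def e)
   have 2: "(\<Sum>w\<in>V. \<Sum>v\<in>V. (\<Sum>(p, q, t)\<leftarrow>e # B. (if near p = w then lam v q - lam v p else 0) *\<^sub>R t) $ j * line_int om w v)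
    = (\<Sum>w\<in>V. \<Sum>v\<in>V. ((if near p = w then lam v q - lam v p else 0) *\<^sub>R t) $ j * line_int om w v)
    + (\<Sum>w\<in>V. \<Sum>v\<in>V. (\<Sum>(p, q, t)\<leftarrow>B. (if near p = w then lam v q - lam v p else 0) *\<^sub>R t) $ j * line_int om w v)"
    by (simp only: e list.map sum_list.Cons prod.case vector_add_component distrib_right sum.distrib)
   show ?case unfolding 1 2 edge[OF pq] IH by simp
  qed
  then have "cl1 A j om = (\<Sum>w\<in>V. \<Sum>v\<in>V. s (w, v) $ j * line_int om w v) - bd A j H + cl2 T j (exterior_derivative 1 om)"
   using A unfolding s_def T_def prod.case by fast
  moreover have "cl1 G j om = - bd A j H"
   unfolding b[rule_format] G_def cl1_def H_def
   by (simp add: sum_list_concat_map comp_def sv su sum_negf sum_distrib_left mult_ac)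
  ultimately show ?thesis by simp
 qed
 moreover have "len G <= real CARD('m) * N * del"
 proof -
  have "len G = (\<Sum>w\<in>U. \<Sum>v\<in>V. lam v w * (norm (\<chi> j. c j w) * norm (v - w)))"
   by (simp add: G_def len_def sum_list_concat_map comp_def sv su V(2) mult.assoc)
  also have "... <= (\<Sum>w\<in>U. \<Sum>v\<in>V. lam v w * ((\<Sum>j\<in>UNIV. \<bar>c j w\<bar>) * del))"
  proof (intro sum_mono)
   fix w v
   show "lam v w * (norm (\<chi> j. c j w) * norm (v - w)) <= lam v w * ((\<Sum>j\<in>UNIV. \<bar>c j w\<bar>) * del)"
   proof (cases "lam v w = 0")
    case False
    then have "norm (v - w) <= del" using V(4)[of v w] by (simp add: norm_minus_commute)
    then show ?thesis using norm_vec_le_sum[of "\<chi> j. c j w"]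
     by (intro mult_left_mono mult_mono V(2) sum_nonneg) simp_all
   qed simp
  qed
  also have "... = (\<Sum>w\<in>U. (\<Sum>v\<in>V. lam v w) * ((\<Sum>j\<in>UNIV. \<bar>c j w\<bar>) * del))" by (simp only: sum_distrib_right)
  also have "... = (\<Sum>w\<in>U. (\<Sum>j\<in>UNIV. \<bar>c j w\<bar>) * del)"
   by (rule sum.cong) (use V(5) U(2) in auto)
  also have "... = (\<Sum>j\<in>UNIV. \<Sum>w\<in>U. \<bar>c j w\<bar>) * del"
   unfolding sum_distrib_right[symmetric] by (subst sum.swap) (rule refl)
  also have "... <= (\<Sum>j\<in>(UNIV :: 'm set). N) * del" using C(2) N by (intro mult_right_mono sum_mono) auto
  finally show ?thesis by simp
 qed
 moreover have "area T <= M * del * (2 + 3 * C)"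
 proof -
  have edge: "area (TE (p, q, t)) <= norm t * norm (q - p) * (del * (2 + 3 * C))"
   if pq: "norm p <= R" "norm q <= R" "norm (q - p) <= del" for p q t
  proof -
   have "area (TE (p, q, t)) = (\<Sum>v\<in>V. lam v q * (norm t * (norm (q - p) * norm (v - p))))
     + (\<Sum>v\<in>V. \<bar>lam v q - lam v p\<bar> * (norm t * (norm (p - near p) * norm (v - near p))))"
    by (simp add: TE_def area_def comp_def sv V(2) mult.assoc)
   also have "... <= (\<Sum>v\<in>V. lam v q * (norm t * (norm (q - p) * (2 * del))))
     + (\<Sum>v\<in>V. \<bar>lam v q - lam v p\<bar> * (norm t * (del * (3 * del))))"
   proof (intro add_mono sum_mono)
    fix v
    \<comment> \<open>When \<open>v\<close> is close to \<open>q\<close> only, the length of the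
      edge has to be added, hence the factor 2.\<close>
    have n: "norm (v - p) <= 2 * del" if "lam v q ~= 0 \<or> lam v p ~= 0"
    proof (cases "lam v p = 0")
     case True
     then have "norm (q - v) <= del" using that V(4) by blast
     moreover have "v - p = (q - p) - (q - v)" by simp
     ultimately show ?thesis using norm_triangle_ineq4[of "q - p" "q - v"] pq(3) by simp
    next
     case False
     then show ?thesis using V(4)[of v p] C(2) by (simp add: norm_minus_commute)
    qed
    show "lam v q * (norm t * (norm (q - p) * norm (v - p))) <= lam v q * (norm t * (norm (q - p) * (2 * del)))"
     using n by (cases "lam v q = 0") (auto intro!: mult_left_mono V(2))
    show "\<bar>lam v q - lam v p\<bar> * (norm t * (norm (p - near p) * norm (v - near p))) <= \<bar>lam v q - lam v p\<bar> * (norm t * (del * (3 * del)))"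
    proof (cases "lam v q - lam v p = 0")
     case False
     then have "norm (v - p) <= 2 * del" by (intro n) auto
     moreover have "v - near p = (v - p) + (p - near p)" by simp
     ultimately have "norm (v - near p) <= 3 * del"
      using norm_triangle_ineq[of "v - p" "p - near p"] near(2)[OF pq(1)] by simp
     then show ?thesis using near(2)[OF pq(1)] C(2) by (intro mult_left_mono mult_mono) simp_all
    qed simp
   qed
   also have "... = (\<Sum>v\<in>V. lam v q) * (norm t * (norm (q - p) * (2 * del))) + (\<Sum>v\<in>V. \<bar>lam v q - lam v p\<bar>) * (norm t * (del * (3 * del)))"
    by (simp only: sum_distrib_right)
   \<comment> \<open>The Lipschitz factor \<open>C / del\<close> turns \<open>3 * del * del\<close>
     into \<open>3 * C * del\<close> times the length of the edge.\<close>
   also have "... <= 1 * (norm t * (norm (q - p) * (2 * del))) + (C / del * norm (q - p)) * (norm t * (del * (3 * del)))"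
    using C by (intro add_mono mult_right_mono V(3) lip) simp_all
   also have "... = norm t * norm (q - p) * (del * (2 + 3 * C))" using C(2) by (simp add: field_simps)
   finally show ?thesis .
  qed
  have "area (concat (map TE B)) <= len B * (del * (2 + 3 * C))"
   if "\<forall>(p, q, t)\<in>set B. norm p <= R & norm q <= R & norm (q - p) <= del" for B
   using that
  proof (induction B)
   case Nil then show ?case by (simp add: area_def len_def)
  next
   case (Cons e B)
   obtain p q t where e: "e = (p, q, t)" by (metis prod_cases3)
   have pq: "norm p <= R" "norm q <= R" "norm (q - p) <= del" using Cons.prems e by auto
   have IH: "area (concat (map TE B)) <= len B * (del * (2 + 3 * C))" using Cons by simp
   have 1: "area (concat (map TE (e # B))) = area (TE (p, q, t)) + area (concat (map TE B))"
    "len (e # B) = norm t * norm (q - p) + len B" by (simp_all add: area_def len_def e)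
   show ?case unfolding 1 distrib_right using edge[OF pq, of t] IH by linarith
  qed
  then have "area T <= len A * (del * (2 + 3 * C))" unfolding T_def using A by fast
  also have "... <= M * (del * (2 + 3 * C))" using M C by (intro mult_right_mono) simp_all
  finally show ?thesis by (simp add: mult.assoc)
 qed
 moreover have "\<forall>i\<in>V \<times> V. norm (s i) <= C / del * M"
 proof (rule ballI)
  fix i assume "i \<in> V \<times> V"
  then obtain w v where i: "i = (w, v)" "v \<in> V" by auto
  have "norm (s (w, v)) <= (\<Sum>(p, q, t)\<leftarrow>A. C / del * (norm t * norm (q - p)))"
   unfolding s_def prod.case
  proof (rule norm_sum_list_le)
   fix e assume "e \<in> set A"
   obtain p q t where e: "e = (p, q, t)" by (metis prod_cases3)
   have "\<bar>lam v q - lam v p\<bar> <= (\<Sum>v\<in>V. \<bar>lam v q - lam v p\<bar>)"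
    by (rule member_le_sum[OF i(2) _ V(1)]) simp
   then have "\<bar>lam v q - lam v p\<bar> <= C / del * norm (q - p)" using lip[of q p] by linarith
   then have "\<bar>if near p = w then lam v q - lam v p else 0\<bar> * norm t <= (C / del * norm (q - p)) * norm t"
    using C by (intro mult_right_mono) simp_all
   then show "norm (case e of (p, q, t) => (if near p = w then lam v q - lam v p else 0) *\<^sub>R t)
    <= (case e of (p, q, t) => C / del * (norm t * norm (q - p)))"
    unfolding e prod.case norm_scaleR by (simp only: mult_ac)
  qed
  also have "... = C / del * len A"
   unfolding len_def by (simp only: split_def sum_list_const_mult)
  also have "... <= C / del * M" using M C by (intro mult_left_mono) simp_all
  finally show "norm (s i) <= C / del * M" unfolding i(1) .
 qed
 ultimately show ?thesis by (intro exI[of _ s] exI[of _ G] exI[of _ T]) simp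
qed

abbreviation flat_dist :: "('a::euclidean_space \<times> 'a \<times> (real^'m::finite)) list => ('a \<times> 'a \<times> (real^'m)) list => ennreal" where
 "flat_dist L L' \<equiv> polyhedral_flat_norm 1 (current_diff (cl1 L) (cl1 L'))"

text \<open>Over a common grid two chains differ, apart from their remainders, by a finite graph
  whose multiplicities are the differences of the coefficients.\<close>

lemma flat_norm_decomposition_diff:
 fixes A A' :: "('a::euclidean_space \<times> 'a \<times> (real^'m::finite)) list"
 assumes V: "finite V"
  and A: "ALL j om. test_form 1 om --> cl1 A j om = (\<Sum>w\<in>V. \<Sum>v\<in>V. s (w, v) $ j * line_int om w v)
    + cl1 G j om + cl2 T j (exterior_derivative 1 om)"
  and A': "ALL j om. test_form 1 om --> cl1 A' j om = (\<Sum>w\<in>V. \<Sum>v\<in>V. s' (w, v) $ j * line_int om w v)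
    + cl1 G' j om + cl2 T' j (exterior_derivative 1 om)"
 shows "flat_dist A A' <=
  ennreal ((\<Sum>w\<in>V. \<Sum>v\<in>V. norm (s (w, v) - s' (w, v)) * norm (v - w)) + len G + len G' + area T + area T')"
proof -
 obtain vs where vs: "set vs = V" "distinct vs" using finite_distinct_list[OF V] by blast
 have sv: "(\<Sum>v\<leftarrow>vs. F v) = (\<Sum>v\<in>V. F v)" for F :: "'a => real"
  using sum_list_distinct_conv_sum_set[OF vs(2)] vs(1) by simp
 define E where "E = concat (map (%w. map (%v. (w, v, s (w, v) - s' (w, v))) vs) vs)"
 define T1 where "T1 = map (%(p, q, r, t). (p, q, r, - t)) T'"
 have T1: "area T1 = area T'" "cl2 T1 j z = - cl2 T' j z" for j z
  unfolding T1_def area_def cl2_def by (induction T') auto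
 have E: "len E = (\<Sum>w\<in>V. \<Sum>v\<in>V. norm (s (w, v) - s' (w, v)) * norm (v - w))"
  "cl1 E j om = (\<Sum>w\<in>V. \<Sum>v\<in>V. s (w, v) $ j * line_int om w v) - (\<Sum>w\<in>V. \<Sum>v\<in>V. s' (w, v) $ j * line_int om w v)" for j om
  by (simp_all add: E_def len_def cl1_def sum_list_concat_map comp_def sv left_diff_distrib sum_subtractf)
 have "flat_dist A A' <= ennreal (len (E @ G @ neg_list G') + area (T @ T1))"
 proof (rule polyhedral_flat_norm_le)
  fix j and om :: "'a form" assume om: "test_form 1 om"
  have "cl2 (T @ T1) j z = cl2 T j z - cl2 T' j z" for z
   using T1(2)[of j z] by (simp add: cl2_def)
  then show "current_diff (cl1 A) (cl1 A') j om = cl1 (E @ G @ neg_list G') j om + cl2 (T @ T1) j (exterior_derivative 1 om)"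
   unfolding current_diff_def A[rule_format, OF om] A'[rule_format, OF om] by (simp add: E(2))
 qed
 moreover have "area (T @ T1) = area T + area T'" using T1(1) by (simp add: area_def)
 ultimately show ?thesis by (simp add: E(1) add.assoc)
qed

text \<open>\<open>A\<close> has the discretized boundary that the grid decomposition needs, and
  \<open>W\<close> is a vanishing correction. The Cauchy property is stated for their union, since
  with \<open>A = L - W\<close> this is the sequence \<open>L\<close> of known cost.\<close>

lemma flat_compactness:
 fixes nu :: "'m::finite => (real^'n => real) => real" and A W :: "nat => ((real^'n) \<times> (real^'n) \<times> (real^'m)) list"
 assumes dem: "demand nu r0 N" and C: "C > 0" "\<forall>del>0. ALL r. \<exists>(V :: (real^'n) set) lam. grid_partition C del r V lam"
  and M: "ALL h. len (A h) <= M" and W: "(%h. len (W h)) \<longlonglongrightarrow> 0"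
  and R: "ALL h. in_ball (r0 + 1) (A h)"
  and nd: "ALL h. demand.near_demand nu r0 N (del h) (U h) (c h)" and del: "del \<longlonglongrightarrow> 0"
  and b: "ALL h j ph. bd (A h) j ph = (\<Sum>v\<in>U h. c h j v * ph v)"
 obtains sg T where "strict_mono sg" "vector_measure T" "compactly_supported T"
  "ALL j ph. test_function ph --> current_of_measure T j (dform ph) = nu j ph"
  "ALL j om. test_form 1 om --> (%h. cl1 (A (sg h)) j om) \<longlonglongrightarrow> current_of_measure T j om"
  "\<forall>e>0. EX n. \<forall>h\<ge>n. \<forall>l\<ge>n.
    flat_dist (A (sg h) @ W (sg h)) (A (sg l) @ W (sg l)) <= ennreal e"
proof -
 interpret demand nu r0 N by (rule dem)
 have M0: "0 <= M" using order_trans[OF len_nonneg M[rule_format]] .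
 let ?B = "%h L'. (ALL j ph. bd L' j ph = bd (A h) j ph) & len L' = len (A h) &
  (ALL j om. test_form 1 om --> cl1 L' j om = cl1 (A h) j om) &
  (\<forall>(p, q, th)\<in>set L'. norm p <= r0 + 1 & norm q <= r0 + 1 & norm (q - p) <= 1 / Suc h)"
 have ex: "ALL h. EX L'. ?B h L'"
 proof (rule allI)
  fix h
  have e: "1 / real (Suc h) > 0" by simp
  show "EX L'. ?B h L'"
   by (rule subdivide[OF R[THEN spec] e]) (intro exI conjI, assumption+)
 qed
 obtain B where B: "ALL h. ?B h (B h)"
  using ex unfolding choice_iff by (elim exE) (rule that)
 have B1: "bd (B h) j ph = (\<Sum>v\<in>U h. c h j v * ph v)" and B2: "len (B h) <= M"
  and B3: "test_form 1 om ==> cl1 (B h) j om = cl1 (A h) j om"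
  and B4: "\<forall>(p, q, th)\<in>set (B h). norm p <= r0 + 1 & norm q <= r0 + 1 & norm (q - p) <= 1 / Suc h" for h j ph om
  using B[rule_format, of h] b M by simp_all
 define d where "d k = 1 / real (Suc k)" for k
 have d0: "d k > 0" for k by (simp add: d_def)
 have "ALL k. EX V lam. grid_partition C (d k) (r0 + 1) (V :: (real^'n) set) lam"
  by (intro allI) (rule C(2)[rule_format, OF d0])
 then obtain V where "ALL k. EX lam. grid_partition C (d k) (r0 + 1) (V k :: (real^'n) set) lam" by (rule choice[THEN exE])
 then obtain lam where g: "ALL k. grid_partition C (d k) (r0 + 1) (V k :: (real^'n) set) (lam k)" by (rule choice[THEN exE])
 have fV: "finite (V k)" for k using g unfolding grid_partition_def by blast
 \<comment> \<open>Restricted to \<open>k \<le> h\<close>, where the edges of \<open>B h\<close> are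
   no longer than the mesh \<open>d k\<close>.\<close>
 let ?D = "%k h s G T. k <= h --> (ALL j om. test_form 1 om --> cl1 (A h) j om = (\<Sum>w\<in>V k. \<Sum>v\<in>V k. s (w, v) $ j * line_int om w v)
    + cl1 G j om + cl2 T j (exterior_derivative 1 om)) &
   len G <= real CARD('m) * N * d k & area T <= M * d k * (2 + 3 * C) & (\<forall>i\<in>V k \<times> V k. norm (s i) <= C / d k * M)"
 have dec: "ALL k h. EX s G T. ?D k h s G T"
 proof (intro allI)
  fix k h :: nat
  show "EX s G T. ?D k h s G T"
  proof (cases "k <= h")
   case True
   have "1 / real (Suc h) <= d k" using True unfolding d_def by (intro divide_left_mono) simp_all
   then have 1: "\<forall>(p, q, th)\<in>set (B h). norm p <= r0 + 1 & norm q <= r0 + 1 & norm (q - p) <= d k"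
    using B4[of h] by fastforce
   have 2: "ALL j ph. bd (B h) j ph = (\<Sum>v\<in>U h. c h j v * ph v)" using B1 by blast
   have 3: "finite (U h)" "U h \<subseteq> cball 0 (r0 + 1)" "ALL j. (\<Sum>w\<in>U h. \<bar>c h j w\<bar>) <= N"
    using nd[rule_format, of h] unfolding near_demand_def by blast+
   obtain s G T where "ALL j om. test_form 1 om --> cl1 (B h) j om = (\<Sum>w\<in>V k. \<Sum>v\<in>V k. s (w, v) $ j * line_int om w v)
    + cl1 G j om + cl2 T j (exterior_derivative 1 om)"
    "len G <= real CARD('m) * N * d k" "area T <= M * d k * (2 + 3 * C)" "\<forall>i\<in>V k \<times> V k. norm (s i) <= C / d k * M"
    using grid_decomposition[OF g[rule_format] C(1) d0 1 B2 2 3] by (elim exE conjE) (rule that)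
   then show ?thesis by (intro exI[of _ s] exI[of _ G] exI[of _ T] impI conjI) (simp_all add: B3)
  qed simp
 qed
 obtain s G S where dec: "ALL k h. ?D k h (s k h) (G k h) (S k h)"
  using dec unfolding choice_iff by (elim exE) (rule that)
 note decD = dec[THEN spec, THEN spec, THEN mp]
 define Q where "Q = Sigma UNIV (%k. V k \<times> V k)"
 have cQ: "countable Q" unfolding Q_def by (rule countable_SIGMA) (simp_all add: countable_finite fV)
 \<comment> \<open>The coefficients of level \<open>k\<close> are bounded by
   \<open>C / d k * M\<close>; multiplying by \<open>d k\<close> gives a bound common to all levels,
   as the diagonal extraction requires.\<close>
 define f where "f h x = (if fst x <= h then d (fst x) *\<^sub>R s (fst x) h (snd x) else 0)" for h x
 have bQ: "norm (f h x) <= C * M" if x: "x \<in> Q" for h x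
 proof (cases "fst x <= h")
  case True
  have "snd x \<in> V (fst x) \<times> V (fst x)" using x by (auto simp: Q_def)
  then have "norm (s (fst x) h (snd x)) <= C / d (fst x) * M"
   by (rule decD[OF True, THEN conjunct2, THEN conjunct2, THEN conjunct2, THEN bspec])
  then have "d (fst x) * norm (s (fst x) h (snd x)) <= d (fst x) * (C / d (fst x) * M)" using d0 by (intro mult_left_mono) (simp_all add: less_imp_le)
  then show ?thesis using True d0[of "fst x"] by (simp add: f_def)
 qed (use C M0 in \<open>simp add: f_def\<close>)
 obtain sg1 where sg1: "strict_mono sg1"
  and conv: "\<forall>x\<in>Q. EX l. (%n. f (sg1 n) x) \<longlonglongrightarrow> l"
 proof (rule function_convergent_subsequence[OF cQ bQ])
  fix k :: "nat => nat" assume k: "strict_mono k" and c: "!!x. x \<in> Q ==> EX l. (%n. f (k n) x) \<longlonglongrightarrow> l"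
  show thesis by (rule that[OF k]) (intro ballI c)
 qed
 have len1: "ALL h. len (B (sg1 h)) <= M" using B2 by blast
 have sub1: "ALL h. \<forall>(p, q, th)\<in>set (B (sg1 h)). norm p <= r0 + 1 & norm (q - p) <= 1 / Suc h"
 proof (rule allI)
  fix h
  have "1 / real (Suc (sg1 h)) <= 1 / real (Suc h)" using seq_suble[OF sg1, of h] by (intro divide_left_mono) simp_all
  then show "\<forall>(p, q, th)\<in>set (B (sg1 h)). norm p <= r0 + 1 & norm (q - p) <= 1 / Suc h"
   using B4[of "sg1 h"] by fastforce
 qed
 obtain sg2 T where sg2: "strict_mono sg2" and T: "vector_measure T" "compactly_supported T"
  and limB: "ALL j om. test_form 1 om --> (%h. cl1 (B (sg1 (sg2 h))) j om) \<longlonglongrightarrow> current_of_measure T j om"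
  by (rule chain_weak_limit[OF len1 sub1])
 define sg where "sg h = sg1 (sg2 h)" for h
 have sg: "strict_mono sg" using strict_mono_o[OF sg1 sg2] by (simp add: comp_def sg_def[abs_def])
 have lim: "(%h. cl1 (A (sg h)) j om) \<longlonglongrightarrow> current_of_measure T j om" if "test_form 1 om" for j om
  using limB[rule_format, OF that, of j] by (simp only: B3[OF that] sg_def)
 have flux: "current_of_measure T j (dform ph) = nu j ph" if t: "test_function ph" for j ph
 proof -
  have s: "smooth ph" using t by (simp add: test_function_def)
  have l1: "(%h. \<Sum>v\<in>U (sg h). c (sg h) j v * ph v) \<longlonglongrightarrow> current_of_measure T j (dform ph)"
   using lim[OF test_form_dform[OF t], of j] by (simp only: cl1_dform[OF s] b[rule_format])
  \<comment> \<open>Uniform continuity on the ball of radius \<open>r0 + 1\<close>, which contains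
    all points involved once \<open>del h < 1\<close>, makes the oscillation of \<open>ph\<close>
    over distance \<open>del h\<close> small.\<close>
  have "(%h. \<Sum>v\<in>U h. c h j v * ph v) \<longlonglongrightarrow> nu j ph"
  proof (rule LIMSEQ_I)
   fix e :: real assume e: "0 < e"
   define e' where "e' = e / (N + 1)"
   have e': "e' > 0" using e N by (simp add: e'_def)
   have "uniformly_continuous_on (cball 0 (r0 + 1)) ph"
    by (intro compact_uniformly_continuous smooth_continuous s) simp
   then obtain \<eta> where \<eta>: "\<eta> > 0" "\<forall>x\<in>cball 0 (r0 + 1). \<forall>y\<in>cball 0 (r0 + 1). dist y x < \<eta> --> dist (ph y) (ph x) < e'"
    unfolding uniformly_continuous_on_def using e' by blast
   have "\<forall>\<^sub>F h in sequentially. del h < min \<eta> 1" by (rule order_tendstoD(2)[OF del]) (use \<eta>(1) in simp)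
   then obtain n where n: "\<forall>h\<ge>n. del h < min \<eta> 1" unfolding eventually_sequentially by blast
   show "EX no. \<forall>h\<ge>no. norm ((\<Sum>v\<in>U h. c h j v * ph v) - nu j ph) < e"
   proof (intro exI[of _ n] allI impI)
    fix h assume h: "n <= h"
    have "\<bar>ph v - ph x\<bar> <= e'" if x: "norm x <= r0" "norm (x - v) <= del h" for x v
    proof -
     have d: "norm (x - v) < \<eta>" "norm (x - v) < 1" using n h x(2) by fastforce+
     have "norm v <= norm x + norm (x - v)" using norm_triangle_ineq4[of x "x - v"] by simp
     then have "v \<in> cball 0 (r0 + 1)" "x \<in> cball 0 (r0 + 1)" using x(1) d(2) by simp_all
     moreover have "dist v x < \<eta>" using d(1) by (simp add: dist_norm norm_minus_commute)
     ultimately have "dist (ph v) (ph x) < e'" using \<eta>(2) by blast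
     then show ?thesis by (simp add: dist_real_def)
    qed
    then have "\<bar>(\<Sum>v\<in>U h. c h j v * ph v) - nu j ph\<bar> <= e' * N"
     using nd[rule_format, of h] test_function_bounded_continuous[OF t] unfolding near_demand_def by blast
    also have "... < e' * (N + 1)" using e' by simp
    also have "... = e" using N by (simp add: e'_def)
    finally show "norm ((\<Sum>v\<in>U h. c h j v * ph v) - nu j ph) < e" by simp
   qed
  qed
  from LIMSEQ_subseq_LIMSEQ[OF this sg] have "(%h. \<Sum>v\<in>U (sg h). c (sg h) j v * ph v) \<longlonglongrightarrow> nu j ph" by (simp add: comp_def)
  then show ?thesis by (rule LIMSEQ_unique[OF l1])
 qed
 have cauchy: "EX n. \<forall>h\<ge>n. \<forall>l\<ge>n.
   flat_dist (A (sg h) @ W (sg h)) (A (sg l) @ W (sg l)) <= ennreal e"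
  if e: "e > 0" for e :: real
 proof -
  \<comment> \<open>The remainders of two chains at level \<open>k\<close>. The level is fixed
    first; afterwards only its finitely many coefficients have to converge.\<close>
  define E where "E k = 2 * (real CARD('m) * N * d k) + 2 * (M * d k * (2 + 3 * C))" for k
  have "E \<longlonglongrightarrow> 0" unfolding E_def d_def by real_asymp
  then have "\<forall>\<^sub>F k in sequentially. E k < e / 2" by (rule order_tendstoD(2)) (use e in simp)
  then obtain k where k: "E k < e / 2" by (auto dest!: eventually_happens)
  have "\<forall>i\<in>V k \<times> V k. EX l. (%n. s k (sg1 n) i) \<longlonglongrightarrow> l"
  proof (rule ballI)
   fix i assume "i \<in> V k \<times> V k"
   then have "(k, i) \<in> Q" by (simp add: Q_def)
   from bspec[OF conv this] obtain l where "(%n. f (sg1 n) (k, i)) \<longlonglongrightarrow> l" by (rule exE)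
   then have l: "(%n. (if k <= sg1 n then d k *\<^sub>R s k (sg1 n) i else 0)) \<longlonglongrightarrow> l"
    unfolding f_def fst_conv snd_conv .
   have "\<forall>\<^sub>F n in sequentially. (1 / d k) *\<^sub>R (if k <= sg1 n then d k *\<^sub>R s k (sg1 n) i else 0) = s k (sg1 n) i"
    using eventually_ge_at_top[of k]
   proof eventually_elim
    case (elim n)
    then have "k <= sg1 n" using seq_suble[OF sg1, of n] by simp
    then show ?case using d0[of k] by simp
   qed
   from Lim_transform_eventually[OF tendsto_scaleR[OF tendsto_const l] this]
   show "EX l. (%n. s k (sg1 n) i) \<longlonglongrightarrow> l" by (rule exI)
  qed
  then obtain l where l: "\<forall>i\<in>V k \<times> V k. (%n. s k (sg1 n) i) \<longlonglongrightarrow> l i" by (rule bchoice[THEN exE])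
  have l': "(%n. s k (sg n) i) \<longlonglongrightarrow> l i" if "i \<in> V k \<times> V k" for i
   using LIMSEQ_subseq_LIMSEQ[OF l[rule_format, OF that] sg2] by (simp add: comp_def sg_def)
  define F where "F n = (\<Sum>w\<in>V k. \<Sum>v\<in>V k. norm (s k (sg n) (w, v) - l (w, v)) * norm (v - w))" for n
  have "F \<longlonglongrightarrow> (\<Sum>w\<in>V k. \<Sum>v\<in>V k. norm (l (w, v) - l (w, v)) * norm (v - w))"
   unfolding F_def by (intro tendsto_sum tendsto_mult tendsto_norm tendsto_diff tendsto_const l') auto
  then have "F \<longlonglongrightarrow> 0" by simp
  then have "\<forall>\<^sub>F n in sequentially. F n < e / 8" by (rule order_tendstoD(2)) (use e in simp)
  moreover have "\<forall>\<^sub>F n in sequentially. len (W n) < e / 8" by (rule order_tendstoD(2)[OF W]) (use e in simp)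
  ultimately have "\<forall>\<^sub>F n in sequentially. F n < e / 8 & len (W n) < e / 8" by (rule eventually_conj)
  then obtain n where n: "\<forall>h\<ge>n. F h < e / 8 & len (W h) < e / 8" unfolding eventually_sequentially by blast
  show ?thesis
  proof (intro exI[of _ "max n k"] allI impI)
   fix h m assume hm: "max n k <= h" "max n k <= m"
   have k1: "k <= sg h" "k <= sg m" using hm seq_suble[OF sg, of h] seq_suble[OF sg, of m] by simp_all
   have D: "ALL j om. test_form 1 om --> cl1 (A h @ W h) j om = (\<Sum>w\<in>V k. \<Sum>v\<in>V k. s k h (w, v) $ j * line_int om w v)
    + cl1 (G k h @ W h) j om + cl2 (S k h) j (exterior_derivative 1 om)" if "k <= h" for h
   proof (intro allI impI)
    fix j and om :: "(real^'n) form" assume om: "test_form 1 om"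
    have "cl1 (A h) j om = (\<Sum>w\<in>V k. \<Sum>v\<in>V k. s k h (w, v) $ j * line_int om w v)
     + cl1 (G k h) j om + cl2 (S k h) j (exterior_derivative 1 om)"
     by (rule decD[OF that, THEN conjunct1, THEN spec, THEN spec, THEN mp, OF om])
    then show "cl1 (A h @ W h) j om = (\<Sum>w\<in>V k. \<Sum>v\<in>V k. s k h (w, v) $ j * line_int om w v)
     + cl1 (G k h @ W h) j om + cl2 (S k h) j (exterior_derivative 1 om)" unfolding cl1_append by linarith
   qed
   have "flat_dist (A (sg h) @ W (sg h)) (A (sg m) @ W (sg m)) <=
    ennreal ((\<Sum>w\<in>V k. \<Sum>v\<in>V k. norm (s k (sg h) (w, v) - s k (sg m) (w, v)) * norm (v - w)) + len (G k (sg h) @ W (sg h)) + len (G k (sg m) @ W (sg m)) + area (S k (sg h)) + area (S k (sg m)))"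
    by (rule flat_norm_decomposition_diff[OF fV D[OF k1(1)] D[OF k1(2)]])
   also have "... <= ennreal e"
   proof (rule ennreal_leI)
    have "(\<Sum>w\<in>V k. \<Sum>v\<in>V k. norm (s k (sg h) (w, v) - s k (sg m) (w, v)) * norm (v - w)) <= F h + F m"
     unfolding F_def sum.distrib[symmetric] distrib_right[symmetric]
    proof (intro sum_mono mult_right_mono norm_ge_zero)
     fix w v
     show "norm (s k (sg h) (w, v) - s k (sg m) (w, v)) <= norm (s k (sg h) (w, v) - l (w, v)) + norm (s k (sg m) (w, v) - l (w, v))"
      using norm_triangle_ineq4[of "s k (sg h) (w, v) - l (w, v)" "s k (sg m) (w, v) - l (w, v)"] by simp
    qed
    moreover have "F h < e / 8" "F m < e / 8" using n hm by simp_all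
    moreover have "len (W (sg h)) < e / 8" "len (W (sg m)) < e / 8"
     using n hm seq_suble[OF sg, of h] seq_suble[OF sg, of m] by simp_all
    moreover have "len (G k (sg h)) <= real CARD('m) * N * d k" "len (G k (sg m)) <= real CARD('m) * N * d k"
     "area (S k (sg h)) <= M * d k * (2 + 3 * C)" "area (S k (sg m)) <= M * d k * (2 + 3 * C)"
     by (rule decD[OF k1(1), THEN conjunct2, THEN conjunct1] decD[OF k1(2), THEN conjunct2, THEN conjunct1]
      decD[OF k1(1), THEN conjunct2, THEN conjunct2, THEN conjunct1] decD[OF k1(2), THEN conjunct2, THEN conjunct2, THEN conjunct1])+
    ultimately show "(\<Sum>w\<in>V k. \<Sum>v\<in>V k. norm (s k (sg h) (w, v) - s k (sg m) (w, v)) * norm (v - w)) + len (G k (sg h) @ W (sg h)) + len (G k (sg m) @ W (sg m)) + area (S k (sg h)) + area (S k (sg m)) <= e"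
     using k unfolding E_def len_append by linarith
   qed
   finally show "flat_dist (A (sg h) @ W (sg h)) (A (sg m) @ W (sg m)) <= ennreal e" .
  qed
 qed
 show thesis
  by (rule that[OF sg T]) (intro allI impI, rule flux, assumption, intro allI impI, rule lim, assumption, intro allI impI, rule cauchy, assumption)
qed

section \<open>Existence of minimizers\<close>

lemma test_form_1_bounded:
 fixes w :: "(real^'n) form"
 assumes w: "test_form 1 w"
 obtains B where "B > 0" "ALL x v. \<bar>w x v\<bar> <= B * norm (v 0)"
proof -
 define F where "F x = (\<chi> i. w x (%_. axis i 1))" for x
 have c: "continuous_on UNIV F"
  unfolding F_def by (intro continuous_on_vec_lambda smooth_continuous test_form_smooth[OF w])
 obtain K where K: "compact K" "ALL x. x \<notin> K --> w x = (%v. 0)" using w by (auto simp: test_form_def)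
 have "bounded (F ` K)" by (intro compact_imp_bounded compact_continuous_image continuous_on_subset[OF c] K(1)) simp
 then obtain B where B: "B > 0" "\<forall>y\<in>F ` K. norm y <= B" unfolding bounded_pos by blast
 have FB: "norm (F x) <= B" for x
 proof (cases "x \<in> K")
  case False
  then have "F x = 0" using K(2) by (simp add: F_def vec_eq_iff)
  then show ?thesis using B(1) by simp
 qed (use B(2) in blast)
 have "\<bar>w x v\<bar> <= B * norm (v 0)" for x v
 proof -
  have "w x v = w x (%_. v 0)" by (rule covector_1[OF test_form_covector[OF w]])
  also have "... = v 0 \<bullet> F x" unfolding F_def by (rule covector_1_inner[OF w])
  finally have "\<bar>w x v\<bar> <= norm (v 0) * norm (F x)" using Cauchy_Schwarz_ineq2[of "v 0" "F x"] by simp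
  also have "... <= norm (v 0) * B" by (rule mult_left_mono[OF FB]) simp
  finally show ?thesis by (simp add: mult.commute)
 qed
 then show thesis using that[OF B(1)] by blast
qed

lemma polyhedral_current_cl1: "polyhedral_current 1 (cl1 L)"
proof -
 obtain P where "polyhedral_chain 1 P" "current_eq 1 (cl1 L) (current_of_chain 1 P)" by (rule cl1_polyhedral)
 then show ?thesis unfolding polyhedral_current_def by (intro exI conjI)
qed

lemma cl1_tendsto_0:
 fixes W :: "nat => ((real^'n) \<times> (real^'n) \<times> (real^'m)) list"
 assumes W: "(%h. len (W h)) \<longlonglongrightarrow> 0" and w: "test_form 1 w"
 shows "(%h. cl1 (W h) j w) \<longlonglongrightarrow> 0"
proof -
 obtain B where B: "B > 0" "ALL x v. \<bar>w x v\<bar> <= B * norm (v 0)" by (rule test_form_1_bounded[OF w])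
 \<comment> \<open>\<open>mass_bound\<close> takes a strict inequality, hence the additional
   \<open>1 / Suc h\<close>.\<close>
 have bound: "\<bar>cl1 (W h) j w\<bar> <= B * (len (W h) + 1 / Suc h)" for h
 proof (rule mass_bound[OF polyhedral_current_cl1 _ w B(1)])
  have "mass 1 (cl1 (W h)) <= ennreal (len (W h))" by (rule mass_cl1_le)
  also have "... < ennreal (len (W h) + 1 / Suc h)" by (rule ennreal_lessI) (simp_all add: add_nonneg_pos len_nonneg)
  finally show "mass 1 (cl1 (W h)) < ennreal (len (W h) + 1 / Suc h)" .
  show "\<bar>w x v\<bar> <= B * norm (v 0)" for x v using B(2) by blast
 qed
 have "(%h. 1 / real (Suc h)) \<longlonglongrightarrow> 0" by real_asymp
 from tendsto_mult[OF tendsto_const tendsto_add[OF W this], of B]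
 have "(%h. B * (len (W h) + 1 / Suc h)) \<longlonglongrightarrow> 0" by simp
 then show ?thesis
  by (rule Lim_null_comparison[rotated]) (intro always_eventually allI, simp only: real_norm_def bound)
qed

lemma cl1_supported:
 fixes L :: "((real^'n) \<times> (real^'n) \<times> (real^'m)) list"
 assumes L: "in_ball R L" and P: "current_eq 1 (cl1 L) P"
 shows "supported_in 1 P (cball 0 R)"
 unfolding supported_in_def
proof (intro allI impI)
 fix j and w :: "(real^'n) form"
 assume w: "test_form 1 w" and d: "closure {x. w x ~= (%v. 0)} \<inter> cball 0 R = {}"
 have z: "w x = (%v. 0)" if "norm x <= R" for x
 proof (rule ccontr)
  assume "w x ~= (%v. 0)"
  then have "x \<in> closure {x. w x ~= (%v. 0)}" by (intro subsetD[OF closure_subset]) simp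
  then show False using d that by auto
 qed
 have li: "line_int w p q = 0" if pq: "norm p <= R" "norm q <= R" for p q
 proof -
  have "indicator {0..1} s *\<^sub>R w (p + s *\<^sub>R (q - p)) (%_. q - p) = 0" for s :: real
  proof (cases "s \<in> {0..1}")
   case True
   have "p + s *\<^sub>R (q - p) = (1 - s) *\<^sub>R p + s *\<^sub>R q" by (simp add: algebra_simps)
   also have "... \<in> cball 0 R" by (rule convexD[OF convex_cball]) (use pq True in auto)
   finally show ?thesis using z by simp
  qed simp
  then show ?thesis unfolding line_int_def set_lebesgue_integral_def by (simp only: Bochner_Integration.integral_zero)
 qed
 have "P j w = cl1 L j w" using P w unfolding current_eq_def by simp
 also have "... = sum_list (map (%_. 0) L)"
  unfolding cl1_def
 proof (rule arg_cong[of _ _ sum_list], rule map_cong[OF refl])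
  fix e assume e: "e \<in> set L"
  obtain p q t where e': "e = (p, q, t)" by (metis prod_cases3)
  have "norm p <= R" "norm q <= R" using L e unfolding e' by auto
  then show "(case e of (p, q, t) => t $ j * line_int w p q) = 0" by (simp add: e' li)
 qed
 finally show "P j w = 0" by simp
qed

text \<open>The difference to the limit is represented by the differences to later members of the
  sequence, whose flat norms are at most \<open>e\<close>.\<close>

lemma flat_norm_limit:
 fixes L :: "nat => ((real^'n) \<times> (real^'n) \<times> (real^'m)) list"
 assumes P: "current_eq 1 (cl1 (L h)) P"
  and lim: "ALL j w. test_form 1 w --> (%h. cl1 (L h) j w) \<longlonglongrightarrow> T j w"
  and cauchy: "\<forall>e>0. EX n. \<forall>h\<ge>n. \<forall>l\<ge>n. flat_dist (L h) (L l) <= ennreal e"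
  and e: "\<forall>l\<ge>n. flat_dist (L h) (L l) <= ennreal e"
 shows "flat_norm 1 (current_diff P T) <= ennreal e"
proof -
 \<comment> \<open>The definition of \<open>flat_norm\<close> asks for convergent flat norms;
   compactness of the extended half-line provides a subsequence along which they converge.\<close>
 define X where "X i = flat_dist (L h) (L i)" for i
 obtain l s where s: "strict_mono (s :: nat => nat)" and l: "(X \<circ> s) \<longlonglongrightarrow> l"
  using compact_complete_linorder[of X] by blast
 have "l <= ennreal e"
 proof (rule tendsto_upperbound[OF l])
  show "\<forall>\<^sub>F i in sequentially. (X \<circ> s) i <= ennreal e"
   using eventually_ge_at_top[of n]
  proof eventually_elim
   case (elim i)
   then have "n <= s i" using seq_suble[OF s, of i] by simp
   then show ?case using e by (simp add: X_def)
  qed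
 qed simp
 moreover have "flat_norm 1 (current_diff P T) <= l"
  unfolding flat_norm_def
 proof (rule Inf_lower, rule CollectI, intro exI[of _ "%i. current_diff (cl1 (L h)) (cl1 (L (s i)))"] conjI)
  show "(%i. flat_dist (L h) (L (s i))) \<longlonglongrightarrow> l"
   using l by (simp add: comp_def X_def)
  show "represents 1 (%i. current_diff (cl1 (L h)) (cl1 (L (s i)))) (current_diff P T)"
   unfolding represents_def
  proof (intro conjI allI impI)
   fix i
   have "current_diff (cl1 (L h)) (cl1 (L (s i))) = cl1 (L h @ neg_list (L (s i)))"
    by (simp add: current_diff_def fun_eq_iff)
   then show "polyhedral_current 1 (current_diff (cl1 (L h)) (cl1 (L (s i))))" by (simp only: polyhedral_current_cl1)
  next
   fix eps :: ennreal assume "eps > 0"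
   then obtain y where y: "0 < y" "y < eps" using dense by blast
   then have "y ~= \<top>" using less_top by fastforce
   then obtain r where r: "y = ennreal r" "r >= 0" by (cases y) auto
   then have "r > 0" using y(1) by (simp add: ennreal_less_zero_iff)
   then obtain k where k: "\<forall>h\<ge>k. \<forall>l\<ge>k. flat_dist (L h) (L l) <= ennreal r"
    using cauchy by blast
   show "EX N. \<forall>i\<ge>N. \<forall>l\<ge>N. polyhedral_flat_norm 1 (current_diff (current_diff (cl1 (L h)) (cl1 (L (s i))))
     (current_diff (cl1 (L h)) (cl1 (L (s l))))) < eps"
   proof (intro exI[of _ k] allI impI)
    fix i m assume "k <= i" "k <= m"
    then have "k <= s i" "k <= s m" using seq_suble[OF s, of i] seq_suble[OF s, of m] by simp_all
    then have "flat_dist (L (s m)) (L (s i)) <= ennreal r" using k by blast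
    also have "current_diff (cl1 (L (s m))) (cl1 (L (s i))) =
     current_diff (current_diff (cl1 (L h)) (cl1 (L (s i)))) (current_diff (cl1 (L h)) (cl1 (L (s m))))"
     by (simp add: current_diff_def fun_eq_iff)
    finally show "polyhedral_flat_norm 1 (current_diff (current_diff (cl1 (L h)) (cl1 (L (s i))))
     (current_diff (cl1 (L h)) (cl1 (L (s m))))) < eps" using y(2) unfolding r(1) by (rule le_less_trans)
   qed
  next
   fix j and w :: "(real^'n) form" assume w: "test_form 1 w"
   have "(%i. cl1 (L (s i)) j w) \<longlonglongrightarrow> T j w"
    using LIMSEQ_subseq_LIMSEQ[OF lim[rule_format, OF w] s] by (simp add: comp_def)
   from tendsto_diff[OF tendsto_const this, of "cl1 (L h) j w"]
   show "(%i. current_diff (cl1 (L h)) (cl1 (L (s i))) j w) \<longlonglongrightarrow> current_diff P T j w"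
    using P w unfolding current_eq_def by (simp add: current_diff_def)
  qed
 qed
 ultimately show ?thesis by (rule order_trans[rotated])
qed

text \<open>One admissible sequence bounds the relaxed energy from above; the edge lists become
  polyhedral chains without an increase of cost.\<close>

lemma energy_le_liminf:
 fixes L :: "nat => ((real^'n) \<times> (real^'n) \<times> (real^'m)) list" and T :: "(real^'n) set => real^'m^'n"
 assumes C: "multi_material_cost C" and R: "ALL h. in_ball R (L h)"
  and lim: "ALL j w. test_form 1 w --> (%h. cl1 (L h) j w) \<longlonglongrightarrow> current_of_measure T j w"
  and cauchy: "\<forall>e>0. EX n. \<forall>h\<ge>n. \<forall>l\<ge>n. flat_dist (L h) (L l) <= ennreal e"
 shows "energy C T <= liminf (%h. list_cost C (L h))"
proof -
 have "ALL h. EX P. polyhedral_chain 1 P & current_eq 1 (cl1 (L h)) (current_of_chain 1 P) &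
  discrete_energy C P <= (list_cost C (L h))"
 proof (rule allI)
  fix h
  obtain P where "polyhedral_chain 1 P" "current_eq 1 (cl1 (L h)) (current_of_chain 1 P)"
   "ALL C. multi_material_cost C --> discrete_energy C P <= (list_cost C (L h))"
   by (rule cl1_polyhedral)
  then show "EX P. polyhedral_chain 1 P & current_eq 1 (cl1 (L h)) (current_of_chain 1 P) &
   discrete_energy C P <= (list_cost C (L h))" using C by (intro exI[of _ P]) simp
 qed
 then obtain P where P: "ALL h. polyhedral_chain 1 (P h) & current_eq 1 (cl1 (L h)) (current_of_chain 1 (P h)) &
  discrete_energy C (P h) <= (list_cost C (L h))" by (rule choice[THEN exE])
 have "energy C T <= liminf (%h. discrete_energy C (P h))"
  unfolding energy_def
 proof (rule Inf_lower, rule CollectI, intro exI[of _ P] conjI refl exI[of _ "cball 0 R"] allI)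
  show "polyhedral_chain 1 (P h)" for h using P by simp
  show "compact (cball (0 :: real^'n) R)" by simp
  show "supported_in 1 (current_of_chain 1 (P h)) (cball 0 R)" for h
   by (rule cl1_supported[OF R[THEN spec, of h]]) (use P in simp)
  show "(%h. flat_norm 1 (current_diff (current_of_chain 1 (P h)) (current_of_measure T))) \<longlonglongrightarrow> 0"
  proof (rule order_tendstoI)
   fix a :: ennreal assume "0 < a"
   then obtain y where y: "0 < y" "y < a" using dense by blast
   then have "y ~= \<top>" using less_top by fastforce
   then obtain r where r: "y = ennreal r" "r >= 0" by (cases y) auto
   then have "r > 0" using y(1) by (simp add: ennreal_less_zero_iff)
   then obtain n where n: "\<forall>h\<ge>n. \<forall>l\<ge>n. flat_dist (L h) (L l) <= ennreal r"
    using cauchy by blast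
   show "\<forall>\<^sub>F h in sequentially. flat_norm 1 (current_diff (current_of_chain 1 (P h)) (current_of_measure T)) < a"
    using eventually_ge_at_top[of n]
   proof eventually_elim
    case (elim h)
    have "flat_norm 1 (current_diff (current_of_chain 1 (P h)) (current_of_measure T)) <= ennreal r"
     by (rule flat_norm_limit[OF _ lim cauchy]) (use P n elim in auto)
    then show ?case using y(2) unfolding r(1) by (rule le_less_trans)
   qed
  qed simp
 qed
 also have "... <= liminf (%h. list_cost C (L h))"
  by (rule Liminf_mono) (use P in simp)
 finally show ?thesis .
qed

lemma sum_list_ennreal:
 "(!!x. x \<in> set xs ==> 0 <= f x) ==> (\<Sum>x\<leftarrow>xs. ennreal (f x)) = ennreal (\<Sum>x\<leftarrow>xs. f x)"
proof (induction xs)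
 case (Cons a xs)
 have "0 <= f a" "0 <= (\<Sum>x\<leftarrow>xs. f x)" using Cons.prems by (auto intro!: sum_list_nonneg)
 then show ?case using Cons by simp
qed simp

lemma len_le_cost:
 fixes L :: "('a::euclidean_space \<times> 'a \<times> (real^'m)) list"
 assumes C: "multi_material_cost C" and K: "K > 0" "ALL t. (ALL j. \<bar>t $ j\<bar> <= N) --> norm t <= K * C t"
  and L: "\<forall>(p, q, t)\<in>set L. ALL j. \<bar>t $ j\<bar> <= N"
  and E: "(list_cost C L) <= ennreal E" "E >= 0"
 shows "len L <= K * E"
proof -
 have C0: "0 <= C t" for t using C by (simp add: multi_material_cost_def)
 have "(\<Sum>x\<leftarrow>L. ennreal (case x of (p, q, t) => C t * dist p q)) = ennreal (\<Sum>(p, q, t)\<leftarrow>L. C t * dist p q)"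
  by (rule sum_list_ennreal) (auto simp: C0)
 moreover have "(\<Sum>x\<leftarrow>L. ennreal (case x of (p, q, t) => C t * dist p q)) = (list_cost C L)"
  by (simp add: split_def)
 ultimately have s: "(\<Sum>(p, q, t)\<leftarrow>L. C t * dist p q) <= E" using E by (simp add: ennreal_le_iff)
 have "len L <= K * (\<Sum>(p, q, t)\<leftarrow>L. C t * dist p q)"
  using L
 proof (induction L)
  case Nil then show ?case by (simp add: len_def)
 next
  case (Cons e L)
  obtain p q t where e: "e = (p, q, t)" by (metis prod_cases3)
  have "ALL j. \<bar>t $ j\<bar> <= N" using Cons.prems by (simp add: e)
  then have "norm t * norm (q - p) <= (K * C t) * norm (q - p)" using K(2) by (intro mult_right_mono) simp_all
  then show ?case using Cons by (simp add: e len_def distrib_left dist_norm norm_minus_commute mult.assoc)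
 qed
 also have "... <= K * E" using s K(1) by (intro mult_left_mono) simp_all
 finally show ?thesis .
qed

lemma flux_exists:
 fixes \<mu>m \<mu>p :: "(real^'n) set => real^'m"
 assumes dem: "demand (demand_of \<mu>m \<mu>p) r0 N"
  and C: "C > 0" "\<forall>del>0. ALL r. \<exists>(V :: (real^'n) set) lam. grid_partition C del r V lam"
 shows "EX T. multi_material_flux T \<mu>m \<mu>p"
proof -
 interpret demand "demand_of \<mu>m \<mu>p" r0 N by (rule dem)
 define del where "del h = 1 / real (Suc h)" for h
 have ex: "ALL h. EX V c. near_demand (del h) V c"
 proof (rule allI)
  fix h
  have d: "del h > 0" "del h <= 1" by (simp_all add: del_def)
  obtain V lam where "grid_partition C (del h) r0 (V :: (real^'n) set) lam" using C(2)[rule_format, OF d(1), of r0] by (elim exE) (rule that)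
  from grid_near_demand(1)[OF this order_refl d(2)] show "EX V c. near_demand (del h) V c" by (intro exI)
 qed
 obtain V c where Vc: "ALL h. near_demand (del h) (V h) (c h)"
  using ex unfolding choice_iff by (elim exE) (rule that)
 have fV: "finite (V h)" and nV: "v \<in> V h ==> norm v <= r0 + 1" and cV: "(\<Sum>v\<in>V h. \<bar>c h j v\<bar>) <= N" for h v j
  using Vc unfolding near_demand_def by (auto simp: subset_iff)
 have "ALL h. EX vs. set vs = V h & distinct vs" using finite_distinct_list[OF fV] by blast
 then obtain vs where vs: "ALL h. set (vs h) = V h & distinct (vs h)" by (rule choice[THEN exE])
 have sv: "(\<Sum>v\<leftarrow>vs h. F v) = (\<Sum>v\<in>V h. F v)" for F :: "real^'n => real" and h
  using sum_list_distinct_conv_sum_set[of "vs h" F] vs by simp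
 \<comment> \<open>Cones with apex 0: the weights balance, so the apex carries no boundary.\<close>
 define A where "A h = map (%v. (0 :: real^'n, v, \<chi> j. c h j v)) (vs h)" for h
 have bA: "bd (A h) j f = (\<Sum>v\<in>V h. c h j v * f v)" for h j f
  using near_demand_sum[OF Vc[rule_format, of h], of j]
  by (simp add: A_def bd_def comp_def sv right_diff_distrib sum_subtractf sum_distrib_right[symmetric])
 have lA: "len (A h) <= real CARD('m) * N * (r0 + 1)" for h
 proof -
  have "len (A h) = (\<Sum>v\<in>V h. norm (\<chi> j. c h j v) * norm v)" by (simp add: A_def len_def comp_def sv)
  also have "... <= (\<Sum>v\<in>V h. (\<Sum>j\<in>UNIV. \<bar>c h j v\<bar>) * (r0 + 1))"
  proof (rule sum_mono)
   fix v assume "v \<in> V h"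
   then show "norm (\<chi> j. c h j v) * norm v <= (\<Sum>j\<in>UNIV. \<bar>c h j v\<bar>) * (r0 + 1)"
    using norm_vec_le_sum[of "\<chi> j. c h j v"] nV by (intro mult_mono sum_nonneg) simp_all
  qed
  also have "... = (\<Sum>j\<in>UNIV. \<Sum>v\<in>V h. \<bar>c h j v\<bar>) * (r0 + 1)"
   unfolding sum_distrib_right[symmetric] by (subst sum.swap) (rule refl)
  also have "... <= (\<Sum>j\<in>(UNIV :: 'm set). N) * (r0 + 1)" using r0 by (intro mult_right_mono sum_mono cV) simp
  finally show ?thesis by simp
 qed
 have R: "ALL h. in_ball (r0 + 1) (A h)"
  using nV vs r0 by (auto simp: A_def)
 have del0: "del \<longlonglongrightarrow> 0" unfolding del_def by real_asymp
 have W0: "(%h::nat. len ([] :: ((real^'n) \<times> (real^'n) \<times> (real^'m)) list)) \<longlonglongrightarrow> 0" by (simp add: len_def)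
 obtain T :: "(real^'n) set => real^'m^'n" where "vector_measure T" "compactly_supported T"
  "ALL j f. test_function f --> current_of_measure T j (dform f) = demand_of \<mu>m \<mu>p j f"
  by (rule flat_compactness[OF dem C, of A _ "%_. []" del V c]) (use lA W0 R Vc del0 bA in auto)
 then have "multi_material_flux T \<mu>m \<mu>p" unfolding multi_material_flux_iff by (intro conjI)
 then show ?thesis by (intro exI[of _ T])
qed

text \<open>Finite energy of one flux makes the infimum a real number, so that near-minimizers have
  a finite cost bound, from which the length bound follows.\<close>

lemma optimal_flux_exists:
 fixes \<mu>m \<mu>p :: "(real^'n) set => real^'m"
 assumes dem: "demand (demand_of \<mu>m \<mu>p) r0 N" and C: "multi_material_cost C"
  and Cg: "Cg > 0" "\<forall>d>0. ALL r. \<exists>(V :: (real^'n) set) lam. grid_partition Cg d r V lam"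
  and S: "multi_material_flux S0 \<mu>m \<mu>p" "energy C S0 < \<infinity>"
 shows "EX T. multi_material_flux T \<mu>m \<mu>p & (ALL S. multi_material_flux S \<mu>m \<mu>p --> energy C T <= energy C S)"
proof -
 interpret demand "demand_of \<mu>m \<mu>p" r0 N by (rule dem)
 have C0: "ALL t. 0 <= C t" using C by (simp add: multi_material_cost_def)
 define e0 where "e0 = (INF S\<in>{S. multi_material_flux S \<mu>m \<mu>p}. energy C S)"
 have "e0 <= energy C S0" unfolding e0_def by (rule INF_lower) (use S in simp)
 then have e0: "e0 < \<infinity>" using S(2) by (rule le_less_trans)
 then obtain E0 where E0: "e0 = ennreal E0" "E0 >= 0" by (cases e0) auto
 define eps where "eps h = 1 / real (Suc h)" for h
 have eps: "eps h > 0" "eps h <= 1" for h by (simp_all add: eps_def)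
 define c0 where "c0 = real CARD('m) * (7 * Cg + 1) + 2"
 have c0: "c0 >= 0" using Cg(1) by (simp add: c0_def)
 let ?Q = "%h L W d V c. 0 < d & d <= eps h & near_demand d V c & (ALL j f. bd L j f - bd W j f = (\<Sum>v\<in>V. c j v * f v)) &
  (\<forall>(p, q, t)\<in>set L. norm p <= r0 + 1 & norm q <= r0 + 1 & (ALL j. \<bar>t $ j\<bar> <= N)) &
  (in_ball (r0 + 1) W) & len W <= c0 * eps h &
  (list_cost C L) <= ennreal (E0 + eps h)"
 have "ALL h. EX L W d V c. ?Q h L W d V c"
 proof (rule allI)
  fix h
  have "e0 < ennreal (E0 + eps h)" unfolding E0(1) using E0(2) eps[of h] by (intro ennreal_lessI) simp_all
  then obtain S where Sf: "multi_material_flux S \<mu>m \<mu>p" and "energy C S < ennreal (E0 + eps h)"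
   unfolding e0_def INF_less_iff by blast
  then obtain P where P: "ALL h. polyhedral_chain 1 (P h)" "liminf (%h. discrete_energy C (P h)) < ennreal (E0 + eps h)"
   "(%h. flat_norm 1 (current_diff (current_of_chain 1 (P h)) (current_of_measure S))) \<longlonglongrightarrow> 0"
   unfolding energy_def Inf_less_iff by blast
  \<comment> \<open>A limit inferior gives the cost bound for infinitely many \<open>k\<close>, flat
    convergence holds for all large \<open>k\<close>; a common index exists.\<close>
  have "\<exists>\<^sub>F k in sequentially. discrete_energy C (P k) < ennreal (E0 + eps h)"
  proof (rule ccontr)
   assume "\<not> ?thesis"
   then have "\<forall>\<^sub>F k in sequentially. ennreal (E0 + eps h) <= discrete_energy C (P k)"
    unfolding frequently_def not_not not_less .
   from Liminf_bounded[OF this] show False using P(2) by simp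
  qed
  moreover have "\<forall>\<^sub>F k in sequentially. flat_norm 1 (current_diff (current_of_chain 1 (P k)) (current_of_measure S)) < ennreal (eps h)"
   by (rule order_tendstoD(2)[OF P(3)]) (use eps(1)[of h] in \<open>simp add: ennreal_less_zero_iff\<close>)
  ultimately have "\<exists>\<^sub>F k in sequentially. discrete_energy C (P k) < ennreal (E0 + eps h) &
   flat_norm 1 (current_diff (current_of_chain 1 (P k)) (current_of_measure S)) < ennreal (eps h)"
   by (rule frequently_eventually_frequently)
  then obtain k where k: "discrete_energy C (P k) < ennreal (E0 + eps h)"
   "flat_norm 1 (current_diff (current_of_chain 1 (P k)) (current_of_measure S)) < ennreal (eps h)"
   by (auto dest!: frequently_ex)
  obtain L where L: "current_eq 1 (current_of_chain 1 (P k)) (cl1 L)"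
   "ALL C. (ALL t. 0 <= C t) --> discrete_energy C (P k) = (list_cost C L)"
   by (rule chain_to_list[OF P(1)[rule_format]])
  have Sd: "current_of_measure S j (dform f) = demand_of \<mu>m \<mu>p j f" if "test_function f" for j f
   using Sf that unfolding multi_material_flux_iff by blast
  obtain W V c d where W: "0 < d" "d <= eps h" "near_demand d V c"
   "ALL j f. bd L j f - bd W j f = (\<Sum>v\<in>V. c j v * f v)" "len W <= c0 * eps h"
   by (rule flux_near_grid[OF Sd L(1) k(2) eps(1) Cg eps(1), folded c0_def])
  obtain L' W' where L': "ALL j f. bd L' j f - bd W' j f = (\<Sum>v\<in>V. c j v * f v)"
   "\<forall>(p, q, t)\<in>set L'. norm p <= r0 + 1 & norm q <= r0 + 1 & (ALL j. \<bar>t $ j\<bar> <= N)"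
   "in_ball (r0 + 1) W'" "len W' <= len W"
   "ALL C. multi_material_cost C --> (list_cost C L') <= (list_cost C L)"
   by (rule reduced_flux[OF W(3,4)])
  have "(list_cost C L') <= (list_cost C L)"
   by (rule L'(5)[rule_format, OF C])
  also have "... = discrete_energy C (P k)" by (rule L(2)[THEN spec, THEN mp, OF C0, symmetric])
  also have "... <= ennreal (E0 + eps h)" using k(1) by (rule less_imp_le)
  finally have cost: "(list_cost C L') <= ennreal (E0 + eps h)" .
  show "EX L W d V c. ?Q h L W d V c"
   by (rule exI[of _ L'], rule exI[of _ W'], rule exI[of _ d], rule exI[of _ V], rule exI[of _ c])
     (intro conjI W(1-3) L'(1-3) cost order_trans[OF L'(4) W(5)])
 qed
 then obtain L W d V c where LW: "ALL h. ?Q h (L h) (W h) (d h) (V h) (c h)"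
  unfolding choice_iff by (elim exE) (rule that)
 note D = LW[THEN spec]
 note D1 = D[THEN conjunct1] and D2 = D[THEN conjunct2, THEN conjunct1] and D3 = D[THEN conjunct2, THEN conjunct2, THEN conjunct1]
 note D' = D[THEN conjunct2, THEN conjunct2, THEN conjunct2]
 note D4 = D'[THEN conjunct1] and D5 = D'[THEN conjunct2, THEN conjunct1]
  and D6 = D'[THEN conjunct2, THEN conjunct2, THEN conjunct1]
  and D7 = D'[THEN conjunct2, THEN conjunct2, THEN conjunct2, THEN conjunct1]
  and D8 = D'[THEN conjunct2, THEN conjunct2, THEN conjunct2, THEN conjunct2]
 have eeps: "eps \<longlonglongrightarrow> 0" unfolding eps_def by real_asymp
 have d0: "d \<longlonglongrightarrow> 0"
  by (rule real_tendsto_sandwich[OF _ _ tendsto_const eeps]) (intro always_eventually allI less_imp_le D1, intro always_eventually allI D2)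
 have W0: "(%h. len (W h)) \<longlonglongrightarrow> 0"
 proof (rule real_tendsto_sandwich)
  show "\<forall>\<^sub>F h in sequentially. 0 <= len (W h)" by (intro always_eventually allI len_nonneg)
  show "\<forall>\<^sub>F h in sequentially. len (W h) <= c0 * eps h" by (intro always_eventually allI D7)
  show "(%h. c0 * eps h) \<longlonglongrightarrow> 0" using tendsto_mult[OF tendsto_const eeps, of c0] by simp
 qed simp
 obtain K where K: "K > 0" "ALL t. (ALL j. \<bar>t $ j\<bar> <= N) --> norm t <= K * C t" by (rule cost_lower_bound[OF C])
 \<comment> \<open>\<open>L\<close> carries the cost bound and \<open>L - W\<close> the exact
   discretized boundary; compactness is applied to the latter.\<close>
 define A where "A h = L h @ neg_list (W h)" for h
 have lA: "ALL h. len (A h) <= K * (E0 + 1) + c0"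
 proof (rule allI)
  fix h
  have "len (L h) <= K * (E0 + eps h)"
   by (rule len_le_cost[OF C K _ D8]) (use D5[of h] E0(2) eps(1)[of h] in auto)
  also have "... <= K * (E0 + 1)" using K(1) eps(2)[of h] by (intro mult_left_mono) simp_all
  finally have "len (L h) <= K * (E0 + 1)" .
  moreover have "len (W h) <= c0" using D7[of h] mult_left_mono[OF eps(2)[of h] c0] by simp
  ultimately show "len (A h) <= K * (E0 + 1) + c0" by (simp add: A_def)
 qed
 have RL: "ALL h. in_ball (r0 + 1) (L h)" using D5 by fast
 have RA: "ALL h. in_ball (r0 + 1) (A h)"
 proof (rule allI, rule ballI)
  fix h x assume x: "x \<in> set (A h)"
  obtain p q t where e: "x = (p, q, t)" by (metis prod_cases3)
  have "(p, q, t) \<in> set (L h) \<or> (EX t'. (p, q, t') \<in> set (W h))" using x by (auto simp: A_def e neg_list_def)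
  then show "case x of (p, q, t) => norm p <= r0 + 1 & norm q <= r0 + 1"
  proof (elim disjE exE)
   assume "(p, q, t) \<in> set (L h)"
   from bspec[OF RL[THEN spec, of h] this] show ?thesis by (simp add: e)
  next
   fix t' assume "(p, q, t') \<in> set (W h)"
   from bspec[OF D6[of h] this] show ?thesis by (simp add: e)
  qed
 qed
 have bA: "ALL h j f. bd (A h) j f = (\<Sum>v\<in>V h. c h j v * f v)"
 proof (intro allI)
  fix h j f
  show "bd (A h) j f = (\<Sum>v\<in>V h. c h j v * f v)"
   using D4[of h, THEN spec, THEN spec, of j f] by (simp add: A_def)
 qed
 have nd: "ALL h. near_demand (d h) (V h) (c h)" using D3 by (rule allI)
 obtain s and T :: "(real^'n) set => real^'m^'n" where s: "strict_mono s" and T: "vector_measure T" "compactly_supported T"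
  "ALL j f. test_function f --> current_of_measure T j (dform f) = demand_of \<mu>m \<mu>p j f"
  and lim: "ALL j w. test_form 1 w --> (%h. cl1 (A (s h)) j w) \<longlonglongrightarrow> current_of_measure T j w"
  and cau: "\<forall>e>0. EX n. \<forall>h\<ge>n. \<forall>l\<ge>n.
    flat_dist (A (s h) @ W (s h)) (A (s l) @ W (s l)) <= ennreal e"
  by (rule flat_compactness[OF dem Cg lA W0 RA nd d0 bA])
 have flux: "multi_material_flux T \<mu>m \<mu>p" unfolding multi_material_flux_iff using T by (intro conjI)
 \<comment> \<open>Appending \<open>W\<close> cancels it as a current, though not as a list, and
   returns the chains of controlled cost.\<close>
 have AW: "cl1 (A h @ W h) = cl1 (L h)" for h by (simp add: fun_eq_iff A_def)
 have limL: "ALL j w. test_form 1 w --> (%h. cl1 (L (s h)) j w) \<longlonglongrightarrow> current_of_measure T j w"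
 proof (intro allI impI)
  fix j and w :: "(real^'n) form" assume w: "test_form 1 w"
  from tendsto_add[OF lim[rule_format, OF w, of j] LIMSEQ_subseq_LIMSEQ[OF cl1_tendsto_0[OF W0 w, of j] s]]
  show "(%h. cl1 (L (s h)) j w) \<longlonglongrightarrow> current_of_measure T j w" by (simp add: comp_def A_def)
 qed
 have "energy C T <= liminf (%h. list_cost C (L (s h)))"
  by (rule energy_le_liminf[OF C _ limL cau[unfolded AW]]) (use RL in blast)
 also have "... <= liminf (%h. ennreal (E0 + eps (s h)))"
  by (rule Liminf_mono) (intro always_eventually allI D8)
 also have "... = e0"
 proof (rule lim_imp_Liminf)
  have "(%h. E0 + eps (s h)) \<longlonglongrightarrow> E0 + 0"
   using LIMSEQ_subseq_LIMSEQ[OF eeps s] by (intro tendsto_add tendsto_const) (simp add: comp_def)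
  then show "(%h. ennreal (E0 + eps (s h))) \<longlonglongrightarrow> e0" unfolding E0(1) by (intro tendsto_ennrealI) simp
 qed simp
 finally have "energy C T <= e0" .
 then have "energy C T <= energy C S" if "multi_material_flux S \<mu>m \<mu>p" for S
  by (rule order_trans) (unfold e0_def, rule INF_lower, use that in simp)
 with flux show ?thesis by blast
qed

theorem theorem3p10:
 fixes C :: "real^'m \<Rightarrow> real"
  and \<mu>m \<mu>p :: "(real^'n) set \<Rightarrow> real^'m"
 assumes "CARD('n) \<ge> 2"
  and "multi_material_cost C"
  and "vector_measure \<mu>m" and "compactly_supported \<mu>m"
  and "vector_measure \<mu>p" and "compactly_supported \<mu>p"
  and "compatible \<mu>m \<mu>p"
 shows "\<exists>T. multi_material_flux T \<mu>m \<mu>p \<and>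
       (\<forall>S. multi_material_flux S \<mu>m \<mu>p \<longrightarrow> energy C T \<le> energy C S)"
proof -
 obtain r0 N where dem: "demand (demand_of \<mu>m \<mu>p) r0 N" by (rule demand_demand_of[OF assms(3-7)])
 obtain Cg where Cg: "Cg > 0" "\<forall>\<delta>>0. \<forall>r. \<exists>(V :: (real^'n) set) lam. grid_partition Cg \<delta> r V lam"
  using grid_partition_exists by blast
 show ?thesis
 proof (cases "\<exists>S. multi_material_flux S \<mu>m \<mu>p \<and> energy C S < \<infinity>")
  case True
  then obtain S where "multi_material_flux S \<mu>m \<mu>p" "energy C S < \<infinity>" by blast
  then show ?thesis by (rule optimal_flux_exists[OF dem assms(2) Cg])
 next
  case False
  obtain T where T: "multi_material_flux T \<mu>m \<mu>p" using flux_exists[OF dem Cg] by (rule exE)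
  have "energy C T \<le> energy C S" if "multi_material_flux S \<mu>m \<mu>p" for S
   using False that by (simp add: less_top[symmetric])
  with T show ?thesis by blast
 qed
qed

end
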